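(* Let $\nu>0$ and let $u_{\mathrm{in}}$ be a divergence-free, smooth vector field on $\mathbb{T}\times\mathbb{R}\times\mathbb{T}$. Let $u=(u^1,u^2,u^3)$ be the solution with initial data $u(0)=u_{\mathrm{in}}$ of the linearized equation $$\partial_t u + y\,\partial_x u + \begin{pmatrix}0\\ u^1\\ 0\end{pmatrix} - \nu\Delta u + \nabla(-\Delta)^{-1}\partial_x u^2 + \nabla(-\Delta)^{-1}\partial_y u^1 = 0 .$$ Let $U(t,X,Y,Z)=u(t,x,y,z)$ with $X=x-ty$, $Y=y$, $Z=z$. Then: (1) For any $s\ge 0$, every $k\in\mathbb{Z}\setminus\{0\}$ and all $t\ge 0$, the component $U_k$ of $U_{\neq}$ at frequency $k$ in $X$ satisfies $$\|(U^1_k,U^2_k)(t)\|_{H^s}\lesssim \langle t\rangle^{-1}e^{-\frac{\nu}{6}k^2t^3}\|u_{\mathrm{in}}\|_{H^{s+2}},\qquad \|U^3_k(t)\|_{H^s}\lesssim e^{-\frac{\nu}{6}k^2t^3}\|u_{\mathrm{in}}\|_{H^{s+2}}.$$ (2) The zero $x$-frequency part $u_0$ of $u$ is given by $$\begin{cases}u_0^1(t,y,z)=e^{\nu\Delta_{y,z}t}(u^1_{\mathrm{in}})_0,\\ u_0^2(t,y,z)=e^{\nu\Delta_{y,z}t}\big((u^2_{\mathrm{in}})_0-t\,\partial_z\Delta_{y,z}^{-1}\partial_z(u^1_{\mathrm{in}})_0\big),\\ u_0^3(t,y,z)=e^{\nu\Delta_{y,z}t}\big((u^3_{\mathrm{i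n}})_0+t\,\partial_z\Delta_{y,z}^{-1}\partial_y(u^1_{\mathrm{in}})_0\big).\end{cases}$$
   Context: $\mathbb{T}$ is the periodized interval $[0,1]$. The Fourier transform on $\mathbb{T}\times\mathbb{R}\times\mathbb{T}$ is $\widehat f(k,\eta,l)=\int f(x,y,z)e^{-2\pi i(kx+\eta y+lz)}\,dx\,dy\,dz$, $(k,\eta,l)\in\mathbb{Z}\times\mathbb{R}\times\mathbb{Z}$. The Sobolev norm is $\|f\|_{H^s}=\|\langle k,\eta,l\rangle^s\widehat f\|_{L^2}$ with $\langle k,\eta,l\rangle=\sqrt{1+k^2+\eta^2+l^2}$; $\langle t\rangle=\sqrt{1+t^2}$. For a function $f$, $f_0(y,z)=\int_{\mathbb{T}}f(x,y,z)\,dx$ and $f_{\neq}=f-f_0$ (the same notation is used in the variables $(X,Y,Z)$); the component of $f$ at frequency $k$ in $X$ is the part of $f$ whose Fourier transform is supported on $\{k\}\times\mathbb{R}\times\mathbb{Z}$. $\Delta_{y,z}=\partial_y^2+\partial_z^2$; the operators $\partial_z\Delta_{y,z}^{-1}\partial_z$ and $\partial_z\Delta_{y,z}^{-1}\partial_y$ are the Fourier multipliers $l^2/(\eta^2+l^2)$ and $\eta l/(\eta^2+l^2)$. Data are understood to have the Sobolev regularity needed for the norms appearing to be finite. $A\lesssim B$ means $A\le CB$ with $C$ independent of $\nu$, $t$, $k$ and $u_{\mathrm{in}}$ (it may depend on $s$). *)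

theory Defs
  imports "HOL-Analysis.Analysis"
begin

text \<open>
  Functions on the physical space (torus, line, torus) are functions of
  \<open>(x, y, z)\<close> on the whole of three-space that have period 1 in \<open>x\<close> and in \<open>z\<close>; integrals over
  the physical space are taken over one period cell.
\<close>

type_synonym point = "real \<times> real \<times> real"
type_synonym freq = "int \<times> real \<times> int"

definition cell :: "point measure" where
  "cell = restrict_space lborel ({0..1} \<times> UNIV \<times> {0..1})"

definition freq_measure :: "freq measure" where
  "freq_measure = count_space UNIV \<Otimes>\<^sub>M (lborel \<Otimes>\<^sub>M count_space UNIV)"

definition periodic_xz :: "(point \<Rightarrow> 'b) \<Rightarrow> bool" where
  "periodic_xz f \<longleftrightarrow> (\<forall>x y z. f (x + 1, y, z) = f (x, y, z) \<and> f (x, y, z + 1) = f (x, y, z))"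

definition square_integrable ::
    "'a measure \<Rightarrow> ('a \<Rightarrow> 'b::{banach, second_countable_topology}) \<Rightarrow> bool" where
  "square_integrable M f \<longleftrightarrow> f \<in> borel_measurable M \<and> integrable M (\<lambda>x. (norm (f x))\<^sup>2)"


subsection \<open>Partial derivatives and classes of differentiable functions\<close>

definition dir_deriv ::
    "'a::euclidean_space \<Rightarrow> ('a \<Rightarrow> 'b::real_normed_vector) \<Rightarrow> 'a \<Rightarrow> 'b" where
  "dir_deriv b f p = vector_derivative (\<lambda>h. f (p + h *\<^sub>R b)) (at 0)"

text \<open>For an open set \<open>S\<close>: all partial derivatives up to order \<open>n\<close> exist and are continuous.\<close>

primrec Ck_on ::
    "nat \<Rightarrow> 'a::euclidean_space set \<Rightarrow> ('a \<Rightarrow> 'b::real_normed_vector) \<Rightarrow> bool" where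
  "Ck_on 0 S f \<longleftrightarrow> continuous_on S f"
| "Ck_on (Suc n) S f \<longleftrightarrow> continuous_on S f \<and>
     (\<forall>b\<in>Basis. (\<forall>p\<in>S. (\<lambda>h. f (p + h *\<^sub>R b)) differentiable (at 0)) \<and> Ck_on n S (dir_deriv b f))"

definition laplacian :: "(point \<Rightarrow> 'b::real_normed_vector) \<Rightarrow> point \<Rightarrow> 'b" where
  "laplacian f p = (\<Sum>b\<in>Basis. dir_deriv b (dir_deriv b f) p)"

definition divergence :: "(point \<Rightarrow> real^3) \<Rightarrow> point \<Rightarrow> real" where
  "divergence v p =
     dir_deriv (1, 0, 0) v p $ 1 + dir_deriv (0, 1, 0) v p $ 2 + dir_deriv (0, 0, 1) v p $ 3"


subsection \<open>Fourier transform, multipliers and Sobolev norms\<close>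

definition freq_vec :: "freq \<Rightarrow> real^3" where
  "freq_vec = (\<lambda>(k, \<eta>, l). vector [of_int k, \<eta>, of_int l])"

definition fourier_trunc :: "real \<Rightarrow> (point \<Rightarrow> complex) \<Rightarrow> freq \<Rightarrow> complex" where
  "fourier_trunc R f = (\<lambda>(k, \<eta>, l).
     set_lebesgue_integral cell {(x, y, z). \<bar>y\<bar> \<le> R}
       (\<lambda>(x, y, z). exp (- 2 * of_real pi * \<i> * of_real (of_int k * x + \<eta> * y + of_int l * z))
                     * f (x, y, z)))"

text \<open>
  The Fourier transform of a square integrable \<open>f\<close> need not be an absolutely convergent integral,
  so it is taken in the sense of Plancherel: it is the limit in the mean of the integrals over
  \<open>\<bar>y\<bar> \<le> N\<close>. This determines it almost everywhere; for integrable \<open>f\<close> it is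
  almost everywhere the usual integral.
\<close>

definition is_fourier :: "(point \<Rightarrow> complex) \<Rightarrow> (freq \<Rightarrow> complex) \<Rightarrow> bool" where
  "is_fourier f g \<longleftrightarrow> square_integrable freq_measure g \<and>
     (\<lambda>N::nat. \<integral>\<^sup>+\<xi>. ennreal ((cmod (fourier_trunc (real N) f \<xi> - g \<xi>))\<^sup>2) \<partial>freq_measure)
       \<longlonglongrightarrow> 0"

definition fourier :: "(point \<Rightarrow> complex) \<Rightarrow> freq \<Rightarrow> complex" where
  "fourier f = (SOME g. is_fourier f g)"

text \<open>
  The multiplier operator with symbol \<open>m\<close>; its value is determined almost everywhere on the period
  cell. At frequency 0, a null set, the symbols below use division by zero.
\<close>

definition multiplier :: "(freq \<Rightarrow> complex) \<Rightarrow> (point \<Rightarrow> complex) \<Rightarrow> point \<Rightarrow> complex" where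
  "multiplier m f = (SOME g. square_integrable cell g \<and>
     (AE \<xi> in freq_measure. fourier g \<xi> = m \<xi> * fourier f \<xi>))"

definition japanese :: "freq \<Rightarrow> real" where
  "japanese \<xi> = sqrt (1 + (norm (freq_vec \<xi>))\<^sup>2)"

definition fourier_vec :: "(point \<Rightarrow> complex^'n) \<Rightarrow> freq \<Rightarrow> complex^'n" where
  "fourier_vec f \<xi> = (\<chi> j. fourier (\<lambda>p. f p $ j) \<xi>)"

definition in_sobolev :: "real \<Rightarrow> (point \<Rightarrow> complex^'n) \<Rightarrow> bool" where
  "in_sobolev s f \<longleftrightarrow> square_integrable cell f \<and>
     square_integrable freq_measure (\<lambda>\<xi>. japanese \<xi> powr s *\<^sub>R fourier_vec f \<xi>)"

definition sobolev_norm :: "real \<Rightarrow> (point \<Rightarrow> complex^'n) \<Rightarrow> real" where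
  "sobolev_norm s f =
     sqrt (LINT \<xi>|freq_measure. (norm (japanese \<xi> powr s *\<^sub>R fourier_vec f \<xi>))\<^sup>2)"

definition complexify :: "(point \<Rightarrow> real^'n) \<Rightarrow> point \<Rightarrow> complex^'n" where
  "complexify v p = (\<chi> j. complex_of_real (v p $ j))"

definition component :: "(point \<Rightarrow> real^'n) \<Rightarrow> 'n \<Rightarrow> point \<Rightarrow> complex" where
  "component v j p = complex_of_real (v p $ j)"


subsection \<open>Frequencies in the first variable\<close>

text \<open>The zero mode is kept as a function of \<open>(x, y, z)\<close> that does not depend on \<open>x\<close>.\<close>

definition zero_mode ::
    "(point \<Rightarrow> 'b::{banach, second_countable_topology}) \<Rightarrow> point \<Rightarrow> 'b" where
  "zero_mode f = (\<lambda>(x, y, z). LINT x':{0..1}|lborel. f (x', y, z))"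

definition nonzero_modes ::
    "(point \<Rightarrow> 'b::{banach, second_countable_topology}) \<Rightarrow> point \<Rightarrow> 'b" where
  "nonzero_modes f p = f p - zero_mode f p"

definition x_mode :: "int \<Rightarrow> (point \<Rightarrow> complex) \<Rightarrow> point \<Rightarrow> complex" where
  "x_mode k f = multiplier (\<lambda>(k', \<eta>, l). if k' = k then 1 else 0) f"


subsection \<open>The linearized equation\<close>

text \<open>Symbol of \<open>\<partial>\<^sub>i (-\<Delta>)\<^sup>-\<^sup>1 \<partial>\<^sub>j\<close>.\<close>

definition riesz_symbol :: "3 \<Rightarrow> 3 \<Rightarrow> freq \<Rightarrow> complex" where
  "riesz_symbol i j \<xi> =
     (2 * of_real pi * \<i> * of_real (freq_vec \<xi> $ i)) * (2 * of_real pi * \<i> * of_real (freq_vec \<xi> $ j))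
       / of_real (4 * pi\<^sup>2 * (norm (freq_vec \<xi>))\<^sup>2)"

definition initial_datum :: "(point \<Rightarrow> real^3) \<Rightarrow> bool" where
  "initial_datum v \<longleftrightarrow> periodic_xz v \<and> (\<forall>n. Ck_on n UNIV v) \<and> (\<forall>p. divergence v p = 0) \<and>
     square_integrable cell v"

text \<open>
  Classical solutions for positive times that are continuous in time with values in \<open>L\<^sup>2\<close>,
  up to the initial time. The equation is required almost everywhere because the nonlocal terms
  are defined only up to null sets.
\<close>

definition linearized_solution ::
    "real \<Rightarrow> (point \<Rightarrow> real^3) \<Rightarrow> (real \<Rightarrow> point \<Rightarrow> real^3) \<Rightarrow> bool" where
  "linearized_solution \<nu> u_in u \<longleftrightarrow>
     u 0 = u_in \<and>
     (\<forall>t\<ge>0. periodic_xz (u t) \<and> square_integrable cell (u t)) \<and>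
     (\<forall>t\<ge>0. ((\<lambda>\<tau>. LINT p|cell. (norm (u \<tau> p - u t p))\<^sup>2) \<longlongrightarrow> 0) (at t within {0..})) \<and>
     Ck_on 2 ({0<..} \<times> UNIV) (\<lambda>(t, p). u t p) \<and>
     (\<forall>t>0. AE (x, y, z) in cell. \<forall>j.
        complex_of_real
          (vector_derivative (\<lambda>\<tau>. u \<tau> (x, y, z)) (at t) $ j
           + y * dir_deriv (1, 0, 0) (u t) (x, y, z) $ j
           + (if j = 2 then u t (x, y, z) $ 1 else 0)
           - \<nu> * laplacian (u t) (x, y, z) $ j)
        + multiplier (riesz_symbol j 1) (component (u t) 2) (x, y, z)
        + multiplier (riesz_symbol j 2) (component (u t) 1) (x, y, z) = 0)"

text \<open>\<open>U(t, X, Y, Z) = u(t, x, y, z)\<close> with \<open>X = x - t y\<close>, \<open>Y = y\<close>, \<open>Z = z\<close>.\<close>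

definition moving_frame :: "(real \<Rightarrow> point \<Rightarrow> 'b) \<Rightarrow> real \<Rightarrow> point \<Rightarrow> 'b" where
  "moving_frame u t = (\<lambda>(X, Y, Z). u t (X + t * Y, Y, Z))"

definition U_mode :: "(real \<Rightarrow> point \<Rightarrow> real^3) \<Rightarrow> int \<Rightarrow> 3 \<Rightarrow> real \<Rightarrow> point \<Rightarrow> complex" where
  "U_mode u k j t = x_mode k (component (nonzero_modes (moving_frame u t)) j)"

text \<open>
  \<open>e\<^bsup>\<nu>t\<Delta>\<^esup>\<close>, \<open>\<partial>\<^sub>z\<Delta>\<^sup>-\<^sup>1\<partial>\<^sub>z\<close>
  and \<open>\<partial>\<^sub>z\<Delta>\<^sup>-\<^sup>1\<partial>\<^sub>y\<close> with the Laplacian in \<open>(y, z)\<close>. The factor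
  \<open>4\<pi>\<^sup>2\<close> comes from the convention \<open>e\<^bsup>-2\<pi>i(kx+\<eta>y+lz)\<^esup>\<close> for the Fourier transform.
\<close>

definition heat_yz :: "real \<Rightarrow> real \<Rightarrow> (point \<Rightarrow> complex) \<Rightarrow> point \<Rightarrow> complex" where
  "heat_yz \<nu> t = multiplier (\<lambda>(k, \<eta>, l). of_real (exp (- 4 * pi\<^sup>2 * \<nu> * t * (\<eta>\<^sup>2 + (of_int l)\<^sup>2))))"

definition zz_op :: "(point \<Rightarrow> complex) \<Rightarrow> point \<Rightarrow> complex" where
  "zz_op = multiplier (\<lambda>(k, \<eta>, l). of_real ((of_int l)\<^sup>2 / (\<eta>\<^sup>2 + (of_int l)\<^sup>2)))"

definition zy_op :: "(point \<Rightarrow> complex) \<Rightarrow> point \<Rightarrow> complex" where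
  "zy_op = multiplier (\<lambda>(k, \<eta>, l). of_real (\<eta> * of_int l / (\<eta>\<^sup>2 + (of_int l)\<^sup>2)))"

end

theory Submission
  imports Defs "HOL-Probability.Probability"
begin

text \<open>
  The Fourier transform on the cell is the tensor product of those on the circle and the line; each
  is an isometry of square integrable functions with dense range, which gives the Plancherel theorem,
  injectivity and the multiplier calculus. A solution is tested against plane waves
  carried by the shear and cut off in \<open>y\<close>. As the cutoff is removed, integration by parts turns the
  equation into a linear system of ordinary differential equations for the Fourier coefficients in
  the moving frame, and this system is solved by functionals that are constant in time. The estimates
  then follow from \<open>\<integral>\<^sub>0\<^sup>t (k\<^sup>2 + (\<eta> - k s)\<^sup>2 + l\<^sup>2) ds \<ge> k\<^sup>2 t\<^sup>3 / 12\<close> and from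
  \<open>\<bar>k\<bar> t \<le> \<bar>\<eta>\<bar> + \<bar>\<eta> - k t\<bar>\<close>, which trades decay in time for two derivatives of the data.
\<close>

section \<open>Square-integrable functions\<close>

text \<open>The coefficients of a merely square integrable solution exist only almost everywhere in
  the y-frequency, with a null set that may depend on time, and nothing is known about integrability
  of the derivatives. A differential equation cannot be stated frequency by frequency. What can be
  differentiated is a coefficient cut off in \<open>y\<close>, integrated over an interval [a, b] of
  frequencies against weights that solve the adjoint system. The adjoint equation cancels everything
  but two errors: the commutator of the Laplacian with the cutoff, and the failure of the Riesz
  multipliers to commute with the cutoff. Both vanish in the limit, the second one only at each
  fixed time, so the limit is taken after integrating in time. The adjoint system is explicit
  because of a cancellation: without viscosity, K^2 + (\<eta> - K t)^2 + L^2 times the coefficient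
  of either of the first two components is affine in \<open>t\<close>. Hence the polynomial entries
  of the invariants; viscosity contributes only the exponential of the integrated squared
  frequency.\<close>

definition l2norm :: "'a measure \<Rightarrow> ('a \<Rightarrow> complex) \<Rightarrow> real" where
  "l2norm M f = sqrt (LINT x|M. (cmod (f x))\<^sup>2)"

lemma borel_measurable_cnj [measurable]: "cnj \<in> borel_measurable borel"
  by (intro borel_measurable_continuous_onI continuous_intros)

lemma l2norm_nonneg [simp]: "0 \<le> l2norm M f"
  by (simp add: l2norm_def)

lemma l2norm_power2: "(l2norm M f)\<^sup>2 = (LINT x|M. (cmod (f x))\<^sup>2)"
  by (simp add: l2norm_def)

lemma square_integrable_measurable: "square_integrable M f \<Longrightarrow> f \<in> borel_measurable M"
  by (simp add: square_integrable_def)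

lemma square_integrable_iff_nn_integral:
  fixes f :: "'a \<Rightarrow> complex"
  assumes [measurable]: "f \<in> borel_measurable M"
  shows "square_integrable M f \<longleftrightarrow> (\<integral>\<^sup>+x. ennreal ((cmod (f x))\<^sup>2) \<partial>M) < \<infinity>"
  by (auto simp: square_integrable_def integrable_iff_bounded)

lemma nn_integral_eq_l2norm:
  fixes f :: "'a \<Rightarrow> complex"
  assumes "square_integrable M f"
  shows "(\<integral>\<^sup>+x. ennreal ((cmod (f x))\<^sup>2) \<partial>M) = ennreal ((l2norm M f)\<^sup>2)"
  using assms by (simp add: l2norm_power2 square_integrable_def nn_integral_eq_integral)

lemma l2norm_eq_of_nn_integral:
  fixes f :: "'a \<Rightarrow> complex"
  assumes "f \<in> borel_measurable M" "(\<integral>\<^sup>+x. ennreal ((cmod (f x))\<^sup>2) \<partial>M) = ennreal (c\<^sup>2)" "0 \<le> c"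
  shows "square_integrable M f" "l2norm M f = c"
proof -
  show s: "square_integrable M f"
    using assms by (simp add: square_integrable_iff_nn_integral)
  have "ennreal ((l2norm M f)\<^sup>2) = ennreal (c\<^sup>2)"
    using nn_integral_eq_l2norm[OF s] assms by simp
  thus "l2norm M f = c"
    using assms(3) by (simp add: ennreal_inj)
qed

lemma square_integrable_dominated:
  fixes f g :: "'a \<Rightarrow> complex"
  assumes f: "square_integrable M f" and g[measurable]: "g \<in> borel_measurable M"
    and C: "0 \<le> C" and le: "AE x in M. cmod (g x) \<le> C * cmod (f x)"
  shows "square_integrable M g" "l2norm M g \<le> C * l2norm M f"
proof -
  have fi: "integrable M (\<lambda>x. (cmod (f x))\<^sup>2)" using f by (simp add: square_integrable_def)
  have le2: "AE x in M. (cmod (g x))\<^sup>2 \<le> C\<^sup>2 * (cmod (f x))\<^sup>2"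
    using le by eventually_elim (metis norm_ge_zero power_mono power_mult_distrib)
  have gi: "integrable M (\<lambda>x. (cmod (g x))\<^sup>2)"
    by (rule Bochner_Integration.integrable_bound[OF integrable_mult_right[OF fi, of "C\<^sup>2"]])
       (use le2 in auto)
  thus "square_integrable M g" by (simp add: square_integrable_def)
  have "(LINT x|M. (cmod (g x))\<^sup>2) \<le> (LINT x|M. C\<^sup>2 * (cmod (f x))\<^sup>2)"
    by (rule integral_mono_AE[OF gi integrable_mult_right[OF fi] le2])
  hence "(l2norm M g)\<^sup>2 \<le> (C * l2norm M f)\<^sup>2"
    by (simp add: l2norm_power2 power_mult_distrib)
  thus "l2norm M g \<le> C * l2norm M f"
    by (rule power2_le_imp_le) (use C in simp)
qed

lemma square_integrable_cong_AE:
  fixes f g :: "'a \<Rightarrow> complex"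
  assumes "square_integrable M f" "g \<in> borel_measurable M" "AE x in M. f x = g x"
  shows "square_integrable M g"
  by (rule square_integrable_dominated(1)[OF assms(1,2), of 1]) (use assms(3) in auto)

lemma l2norm_cong_AE:
  fixes f g :: "'a \<Rightarrow> complex"
  assumes "f \<in> borel_measurable M" "g \<in> borel_measurable M" "AE x in M. f x = g x"
  shows "l2norm M f = l2norm M g"
  unfolding l2norm_def
  by (rule arg_cong[where f=sqrt], rule integral_cong_AE) (use assms in auto)

lemma square_integrable_zero [simp]: "square_integrable M (\<lambda>x. 0::complex)" "l2norm M (\<lambda>x. 0) = 0"
  by (simp_all add: square_integrable_def l2norm_def)

lemma square_integrable_mult_bounded:
  fixes f m :: "'a \<Rightarrow> complex"
  assumes f: "square_integrable M f" and m: "m \<in> borel_measurable M"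
    and C: "0 \<le> C" and le: "AE x in M. cmod (m x) \<le> C"
  shows "square_integrable M (\<lambda>x. m x * f x)" "l2norm M (\<lambda>x. m x * f x) \<le> C * l2norm M f"
proof -
  have "AE x in M. cmod (m x * f x) \<le> C * cmod (f x)"
    using le by eventually_elim (auto simp: norm_mult mult_right_mono)
  moreover have "(\<lambda>x. m x * f x) \<in> borel_measurable M"
    using square_integrable_measurable[OF f] m by measurable
  ultimately show "square_integrable M (\<lambda>x. m x * f x)"
      "l2norm M (\<lambda>x. m x * f x) \<le> C * l2norm M f"
    using square_integrable_dominated[OF f _ C] by blast+
qed

lemma square_integrable_indicator:
  fixes f :: "'a \<Rightarrow> complex"
  assumes "square_integrable M f" "A \<in> sets M"
  shows "square_integrable M (\<lambda>x. indicator A x * f x)"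
    and "l2norm M (\<lambda>x. indicator A x * f x) \<le> l2norm M f"
  using square_integrable_mult_bounded[OF assms(1), of "indicator A" 1] assms(2)
  by (auto simp: indicator_def)

lemma square_integrable_uminus:
  fixes f :: "'a \<Rightarrow> complex"
  assumes f: "square_integrable M f"
  shows "square_integrable M (\<lambda>x. - f x)" "l2norm M (\<lambda>x. - f x) = l2norm M f"
  using f by (auto simp: square_integrable_def l2norm_def)

lemma square_integrable_scale:
  fixes f :: "'a \<Rightarrow> complex"
  assumes f: "square_integrable M f"
  shows "square_integrable M (\<lambda>x. c * f x)" "l2norm M (\<lambda>x. c * f x) \<le> cmod c * l2norm M f"
  using square_integrable_mult_bounded[OF f, of "\<lambda>_. c" "cmod c"] by auto

text \<open>Cauchy--Schwarz comes from integrating the weighted inequality 2ab <= t a^2 + b^2 / t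
  and choosing \<open>t\<close>. The optimal \<open>t\<close> is the quotient of the two norms; as
  either norm may vanish, \<open>t\<close> is taken near it and an arbitrarily small amount is
  lost.\<close>

lemma square_integrable_prod:
  fixes f g :: "'a \<Rightarrow> complex"
  assumes f: "square_integrable M f" and g: "square_integrable M g"
  shows "integrable M (\<lambda>x. cmod (f x) * cmod (g x))"
    and "integrable M (\<lambda>x. f x * cnj (g x))"
    and "(LINT x|M. cmod (f x) * cmod (g x)) \<le> l2norm M f * l2norm M g"
    and "cmod (LINT x|M. f x * cnj (g x)) \<le> l2norm M f * l2norm M g"
proof -
  have [measurable]: "f \<in> borel_measurable M" "g \<in> borel_measurable M"
    using f g by (auto simp: square_integrable_def)
  have fi: "integrable M (\<lambda>x. (cmod (f x))\<^sup>2)" and gi: "integrable M (\<lambda>x. (cmod (g x))\<^sup>2)"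
    using f g by (auto simp: square_integrable_def)
  have am: "2 * (a * b) \<le> t * a\<^sup>2 + b\<^sup>2 / t" if "t > 0" for a b t :: real
  proof -
    have "0 \<le> (t * a - b)\<^sup>2 / t" using that by simp
    also have "\<dots> = t * a\<^sup>2 + b\<^sup>2 / t - 2 * (a * b)"
      using that by (simp add: power2_eq_square field_simps)
    finally show ?thesis by simp
  qed
  have fg: "integrable M (\<lambda>x. (cmod (f x))\<^sup>2 + (cmod (g x))\<^sup>2)" using fi gi by simp
  show ci: "integrable M (\<lambda>x. cmod (f x) * cmod (g x))"
  proof (rule Bochner_Integration.integrable_bound[OF fg])
    show "AE x in M. norm (cmod (f x) * cmod (g x)) \<le> norm ((cmod (f x))\<^sup>2 + (cmod (g x))\<^sup>2)"
    proof (rule AE_I2)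
      fix x
      have "2 * (cmod (f x) * cmod (g x)) \<le> (cmod (f x))\<^sup>2 + (cmod (g x))\<^sup>2"
        using am[of 1] by simp
      moreover have "0 \<le> cmod (f x) * cmod (g x)" by simp
      ultimately show "norm (cmod (f x) * cmod (g x)) \<le> norm ((cmod (f x))\<^sup>2 + (cmod (g x))\<^sup>2)"
        by (simp only: real_norm_def)
    qed
  qed simp
  show pi: "integrable M (\<lambda>x. f x * cnj (g x))"
    by (rule Bochner_Integration.integrable_bound[OF ci]) (auto simp: norm_mult)
  let ?c = "LINT x|M. cmod (f x) * cmod (g x)"
  let ?a = "l2norm M f" and ?b = "l2norm M g"
  have main: "2 * ?c \<le> t * ?a\<^sup>2 + ?b\<^sup>2 / t" if "t > 0" for t
  proof -
    have "2 * ?c = (LINT x|M. 2 * (cmod (f x) * cmod (g x)))" by simp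
    also have "\<dots> \<le> (LINT x|M. t * (cmod (f x))\<^sup>2 + (cmod (g x))\<^sup>2 / t)"
      by (rule integral_mono) (use ci fi gi am[OF that] in auto)
    also have "\<dots> = t * ?a\<^sup>2 + ?b\<^sup>2 / t"
      using fi gi by (simp add: l2norm_power2)
    finally show ?thesis .
  qed
  show cs: "?c \<le> ?a * ?b"
  proof (rule field_le_epsilon)
    fix e :: real assume e: "e > 0"
    show "?c \<le> ?a * ?b + e"
    \<comment> \<open>If \<open>?a\<close> is zero, a large \<open>t\<close> makes the surviving
      term at most \<open>e\<close>. Otherwise \<open>t\<close> is the optimal quotient with its
      numerator raised by \<open>d\<close>, which keeps it positive and costs exactly
      \<open>?a * d = e\<close>.\<close>
    proof (cases "?a = 0")
      case True
      have "?b\<^sup>2 / ((?b\<^sup>2 + 1) / e) \<le> e"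
      proof -
        have "0 < 1 + ?b\<^sup>2" by (simp add: add_pos_nonneg)
        thus ?thesis using e by (simp add: pos_divide_le_eq algebra_simps)
      qed
      hence "2 * ?c \<le> e" using main[of "(?b\<^sup>2 + 1) / e"] e True by (simp add: add_nonneg_pos)
      thus ?thesis using True e by simp
    next
      case False
      hence a: "?a > 0" by (simp add: order_less_le)
      define d where "d = e / ?a"
      have d: "d > 0" using a e by (simp add: d_def)
      have "?b\<^sup>2 / ((?b + d) / ?a) \<le> ?a * ?b"
      proof -
        have bd: "?b + d > 0" using d l2norm_nonneg[of M g] by linarith
        have "?b\<^sup>2 * ?a \<le> ?a * ?b * (?b + d)" using a d by (simp add: power2_eq_square algebra_simps)
        thus ?thesis using bd a by (simp add: field_simps)
      qed
      moreover have "(?b + d) / ?a * ?a\<^sup>2 = ?a * ?b + e"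
        using a by (simp add: d_def power2_eq_square field_simps)
      moreover have "(?b + d) / ?a > 0" using a d l2norm_nonneg[of M g] by (simp add: add_nonneg_pos)
      ultimately have "2 * ?c \<le> 2 * (?a * ?b) + e" using main[of "(?b + d) / ?a"] by linarith
      thus ?thesis using e by simp
    qed
  qed
  have "cmod (LINT x|M. f x * cnj (g x)) \<le> (LINT x|M. cmod (f x * cnj (g x)))"
    by (rule integral_norm_bound)
  also have "\<dots> = ?c" by (simp add: norm_mult)
  finally show "cmod (LINT x|M. f x * cnj (g x)) \<le> ?a * ?b" using cs by simp
qed

lemma square_integrable_add:
  fixes f g :: "'a \<Rightarrow> complex"
  assumes f: "square_integrable M f" and g: "square_integrable M g"
  shows "square_integrable M (\<lambda>x. f x + g x)" "l2norm M (\<lambda>x. f x + g x) \<le> l2norm M f + l2norm M g"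
proof -
  have [measurable]: "f \<in> borel_measurable M" "g \<in> borel_measurable M"
    using f g by (auto simp: square_integrable_def)
  have fi: "integrable M (\<lambda>x. (cmod (f x))\<^sup>2)" and gi: "integrable M (\<lambda>x. (cmod (g x))\<^sup>2)"
    using f g by (auto simp: square_integrable_def)
  note ci = square_integrable_prod(1)[OF f g]
  have I: "integrable M (\<lambda>x. (cmod (f x))\<^sup>2 + 2 * (cmod (f x) * cmod (g x)) + (cmod (g x))\<^sup>2)"
    using fi gi ci by simp
  have le: "(cmod (f x + g x))\<^sup>2 \<le> (cmod (f x))\<^sup>2 + 2 * (cmod (f x) * cmod (g x)) + (cmod (g x))\<^sup>2" for x
  proof -
    have "(cmod (f x + g x))\<^sup>2 \<le> (cmod (f x) + cmod (g x))\<^sup>2"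
      by (intro power_mono norm_triangle_ineq) simp
    thus ?thesis by (simp add: power2_sum)
  qed
  have si: "integrable M (\<lambda>x. (cmod (f x + g x))\<^sup>2)"
  proof (rule Bochner_Integration.integrable_bound[OF I])
    show "AE x in M. norm ((cmod (f x + g x))\<^sup>2)
        \<le> norm ((cmod (f x))\<^sup>2 + 2 * (cmod (f x) * cmod (g x)) + (cmod (g x))\<^sup>2)"
    proof (rule AE_I2)
      fix x show "norm ((cmod (f x + g x))\<^sup>2)
        \<le> norm ((cmod (f x))\<^sup>2 + 2 * (cmod (f x) * cmod (g x)) + (cmod (g x))\<^sup>2)"
        using le[of x] by (metis abs_ge_self abs_of_nonneg order_trans real_norm_def zero_le_power2)
    qed
  qed simp
  thus "square_integrable M (\<lambda>x. f x + g x)" by (simp add: square_integrable_def)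
  have "(l2norm M (\<lambda>x. f x + g x))\<^sup>2
      \<le> (LINT x|M. (cmod (f x))\<^sup>2 + 2 * (cmod (f x) * cmod (g x)) + (cmod (g x))\<^sup>2)"
    unfolding l2norm_power2 by (rule integral_mono[OF si I le])
  also have "\<dots> = (l2norm M f)\<^sup>2 + 2 * (LINT x|M. cmod (f x) * cmod (g x)) + (l2norm M g)\<^sup>2"
    using fi gi ci by (simp add: l2norm_power2)
  also have "\<dots> \<le> (l2norm M f + l2norm M g)\<^sup>2"
    using square_integrable_prod(3)[OF f g] by (simp add: power2_sum)
  finally show "l2norm M (\<lambda>x. f x + g x) \<le> l2norm M f + l2norm M g"
    by (rule power2_le_imp_le) simp
qed

lemma square_integrable_diff:
  fixes f g :: "'a \<Rightarrow> complex"
  assumes f: "square_integrable M f" and g: "square_integrable M g"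
  shows "square_integrable M (\<lambda>x. f x - g x)" "l2norm M (\<lambda>x. f x - g x) \<le> l2norm M f + l2norm M g"
  using square_integrable_add[OF f square_integrable_uminus(1)[OF g]] square_integrable_uminus(2)[OF g]
  by auto

lemma square_integrable_sum:
  fixes f :: "'i \<Rightarrow> 'a \<Rightarrow> complex"
  assumes "\<And>i. i \<in> I \<Longrightarrow> square_integrable M (f i)"
  shows "square_integrable M (\<lambda>x. \<Sum>i\<in>I. f i x)"
  using assms by (induction I rule: infinite_finite_induct) (auto simp: square_integrable_add(1))

lemma l2norm_diff_commute: "l2norm M (\<lambda>x. f x - g x) = l2norm M (\<lambda>x. g x - f x)"
  by (simp add: l2norm_def norm_minus_commute)

lemma l2norm_triangle_diff:
  fixes f g h :: "'a \<Rightarrow> complex"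
  assumes "square_integrable M f" "square_integrable M g" "square_integrable M h"
  shows "l2norm M (\<lambda>x. f x - h x) \<le> l2norm M (\<lambda>x. f x - g x) + l2norm M (\<lambda>x. g x - h x)"
  using square_integrable_add(2)[OF square_integrable_diff(1)[OF assms(1,2)] square_integrable_diff(1)[OF assms(2,3)]]
  by simp

lemma l2norm_diff_abs:
  fixes f g :: "'a \<Rightarrow> complex"
  assumes f: "square_integrable M f" and g: "square_integrable M g"
  shows "\<bar>l2norm M f - l2norm M g\<bar> \<le> l2norm M (\<lambda>x. f x - g x)"
  using square_integrable_add(2)[OF square_integrable_diff(1)[OF f g] g]
    square_integrable_add(2)[OF square_integrable_diff(1)[OF g f] f]
    l2norm_diff_commute[of M f g] by auto

lemma l2norm_eq_0D:
  fixes f :: "'a \<Rightarrow> complex"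
  assumes f: "square_integrable M f" and 0: "l2norm M f = 0"
  shows "AE x in M. f x = 0"
proof -
  have "(LINT x|M. (cmod (f x))\<^sup>2) = 0" using 0 l2norm_power2[of M f] by simp
  hence "AE x in M. (cmod (f x))\<^sup>2 = 0"
    using f by (subst (asm) integral_nonneg_eq_0_iff_AE) (auto simp: square_integrable_def)
  thus ?thesis by simp
qed

lemma l2norm_limit_unique:
  fixes f g :: "'a \<Rightarrow> complex"
  assumes h: "\<And>n. square_integrable M (h n)" and f: "square_integrable M f" and g: "square_integrable M g"
    and lf: "(\<lambda>n. l2norm M (\<lambda>x. h n x - f x)) \<longlonglongrightarrow> 0"
    and lg: "(\<lambda>n. l2norm M (\<lambda>x. h n x - g x)) \<longlonglongrightarrow> 0"
  shows "AE x in M. f x = g x"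
proof -
  have "l2norm M (\<lambda>x. f x - g x) \<le> l2norm M (\<lambda>x. h n x - f x) + l2norm M (\<lambda>x. h n x - g x)" for n
    using l2norm_triangle_diff[OF f h g, of n] l2norm_diff_commute[of M f "h n"] by simp
  hence "l2norm M (\<lambda>x. f x - g x) \<le> 0"
    by (intro LIMSEQ_le_const[OF tendsto_add_zero[OF lf lg]]) auto
  hence "l2norm M (\<lambda>x. f x - g x) = 0" using l2norm_nonneg by (metis antisym)
  from l2norm_eq_0D[OF square_integrable_diff(1)[OF f g] this] show ?thesis by simp
qed

lemma l2norm_tendsto:
  fixes f :: "'a \<Rightarrow> complex"
  assumes h: "\<And>n. square_integrable M (h n)" and f: "square_integrable M f"
    and lf: "(\<lambda>n. l2norm M (\<lambda>x. h n x - f x)) \<longlonglongrightarrow> 0"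
  shows "(\<lambda>n. l2norm M (h n)) \<longlonglongrightarrow> l2norm M f"
proof (rule LIM_zero_cancel, rule tendsto_rabs_zero_cancel, rule tendsto_sandwich[OF _ _ tendsto_const lf])
  show "\<forall>\<^sub>F n in sequentially. \<bar>l2norm M (h n) - l2norm M f\<bar> \<le> l2norm M (\<lambda>x. h n x - f x)"
    using l2norm_diff_abs[OF h f] by auto
qed auto

lemma inner_tendsto:
  fixes f g :: "'a \<Rightarrow> complex"
  assumes h: "\<And>n. square_integrable M (h n)" and f: "square_integrable M f" and g: "square_integrable M g"
    and lf: "(\<lambda>n. l2norm M (\<lambda>x. h n x - f x)) \<longlonglongrightarrow> 0"
  shows "(\<lambda>n. LINT x|M. h n x * cnj (g x)) \<longlonglongrightarrow> (LINT x|M. f x * cnj (g x))"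
    and "(\<lambda>n. LINT x|M. g x * cnj (h n x)) \<longlonglongrightarrow> (LINT x|M. g x * cnj (f x))"
proof -
  have l: "(\<lambda>n. l2norm M (\<lambda>x. h n x - f x) * l2norm M g) \<longlonglongrightarrow> 0"
    using tendsto_mult_left_zero[OF lf] .
  have "cmod ((LINT x|M. h n x * cnj (g x)) - (LINT x|M. f x * cnj (g x)))
     \<le> l2norm M (\<lambda>x. h n x - f x) * l2norm M g" for n
  proof -
    have "(LINT x|M. h n x * cnj (g x)) - (LINT x|M. f x * cnj (g x))
        = (LINT x|M. (h n x - f x) * cnj (g x))"
      using square_integrable_prod(2)[OF h g, of n] square_integrable_prod(2)[OF f g]
      by (simp add: left_diff_distrib)
    thus ?thesis using square_integrable_prod(4)[OF square_integrable_diff(1)[OF h f] g, of n] by simp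
  qed
  thus "(\<lambda>n. LINT x|M. h n x * cnj (g x)) \<longlonglongrightarrow> (LINT x|M. f x * cnj (g x))"
    by (intro LIM_zero_cancel[OF Lim_null_comparison[OF _ l]]) auto
  have "cmod ((LINT x|M. g x * cnj (h n x)) - (LINT x|M. g x * cnj (f x)))
     \<le> l2norm M (\<lambda>x. h n x - f x) * l2norm M g" for n
  proof -
    have "(LINT x|M. g x * cnj (h n x)) - (LINT x|M. g x * cnj (f x))
        = (LINT x|M. g x * cnj (h n x - f x))"
      using square_integrable_prod(2)[OF g h, of n] square_integrable_prod(2)[OF g f]
      by (simp add: right_diff_distrib)
    thus ?thesis using square_integrable_prod(4)[OF g square_integrable_diff(1)[OF h f], of n]
      by (simp add: mult.commute)
  qed
  thus "(\<lambda>n. LINT x|M. g x * cnj (h n x)) \<longlonglongrightarrow> (LINT x|M. g x * cnj (f x))"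
    by (intro LIM_zero_cancel[OF Lim_null_comparison[OF _ l]]) auto
qed

text \<open>Dominated convergence with majorant |f|^2. With \<open>c n\<close> equal to a cutoff
  minus 1 it shows that cut off functions converge back to \<open>f\<close> in mean.\<close>

lemma l2norm_dominated_tendsto:
  fixes f :: "'a \<Rightarrow> complex" and c :: "nat \<Rightarrow> 'a \<Rightarrow> complex"
  assumes f: "square_integrable M f" and [measurable]: "\<And>n. c n \<in> borel_measurable M"
    and b: "\<And>n x. x \<in> space M \<Longrightarrow> cmod (c n x) \<le> 1"
    and l: "\<And>x. x \<in> space M \<Longrightarrow> (\<lambda>n. c n x) \<longlonglongrightarrow> 0"
  shows "(\<lambda>n. l2norm M (\<lambda>x. c n x * f x)) \<longlonglongrightarrow> 0"
proof -
  have [measurable]: "f \<in> borel_measurable M" using f by (simp add: square_integrable_def)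
  have "(\<lambda>n. LINT x|M. (cmod (c n x * f x))\<^sup>2) \<longlonglongrightarrow> (LINT x|M. 0)"
  proof (rule integral_dominated_convergence[where w="\<lambda>x. (cmod (f x))\<^sup>2"])
    show "integrable M (\<lambda>x. (cmod (f x))\<^sup>2)" using f by (simp add: square_integrable_def)
    show "AE x in M. (\<lambda>n. (cmod (c n x * f x))\<^sup>2) \<longlonglongrightarrow> 0"
    proof (rule AE_I2)
      fix x assume "x \<in> space M"
      from tendsto_norm[OF tendsto_mult_left_zero[OF l[OF this], of "f x"]]
      have "(\<lambda>n. cmod (c n x * f x)) \<longlonglongrightarrow> 0" by simp
      from tendsto_power[OF this, of 2] show "(\<lambda>n. (cmod (c n x * f x))\<^sup>2) \<longlonglongrightarrow> 0" by simp
    qed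
    show "AE x in M. norm ((cmod (c n x * f x))\<^sup>2) \<le> (cmod (f x))\<^sup>2" for n
      by (rule AE_I2) (auto simp: norm_mult power_mult_distrib b intro!: mult_left_le_one_le power_le_one)
  qed auto
  from tendsto_real_sqrt[OF this] show ?thesis by (simp add: l2norm_def)
qed

text \<open>Riesz--Fischer. A subsequence with rapidly shrinking increments converges almost
  everywhere because a weighted sum of the squared increments has finite integral; Fatou's lemma
  turns the pointwise limit into a limit in mean of the whole sequence.\<close>

lemma l2_complete:
  fixes f :: "nat \<Rightarrow> 'a \<Rightarrow> complex"
  assumes f: "\<And>n. square_integrable M (f n)"
    and cauchy: "\<And>e. e > 0 \<Longrightarrow> \<exists>N. \<forall>m\<ge>N. \<forall>n\<ge>m. l2norm M (\<lambda>x. f n x - f m x) < e"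
  obtains g where "square_integrable M g" "(\<lambda>n. l2norm M (\<lambda>x. f n x - g x)) \<longlonglongrightarrow> 0"
proof -
  \<comment> \<open>The squared norms of the increments will be at most 16^(-k). The weight 4^k
    leaves a summable series and, pointwise, forces the increments below a multiple of
    2^(-k).\<close>
  define a :: "nat \<Rightarrow> real" where "a k = (1/4)^k" for k
  have a0: "a k > 0" for k by (simp add: a_def)
  have a2: "4^k * (a k)\<^sup>2 = a k" for k
  proof -
    have "4^k * (1/4::real)^k = (4 * (1/4))^k" by (rule power_mult_distrib[symmetric])
    hence "4^k * a k = 1" by (simp add: a_def del: power_divide power_one_over)
    thus ?thesis by (simp add: power2_eq_square mult.assoc[symmetric])
  qed
  have asum: "summable a" unfolding a_def by (rule summable_geometric) simp
  have [measurable]: "f n \<in> borel_measurable M" for n using f by (simp add: square_integrable_def)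
  have "\<exists>r. \<forall>k. (\<forall>m\<ge>r k. \<forall>n\<ge>m. l2norm M (\<lambda>x. f n x - f m x) < a k) \<and> r k < r (Suc k)"
  proof (rule dependent_nat_choice)
    show "\<exists>x. \<forall>m\<ge>x. \<forall>n\<ge>m. l2norm M (\<lambda>x. f n x - f m x) < a 0" using cauchy[OF a0] by blast
    fix x k
    obtain N where N: "\<forall>m\<ge>N. \<forall>n\<ge>m. l2norm M (\<lambda>x. f n x - f m x) < a (Suc k)"
      using cauchy[OF a0] by blast
    show "\<exists>y. (\<forall>m\<ge>y. \<forall>n\<ge>m. l2norm M (\<lambda>x. f n x - f m x) < a (Suc k)) \<and> x < y"
      by (rule exI[of _ "max N (Suc x)"]) (use N in auto)
  qed
  then obtain r where r: "\<And>k m n. m \<ge> r k \<Longrightarrow> n \<ge> m \<Longrightarrow> l2norm M (\<lambda>x. f n x - f m x) < a k"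
    and rs: "\<And>k. r k < r (Suc k)" by blast
  have mono: "strict_mono r" using rs by (simp add: strict_mono_Suc_iff)
  define d where "d k x = f (r (Suc k)) x - f (r k) x" for k x
  have [measurable]: "d k \<in> borel_measurable M" for k unfolding d_def by measurable
  have d: "square_integrable M (d k)" for k unfolding d_def by (intro square_integrable_diff f)
  have dl: "(\<integral>\<^sup>+x. ennreal ((cmod (d k x))\<^sup>2) \<partial>M) \<le> ennreal ((a k)\<^sup>2)" for k
  proof -
    have "l2norm M (d k) \<le> a k"
      unfolding d_def using r[of k "r k" "r (Suc k)"] rs[of k] by (simp add: less_imp_le)
    hence "(l2norm M (d k))\<^sup>2 \<le> (a k)\<^sup>2" by (intro power_mono l2norm_nonneg)
    thus ?thesis unfolding nn_integral_eq_l2norm[OF d] by (rule ennreal_leI)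
  qed
  have "(\<integral>\<^sup>+x. (\<Sum>k. ennreal (4^k * (cmod (d k x))\<^sup>2)) \<partial>M) = (\<Sum>k. \<integral>\<^sup>+x. ennreal (4^k * (cmod (d k x))\<^sup>2) \<partial>M)"
    by (rule nn_integral_suminf) measurable
  also have "\<dots> \<le> (\<Sum>k. ennreal (a k))"
  proof (rule suminf_le)
    fix k
    have "(\<integral>\<^sup>+x. ennreal (4^k * (cmod (d k x))\<^sup>2) \<partial>M) = ennreal (4^k) * (\<integral>\<^sup>+x. ennreal ((cmod (d k x))\<^sup>2) \<partial>M)"
      by (subst nn_integral_cmult[symmetric]) (measurable, intro nn_integral_cong ennreal_mult, simp_all)
    also have "\<dots> \<le> ennreal (4^k) * ennreal ((a k)\<^sup>2)" by (intro mult_left_mono dl) simp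
    also have "\<dots> = ennreal (a k)" by (simp only: ennreal_mult[symmetric] a2 zero_le_power2 zero_le_power zero_le_numeral)
    finally show "(\<integral>\<^sup>+x. ennreal (4^k * (cmod (d k x))\<^sup>2) \<partial>M) \<le> ennreal (a k)" .
  qed auto
  also have "\<dots> < \<infinity>"
    using ennreal_suminf_neq_top[OF asum less_imp_le[OF a0]] by (simp add: less_top[symmetric])
  finally have "AE x in M. (\<Sum>k. ennreal (4^k * (cmod (d k x))\<^sup>2)) \<noteq> \<infinity>"
    by (intro nn_integral_noteq_infinite) auto
  hence conv: "AE x in M. convergent (\<lambda>k. f (r k) x)"
  proof eventually_elim
    case (elim x)
    define S where "S = enn2real (\<Sum>k. ennreal (4^k * (cmod (d k x))\<^sup>2))"
    have "ennreal (4^k * (cmod (d k x))\<^sup>2) \<le> (\<Sum>k. ennreal (4^k * (cmod (d k x))\<^sup>2))" for k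
    proof -
      have "(\<Sum>k\<in>{k}. F k) \<le> (\<Sum>k. F k)" for F :: "nat \<Rightarrow> ennreal"
        by (rule sum_le_suminf) auto
      thus ?thesis by force
    qed
    also have "\<dots> = ennreal S" using elim by (simp add: S_def ennreal_enn2real_if)
    finally have S: "4^k * (cmod (d k x))\<^sup>2 \<le> S" for k
      by (simp add: S_def)
    have "cmod (d k x) \<le> sqrt S * (1/2)^k" for k
    proof -
      have "(2^k * cmod (d k x))\<^sup>2 = 4^k * (cmod (d k x))\<^sup>2"
        by (simp add: power_mult_distrib power_even_eq[symmetric] power_mult)
      hence "(2^k * cmod (d k x))\<^sup>2 \<le> S" using S by simp
      hence "2^k * cmod (d k x) \<le> sqrt S" by (rule real_le_rsqrt)
      thus ?thesis by (simp add: field_simps)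
    qed
    moreover have "summable (\<lambda>k. sqrt S * (1/2)^k)" by (intro summable_mult) simp
    ultimately have "summable (\<lambda>k. d k x)"
      by (intro summable_comparison_test[of "\<lambda>k. d k x" "\<lambda>k. sqrt S * (1/2)^k"]) blast+
    hence "convergent (\<lambda>n. \<Sum>k<n. d k x)" by (simp add: summable_iff_convergent)
    hence "convergent (\<lambda>n. (\<Sum>k<n. d k x) + f (r 0) x)" by (intro convergent_add convergent_const)
    moreover have "(\<Sum>k<n. d k x) + f (r 0) x = f (r n) x" for n
      unfolding d_def using sum_lessThan_telescope[of "\<lambda>k. f (r k) x" n] by simp
    ultimately show ?case by simp
  qed
  define g where "g x = lim (\<lambda>k. f (r k) x)" for x
  have g[measurable]: "g \<in> borel_measurable M" unfolding g_def by measurable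
  have gl: "AE x in M. (\<lambda>k. f (r k) x) \<longlonglongrightarrow> g x"
    using conv by eventually_elim (simp add: g_def convergent_LIMSEQ_iff)
  \<comment> \<open>Fatou along the subsequence: for fixed \<open>n\<close> the integrand is the
    almost everywhere limit of the squares of \<open>f n - f (r j)\<close>, and these are controlled
    by the Cauchy estimate once \<open>r j\<close> has passed \<open>n\<close>.\<close>
  have fat: "(\<integral>\<^sup>+x. ennreal ((cmod (f n x - g x))\<^sup>2) \<partial>M) \<le> ennreal ((a k)\<^sup>2)" if "n \<ge> r k" for n k
  proof -
    have "(\<integral>\<^sup>+x. ennreal ((cmod (f n x - g x))\<^sup>2) \<partial>M)
        = (\<integral>\<^sup>+x. liminf (\<lambda>j. ennreal ((cmod (f n x - f (r j) x))\<^sup>2)) \<partial>M)"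
    proof (rule nn_integral_cong_AE, use gl in eventually_elim)
      case (elim x)
      have "(\<lambda>j. ennreal ((cmod (f n x - f (r j) x))\<^sup>2)) \<longlonglongrightarrow> ennreal ((cmod (f n x - g x))\<^sup>2)"
        by (intro tendsto_intros elim)
      from lim_imp_Liminf[OF trivial_limit_sequentially this] show ?case by (rule sym)
    qed
    also have "\<dots> \<le> liminf (\<lambda>j. \<integral>\<^sup>+x. ennreal ((cmod (f n x - f (r j) x))\<^sup>2) \<partial>M)"
      by (rule nn_integral_liminf) measurable
    also have "\<dots> \<le> limsup (\<lambda>j. \<integral>\<^sup>+x. ennreal ((cmod (f n x - f (r j) x))\<^sup>2) \<partial>M)"
      by (rule Liminf_le_Limsup) simp
    also have "\<dots> \<le> ennreal ((a k)\<^sup>2)"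
    proof (rule Limsup_bounded)
      show "\<forall>\<^sub>F j in sequentially. (\<integral>\<^sup>+x. ennreal ((cmod (f n x - f (r j) x))\<^sup>2) \<partial>M) \<le> ennreal ((a k)\<^sup>2)"
        using eventually_ge_at_top[of n]
      proof eventually_elim
        case (elim j)
        have "j \<le> r j" using mono by (rule strict_mono_imp_increasing)
        hence "n \<le> r j" using elim by simp
        hence "l2norm M (\<lambda>x. f (r j) x - f n x) < a k" using r[OF that] by blast
        hence "l2norm M (\<lambda>x. f n x - f (r j) x) \<le> a k"
          using l2norm_diff_commute[of M "f n" "f (r j)"] by simp
        thus ?case
          by (subst nn_integral_eq_l2norm) (intro square_integrable_diff f ennreal_leI power_mono l2norm_nonneg | assumption)+
      qed
    qed
    finally show ?thesis .
  qed
  have sd: "square_integrable M (\<lambda>x. f n x - g x)" if "n \<ge> r 0" for n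
    using fat[OF that] by (subst square_integrable_iff_nn_integral) (measurable, erule le_less_trans, simp)
  have "square_integrable M (\<lambda>x. f (r 0) x - (f (r 0) x - g x))"
    by (rule square_integrable_diff(1)[OF f sd]) simp
  hence gs: "square_integrable M g" by simp
  have "(\<lambda>n. l2norm M (\<lambda>x. f n x - g x)) \<longlonglongrightarrow> 0"
  proof (rule LIMSEQ_I)
    fix e :: real assume "e > 0"
    then obtain k where k: "a k < e" using real_arch_pow_inv[of e "1/4"] unfolding a_def by auto
    have "l2norm M (\<lambda>x. f n x - g x) < e" if "n \<ge> r k" for n
    proof -
      have "ennreal ((l2norm M (\<lambda>x. f n x - g x))\<^sup>2) \<le> ennreal ((a k)\<^sup>2)"
        using fat[OF that] unfolding nn_integral_eq_l2norm[OF square_integrable_diff(1)[OF f gs]] .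
      hence "(l2norm M (\<lambda>x. f n x - g x))\<^sup>2 \<le> (a k)\<^sup>2" by (subst (asm) ennreal_le_iff) simp_all
      hence "l2norm M (\<lambda>x. f n x - g x) \<le> a k" by (rule power2_le_imp_le) (rule less_imp_le[OF a0])
      thus ?thesis using k by simp
    qed
    thus "\<exists>N. \<forall>n\<ge>N. norm (l2norm M (\<lambda>x. f n x - g x) - 0) < e" by auto
  qed
  with gs that show ?thesis by blast
qed

section \<open>Integral kernels that are isometric on square-integrable functions\<close>

definition kernel_int :: "'a measure \<Rightarrow> 'a set \<Rightarrow> ('a \<Rightarrow> 'b \<Rightarrow> complex) \<Rightarrow> ('a \<Rightarrow> complex) \<Rightarrow> 'b \<Rightarrow> complex" where
  "kernel_int M A e f y = (LINT x|M. indicator A x * f x * e x y)"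

text \<open>The bound concerns truncated integrals only: the integral of a square integrable
  function against the kernel need not converge. The sets \<open>A n\<close> will exhaust the
  space.\<close>

definition l2_contractive ::
    "'a measure \<Rightarrow> 'b measure \<Rightarrow> ('a \<Rightarrow> 'b \<Rightarrow> complex) \<Rightarrow> (nat \<Rightarrow> 'a set) \<Rightarrow> bool" where
  "l2_contractive M N e A \<longleftrightarrow> (\<forall>n f. square_integrable M f \<longrightarrow>
     square_integrable N (kernel_int M (A n) e f) \<and>
     l2norm N (kernel_int M (A n) e f) \<le> l2norm M (\<lambda>x. indicator (A n) x * f x))"

definition l2_isometric ::
    "'a measure \<Rightarrow> 'b measure \<Rightarrow> ('a \<Rightarrow> 'b \<Rightarrow> complex) \<Rightarrow> (nat \<Rightarrow> 'a set) \<Rightarrow> bool" where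
  "l2_isometric M N e A \<longleftrightarrow> (\<forall>n f. square_integrable M f \<longrightarrow>
     square_integrable N (kernel_int M (A n) e f) \<and>
     l2norm N (kernel_int M (A n) e f) = l2norm M (\<lambda>x. indicator (A n) x * f x))"

text \<open>A relation instead of a function, because a limit in mean is determined only up to null
  sets. For the kernel of the period cell this is the Plancherel extension behind
  \<open>is_fourier\<close>.\<close>

definition l2_transform ::
    "'a measure \<Rightarrow> 'b measure \<Rightarrow> ('a \<Rightarrow> 'b \<Rightarrow> complex) \<Rightarrow> (nat \<Rightarrow> 'a set) \<Rightarrow>
     ('a \<Rightarrow> complex) \<Rightarrow> ('b \<Rightarrow> complex) \<Rightarrow> bool" where
  "l2_transform M N e A f g \<longleftrightarrow> square_integrable N g \<and>
     (\<lambda>n. l2norm N (\<lambda>y. kernel_int M (A n) e f y - g y)) \<longlonglongrightarrow> 0"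

lemma l2_isometric_imp_contractive: "l2_isometric M N e A \<Longrightarrow> l2_contractive M N e A"
  by (auto simp: l2_isometric_def l2_contractive_def)

text \<open>Monotone convergence along the exhaustion. It is used when a function is known to be
  square integrable only on each set \<open>A n\<close>, with a norm bound that does not depend on
  \<open>n\<close>.\<close>

lemma square_integrable_exhaustion:
  fixes h :: "'a \<Rightarrow> complex"
  assumes [measurable]: "h \<in> borel_measurable M" "\<And>n. A n \<in> sets M"
    and A: "incseq A" "(\<Union>n. A n) = space M" and "0 \<le> c"
    and le: "\<And>n. square_integrable M (\<lambda>x. indicator (A n) x * h x)"
            "\<And>n. l2norm M (\<lambda>x. indicator (A n) x * h x) \<le> c"
  shows "square_integrable M h" "l2norm M h \<le> c"
proof -
  have sup: "ennreal ((cmod (h x))\<^sup>2) = (SUP n. ennreal ((cmod (indicator (A n) x * h x))\<^sup>2))"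
    if x: "x \<in> space M" for x
  proof (rule antisym)
    obtain n where "x \<in> A n" using x A by auto
    thus "ennreal ((cmod (h x))\<^sup>2) \<le> (SUP n. ennreal ((cmod (indicator (A n) x * h x))\<^sup>2))"
      by (intro SUP_upper2[of n]) auto
    show "(SUP n. ennreal ((cmod (indicator (A n) x * h x))\<^sup>2)) \<le> ennreal ((cmod (h x))\<^sup>2)"
      by (intro SUP_least ennreal_leI power_mono) (auto simp: indicator_def)
  qed
  have "(\<integral>\<^sup>+x. ennreal ((cmod (h x))\<^sup>2) \<partial>M)
      = (\<integral>\<^sup>+x. (SUP n. ennreal ((cmod (indicator (A n) x * h x))\<^sup>2)) \<partial>M)"
    by (rule nn_integral_cong) (rule sup)
  also have "\<dots> = (SUP n. \<integral>\<^sup>+x. ennreal ((cmod (indicator (A n) x * h x))\<^sup>2) \<partial>M)"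
  proof (rule nn_integral_monotone_convergence_SUP)
    show "incseq (\<lambda>n x. ennreal ((cmod (indicator (A n) x * h x))\<^sup>2))"
    proof (intro incseq_SucI le_funI ennreal_leI power_mono)
      fix n x
      have "A n \<subseteq> A (Suc n)" using A(1) by (simp add: incseq_Suc_iff)
      thus "cmod (indicator (A n) x * h x) \<le> cmod (indicator (A (Suc n)) x * h x)"
        by (auto simp: indicator_def)
    qed simp
  qed measurable
  also have "\<dots> \<le> ennreal (c\<^sup>2)"
  proof (rule SUP_least)
    fix n
    show "(\<integral>\<^sup>+x. ennreal ((cmod (indicator (A n) x * h x))\<^sup>2) \<partial>M) \<le> ennreal (c\<^sup>2)"
      unfolding nn_integral_eq_l2norm[OF le(1)] by (intro ennreal_leI power_mono le(2)) simp
  qed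
  finally have *: "(\<integral>\<^sup>+x. ennreal ((cmod (h x))\<^sup>2) \<partial>M) \<le> ennreal (c\<^sup>2)" .
  show s: "square_integrable M h"
    using * by (subst square_integrable_iff_nn_integral) (measurable, erule le_less_trans, simp)
  have "(l2norm M h)\<^sup>2 \<le> c\<^sup>2"
    using * unfolding nn_integral_eq_l2norm[OF s] by (subst (asm) ennreal_le_iff) simp_all
  thus "l2norm M h \<le> c" by (rule power2_le_imp_le) (rule \<open>0 \<le> c\<close>)
qed

lemma l2norm_sq_inner: "complex_of_real ((l2norm M f)\<^sup>2) = (LINT x|M. f x * cnj (f x))"
  by (simp add: l2norm_power2 complex_norm_square[symmetric] del: of_real_power flip: integral_complex_of_real)

text \<open>The common frame for the circle, the line and their products. Truncation to sets of
  finite measure together with a kernel bounded by 1 makes every double integral absolutely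
  convergent; the frame is symmetric under exchanging the two sides and conjugating the
  kernel.\<close>

locale l2_kernel =
  fixes M :: "'a measure" and N :: "'b measure" and e :: "'a \<Rightarrow> 'b \<Rightarrow> complex"
    and A :: "nat \<Rightarrow> 'a set" and B :: "nat \<Rightarrow> 'b set"
  assumes sf: "sigma_finite_measure M" "sigma_finite_measure N"
    and e_meas: "(\<lambda>(x, y). e x y) \<in> borel_measurable (M \<Otimes>\<^sub>M N)"
    and e_norm: "\<And>x y. cmod (e x y) \<le> 1"
    and A_sets [measurable]: "\<And>n. A n \<in> sets M" and A_fin: "\<And>n. emeasure M (A n) < \<infinity>"
    and A_inc: "incseq A" and A_un: "(\<Union>n. A n) = space M"
    and B_sets [measurable]: "\<And>n. B n \<in> sets N" and B_fin: "\<And>n. emeasure N (B n) < \<infinity>"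
    and B_inc: "incseq B" and B_un: "(\<Union>n. B n) = space N"
begin

abbreviation "e' \<equiv> (\<lambda>y x. cnj (e x y))"

lemma e_meas' [measurable (raw)]:
  assumes "f \<in> measurable K M" "g \<in> measurable K N"
  shows "(\<lambda>x. e (f x) (g x)) \<in> borel_measurable K"
proof -
  have "(\<lambda>x. (f x, g x)) \<in> measurable K (M \<Otimes>\<^sub>M N)" using assms by measurable
  from measurable_compose[OF this e_meas] show ?thesis by simp
qed

lemma swap: "l2_kernel N M e' B A"
proof unfold_locales
  show "(\<lambda>(x, y). cnj (e y x)) \<in> borel_measurable (N \<Otimes>\<^sub>M M)" by measurable
qed (use sf e_norm A_sets A_fin A_inc A_un B_sets B_fin B_inc B_un in
      \<open>auto simp: sigma_finite_measure_def\<close>)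

lemma square_integrable_indicator_A: "square_integrable M (indicator (A n) :: _ \<Rightarrow> complex)"
proof -
  have "integrable M (\<lambda>x. (cmod (indicator (A n) x))\<^sup>2) \<longleftrightarrow> integrable M (indicator (A n) :: _ \<Rightarrow> real)"
    by (rule Bochner_Integration.integrable_cong) (auto simp: indicator_def)
  thus ?thesis
    using A_fin[of n] by (simp add: square_integrable_def)
qed

lemma integrable_indicator_A:
  fixes f :: "'a \<Rightarrow> complex"
  assumes "square_integrable M f"
  shows "integrable M (\<lambda>x. indicator (A n) x * f x)"
  using square_integrable_prod(2)[OF assms square_integrable_indicator_A[of n]]
  by (rule Bochner_Integration.integrable_cong[THEN iffD1, rotated 2]) (auto simp: indicator_def)

lemma integrable_kernel:
  assumes f: "square_integrable M f" and y: "y \<in> space N"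
  shows "integrable M (\<lambda>x. indicator (A n) x * f x * e x y)"
proof (rule Bochner_Integration.integrable_bound[OF integrable_indicator_A[OF f, of n]])
  show "(\<lambda>x. indicator (A n) x * f x * e x y) \<in> borel_measurable M"
    using square_integrable_measurable[OF f] y by measurable
  show "AE x in M. cmod (indicator (A n) x * f x * e x y) \<le> cmod (indicator (A n) x * f x)"
    using e_norm by (auto simp: norm_mult mult_left_le)
qed

lemma kernel_int_measurable [measurable]:
  assumes [measurable]: "f \<in> borel_measurable M"
  shows "kernel_int M (A n) e f \<in> borel_measurable N"
proof -
  interpret sigma_finite_measure M by (rule sf)
  show ?thesis unfolding kernel_int_def by measurable
qed

lemma kernel_int_diff:
  assumes "square_integrable M f" "square_integrable M g" "y \<in> space N"
  shows "kernel_int M (A n) e (\<lambda>x. f x - g x) y = kernel_int M (A n) e f y - kernel_int M (A n) e g y"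
  using integrable_kernel[OF assms(1,3)] integrable_kernel[OF assms(2,3)]
  by (simp add: kernel_int_def ring_distribs)

lemma kernel_int_bounded:
  assumes f: "square_integrable M f"
  shows "cmod (kernel_int M (A n) e f y) \<le> (LINT x|M. cmod (indicator (A n) x * f x))"
proof (cases "integrable M (\<lambda>x. indicator (A n) x * f x * e x y)")
  case True
  have "cmod (kernel_int M (A n) e f y) \<le> (LINT x|M. cmod (indicator (A n) x * f x * e x y))"
    unfolding kernel_int_def by (rule integral_norm_bound)
  also have "\<dots> \<le> (LINT x|M. cmod (indicator (A n) x * f x))"
    using True integrable_indicator_A[OF f, of n] e_norm
    by (intro integral_mono integrable_norm) (auto simp: norm_mult mult_left_le)
  finally show ?thesis .
next
  case False
  thus ?thesis by (simp add: kernel_int_def not_integrable_integral_eq)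
qed

lemma kernel_int_indicator:
  "kernel_int M (A n) e (\<lambda>x. indicator (A m) x * f x) = kernel_int M (A (min n m)) e f"
proof -
  have "A (min n m) = A n \<inter> A m"
    using A_inc[THEN monoD] by (metis inf.absorb1 inf.absorb2 min_def nle_le)
  thus ?thesis
    by (auto simp: kernel_int_def fun_eq_iff indicator_inter_arith mult.assoc intro!: Bochner_Integration.integral_cong)
qed

text \<open>Fubini applies because both truncated functions are integrable and the kernel has
  modulus at most 1.\<close>

lemma adjoint:
  assumes f: "square_integrable M f" and g: "square_integrable N g"
  shows "(LINT y|N. kernel_int M (A n) e f y * cnj (indicator (B m) y * g y))
       = (LINT x|M. indicator (A n) x * f x * cnj (kernel_int N (B m) e' g x))"
proof -
  interpret M: sigma_finite_measure M by (rule sf)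
  interpret N: sigma_finite_measure N by (rule sf)
  interpret P: pair_sigma_finite M N ..
  interpret S: l2_kernel N M e' B A by (rule swap)
  have [measurable]: "f \<in> borel_measurable M" "g \<in> borel_measurable N"
    using f g by (auto simp: square_integrable_def)
  let ?F = "\<lambda>x. indicator (A n) x * f x" and ?G = "\<lambda>y. indicator (B m) y * g y"
  have iF: "integrable M ?F" and iG: "integrable N ?G"
    using integrable_indicator_A[OF f] S.integrable_indicator_A[OF g] by auto
  have i1: "integrable (M \<Otimes>\<^sub>M N) (\<lambda>z. cmod (?F (fst z)) * cmod (?G (snd z)))"
  proof (rule P.Fubini_integrable)
    show "(\<lambda>z. cmod (?F (fst z)) * cmod (?G (snd z))) \<in> borel_measurable (M \<Otimes>\<^sub>M N)" by measurable
    show "integrable M (\<lambda>x. LINT y|N. norm (cmod (?F (fst (x, y))) * cmod (?G (snd (x, y)))))"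
      using integrable_norm[OF iF] by (simp add: abs_mult)
    show "AE x in M. integrable N (\<lambda>y. cmod (?F (fst (x, y))) * cmod (?G (snd (x, y))))"
      using integrable_norm[OF iG] by simp
  qed
  have int: "integrable (M \<Otimes>\<^sub>M N) (\<lambda>(x, y). ?F x * e x y * cnj (?G y))"
  proof (rule Bochner_Integration.integrable_bound[OF i1])
    show "(\<lambda>(x, y). ?F x * e x y * cnj (?G y)) \<in> borel_measurable (M \<Otimes>\<^sub>M N)" by measurable
    show "AE z in M \<Otimes>\<^sub>M N. cmod (case z of (x, y) \<Rightarrow> ?F x * e x y * cnj (?G y))
        \<le> norm (cmod (?F (fst z)) * cmod (?G (snd z)))"
    proof (rule AE_I2)
      fix z
      have "cmod (?F (fst z)) * cmod (e (fst z) (snd z)) * cmod (?G (snd z))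
          \<le> cmod (?F (fst z)) * 1 * cmod (?G (snd z))"
        by (intro mult_mono e_norm) auto
      thus "cmod (case z of (x, y) \<Rightarrow> ?F x * e x y * cnj (?G y))
        \<le> norm (cmod (?F (fst z)) * cmod (?G (snd z)))"
        by (simp add: split_beta norm_mult abs_mult)
    qed
  qed
  have "(LINT y|N. kernel_int M (A n) e f y * cnj (?G y)) = (LINT y|N. LINT x|M. ?F x * e x y * cnj (?G y))"
    unfolding kernel_int_def by simp
  also have "\<dots> = (LINT x|M. LINT y|N. ?F x * e x y * cnj (?G y))"
    by (rule P.Fubini_integral[OF int])
  also have "\<dots> = (LINT x|M. ?F x * cnj (kernel_int N (B m) e' g x))"
  proof (rule Bochner_Integration.integral_cong)
    fix x
    have "(LINT y|N. ?F x * e x y * cnj (?G y)) = (LINT y|N. ?F x * cnj (?G y * cnj (e x y)))"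
      by (simp add: mult_ac)
    also have "\<dots> = ?F x * (LINT y|N. cnj (?G y * cnj (e x y)))" by (rule integral_mult_right_zero)
    also have "(LINT y|N. cnj (?G y * cnj (e x y))) = cnj (kernel_int N (B m) e' g x)"
      unfolding kernel_int_def by (rule Bochner_Integration.integral_cnj)
    finally show "(LINT y|N. ?F x * e x y * cnj (?G y)) = ?F x * cnj (kernel_int N (B m) e' g x)" .
  qed simp
  finally show ?thesis .
qed

text \<open>A contraction has a contractive adjoint. If \<open>H\<close> is the truncated image of
  \<open>g\<close>, its squared norm is the pairing of the transform of \<open>H\<close> with the
  truncated \<open>g\<close>; Cauchy--Schwarz bounds this by the product of the norms of
  \<open>H\<close> and of the truncated \<open>g\<close>, and one factor cancels. The truncation of
  the image is removed by exhaustion.\<close>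

lemma contractive_swap:
  assumes c: "l2_contractive M N e A"
  shows "l2_contractive N M e' B"
  unfolding l2_contractive_def
proof (intro allI impI)
  interpret S: l2_kernel N M e' B A by (rule swap)
  fix m and g :: "'b \<Rightarrow> complex" assume g: "square_integrable N g"
  define h where "h = kernel_int N (B m) e' g"
  define C where "C = (LINT y|N. cmod (indicator (B m) y * g y))"
  let ?G = "\<lambda>y. indicator (B m) y * g y"
  have G: "square_integrable N ?G" by (intro square_integrable_indicator g) simp
  have [measurable]: "h \<in> borel_measurable M"
    unfolding h_def using square_integrable_measurable[OF g] by (rule S.kernel_int_measurable)
  \<comment> \<open>The crude supremum bound gives square integrability on each \<open>A n\<close>,
    so that the norm to be cancelled is known to be finite.\<close>
  have "cmod (h x) \<le> C" for x unfolding h_def C_def by (rule S.kernel_int_bounded[OF g])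
  moreover from this[of undefined] have "0 \<le> C" using norm_ge_zero order_trans by blast
  ultimately have "square_integrable M (\<lambda>x. h x * indicator (A n) x)" for n
    by (intro square_integrable_mult_bounded[OF square_integrable_indicator_A, of h C]) auto
  hence ih: "square_integrable M (\<lambda>x. indicator (A n) x * h x)" for n by (simp add: mult.commute)
  have bd: "l2norm M (\<lambda>x. indicator (A n) x * h x) \<le> l2norm N ?G" for n
  proof -
    let ?H = "\<lambda>x. indicator (A n) x * h x"
    have HH: "indicator (A n) x * ?H x = ?H x" for x by (simp add: indicator_def)
    have "complex_of_real ((l2norm M ?H)\<^sup>2) = (LINT x|M. ?H x * cnj (?H x))" by (rule l2norm_sq_inner)
    also have "\<dots> = (LINT x|M. indicator (A n) x * ?H x * cnj (kernel_int N (B m) e' g x))"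
      by (rule Bochner_Integration.integral_cong) (auto simp: h_def indicator_def)
    also have "\<dots> = (LINT y|N. kernel_int M (A n) e ?H y * cnj (?G y))"
      using adjoint[OF ih g, of n n m] by simp
    finally have "(l2norm M ?H)\<^sup>2 = cmod (LINT y|N. kernel_int M (A n) e ?H y * cnj (?G y))"
      by (metis norm_of_real abs_of_nonneg zero_le_power2)
    also have "\<dots> \<le> l2norm N (kernel_int M (A n) e ?H) * l2norm N ?G"
      using c ih G unfolding l2_contractive_def by (intro square_integrable_prod(4)) auto
    also have "\<dots> \<le> l2norm M ?H * l2norm N ?G"
    proof (rule mult_right_mono)
      have "l2norm N (kernel_int M (A n) e ?H) \<le> l2norm M (\<lambda>x. indicator (A n) x * ?H x)"
        using c ih unfolding l2_contractive_def by blast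
      thus "l2norm N (kernel_int M (A n) e ?H) \<le> l2norm M ?H" unfolding HH .
    qed simp
    finally have "l2norm M ?H * l2norm M ?H \<le> l2norm M ?H * l2norm N ?G" by (simp add: power2_eq_square)
    thus ?thesis using l2norm_nonneg[of M ?H] l2norm_nonneg[of N ?G]
      by (metis mult_le_cancel_left_pos order_le_less)
  qed
  show "square_integrable M (kernel_int N (B m) e' g) \<and> l2norm M (kernel_int N (B m) e' g) \<le> l2norm N ?G"
    using square_integrable_exhaustion[OF _ A_sets A_inc A_un l2norm_nonneg ih bd]
    unfolding h_def[symmetric] by auto
qed

lemma truncation_tendsto:
  assumes f: "square_integrable M f"
  shows "(\<lambda>n. l2norm M (\<lambda>x. indicator (A n) x * f x - f x)) \<longlonglongrightarrow> 0"
proof -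
  have "(\<lambda>n. l2norm M (\<lambda>x. (indicator (A n) x - 1) * f x)) \<longlonglongrightarrow> 0"
  proof (rule l2norm_dominated_tendsto[OF f])
    fix x assume "x \<in> space M"
    then obtain m where m: "x \<in> A m" using A_un by auto
    have "indicator (A n) x - 1 = (0::complex)" if "n \<ge> m" for n
      using monoD[OF A_inc that] m by auto
    thus "(\<lambda>n. indicator (A n) x - 1 :: complex) \<longlonglongrightarrow> 0"
      by (intro tendsto_eventually eventually_sequentiallyI)
  qed (auto simp: indicator_def)
  thus ?thesis by (simp add: left_diff_distrib)
qed

text \<open>For m <= n the difference of two truncated transforms is the transform, truncated at
  \<open>A n\<close>, of \<open>f\<close> minus its own truncation at \<open>A m\<close>.
  Contractivity therefore makes the sequence Cauchy.\<close>

lemma transform_exists: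
  assumes c: "l2_contractive M N e A" and f: "square_integrable M f"
  obtains g where "l2_transform M N e A f g"
proof -
  let ?T = "\<lambda>n. kernel_int M (A n) e f" and ?F = "\<lambda>n x. indicator (A n) x * f x"
  have T: "square_integrable N (?T n)" for n using c f by (simp add: l2_contractive_def)
  have F: "square_integrable M (?F n)" for n by (intro square_integrable_indicator f) simp
  have key: "l2norm N (\<lambda>y. ?T n y - ?T m y) \<le> l2norm M (\<lambda>x. ?F n x - f x) + l2norm M (\<lambda>x. ?F m x - f x)"
    if "m \<le> n" for m n
  proof -
    have D: "square_integrable M (\<lambda>x. f x - ?F m x)" by (intro square_integrable_diff f F)
    have "l2norm N (\<lambda>y. ?T n y - ?T m y) = l2norm N (kernel_int M (A n) e (\<lambda>x. f x - ?F m x))"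
      unfolding l2norm_def
      by (rule arg_cong[where f=sqrt], rule Bochner_Integration.integral_cong)
         (use that in \<open>simp_all add: kernel_int_diff[OF f F] kernel_int_indicator min_absorb2\<close>)
    also have "\<dots> \<le> l2norm M (\<lambda>x. indicator (A n) x * (f x - ?F m x))"
      using c D by (simp add: l2_contractive_def)
    also have "\<dots> \<le> l2norm M (\<lambda>x. f x - ?F m x)" by (intro square_integrable_indicator D) simp
    also have "\<dots> = l2norm M (\<lambda>x. ?F m x - f x)" by (rule l2norm_diff_commute)
    finally show ?thesis using l2norm_nonneg[of M "\<lambda>x. ?F n x - f x"] by linarith
  qed
  have "\<exists>K. \<forall>m\<ge>K. \<forall>n\<ge>m. l2norm N (\<lambda>y. ?T n y - ?T m y) < r" if "r > 0" for r
  proof -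
    have "\<forall>\<^sub>F n in sequentially. l2norm M (\<lambda>x. ?F n x - f x) < r / 2"
      using order_tendstoD(2)[OF truncation_tendsto[OF f], of "r/2"] that by simp
    then obtain K where K: "\<And>n. n \<ge> K \<Longrightarrow> l2norm M (\<lambda>x. ?F n x - f x) < r / 2"
      by (auto simp: eventually_sequentially)
    show ?thesis
    proof (intro exI allI impI)
      fix m n assume "K \<le> m" "m \<le> n"
      thus "l2norm N (\<lambda>y. ?T n y - ?T m y) < r" using key[of m n] K[of m] K[of n] by simp
    qed
  qed
  from l2_complete[OF T this] that show thesis unfolding l2_transform_def by blast
qed

lemma transform_unique:
  assumes c: "l2_contractive M N e A" and f: "square_integrable M f"
    and "l2_transform M N e A f g" "l2_transform M N e A f h"
  shows "AE y in N. g y = h y"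
  using assms l2norm_limit_unique[of N "\<lambda>n. kernel_int M (A n) e f" g h]
  by (simp add: l2_transform_def l2_contractive_def)

text \<open>The limit of \<open>adjoint\<close> in the truncation of \<open>f\<close>. The
  truncation of \<open>h\<close> remains, since the adjoint transform of \<open>h\<close> is itself
  only a limit in mean.\<close>

lemma transform_inner:
  assumes c: "l2_contractive M N e A" and f: "square_integrable M f"
    and g: "l2_transform M N e A f g" and h: "square_integrable N h"
  shows "(LINT y|N. g y * cnj (indicator (B m) y * h y)) = (LINT x|M. f x * cnj (kernel_int N (B m) e' h x))"
proof -
  let ?T = "\<lambda>n. kernel_int M (A n) e f" and ?F = "\<lambda>n x. indicator (A n) x * f x"
  have T: "square_integrable N (?T n)" for n using c f by (simp add: l2_contractive_def)
  have F: "square_integrable M (?F n)" for n by (intro square_integrable_indicator f) simp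
  have H: "square_integrable N (\<lambda>y. indicator (B m) y * h y)" by (intro square_integrable_indicator h) simp
  have K: "square_integrable M (kernel_int N (B m) e' h)"
    using contractive_swap[OF c] h by (simp add: l2_contractive_def)
  have 1: "(\<lambda>n. LINT y|N. ?T n y * cnj (indicator (B m) y * h y)) \<longlonglongrightarrow> (LINT y|N. g y * cnj (indicator (B m) y * h y))"
    using g by (intro inner_tendsto(1) T H) (auto simp: l2_transform_def)
  have 2: "(\<lambda>n. LINT x|M. ?F n x * cnj (kernel_int N (B m) e' h x)) \<longlonglongrightarrow> (LINT x|M. f x * cnj (kernel_int N (B m) e' h x))"
    by (intro inner_tendsto(1) F K f truncation_tendsto)
  show ?thesis by (rule LIMSEQ_unique[OF 1 2[folded adjoint[OF f h]]])
qed

lemma l2_transform_l2norm_le: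
  assumes c: "l2_contractive M N e A" and f: "square_integrable M f" and g: "l2_transform M N e A f g"
  shows "l2norm N g \<le> l2norm M f"
proof (rule LIMSEQ_le_const2)
  show "(\<lambda>n. l2norm N (kernel_int M (A n) e f)) \<longlonglongrightarrow> l2norm N g"
    using c f g by (intro l2norm_tendsto) (auto simp: l2_transform_def l2_contractive_def)
  have "l2norm N (kernel_int M (A n) e f) \<le> l2norm M f" for n
    using c f square_integrable_indicator(2)[OF f A_sets[of n]] unfolding l2_contractive_def
    by (meson order_trans)
  thus "\<exists>K. \<forall>n\<ge>K. l2norm N (kernel_int M (A n) e f) \<le> l2norm M f" by blast
qed

lemma l2_transform_l2norm_eq:
  assumes i: "l2_isometric M N e A" and f: "square_integrable M f" and g: "l2_transform M N e A f g"
  shows "l2norm N g = l2norm M f"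
proof (rule LIMSEQ_unique)
  show "(\<lambda>n. l2norm N (kernel_int M (A n) e f)) \<longlonglongrightarrow> l2norm N g"
    using i f g by (intro l2norm_tendsto) (auto simp: l2_transform_def l2_isometric_def)
  have "(\<lambda>n. l2norm M (\<lambda>x. indicator (A n) x * f x)) \<longlonglongrightarrow> l2norm M f"
    by (intro l2norm_tendsto f truncation_tendsto square_integrable_indicator) simp
  thus "(\<lambda>n. l2norm N (kernel_int M (A n) e f)) \<longlonglongrightarrow> l2norm M f"
    using i f by (simp add: l2_isometric_def)
qed

text \<open>Let \<open>f\<close> be the adjoint transform of \<open>g\<close> and \<open>w\<close>
  the transform of \<open>f\<close>. Isometry of the adjoint gives <w, g> = ||f||^2 = ||g||^2, while
  contractivity gives ||w|| <= ||g||; this is the case of equality in Cauchy--Schwarz and leaves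
  only w = g.\<close>

lemma transform_surj:
  assumes c: "l2_contractive M N e A" and i: "l2_isometric N M e' B" and g: "square_integrable N g"
  obtains f where "square_integrable M f" "l2_transform M N e A f g" "l2norm M f = l2norm N g"
proof -
  interpret S: l2_kernel N M e' B A by (rule swap)
  have c': "l2_contractive N M e' B" using i by (rule l2_isometric_imp_contractive)
  obtain f where f: "l2_transform N M e' B g f" using S.transform_exists[OF c' g] .
  have fs: "square_integrable M f" and fl: "(\<lambda>m. l2norm M (\<lambda>x. kernel_int N (B m) e' g x - f x)) \<longlonglongrightarrow> 0"
    using f by (auto simp: l2_transform_def)
  have lf: "l2norm M f = l2norm N g" by (rule S.l2_transform_l2norm_eq[OF i g f])
  obtain w where w: "l2_transform M N e A f w" using transform_exists[OF c fs] .
  have ws: "square_integrable N w" using w by (simp add: l2_transform_def)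
  have lw: "l2norm N w \<le> l2norm M f" by (rule l2_transform_l2norm_le[OF c fs w])
  have K: "square_integrable M (kernel_int N (B m) e' g)" for m
    using i g by (simp add: l2_isometric_def)
  have 1: "(\<lambda>m. LINT y|N. w y * cnj (indicator (B m) y * g y)) \<longlonglongrightarrow> (LINT y|N. w y * cnj (g y))"
    by (intro inner_tendsto(2) ws g S.truncation_tendsto square_integrable_indicator) simp
  have 2: "(\<lambda>m. LINT x|M. f x * cnj (kernel_int N (B m) e' g x)) \<longlonglongrightarrow> (LINT x|M. f x * cnj (f x))"
    by (intro inner_tendsto(2) fs K fl)
  have wg: "(LINT y|N. w y * cnj (g y)) = (l2norm N g)\<^sup>2"
    using LIMSEQ_unique[OF 1 2[folded transform_inner[OF c fs w g]]]
    by (simp only: l2norm_sq_inner[symmetric] lf)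
  note W = square_integrable_prod(2)[OF ws ws] square_integrable_prod(2)[OF ws g]
    square_integrable_prod(2)[OF g ws] square_integrable_prod(2)[OF g g]
  have gw: "(LINT y|N. g y * cnj (w y)) = (l2norm N g)\<^sup>2"
  proof -
    have "(LINT y|N. g y * cnj (w y)) = (LINT y|N. cnj (w y * cnj (g y)))" by (simp add: mult.commute)
    also have "\<dots> = cnj (LINT y|N. w y * cnj (g y))" by (rule Bochner_Integration.integral_cnj)
    finally show ?thesis using wg by simp
  qed
  \<comment> \<open>In the expanded square the two mixed terms each equal ||g||^2, so the result is
    ||w||^2 - ||g||^2, which is at most zero.\<close>
  have "complex_of_real ((l2norm N (\<lambda>y. w y - g y))\<^sup>2)
      = (LINT y|N. w y * cnj (w y) - w y * cnj (g y) - g y * cnj (w y) + g y * cnj (g y))"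
    unfolding l2norm_sq_inner by (simp add: algebra_simps)
  also have "\<dots> = (l2norm N w)\<^sup>2 - (l2norm N g)\<^sup>2"
    using W by (simp add: wg gw l2norm_sq_inner[symmetric])
  finally have "(l2norm N (\<lambda>y. w y - g y))\<^sup>2 = (l2norm N w)\<^sup>2 - (l2norm N g)\<^sup>2"
    by (metis of_real_eq_iff of_real_diff)
  moreover have "(l2norm N w)\<^sup>2 \<le> (l2norm N g)\<^sup>2" using lw lf by (simp add: power_mono)
  ultimately have "l2norm N (\<lambda>y. w y - g y) = 0" using zero_le_power2[of "l2norm N (\<lambda>y. w y - g y)"] by simp
  hence ae: "AE y in N. w y = g y" using l2norm_eq_0D[OF square_integrable_diff(1)[OF ws g]] by simp
  have "l2_transform M N e A f g" unfolding l2_transform_def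
  proof
    show "square_integrable N g" by (rule g)
    have [measurable]: "w \<in> borel_measurable N" "g \<in> borel_measurable N" "f \<in> borel_measurable M"
      using ws g fs by (auto simp: square_integrable_def)
    have "l2norm N (\<lambda>y. kernel_int M (A n) e f y - w y) = l2norm N (\<lambda>y. kernel_int M (A n) e f y - g y)" for n
      by (rule l2norm_cong_AE) (use ae in auto)
    thus "(\<lambda>n. l2norm N (\<lambda>y. kernel_int M (A n) e f y - g y)) \<longlonglongrightarrow> 0"
      using w by (simp add: l2_transform_def)
  qed
  thus thesis using that fs lf by blast
qed

end

section \<open>Tensor products of kernels\<close>

definition pair_kernel ::
    "('a \<Rightarrow> 'b \<Rightarrow> complex) \<Rightarrow> ('c \<Rightarrow> 'd \<Rightarrow> complex) \<Rightarrow> 'a \<times> 'c \<Rightarrow> 'b \<times> 'd \<Rightarrow> complex" where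
  "pair_kernel e1 e2 x y = e1 (fst x) (fst y) * e2 (snd x) (snd y)"

lemma emeasure_Times_finite:
  assumes "sigma_finite_measure M2" "A \<in> sets M1" "B \<in> sets M2" "emeasure M1 A < \<infinity>" "emeasure M2 B < \<infinity>"
  shows "emeasure (M1 \<Otimes>\<^sub>M M2) (A \<times> B) < \<infinity>"
  using assms by (subst sigma_finite_measure.emeasure_pair_measure_Times) (auto simp: ennreal_mult_less_top)

lemma Times_exhaustion:
  assumes "incseq A" "incseq B" "(\<Union>n. A n) = X" "(\<Union>n. B n) = Y"
  shows "incseq (\<lambda>n. A n \<times> B n)" "(\<Union>n. A n \<times> B n) = X \<times> Y"
proof -
  show "incseq (\<lambda>n. A n \<times> B n)" using assms(1,2) unfolding incseq_def by blast
  show "(\<Union>n. A n \<times> B n) = X \<times> Y"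
  proof (intro equalityI subsetI)
    fix z assume "z \<in> X \<times> Y"
    then obtain m n where mn: "fst z \<in> A m" "snd z \<in> B n" using assms(3,4) by force
    have "A m \<subseteq> A (max m n)" "B n \<subseteq> B (max m n)"
      using assms(1,2) by (auto simp: incseq_def)
    hence "z \<in> A (max m n) \<times> B (max m n)" using mn by (cases z) auto
    thus "z \<in> (\<Union>n. A n \<times> B n)" by blast
  qed (use assms(3,4) in auto)
qed

locale l2_kernel_pair = k1: l2_kernel M1 N1 e1 A1 B1 + k2: l2_kernel M2 N2 e2 A2 B2
  for M1 :: "'a measure" and N1 :: "'b measure" and e1 A1 B1
    and M2 :: "'c measure" and N2 :: "'d measure" and e2 A2 B2
begin

sublocale l2_kernel "M1 \<Otimes>\<^sub>M M2" "N1 \<Otimes>\<^sub>M N2" "pair_kernel e1 e2" "\<lambda>n. A1 n \<times> A2 n" "\<lambda>n. B1 n \<times> B2 n"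
proof (rule l2_kernel.intro)
  interpret M1: sigma_finite_measure M1 by (rule k1.sf)
  interpret M2: sigma_finite_measure M2 by (rule k2.sf)
  interpret N1: sigma_finite_measure N1 by (rule k1.sf)
  interpret N2: sigma_finite_measure N2 by (rule k2.sf)
  interpret M: pair_sigma_finite M1 M2 ..
  interpret N: pair_sigma_finite N1 N2 ..
  show "sigma_finite_measure (M1 \<Otimes>\<^sub>M M2)" "sigma_finite_measure (N1 \<Otimes>\<^sub>M N2)"
    by (rule M.sigma_finite_measure_axioms N.sigma_finite_measure_axioms)+
  show "(\<lambda>(x, y). pair_kernel e1 e2 x y) \<in> borel_measurable ((M1 \<Otimes>\<^sub>M M2) \<Otimes>\<^sub>M (N1 \<Otimes>\<^sub>M N2))"
    unfolding pair_kernel_def by measurable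
  show "cmod (pair_kernel e1 e2 x y) \<le> 1" for x y
    unfolding pair_kernel_def norm_mult by (intro mult_le_one k1.e_norm k2.e_norm) simp
  show "A1 n \<times> A2 n \<in> sets (M1 \<Otimes>\<^sub>M M2)" "B1 n \<times> B2 n \<in> sets (N1 \<Otimes>\<^sub>M N2)" for n
    by measurable
  show "emeasure (M1 \<Otimes>\<^sub>M M2) (A1 n \<times> A2 n) < \<infinity>" for n
    by (intro emeasure_Times_finite k2.sf k1.A_sets k2.A_sets k1.A_fin k2.A_fin)
  show "emeasure (N1 \<Otimes>\<^sub>M N2) (B1 n \<times> B2 n) < \<infinity>" for n
    by (intro emeasure_Times_finite k2.sf k1.B_sets k2.B_sets k1.B_fin k2.B_fin)
  show "incseq (\<lambda>n. A1 n \<times> A2 n)" "(\<Union>n. A1 n \<times> A2 n) = space (M1 \<Otimes>\<^sub>M M2)"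
    using Times_exhaustion[OF k1.A_inc k2.A_inc k1.A_un k2.A_un] by (simp_all add: space_pair_measure)
  show "incseq (\<lambda>n. B1 n \<times> B2 n)" "(\<Union>n. B1 n \<times> B2 n) = space (N1 \<Otimes>\<^sub>M N2)"
    using Times_exhaustion[OF k1.B_inc k2.B_inc k1.B_un k2.B_un] by (simp_all add: space_pair_measure)
qed

text \<open>The transform is carried out one variable at a time: \<open>g\<close> is the partial
  transform in the second variable, and Tonelli adds up the norms of the slices. Slices are square
  integrable only for almost every value of the remaining variable, so both stages work almost
  everywhere.\<close>

lemma isometric_pair:
  assumes i1: "l2_isometric M1 N1 e1 A1" and i2: "l2_isometric M2 N2 e2 A2"
  shows "l2_isometric (M1 \<Otimes>\<^sub>M M2) (N1 \<Otimes>\<^sub>M N2) (pair_kernel e1 e2) (\<lambda>n. A1 n \<times> A2 n)"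
  unfolding l2_isometric_def
proof (intro allI impI)
  interpret M1: sigma_finite_measure M1 by (rule k1.sf)
  interpret M2: sigma_finite_measure M2 by (rule k2.sf)
  interpret N1: sigma_finite_measure N1 by (rule k1.sf)
  interpret N2: sigma_finite_measure N2 by (rule k2.sf)
  interpret M: pair_sigma_finite M1 M2 ..
  interpret N: pair_sigma_finite N1 N2 ..
  interpret MN: pair_sigma_finite M1 N2 ..
  fix n and f :: "'a \<times> 'c \<Rightarrow> complex"
  assume f: "square_integrable (M1 \<Otimes>\<^sub>M M2) f"
  let ?K = "kernel_int (M1 \<Otimes>\<^sub>M M2) (A1 n \<times> A2 n) (pair_kernel e1 e2) f"
  define F where "F z = indicator (A1 n \<times> A2 n) z * f z" for z
  have [measurable]: "f \<in> borel_measurable (M1 \<Otimes>\<^sub>M M2)" using f by (simp add: square_integrable_def)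
  have Fm[measurable]: "F \<in> borel_measurable (M1 \<Otimes>\<^sub>M M2)" unfolding F_def by measurable
  have Fs: "square_integrable (M1 \<Otimes>\<^sub>M M2) F" unfolding F_def by (intro square_integrable_indicator f) simp
  have K1: "indicator (A1 n) x1 * F (x1, x2) = F (x1, x2)" and K2: "indicator (A2 n) x2 * F (x1, x2) = F (x1, x2)" for x1 x2
    by (auto simp: F_def indicator_def)
  define g where "g = (\<lambda>(x1, y2). LINT x2|M2. F (x1, x2) * e2 x2 y2)"
  have gm[measurable]: "g \<in> borel_measurable (M1 \<Otimes>\<^sub>M N2)" unfolding g_def by measurable
  have gK: "g (x1, y2) = kernel_int M2 (A2 n) e2 (\<lambda>x2. F (x1, x2)) y2" for x1 y2
    unfolding g_def kernel_int_def K2 by simp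
  have gI: "indicator (A1 n) x1 * g (x1, y2) = g (x1, y2)" for x1 y2
    unfolding g_def by (cases "x1 \<in> A1 n") (auto simp: F_def)
  have tot: "(\<integral>\<^sup>+x1. \<integral>\<^sup>+x2. ennreal ((cmod (F (x1, x2)))\<^sup>2) \<partial>M2 \<partial>M1) = ennreal ((l2norm (M1 \<Otimes>\<^sub>M M2) F)\<^sup>2)"
    using M2.nn_integral_fst[of "\<lambda>z. ennreal ((cmod (F z))\<^sup>2)" M1] nn_integral_eq_l2norm[OF Fs] by simp
  have "AE x1 in M1. (\<integral>\<^sup>+x2. ennreal ((cmod (F (x1, x2)))\<^sup>2) \<partial>M2) \<noteq> \<infinity>"
    by (rule nn_integral_noteq_infinite) (measurable, simp add: tot)
  hence s1: "AE x1 in M1. (\<integral>\<^sup>+y2. ennreal ((cmod (g (x1, y2)))\<^sup>2) \<partial>N2) = (\<integral>\<^sup>+x2. ennreal ((cmod (F (x1, x2)))\<^sup>2) \<partial>M2)"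
    using AE_space
  proof eventually_elim
    case (elim x1)
    have s: "square_integrable M2 (\<lambda>x2. F (x1, x2))"
      using elim by (subst square_integrable_iff_nn_integral) (measurable, simp add: less_top[symmetric])
    have "square_integrable N2 (\<lambda>y2. g (x1, y2)) \<and> l2norm N2 (\<lambda>y2. g (x1, y2)) = l2norm M2 (\<lambda>x2. F (x1, x2))"
      using i2[unfolded l2_isometric_def, rule_format, OF s, of n] unfolding gK K2 .
    thus ?case using nn_integral_eq_l2norm[of N2 "\<lambda>y2. g (x1, y2)"] nn_integral_eq_l2norm[OF s] by simp
  qed
  have "(\<integral>\<^sup>+x1. \<integral>\<^sup>+y2. ennreal ((cmod (g (x1, y2)))\<^sup>2) \<partial>N2 \<partial>M1) = ennreal ((l2norm (M1 \<Otimes>\<^sub>M M2) F)\<^sup>2)"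
    using nn_integral_cong_AE[OF s1] tot by simp
  hence totg: "(\<integral>\<^sup>+y2. \<integral>\<^sup>+x1. ennreal ((cmod (g (x1, y2)))\<^sup>2) \<partial>M1 \<partial>N2) = ennreal ((l2norm (M1 \<Otimes>\<^sub>M M2) F)\<^sup>2)"
    using MN.Fubini[of "\<lambda>z. ennreal ((cmod (g z))\<^sup>2)"] by simp
  have iF: "integrable (M1 \<Otimes>\<^sub>M M2) F" unfolding F_def by (rule integrable_indicator_A[OF f])
  \<comment> \<open>Fubini for the complex integral is available because of the truncation; it
    identifies the product transform with the first-variable transform of \<open>g\<close> at every
    point, not merely almost everywhere.\<close>
  have Kg: "?K (y1, y2) = kernel_int M1 (A1 n) e1 (\<lambda>x1. g (x1, y2)) y1"
    if y: "y1 \<in> space N1" "y2 \<in> space N2" for y1 y2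
  proof -
    have int: "integrable (M1 \<Otimes>\<^sub>M M2) (\<lambda>z. F z * pair_kernel e1 e2 z (y1, y2))"
      unfolding F_def by (rule integrable_kernel[OF f]) (use y in \<open>simp add: space_pair_measure\<close>)
    have "?K (y1, y2) = (LINT z|(M1 \<Otimes>\<^sub>M M2). F z * pair_kernel e1 e2 z (y1, y2))"
      by (simp add: kernel_int_def F_def)
    also have "\<dots> = (LINT x1|M1. LINT x2|M2. F (x1, x2) * pair_kernel e1 e2 (x1, x2) (y1, y2))"
      using M.integral_fst'[OF int] by simp
    also have "\<dots> = (LINT x1|M1. g (x1, y2) * e1 x1 y1)"
    proof (rule Bochner_Integration.integral_cong)
      fix x1
      have "(LINT x2|M2. F (x1, x2) * pair_kernel e1 e2 (x1, x2) (y1, y2)) = (LINT x2|M2. F (x1, x2) * e2 x2 y2 * e1 x1 y1)"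
        by (simp add: pair_kernel_def mult_ac)
      thus "(LINT x2|M2. F (x1, x2) * pair_kernel e1 e2 (x1, x2) (y1, y2)) = g (x1, y2) * e1 x1 y1"
        by (simp add: g_def)
    qed simp
    finally show ?thesis unfolding kernel_int_def gI .
  qed
  have Km: "?K \<in> borel_measurable (N1 \<Otimes>\<^sub>M N2)" by measurable
  have "AE y2 in N2. (\<integral>\<^sup>+x1. ennreal ((cmod (g (x1, y2)))\<^sup>2) \<partial>M1) \<noteq> \<infinity>"
    by (rule nn_integral_noteq_infinite) (measurable, simp add: totg)
  hence s2: "AE y2 in N2. (\<integral>\<^sup>+y1. ennreal ((cmod (?K (y1, y2)))\<^sup>2) \<partial>N1) = (\<integral>\<^sup>+x1. ennreal ((cmod (g (x1, y2)))\<^sup>2) \<partial>M1)"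
    using AE_space
  proof eventually_elim
    case (elim y2)
    have s: "square_integrable M1 (\<lambda>x1. g (x1, y2))"
      using elim by (subst square_integrable_iff_nn_integral) (measurable, simp add: less_top[symmetric])
    let ?k = "kernel_int M1 (A1 n) e1 (\<lambda>x1. g (x1, y2))"
    have "square_integrable N1 ?k \<and> l2norm N1 ?k = l2norm M1 (\<lambda>x1. g (x1, y2))"
      using i1[unfolded l2_isometric_def, rule_format, OF s, of n] unfolding gI .
    moreover have "(\<integral>\<^sup>+y1. ennreal ((cmod (?K (y1, y2)))\<^sup>2) \<partial>N1) = (\<integral>\<^sup>+y1. ennreal ((cmod (?k y1))\<^sup>2) \<partial>N1)"
      by (rule nn_integral_cong) (simp add: Kg elim)
    ultimately show ?case using nn_integral_eq_l2norm[of N1 ?k] nn_integral_eq_l2norm[OF s] by simp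
  qed
  have "(\<integral>\<^sup>+z. ennreal ((cmod (?K z))\<^sup>2) \<partial>(N1 \<Otimes>\<^sub>M N2)) = (\<integral>\<^sup>+y2. \<integral>\<^sup>+y1. ennreal ((cmod (?K (y1, y2)))\<^sup>2) \<partial>N1 \<partial>N2)"
    by (rule N.nn_integral_snd[symmetric]) measurable
  also have "\<dots> = ennreal ((l2norm (M1 \<Otimes>\<^sub>M M2) F)\<^sup>2)"
    using nn_integral_cong_AE[OF s2] totg by simp
  finally show "square_integrable (N1 \<Otimes>\<^sub>M N2) ?K \<and>
      l2norm (N1 \<Otimes>\<^sub>M N2) ?K = l2norm (M1 \<Otimes>\<^sub>M M2) (\<lambda>x. indicator (A1 n \<times> A2 n) x * f x)"
    using l2norm_eq_of_nn_integral[OF Km] unfolding F_def[symmetric] by simp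
qed

end

section \<open>Fourier series on the circle\<close>

text \<open>Half-open intervals form an intersection-stable generator of the Borel sets, so a Dynkin
  argument applies. The step for complements uses the integral over the whole line, which is the
  limit over the intervals from -n to n.\<close>

lemma set_integral_zero_of_Ioc:
  fixes f :: "real \<Rightarrow> complex"
  assumes f: "integrable lborel f" and Ioc: "\<And>a b. (LINT x:{a<..b}|lborel. f x) = 0"
    and A: "A \<in> sets borel"
  shows "(LINT x:A|lborel. f x) = 0"
proof -
  have UN: "(LINT x:UNIV|lborel. f x) = 0"
  proof -
    have "(\<lambda>n. LINT x:{- real n<..real n}|lborel. f x) \<longlonglongrightarrow> (LINT x:UNIV|lborel. f x)"
      unfolding set_lebesgue_integral_def
    proof (rule integral_dominated_convergence[where w="\<lambda>x. cmod (f x)"])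
      show "AE x in lborel. (\<lambda>n. indicator {- real n<..real n} x *\<^sub>R f x) \<longlonglongrightarrow> indicator UNIV x *\<^sub>R f x"
      proof (rule AE_I2)
        fix x :: real
        obtain m :: nat where m: "\<bar>x\<bar> < real m" using reals_Archimedean2 by blast
        show "(\<lambda>n. indicator {- real n<..real n} x *\<^sub>R f x) \<longlonglongrightarrow> indicator UNIV x *\<^sub>R f x"
          by (intro tendsto_eventually eventually_sequentiallyI[of m]) (use m in \<open>auto simp: indicator_def\<close>)
      qed
    qed (use f in \<open>auto simp: indicator_def\<close>)
    thus ?thesis using Ioc LIMSEQ_unique tendsto_const by (simp add: LIMSEQ_const_iff)
  qed
  have si: "set_integrable lborel B f" if "B \<in> sets borel" for B
    using f that unfolding set_integrable_def by (intro integrable_mult_indicator) auto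
  have A': "A \<in> sigma_sets UNIV (range (\<lambda>(a, b). {a <.. b::real}))"
    using A by (simp add: borel_sigma_sets_Ioc)
  have sets: "B \<in> sets borel" if "B \<in> sigma_sets UNIV (range (\<lambda>(a, b). {a <.. b::real}))" for B
    using that by (simp add: borel_sigma_sets_Ioc)
  have "Int_stable (range (\<lambda>(a, b). {a <.. b::real}))"
    by (auto simp: Int_stable_def)
  moreover have "range (\<lambda>(a, b). {a <.. b::real}) \<subseteq> Pow UNIV" by simp
  ultimately show ?thesis using A'
  proof (induction rule: sigma_sets_induct_disjoint)
    case (basic B) thus ?case using Ioc by auto
  next
    case empty thus ?case by (simp add: set_lebesgue_integral_def)
  next
    case (compl B)
    have "(LINT x:UNIV|lborel. f x) = (LINT x:(UNIV - B) \<union> B|lborel. f x)" by simp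
    also have "\<dots> = (LINT x:(UNIV - B)|lborel. f x) + (LINT x:B|lborel. f x)"
      by (rule set_integral_Un) (use sets[OF compl(1)] in \<open>auto intro!: si\<close>)
    finally show ?case using UN compl by simp
  next
    case (union B)
    have Bs: "B i \<in> sets borel" for i using union(2) by (intro sets) blast
    have "(LINT x:(\<Union>i. B i)|lborel. f x) = (\<Sum>i. (LINT x:(B i)|lborel. f x))"
      by (rule lebesgue_integral_countable_add)
         (use union(1) Bs in \<open>auto intro!: si sets.countable_UN simp: disjoint_family_on_def\<close>)
    thus ?case using union by simp
  qed
qed

lemma AE_zero_of_Ioc_integrals:
  fixes f :: "real \<Rightarrow> complex"
  assumes f: "integrable lborel f" and "\<And>a b. (LINT x:{a<..b}|lborel. f x) = 0"
  shows "AE x in lborel. f x = 0"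
  using sigma_finite_measure.density_zero[OF sigma_finite_lborel f] set_integral_zero_of_Ioc[OF assms] by simp

section \<open>Exponentials on the unit interval and their orthonormality\<close>

definition unit_interval :: "real measure" where
  "unit_interval = restrict_space lborel {0..1}"

definition wave :: "int \<Rightarrow> real \<Rightarrow> complex" where
  "wave k x = exp (2 * of_real pi * \<i> * of_real (of_int k * x))"

lemma wave_measurable [measurable]: "wave k \<in> borel_measurable borel"
  unfolding wave_def by measurable

lemma continuous_on_wave [continuous_intros]: "continuous_on S g \<Longrightarrow> continuous_on S (\<lambda>x. wave k (g x))"
  unfolding wave_def by (intro continuous_intros)

lemma norm_wave [simp]: "cmod (wave k x) = 1"
  by (simp add: wave_def)

lemma wave_0 [simp]: "wave 0 x = 1"
  by (simp add: wave_def)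

lemma wave_add: "wave (k + l) x = wave k x * wave l x"
  by (simp add: wave_def exp_add[symmetric] algebra_simps)

lemma cnj_wave: "cnj (wave k x) = wave (- k) x"
  by (simp add: wave_def exp_cnj)

lemma wave_periodic: "wave k (x + 1) = wave k x"
proof -
  have "2 * of_real pi * \<i> * complex_of_real (of_int k * (x + 1))
      = 2 * of_real pi * \<i> * complex_of_real (of_int k * x) + \<i> * (of_int k * (of_real pi * 2))"
    by (simp add: algebra_simps)
  hence "wave k (x + 1) = wave k x * exp (\<i> * (of_int k * (of_real pi * 2)))"
    by (simp only: wave_def exp_add)
  also have "exp (\<i> * (of_int k * (of_real pi * 2))) = 1"
    using exp_integer_2pi[of "of_int k"] by (simp add: mult_ac)
  finally show ?thesis by simp
qed

lemma space_unit_interval [simp]: "space unit_interval = {0..1}"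
  by (simp add: unit_interval_def)

lemma measurable_unit_interval [measurable (raw)]:
  "f \<in> borel_measurable borel \<Longrightarrow> f \<in> borel_measurable unit_interval"
  unfolding unit_interval_def by (rule measurable_restrict_space1) simp

lemma unit_interval_integral:
  fixes f :: "real \<Rightarrow> 'a::{banach, second_countable_topology}"
  shows "(LINT x|unit_interval. f x) = (LINT x:{0..1}|lborel. f x)"
  unfolding unit_interval_def set_lebesgue_integral_def by (subst integral_restrict_space) auto

lemma emeasure_unit_interval [simp]: "emeasure unit_interval {0..1} = 1"
  by (simp add: unit_interval_def emeasure_restrict_space)

lemma sets_unit_interval [simp, measurable]: "{0..1} \<in> sets unit_interval"
  by (metis sets.top space_unit_interval)

interpretation unit_interval: prob_space unit_interval
  by (rule prob_spaceI) simp

lemma wave_orthonormal: "(LINT x|unit_interval. wave k x) = (if k = 0 then 1 else 0)"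
proof (cases "k = 0")
  case True thus ?thesis using unit_interval.prob_space by simp
next
  case False
  define c where "c = 2 * of_real pi * \<i> * of_int k"
  have c: "c \<noteq> 0" using False by (simp add: c_def)
  have w: "wave k x = exp (c * of_real x)" for x by (simp add: wave_def c_def mult_ac)
  have "(LINT x|unit_interval. wave k x) = (LINT x|lborel. indicator {0..1} x *\<^sub>R wave k x)"
    by (simp add: unit_interval_integral set_lebesgue_integral_def)
  also have "\<dots> = exp (c * of_real 1) / c - exp (c * of_real 0) / c"
  proof (rule integral_FTC_atLeastAtMost)
    fix x :: real
    show "((\<lambda>x. exp (c * of_real x) / c) has_vector_derivative wave k x) (at x within {0..1})"
      unfolding w using c by (auto intro!: derivative_eq_intros has_vector_derivative_real_field simp: )
  qed (auto intro!: continuous_intros)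
  also have "\<dots> = 0" using wave_periodic[of k 0] by (simp add: w)
  finally show ?thesis using False by simp
qed

lemma wave_square_integrable: "square_integrable unit_interval (wave k)"
  by (simp add: square_integrable_def)

definition int_box :: "nat \<Rightarrow> int set" where
  "int_box n = {- int n..int n}"

lemma int_box_exhausts: "incseq int_box" "(\<Union>n. int_box n) = UNIV" "finite (int_box n)"
proof -
  show "(\<Union>n. int_box n) = UNIV"
  proof (intro UNIV_eq_I[symmetric] equalityI subset_UNIV)
    fix k :: int
    have "k \<in> int_box (nat \<bar>k\<bar>)" by (auto simp: int_box_def)
    thus "k \<in> (\<Union>n. int_box n)" by blast
  qed
qed (auto simp: int_box_def incseq_def)

text \<open>The interval has finite measure, hence the constant exhaustion; on the side of the
  integers the boxes are finite, so truncated integrals there are finite sums.\<close>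

interpretation circle: l2_kernel unit_interval "count_space UNIV" "\<lambda>x k. wave (- k) x" "\<lambda>n. {0..1}" int_box
proof (rule l2_kernel.intro)
  show "sigma_finite_measure (count_space (UNIV :: int set))"
    by (rule sigma_finite_measure_count_space)
  show "(\<lambda>(x, k). wave (- k) x) \<in> borel_measurable (unit_interval \<Otimes>\<^sub>M count_space UNIV)"
  proof -
    have "(\<lambda>(k, x). wave (- k) x) \<in> borel_measurable (count_space UNIV \<Otimes>\<^sub>M unit_interval)"
      by (rule measurable_pair_measure_countable1) auto
    from measurable_compose[OF measurable_pair_swap' this] show ?thesis by (simp add: split_beta)
  qed
  show "sigma_finite_measure unit_interval" by (rule unit_interval.sigma_finite_measure_axioms)
qed (use int_box_exhausts in \<open>auto simp: emeasure_count_space of_nat_less_top\<close>)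

text \<open>Orthonormality of the exponentials suffices here because the truncated inverse transform
  is a finite trigonometric sum. Isometry in the other direction rests on completeness of the
  system.\<close>

lemma circle_isometric_inverse: "l2_isometric (count_space UNIV) unit_interval (\<lambda>k x. cnj (wave (- k) x)) int_box"
  unfolding l2_isometric_def
proof (intro allI impI)
  fix n and g :: "int \<Rightarrow> complex"
  let ?B = "int_box n"
  define G where "G = kernel_int (count_space UNIV) ?B (\<lambda>k x. cnj (wave (- k) x)) g"
  have fin: "finite ?B" by (rule int_box_exhausts)
  have sum: "(LINT k|count_space UNIV. indicator ?B k * h k) = (\<Sum>k\<in>?B. h k)" for h :: "int \<Rightarrow> complex"
  proof -
    have "(LINT k|count_space UNIV. indicator ?B k * h k) = (\<Sum>k\<in>{k. k \<in> UNIV \<and> indicator ?B k * h k \<noteq> 0}. indicator ?B k * h k)"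
      by (rule lebesgue_integral_count_space_finite_support) (rule finite_subset[OF _ fin], auto simp: indicator_def)
    also have "\<dots> = (\<Sum>k\<in>?B. indicator ?B k * h k)"
      by (rule sum.mono_neutral_left[OF fin]) (auto simp: indicator_def)
    finally show ?thesis by simp
  qed
  have G: "G x = (\<Sum>k\<in>?B. g k * wave k x)" for x
    unfolding G_def kernel_int_def using sum[of "\<lambda>k. g k * wave k x"] by (simp add: cnj_wave mult.assoc)
  have Gs: "square_integrable unit_interval G"
    unfolding G by (intro square_integrable_sum square_integrable_scale wave_square_integrable)
  have "complex_of_real ((l2norm unit_interval G)\<^sup>2) = (LINT x|unit_interval. G x * cnj (G x))"
    by (rule l2norm_sq_inner)
  also have "\<dots> = (LINT x|unit_interval. (\<Sum>k\<in>?B. \<Sum>l\<in>?B. g k * cnj (g l) * wave (k - l) x))"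
    by (simp add: G sum_product cnj_wave mult_ac diff_conv_add_uminus wave_add del: add_uminus_conv_diff)
  also have "\<dots> = (\<Sum>k\<in>?B. \<Sum>l\<in>?B. g k * cnj (g l) * (LINT x|unit_interval. wave (k - l) x))"
  proof -
    have i: "integrable unit_interval (wave j)" for j
      by (rule unit_interval.integrable_const_bound[of _ 1]) auto
    thus ?thesis by (simp add: Bochner_Integration.integral_sum)
  qed
  also have "\<dots> = (\<Sum>k\<in>?B. g k * cnj (g k))"
    by (intro sum.cong refl) (simp add: wave_orthonormal if_distrib[of "(*) _"] sum.delta fin cong: if_cong)
  also have "\<dots> = (LINT k|count_space UNIV. indicator ?B k * g k * cnj (indicator ?B k * g k))"
  proof -
    have e: "indicator ?B k * (g k * cnj (g k)) = indicator ?B k * g k * cnj (indicator ?B k * g k)" for k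
      by (simp add: indicator_def)
    show ?thesis unfolding sum[of "\<lambda>k. g k * cnj (g k)", symmetric] by (simp only: e)
  qed
  also have "\<dots> = complex_of_real ((l2norm (count_space UNIV) (\<lambda>k. indicator ?B k * g k))\<^sup>2)"
    by (rule l2norm_sq_inner[symmetric])
  finally have "(l2norm unit_interval G)\<^sup>2 = (l2norm (count_space UNIV) (\<lambda>k. indicator ?B k * g k))\<^sup>2"
    by (simp only: of_real_eq_iff)
  hence "l2norm unit_interval G = l2norm (count_space UNIV) (\<lambda>k. indicator ?B k * g k)" by simp
  thus "square_integrable unit_interval G \<and> l2norm unit_interval G = l2norm (count_space UNIV) (\<lambda>k. indicator ?B k * g k)"
    using Gs by blast
qed

text \<open>Stone--Weierstrass on the circle in the plane makes these functions dense.\<close>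

inductive trig_poly :: "(real \<Rightarrow> complex) \<Rightarrow> bool" where
  monomial: "trig_poly (\<lambda>x. c * wave k x)"
| add: "trig_poly p \<Longrightarrow> trig_poly q \<Longrightarrow> trig_poly (\<lambda>x. p x + q x)"

lemma trig_poly_mult:
  assumes "trig_poly p" "trig_poly q"
  shows "trig_poly (\<lambda>x. p x * q x)"
  using assms
proof (induction rule: trig_poly.induct)
  case (monomial c k)
  from monomial show ?case
  proof (induction rule: trig_poly.induct)
    case (monomial d l)
    have "(\<lambda>x. c * wave k x * (d * wave l x)) = (\<lambda>x. (c * d) * wave (k + l) x)"
      by (simp add: wave_add mult_ac)
    thus ?case by (simp add: trig_poly.monomial)
  next
    case (add p q) thus ?case by (simp add: distrib_left trig_poly.add)
  qed
next
  case (add p r) thus ?case by (simp add: distrib_right trig_poly.add)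
qed

lemma trig_poly_continuous: "trig_poly p \<Longrightarrow> continuous_on S p"
  by (induction rule: trig_poly.induct) (auto intro!: continuous_intros)

text \<open>On the circle the real and imaginary parts of \<open>wave 1\<close> are combinations of
  \<open>wave 1\<close> and \<open>wave (- 1)\<close>, and products of exponentials are
  exponentials; a real polynomial in the plane thus restricts to a trigonometric one.\<close>

lemma trig_poly_real_polynomial:
  assumes "real_polynomial_function g"
  shows "trig_poly (\<lambda>x. of_real (g (wave 1 x)))"
  using assms
proof (induction rule: real_polynomial_function.induct)
  case (linear f)
  have f: "f z = Re z * f 1 + Im z * f \<i>" for z
  proof -
    have "f z = f (Re z *\<^sub>R 1 + Im z *\<^sub>R \<i>)" by (rule arg_cong[where f=f]) (simp add: complex_eq_iff)
    thus ?thesis using linear by (simp add: bounded_linear.linear linear_add linear_scale)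
  qed
  have "(\<lambda>x. complex_of_real (f (wave 1 x))) =
      (\<lambda>x. (of_real (f 1) / 2 - \<i> * of_real (f \<i>) / 2) * wave 1 x + (of_real (f 1) / 2 + \<i> * of_real (f \<i>) / 2) * wave (- 1) x)"
  proof
    fix x
    define w where "w = wave 1 x"
    have "complex_of_real (Re w) = (w + cnj w) / 2" by (simp add: complex_add_cnj)
    moreover have "complex_of_real (Im w) = - \<i> * (w - cnj w) / 2" by (simp add: complex_eq_iff)
    ultimately have "complex_of_real (f w) = (w + cnj w) / 2 * of_real (f 1) + (- \<i> * (w - cnj w) / 2) * of_real (f \<i>)"
      by (subst f) simp
    also have "\<dots> = (of_real (f 1) / 2 - \<i> * of_real (f \<i>) / 2) * w + (of_real (f 1) / 2 + \<i> * of_real (f \<i>) / 2) * cnj w"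
      by (simp add: field_simps)
    finally show "complex_of_real (f (wave 1 x)) =
        (of_real (f 1) / 2 - \<i> * of_real (f \<i>) / 2) * wave 1 x + (of_real (f 1) / 2 + \<i> * of_real (f \<i>) / 2) * wave (- 1) x"
      by (simp add: w_def cnj_wave)
  qed
  thus ?case by (simp only: trig_poly.intros)
next
  case (const c)
  have "(\<lambda>x. complex_of_real c) = (\<lambda>x. of_real c * wave 0 x)" by simp
  thus ?case by (simp only: trig_poly.intros)
next
  case (add f g) thus ?case by (simp add: trig_poly.add)
next
  case (mult f g) thus ?case by (simp add: trig_poly_mult)
qed

lemma trig_poly_dense:
  fixes h :: "real \<Rightarrow> real"
  assumes h: "continuous_on {0..1} h" "h 0 = h 1" and e: "e > 0"
  obtains p where "trig_poly p" "\<And>x. x \<in> {0..1} \<Longrightarrow> cmod (of_real (h x) - p x) < e"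
proof -
  \<comment> \<open>\<open>h\<close> is transported to the circle by the angle, which jumps at the
    point 1. Continuity across the jump holds because \<open>h 0 = h 1\<close>; it is read off from
    the correspondence between loops and continuous maps of the circle, applied to the trivial
    homotopy of \<open>h\<close>.\<close>
  define H where "H = h \<circ> (\<lambda>z. Arg2pi z / (2 * pi))"
  have "homotopic_loops UNIV h h"
    using h by (simp add: homotopic_loops_refl path_def pathfinish_def pathstart_def)
  from homotopic_with_imp_continuous[OF homotopic_loops_imp_homotopic_circlemaps[OF this]]
  have "continuous_on (sphere 0 1) H" by (simp add: H_def)
  then obtain g where g: "real_polynomial_function g" "\<And>z. z \<in> sphere 0 1 \<Longrightarrow> \<bar>H z - g z\<bar> < e"
    using Stone_Weierstrass_real_polynomial_function[OF compact_sphere _ e] by blast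
  have Hw: "H (wave 1 x) = h x" if "x \<in> {0..<1}" for x
  proof -
    have "Arg2pi (wave 1 x) = 2 * pi * x"
      by (rule Arg2pi_unique[of 1]) (use that in \<open>auto simp: wave_def mult_ac\<close>)
    thus ?thesis by (simp add: H_def)
  qed
  have Hw1: "H (wave 1 x) = h x" if "x \<in> {0..1}" for x
  proof (cases "x = 1")
    case True
    have "wave 1 1 = wave 1 0" using wave_periodic[of 1 0] by simp
    thus ?thesis using Hw[of 0] h(2) True by simp
  qed (use that Hw in auto)
  show ?thesis
  proof (rule that)
    show "trig_poly (\<lambda>x. of_real (g (wave 1 x)))" by (rule trig_poly_real_polynomial[OF g(1)])
    show "cmod (of_real (h x) - of_real (g (wave 1 x))) < e" if "x \<in> {0..1}" for x
      using g(2)[of "wave 1 x"] Hw1[OF that] by (simp flip: of_real_diff)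
  qed
qed

text \<open>Orthogonality to all exponentials extends to trigonometric polynomials, by density to
  continuous functions with equal end values, and through trapezoids to indicators of intervals;
  vanishing integrals over intervals force \<open>f\<close> to vanish.\<close>

lemma fourier_coefficients_unique:
  fixes f :: "real \<Rightarrow> complex"
  assumes f: "square_integrable unit_interval f" and z: "\<And>k. (LINT x|unit_interval. f x * wave k x) = 0"
  shows "AE x in unit_interval. f x = 0"
proof -
  have [measurable]: "f \<in> borel_measurable unit_interval" using f by (simp add: square_integrable_def)
  have fi: "integrable unit_interval f"
    using circle.integrable_indicator_A[OF f] by (rule Bochner_Integration.integrable_cong[THEN iffD1, rotated 2]) auto
  have bi: "integrable unit_interval (\<lambda>x. f x * g x)"
    if "continuous_on {0..1} g" for g :: "real \<Rightarrow> complex"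
  proof -
    have "compact (g ` {0..1})" by (intro compact_continuous_image that) simp
    then obtain C where C: "\<And>x. x \<in> {0..1} \<Longrightarrow> cmod (g x) \<le> C"
      by (meson bounded_iff compact_imp_bounded imageI)
    have [measurable]: "g \<in> borel_measurable unit_interval"
      unfolding unit_interval_def using that
      by (metis borel_measurable_continuous_on_restrict measurable_cong_sets sets_lborel sets_restrict_space_cong)
    have "AE x in unit_interval. cmod (f x * g x) \<le> cmod (C *\<^sub>R f x)"
    proof (rule AE_I2)
      fix x assume x: "x \<in> space unit_interval"
      hence "0 \<le> C" using C[of x] norm_ge_zero[of "g x"] by (simp del: norm_ge_zero)
      thus "cmod (f x * g x) \<le> cmod (C *\<^sub>R f x)" using mult_right_mono[OF C[of x], of "cmod (f x)"] x by (simp add: norm_mult mult.commute)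
    qed
    thus ?thesis by (intro Bochner_Integration.integrable_bound[OF integrable_scaleR_right[OF fi, of C]]) auto
  qed
  have tp: "(LINT x|unit_interval. f x * p x) = 0" if "trig_poly p" for p
    using that
  proof (induction rule: trig_poly.induct)
    case (monomial c k)
    have "(LINT x|unit_interval. f x * (c * wave k x)) = (LINT x|unit_interval. c * (f x * wave k x))" by (simp add: mult_ac)
    thus ?case using z by simp
  next
    case (add p q) thus ?case using bi[OF trig_poly_continuous] by (simp add: distrib_left)
  qed
  have cont: "(LINT x|unit_interval. f x * of_real (h x)) = 0"
    if h: "continuous_on {0..1} h" "h 0 = h 1" for h :: "real \<Rightarrow> real"
  proof -
    define J where "J = (LINT x|unit_interval. cmod (f x))"
    have "cmod (LINT x|unit_interval. f x * of_real (h x)) \<le> 0 + e" if e: "e > 0" for e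
    proof -
      have I: "J \<ge> 0" by (simp add: J_def)
      have I1: "J + 1 > 0" using I by linarith
      \<comment> \<open>Adding 1 to the norm \<open>J\<close> keeps the quotient meaningful when
        \<open>J\<close> is zero.\<close>
      define d where "d = e / (J + 1)"
      have d: "d > 0" using e I by (simp add: d_def add_nonneg_pos)
      obtain p where p: "trig_poly p" "\<And>x. x \<in> {0..1} \<Longrightarrow> cmod (of_real (h x) - p x) < d"
        using trig_poly_dense[OF h d] by blast
      have hc: "continuous_on {0..1} (\<lambda>x. complex_of_real (h x))" using h by (intro continuous_intros)
      have i1: "integrable unit_interval (\<lambda>x. f x * (of_real (h x) - p x))"
        by (intro bi continuous_intros hc trig_poly_continuous p)
      have "(LINT x|unit_interval. f x * of_real (h x)) = (LINT x|unit_interval. f x * (of_real (h x) - p x))"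
        using bi[OF hc] bi[OF trig_poly_continuous[OF p(1)]] tp[OF p(1)] by (simp add: right_diff_distrib)
      also have "cmod \<dots> \<le> (LINT x|unit_interval. d * cmod (f x))"
      proof (rule order_trans[OF integral_norm_bound], rule integral_mono)
        fix x assume "x \<in> space unit_interval"
        thus "cmod (f x * (of_real (h x) - p x)) \<le> d * cmod (f x)"
          using mult_right_mono[OF less_imp_le[OF p(2)[of x]], of "cmod (f x)"] by (simp add: norm_mult mult.commute)
      qed (use i1 fi in auto)
      also have "\<dots> = d * J" by (simp add: J_def)
      also have "\<dots> = e * (J / (J + 1))" by (simp add: d_def)
      also have "\<dots> \<le> e"
      proof (rule mult_left_le)
        show "J / (J + 1) \<le> 1" using I1 by (simp add: pos_divide_le_eq)
      qed (use e in linarith)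
      finally show ?thesis by simp
    qed
    hence "cmod (LINT x|unit_interval. f x * of_real (h x)) \<le> 0" by (rule field_le_epsilon)
    thus ?thesis by simp
  qed
  define F where "F x = indicator {0..1} x *\<^sub>R f x" for x
  have Fi: "integrable lborel F"
    using fi unfolding unit_interval_def F_def by (subst (asm) integrable_restrict_space) auto
  have op: "(LINT x:{c<..<d}|lborel. F x) = 0" if cd: "0 \<le> c" "c < d" "d \<le> 1" for c d
  proof -
    \<comment> \<open>Trapezoids of slope \<open>n\<close> that increase to the indicator of the
      open interval. They vanish at 0 and at 1, hence are admissible periodic test
      functions.\<close>
    define h where "h n x = max 0 (min 1 (real n * min (x - c) (d - x)))" for n x
    have hz: "h n x = 0" if "min (x - c) (d - x) \<le> 0" for n x
    proof -
      have "real n * min (x - c) (d - x) \<le> 0" using that by (intro mult_nonneg_nonpos) auto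
      thus ?thesis unfolding h_def by (metis max.absorb1 min.coboundedI2)
    qed
    have "(\<lambda>n. LINT x|unit_interval. f x * of_real (h n x)) \<longlonglongrightarrow> (LINT x|unit_interval. f x * indicator {c<..<d} x)"
    proof (rule integral_dominated_convergence[where w="\<lambda>x. cmod (f x)"])
      show "AE x in unit_interval. (\<lambda>n. f x * of_real (h n x)) \<longlonglongrightarrow> f x * indicator {c<..<d} x"
      proof (rule AE_I2, rule tendsto_mult_left)
        fix x :: real
        show "(\<lambda>n. complex_of_real (h n x)) \<longlonglongrightarrow> indicator {c<..<d} x"
        proof (cases "x \<in> {c<..<d}")
          case True
          hence m: "min (x - c) (d - x) > 0" by auto
          obtain N :: nat where N: "1 < real N * min (x - c) (d - x)"
            using reals_Archimedean3[OF m] by blast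
          have "h n x = 1" if "n \<ge> N" for n
          proof -
            have "real N * min (x - c) (d - x) \<le> real n * min (x - c) (d - x)"
              using that m by (intro mult_right_mono) auto
            thus ?thesis using N by (simp add: h_def)
          qed
          thus ?thesis using True by (intro tendsto_eventually eventually_sequentiallyI[of N]) auto
        next
          case False
          hence "min (x - c) (d - x) \<le> 0" by auto
          hence "h n x = 0" for n by (rule hz)
          thus ?thesis using False by simp
        qed
      qed
      show "AE x in unit_interval. cmod (f x * of_real (h n x)) \<le> cmod (f x)" for n
        by (intro AE_I2) (auto simp: norm_mult h_def intro!: mult_left_le)
      show "(\<lambda>x. f x * of_real (h n x)) \<in> borel_measurable unit_interval" for n
        unfolding h_def by measurable
    qed (use fi in auto)
    moreover have "(LINT x|unit_interval. f x * of_real (h n x)) = 0" for n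
    proof (rule cont)
      show "continuous_on {0..1} (h n)" unfolding h_def by (intro continuous_intros)
      have "h n 0 = 0"
        using cd by (intro hz) auto
      moreover have "h n 1 = 0"
        using cd by (intro hz) auto
      ultimately show "h n 0 = h n 1" by simp
    qed
    ultimately have "(LINT x|unit_interval. f x * indicator {c<..<d} x) = 0"
      using LIMSEQ_unique[OF _ tendsto_const[of "0::complex"]] by simp
    moreover have "(LINT x|unit_interval. f x * indicator {c<..<d} x) = (LINT x:{c<..<d}|lborel. F x)"
      unfolding unit_interval_integral set_lebesgue_integral_def F_def
      by (rule Bochner_Integration.integral_cong) (auto simp: indicator_def)
    ultimately show ?thesis by simp
  qed
  \<comment> \<open>\<open>F\<close> vanishes outside the unit interval, so any interval may be
    clipped to it; the end points are null.\<close>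
  have "(LINT x:{a<..b}|lborel. F x) = 0" for a b
  proof -
    define c where "c = max a 0"
    define d where "d = min b 1"
    show ?thesis
    proof (cases "c < d")
      case True
      have "AE x in lborel. x \<noteq> c \<and> x \<noteq> d" using AE_lborel_singleton[of c] AE_lborel_singleton[of d] by eventually_elim auto
      hence "(LINT x:{a<..b}|lborel. F x) = (LINT x:{c<..<d}|lborel. F x)"
        unfolding set_lebesgue_integral_def
      proof (intro integral_cong_AE, goal_cases)
        case 3 thus ?case
        proof eventually_elim
          case (elim x)
          show ?case
          proof (cases "x \<in> {0..1}")
            case True
            have "x \<in> {a<..b} \<longleftrightarrow> x \<in> {c<..<d}"
              using True elim unfolding c_def d_def by (auto simp: max_def min_def)
            thus ?thesis by (simp add: indicator_def)
          qed (simp add: F_def)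
        qed
      qed (use Fi in simp_all)
      thus ?thesis using op[of c d] True by (simp add: c_def d_def)
    next
      case False
      have "AE x in lborel. x \<noteq> 0 \<and> x \<noteq> 1" using AE_lborel_singleton[of 0] AE_lborel_singleton[of 1] by eventually_elim auto
      hence "AE x in lborel. indicator {a<..b} x *\<^sub>R F x = 0"
      proof eventually_elim
        case (elim x)
        show ?case
        proof (cases "x \<in> {0..1}")
          case True
          have "x \<notin> {a<..b}"
            using True elim False unfolding c_def d_def by (auto simp: max_def min_def split: if_splits)
          thus ?thesis by (simp add: indicator_def)
        qed (simp add: F_def)
      qed
      thus ?thesis unfolding set_lebesgue_integral_def by (rule integral_eq_zero_AE)
    qed
  qed
  from AE_zero_of_Ioc_integrals[OF Fi this] have "AE x in lborel. x \<in> {0..1} \<longrightarrow> f x = 0"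
    by eventually_elim (auto simp: F_def)
  thus ?thesis unfolding unit_interval_def by (subst AE_restrict_space_iff) auto
qed

text \<open>By \<open>transform_surj\<close> the coefficients of \<open>f\<close> belong to some
  \<open>f'\<close> whose norm is that of the coefficients; equality of all coefficients identifies
  \<open>f'\<close> with \<open>f\<close> almost everywhere.\<close>

lemma circle_isometric: "l2_isometric unit_interval (count_space UNIV) (\<lambda>x k. wave (- k) x) (\<lambda>n. {0..1})"
  unfolding l2_isometric_def
proof (intro allI impI)
  fix n :: nat and f :: "real \<Rightarrow> complex" assume f: "square_integrable unit_interval f"
  interpret S: l2_kernel "count_space UNIV" unit_interval "\<lambda>k x. cnj (wave (- k) x)" int_box "\<lambda>n. {0..1}"
    by (rule circle.swap)
  let ?K = "kernel_int unit_interval {0..1} (\<lambda>x k. wave (- k) x)"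
  have c: "l2_contractive unit_interval (count_space UNIV) (\<lambda>x k. wave (- k) x) (\<lambda>n. {0..1})"
    using S.contractive_swap[OF l2_isometric_imp_contractive[OF circle_isometric_inverse]] by simp
  have g: "square_integrable (count_space UNIV) (?K f)" using c f by (simp add: l2_contractive_def)
  obtain f' where f': "square_integrable unit_interval f'"
      "l2_transform unit_interval (count_space UNIV) (\<lambda>x k. wave (- k) x) (\<lambda>n. {0..1}) f' (?K f)"
      "l2norm unit_interval f' = l2norm (count_space UNIV) (?K f)"
    using circle.transform_surj[OF c circle_isometric_inverse g] .
  \<comment> \<open>The truncation sets do not depend on the index, so convergence in mean is
    equality here.\<close>
  have "l2norm (count_space UNIV) (\<lambda>k. ?K f' k - ?K f k) = 0"
    using f'(2) by (simp add: l2_transform_def LIMSEQ_const_iff)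
  moreover have "square_integrable (count_space UNIV) (\<lambda>k. ?K f' k - ?K f k)"
    using c f'(1) g by (intro square_integrable_diff) (auto simp: l2_contractive_def)
  ultimately have K: "?K f' k = ?K f k" for k
    using l2norm_eq_0D[of "count_space UNIV" "\<lambda>k. ?K f' k - ?K f k"] by (simp add: AE_count_space)
  have "(LINT x|unit_interval. (f' x - f x) * wave k x) = 0" for k
  proof -
    have "?K (\<lambda>x. f' x - f x) (- k) = 0"
      using circle.kernel_int_diff[OF f'(1) f, of "- k"] K by simp
    moreover have "?K (\<lambda>x. f' x - f x) (- k) = (LINT x|unit_interval. (f' x - f x) * wave k x)"
      unfolding kernel_int_def by (rule Bochner_Integration.integral_cong) auto
    ultimately show ?thesis by simp
  qed
  from fourier_coefficients_unique[OF square_integrable_diff(1)[OF f'(1) f] this]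
  have "AE x in unit_interval. f' x = f x" by simp
  hence "l2norm unit_interval f' = l2norm unit_interval f"
    by (intro l2norm_cong_AE) (use f f'(1) in \<open>auto simp: square_integrable_def\<close>)
  moreover have "l2norm unit_interval (\<lambda>x. indicator {0..1} x * f x) = l2norm unit_interval f"
    unfolding l2norm_def by (rule arg_cong[where f=sqrt], rule Bochner_Integration.integral_cong) auto
  ultimately show "square_integrable (count_space UNIV) (?K f) \<and>
      l2norm (count_space UNIV) (?K f) = l2norm unit_interval (\<lambda>x. indicator {0..1} x * f x)"
    using f'(3) g by simp
qed

section \<open>The Fourier transform on the line\<close>

lemma ennreal_norm_integral_le:
  "ennreal (norm (integral\<^sup>L M f)) \<le> (\<integral>\<^sup>+x. ennreal (norm (f x)) \<partial>M)"
  by (cases "integrable M f") (simp_all add: integral_norm_bound_ennreal not_integrable_integral_eq)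

definition phase :: "real \<Rightarrow> complex" where
  "phase t = exp (2 * of_real pi * \<i> * of_real t)"

lemma phase_measurable [measurable]: "phase \<in> borel_measurable borel"
  unfolding phase_def by measurable

lemma norm_phase [simp]: "cmod (phase t) = 1"
  by (simp add: phase_def)

lemma phase_0 [simp]: "phase 0 = 1"
  by (simp add: phase_def)

lemma phase_add: "phase (s + t) = phase s * phase t"
  by (simp add: phase_def exp_add[symmetric] algebra_simps)

lemma cnj_phase: "cnj (phase t) = phase (- t)"
  by (simp add: phase_def exp_cnj)

lemma wave_eq_phase: "wave k x = phase (of_int k * x)"
  by (simp add: wave_def phase_def)

definition real_box :: "nat \<Rightarrow> real set" where
  "real_box n = {- real n..real n}"

lemma real_box_sets [measurable, simp]: "real_box n \<in> sets borel"
  by (simp add: real_box_def)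

lemma real_box_exhausts: "incseq real_box" "(\<Union>n. real_box n) = UNIV"
proof -
  show "(\<Union>n. real_box n) = UNIV"
  proof (intro equalityI subset_UNIV subsetI)
    fix x :: real
    obtain n :: nat where "\<bar>x\<bar> \<le> real n" using real_arch_simple by blast
    hence "x \<in> real_box n" by (auto simp: real_box_def)
    thus "x \<in> (\<Union>n. real_box n)" by blast
  qed
qed (auto simp: real_box_def incseq_def)

interpretation line: l2_kernel lborel lborel "\<lambda>y \<eta>. phase (- (\<eta> * y))" real_box real_box
proof (rule l2_kernel.intro)
  show "(\<lambda>(y, \<eta>). phase (- (\<eta> * y))) \<in> borel_measurable (lborel \<Otimes>\<^sub>M lborel)"
    by measurable
  show "real_box n \<in> sets lborel" "emeasure lborel (real_box n) < \<infinity>" for n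
    by (auto simp: real_box_def emeasure_lborel_Icc_eq)
  thus "real_box n \<in> sets lborel" "emeasure lborel (real_box n) < \<infinity>" for n
    by auto
qed (use real_box_exhausts in \<open>auto simp: sigma_finite_lborel\<close>)

section \<open>Absolutely convergent transforms on the line and their Gaussian
  regularization\<close>

definition line_ft :: "(real \<Rightarrow> complex) \<Rightarrow> real \<Rightarrow> complex" where
  "line_ft F \<eta> = (LINT y|lborel. F y * phase (- (\<eta> * y)))"

lemma line_ft_measurable [measurable]:
  assumes [measurable]: "F \<in> borel_measurable borel"
  shows "line_ft F \<in> borel_measurable borel"
  unfolding line_ft_def by measurable

lemma line_ft_bound: "cmod (line_ft F \<eta>) \<le> (LINT y|lborel. cmod (F y))"
  unfolding line_ft_def using integral_norm_bound[of lborel "\<lambda>y. F y * phase (- (\<eta> * y))"]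
  by (simp add: norm_mult)

lemma integrable_mult_phase:
  assumes "integrable lborel F" "g \<in> borel_measurable borel"
  shows "integrable lborel (\<lambda>y. F y * phase (g y))"
  by (rule Bochner_Integration.integrable_bound[OF assms(1)]) (use assms in \<open>auto simp: norm_mult\<close>)

text \<open>Fubini. It moves the transform from \<open>F\<close> to an integrable weight, which is
  how inner products of transforms are evaluated before the transforms are known to be square
  integrable.\<close>

lemma line_ft_multiplication:
  fixes F W :: "real \<Rightarrow> complex"
  assumes F: "integrable lborel F" and W: "integrable lborel W"
  shows "(LINT \<eta>|lborel. W \<eta> * line_ft F \<eta>) = (LINT y|lborel. F y * line_ft W y)"
proof -
  have [measurable]: "F \<in> borel_measurable borel" "W \<in> borel_measurable borel" using F W by auto
  have int: "integrable (lborel \<Otimes>\<^sub>M lborel) (\<lambda>(\<eta>, y). W \<eta> * (F y * phase (- (\<eta> * y))))"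
  proof (rule lborel_pair.Fubini_integrable)
    show "integrable lborel (\<lambda>\<eta>. LINT y|lborel. norm (case (\<eta>, y) of (\<eta>, y) \<Rightarrow> W \<eta> * (F y * phase (- (\<eta> * y)))))"
      using W by (simp add: norm_mult)
    show "AE \<eta> in lborel. integrable lborel (\<lambda>y. case (\<eta>, y) of (\<eta>, y) \<Rightarrow> W \<eta> * (F y * phase (- (\<eta> * y))))"
      using integrable_mult_phase[OF F] by simp
  qed measurable
  have "(LINT \<eta>|lborel. W \<eta> * line_ft F \<eta>) = (LINT \<eta>|lborel. LINT y|lborel. W \<eta> * (F y * phase (- (\<eta> * y))))"
    by (simp add: line_ft_def)
  also have "\<dots> = (LINT y|lborel. LINT \<eta>|lborel. W \<eta> * (F y * phase (- (\<eta> * y))))"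
    by (rule lborel_pair.Fubini_integral[OF int, symmetric])
  also have "\<dots> = (LINT y|lborel. F y * line_ft W y)"
  proof (rule Bochner_Integration.integral_cong)
    fix y
    have "(LINT \<eta>|lborel. W \<eta> * (F y * phase (- (\<eta> * y)))) = (LINT \<eta>|lborel. F y * (W \<eta> * phase (- (y * \<eta>))))"
      by (simp add: mult_ac)
    thus "(LINT \<eta>|lborel. W \<eta> * (F y * phase (- (\<eta> * y)))) = F y * line_ft W y"
      by (simp add: line_ft_def)
  qed simp
  finally show ?thesis .
qed

text \<open>exp (- 2 \<pi>^2 \<sigma>^2 \<eta>^2), scaled so that for positive \<sigma> its
  transform is the centred normal density of standard deviation \<sigma>. It tends to 1 as \<sigma>
  tends to 0.\<close>

definition gauss_weight :: "real \<Rightarrow> real \<Rightarrow> real" where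
  "gauss_weight \<sigma> \<eta> = exp (- (2 * pi * \<sigma> * \<eta>)\<^sup>2 / 2)"

lemma gauss_weight_eq_density: "\<sigma> > 0 \<Longrightarrow> gauss_weight \<sigma> \<eta> = sqrt (2 * pi) * std_normal_density (2 * pi * \<sigma> * \<eta>)"
  by (simp add: gauss_weight_def std_normal_density_def)

lemma gauss_weight_bounds: "0 \<le> gauss_weight \<sigma> \<eta>" "gauss_weight \<sigma> \<eta> \<le> 1"
  by (simp_all add: gauss_weight_def)

lemma gauss_weight_measurable [measurable]: "gauss_weight \<sigma> \<in> borel_measurable borel"
  unfolding gauss_weight_def by measurable

lemma gauss_weight_integrable:
  assumes "\<sigma> > 0"
  shows "integrable lborel (gauss_weight \<sigma>)"
proof -
  have "integrable lborel (\<lambda>\<eta>. std_normal_density (0 + (2 * pi * \<sigma>) * \<eta>))"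
    by (rule lborel_integrable_real_affine) (use assms in auto)
  thus ?thesis by (subst gauss_weight_eq_density[OF assms, abs_def]) simp
qed

text \<open>The characteristic function of the standard normal law is a known Gaussian; the
  substitution x = 2 \<pi> \<sigma> \<eta> converts its normalization into that of
  \<open>phase\<close>.\<close>

lemma gauss_weight_ft:
  assumes s: "\<sigma> > 0"
  shows "line_ft (\<lambda>\<eta>. of_real (gauss_weight \<sigma> \<eta>)) y = of_real (normal_density 0 \<sigma> y)"
proof -
  define c where "c = 2 * pi * \<sigma>"
  have c: "c > 0" using s by (simp add: c_def)
  have "exp (- ((y/\<sigma>)\<^sup>2) / 2) = char std_normal_distribution (- (y / \<sigma>))"
    by (simp add: char_std_normal_distribution)
  also have "\<dots> = (LINT x|lborel. std_normal_density x *\<^sub>R iexp (- (y / \<sigma>) * x))"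
    unfolding char_def by (subst integral_density) auto
  also have "\<dots> = \<bar>c\<bar> *\<^sub>R (LINT \<eta>|lborel. std_normal_density (0 + c * \<eta>) *\<^sub>R iexp (- (y / \<sigma>) * (0 + c * \<eta>)))"
    by (rule lborel_integral_real_affine) (use c in simp)
  also have "(LINT \<eta>|lborel. std_normal_density (0 + c * \<eta>) *\<^sub>R iexp (- (y / \<sigma>) * (0 + c * \<eta>)))
     = (LINT \<eta>|lborel. of_real (1 / sqrt (2 * pi)) * (of_real (gauss_weight \<sigma> \<eta>) * phase (- (y * \<eta>))))"
  proof (rule Bochner_Integration.integral_cong)
    fix \<eta>
    have "iexp (- (y / \<sigma>) * (0 + c * \<eta>)) = phase (- (y * \<eta>))"
      using s by (simp add: phase_def c_def mult_ac)
    thus "std_normal_density (0 + c * \<eta>) *\<^sub>R iexp (- (y / \<sigma>) * (0 + c * \<eta>))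
        = of_real (1 / sqrt (2 * pi)) * (of_real (gauss_weight \<sigma> \<eta>) * phase (- (y * \<eta>)))"
      by (simp add: gauss_weight_eq_density[OF s] c_def scaleR_conv_of_real)
  qed simp
  also have "\<dots> = of_real (1 / sqrt (2 * pi)) * line_ft (\<lambda>\<eta>. of_real (gauss_weight \<sigma> \<eta>)) y"
    unfolding line_ft_def by (rule integral_mult_right_zero)
  finally have "of_real (exp (- ((y/\<sigma>)\<^sup>2) / 2)) = of_real (c / sqrt (2 * pi)) * line_ft (\<lambda>\<eta>. of_real (gauss_weight \<sigma> \<eta>)) y"
    using c by (simp add: scaleR_conv_of_real)
  hence "line_ft (\<lambda>\<eta>. of_real (gauss_weight \<sigma> \<eta>)) y = of_real (exp (- ((y/\<sigma>)\<^sup>2) / 2) / (c / sqrt (2 * pi)))"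
    using c by (simp add: field_simps)
  also have "exp (- ((y/\<sigma>)\<^sup>2) / 2) / (c / sqrt (2 * pi)) = normal_density 0 \<sigma> y"
  proof -
    have "sqrt (2 * pi) * sqrt (2 * pi) = 2 * pi" by simp
    hence "1 / (c / sqrt (2 * pi)) = 1 / (sqrt (2 * pi) * \<sigma>)"
      using s by (simp add: c_def field_simps)
    moreover have "sqrt (2 * pi * \<sigma>\<^sup>2) = sqrt (2 * pi) * \<sigma>" using s by (simp add: real_sqrt_mult)
    ultimately show ?thesis using s
      by (simp add: normal_density_def power_divide field_simps)
  qed
  finally show ?thesis .
qed

text \<open>The weight makes the product of transforms integrable.
  \<open>line_ft_multiplication\<close> is used twice: to move the transform off \<open>F\<close>,
  and, inside, to move it off the conjugate of \<open>H\<close> onto the Gaussian, where a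
  modulation becomes a translation of the density.\<close>

lemma gauss_parseval:
  fixes F H :: "real \<Rightarrow> complex"
  assumes F: "integrable lborel F" and H: "integrable lborel H" and s: "\<sigma> > 0"
  shows "(LINT \<eta>|lborel. of_real (gauss_weight \<sigma> \<eta>) * cnj (line_ft H \<eta>) * line_ft F \<eta>)
       = (LINT y|lborel. F y * (LINT y'|lborel. cnj (H y') * of_real (normal_density 0 \<sigma> (y - y'))))"
proof -
  have [measurable]: "F \<in> borel_measurable borel" "H \<in> borel_measurable borel" using F H by auto
  let ?g = "\<lambda>\<eta>. complex_of_real (gauss_weight \<sigma> \<eta>)"
  have gi: "integrable lborel ?g" using gauss_weight_integrable[OF s] by simp
  have W: "integrable lborel (\<lambda>\<eta>. ?g \<eta> * cnj (line_ft H \<eta>))"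
  proof (rule Bochner_Integration.integrable_bound)
    show "integrable lborel (\<lambda>\<eta>. (LINT y|lborel. cmod (H y)) * gauss_weight \<sigma> \<eta>)"
      using gauss_weight_integrable[OF s] by simp
    show "AE \<eta> in lborel. cmod (?g \<eta> * cnj (line_ft H \<eta>)) \<le> norm ((LINT y|lborel. cmod (H y)) * gauss_weight \<sigma> \<eta>)"
      using mult_right_mono[OF line_ft_bound gauss_weight_bounds(1)]
      by (intro AE_I2) (simp add: norm_mult gauss_weight_bounds mult.commute)
  qed measurable
  have "line_ft (\<lambda>\<eta>. ?g \<eta> * cnj (line_ft H \<eta>)) y = (LINT y'|lborel. cnj (H y') * of_real (normal_density 0 \<sigma> (y - y')))" for y
  proof -
    have cH: "cnj (line_ft H \<eta>) = line_ft (\<lambda>y'. cnj (H y')) (- \<eta>)" for \<eta>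
      unfolding line_ft_def by (simp add: cnj_phase flip: Bochner_Integration.integral_cnj)
    have iy: "integrable lborel (\<lambda>\<eta>. ?g \<eta> * phase (y * \<eta>))" by (rule integrable_mult_phase[OF gi]) measurable
    have "line_ft (\<lambda>\<eta>. ?g \<eta> * cnj (line_ft H \<eta>)) y
        = (LINT \<eta>|lborel. ?g \<eta> * phase (- (y * \<eta>)) * line_ft (\<lambda>y'. cnj (H y')) (- \<eta>))"
      by (simp add: line_ft_def cH[unfolded line_ft_def] mult_ac)
    \<comment> \<open>Reflection of \<eta>: the conjugate of a transform is the transform of the
      conjugate at the opposite frequency, and the weight is even.\<close>
    also have "\<dots> = (LINT \<eta>|lborel. ?g \<eta> * phase (y * \<eta>) * line_ft (\<lambda>y'. cnj (H y')) \<eta>)"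
      by (subst lborel_integral_real_affine[where c="-1" and t=0]) (simp_all add: gauss_weight_def)
    also have "\<dots> = (LINT y'|lborel. cnj (H y') * line_ft (\<lambda>\<eta>. ?g \<eta> * phase (y * \<eta>)) y')"
      by (rule line_ft_multiplication) (use H iy in auto)
    also have "(\<lambda>y'. line_ft (\<lambda>\<eta>. ?g \<eta> * phase (y * \<eta>)) y') = (\<lambda>y'. line_ft ?g (y' - y))"
    proof
      fix y'
      have e: "?g \<eta> * phase (y * \<eta>) * phase (- (y' * \<eta>)) = ?g \<eta> * phase (- ((y' - y) * \<eta>))" for \<eta>
        unfolding mult.assoc phase_add[symmetric] by (simp add: algebra_simps)
      show "line_ft (\<lambda>\<eta>. ?g \<eta> * phase (y * \<eta>)) y' = line_ft ?g (y' - y)"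
        unfolding line_ft_def by (simp only: e)
    qed
    also have "(\<lambda>y'. line_ft ?g (y' - y)) = (\<lambda>y'. of_real (normal_density 0 \<sigma> (y - y')))"
      unfolding gauss_weight_ft[OF s] by (simp add: normal_density_def power2_commute)
    finally show ?thesis .
  qed
  thus ?thesis using line_ft_multiplication[OF F W] by simp
qed

lemma nn_integral_normal_density:
  assumes "\<sigma> > 0"
  shows "(\<integral>\<^sup>+y'. ennreal (normal_density 0 \<sigma> (y - y')) \<partial>lborel) = 1"
    and "(\<integral>\<^sup>+y. ennreal (normal_density 0 \<sigma> (y - y')) \<partial>lborel) = 1"
proof -
  have 1: "(\<integral>\<^sup>+y. ennreal (normal_density 0 \<sigma> y) \<partial>lborel) = 1"
    using assms by (subst nn_integral_eq_integral) auto
  show "(\<integral>\<^sup>+y'. ennreal (normal_density 0 \<sigma> (y - y')) \<partial>lborel) = 1"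
    using nn_integral_real_affine[of "\<lambda>y. ennreal (normal_density 0 \<sigma> y)" "-1" y] 1 by simp
  show "(\<integral>\<^sup>+y. ennreal (normal_density 0 \<sigma> (y - y')) \<partial>lborel) = 1"
    using nn_integral_real_affine[of "\<lambda>y. ennreal (normal_density 0 \<sigma> y)" "1" "- y'"] 1 by (simp add: add.commute)
qed

text \<open>Schur's test for the Gaussian convolution; the weight is then removed by Fatou.\<close>

lemma line_ft_contractive:
  fixes F :: "real \<Rightarrow> complex"
  assumes F: "integrable lborel F" and F2: "square_integrable lborel F"
  shows "square_integrable lborel (line_ft F)" "l2norm lborel (line_ft F) \<le> l2norm lborel F"
proof -
  have [measurable]: "F \<in> borel_measurable borel" using F by auto
  let ?N = "\<integral>\<^sup>+y. ennreal ((cmod (F y))\<^sup>2) \<partial>lborel"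
  have w: "(\<integral>\<^sup>+\<eta>. ennreal (gauss_weight \<sigma> \<eta> * (cmod (line_ft F \<eta>))\<^sup>2) \<partial>lborel) \<le> ?N" if s: "\<sigma> > 0" for \<sigma>
  proof -
    let ?K = "\<lambda>y y'. normal_density 0 \<sigma> (y - y')"
    have cF: "integrable lborel (\<lambda>y. cmod (F y))" using F by simp
    have gw: "integrable lborel (\<lambda>\<eta>. gauss_weight \<sigma> \<eta> * (cmod (line_ft F \<eta>))\<^sup>2)"
    proof (rule Bochner_Integration.integrable_bound)
      show "integrable lborel (\<lambda>\<eta>. (LINT y|lborel. cmod (F y))\<^sup>2 * gauss_weight \<sigma> \<eta>)"
        using gauss_weight_integrable[OF s] by simp
      show "AE \<eta> in lborel. norm (gauss_weight \<sigma> \<eta> * (cmod (line_ft F \<eta>))\<^sup>2)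
          \<le> norm ((LINT y|lborel. cmod (F y))\<^sup>2 * gauss_weight \<sigma> \<eta>)"
        using mult_right_mono[OF power_mono[OF line_ft_bound norm_ge_zero] gauss_weight_bounds(1)]
        by (intro AE_I2) (simp add: abs_mult gauss_weight_bounds mult.commute)
    qed measurable
    let ?I = "LINT \<eta>|lborel. gauss_weight \<sigma> \<eta> * (cmod (line_ft F \<eta>))\<^sup>2"
    have "complex_of_real ?I = (LINT \<eta>|lborel. of_real (gauss_weight \<sigma> \<eta>) * cnj (line_ft F \<eta>) * line_ft F \<eta>)"
      by (subst integral_complex_of_real[symmetric])
         (simp only: of_real_mult complex_norm_square mult_ac)
    also have "\<dots> = (LINT y|lborel. F y * (LINT y'|lborel. cnj (F y') * of_real (?K y y')))"
      by (rule gauss_parseval[OF F F s])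
    finally have "cmod (complex_of_real ?I) = cmod (LINT y|lborel. F y * (LINT y'|lborel. cnj (F y') * of_real (?K y y')))"
      by (rule arg_cong)
    hence "?I \<le> cmod (LINT y|lborel. F y * (LINT y'|lborel. cnj (F y') * of_real (?K y y')))"
      unfolding norm_of_real by linarith
    hence "ennreal ?I \<le> ennreal (cmod (LINT y|lborel. F y * (LINT y'|lborel. cnj (F y') * of_real (?K y y'))))"
      by (rule ennreal_leI)
    also have "\<dots> \<le> (\<integral>\<^sup>+y. ennreal (cmod (F y * (LINT y'|lborel. cnj (F y') * of_real (?K y y')))) \<partial>lborel)"
      by (rule ennreal_norm_integral_le)
    also have "\<dots> \<le> (\<integral>\<^sup>+y. \<integral>\<^sup>+y'. ennreal (cmod (F y) * cmod (F y') * ?K y y') \<partial>lborel \<partial>lborel)"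
    proof (rule nn_integral_mono)
      fix y
      have "ennreal (cmod (F y * (LINT y'|lborel. cnj (F y') * of_real (?K y y'))))
          = ennreal (cmod (F y)) * ennreal (cmod (LINT y'|lborel. cnj (F y') * of_real (?K y y')))"
        by (simp add: norm_mult ennreal_mult)
      also have "\<dots> \<le> ennreal (cmod (F y)) * (\<integral>\<^sup>+y'. ennreal (cmod (cnj (F y') * of_real (?K y y'))) \<partial>lborel)"
        by (intro mult_left_mono ennreal_norm_integral_le) simp
      also have "\<dots> = (\<integral>\<^sup>+y'. ennreal (cmod (F y)) * ennreal (cmod (cnj (F y') * of_real (?K y y'))) \<partial>lborel)"
        by (rule nn_integral_cmult[symmetric]) measurable
      also have "\<dots> = (\<integral>\<^sup>+y'. ennreal (cmod (F y) * cmod (F y') * ?K y y') \<partial>lborel)"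
        by (rule nn_integral_cong) (simp add: norm_mult ennreal_mult mult.assoc)
      finally show "ennreal (cmod (F y * (LINT y'|lborel. cnj (F y') * of_real (?K y y'))))
          \<le> (\<integral>\<^sup>+y'. ennreal (cmod (F y) * cmod (F y') * ?K y y') \<partial>lborel)" .
    qed
    \<comment> \<open>By 2ab <= a^2 + b^2 the integrand splits into two terms, in each of which one
      variable occurs only in the density and integrates to 1.\<close>
    also have "\<dots> \<le> (\<integral>\<^sup>+y. \<integral>\<^sup>+y'. (ennreal ((cmod (F y))\<^sup>2 / 2) * ennreal (?K y y') + ennreal ((cmod (F y'))\<^sup>2 / 2) * ennreal (?K y y')) \<partial>lborel \<partial>lborel)"
    proof (intro nn_integral_mono)
      fix y y'
      have "2 * (cmod (F y) * cmod (F y')) \<le> (cmod (F y))\<^sup>2 + (cmod (F y'))\<^sup>2"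
        using sum_squares_bound[of "cmod (F y)" "cmod (F y')"] by (simp add: mult.assoc)
      hence "cmod (F y) * cmod (F y') * ?K y y' \<le> ((cmod (F y))\<^sup>2 / 2 + (cmod (F y'))\<^sup>2 / 2) * ?K y y'"
        by (intro mult_right_mono) auto
      thus "ennreal (cmod (F y) * cmod (F y') * ?K y y')
          \<le> ennreal ((cmod (F y))\<^sup>2 / 2) * ennreal (?K y y') + ennreal ((cmod (F y'))\<^sup>2 / 2) * ennreal (?K y y')"
        by (subst ennreal_mult[symmetric], simp, simp)+
           (subst ennreal_plus[symmetric], simp, simp, rule ennreal_leI, simp add: distrib_right)
    qed
    also have "\<dots> = (\<integral>\<^sup>+y. \<integral>\<^sup>+y'. ennreal ((cmod (F y))\<^sup>2 / 2) * ennreal (?K y y') \<partial>lborel \<partial>lborel)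
         + (\<integral>\<^sup>+y. \<integral>\<^sup>+y'. ennreal ((cmod (F y'))\<^sup>2 / 2) * ennreal (?K y y') \<partial>lborel \<partial>lborel)"
      by (subst nn_integral_add[symmetric]) (auto intro!: nn_integral_cong nn_integral_add)
    also have "(\<integral>\<^sup>+y. \<integral>\<^sup>+y'. ennreal ((cmod (F y'))\<^sup>2 / 2) * ennreal (?K y y') \<partial>lborel \<partial>lborel)
        = (\<integral>\<^sup>+y'. \<integral>\<^sup>+y. ennreal ((cmod (F y'))\<^sup>2 / 2) * ennreal (?K y y') \<partial>lborel \<partial>lborel)"
      by (rule lborel_pair.Fubini') measurable
    also have "\<dots> = (\<integral>\<^sup>+y'. ennreal ((cmod (F y'))\<^sup>2 / 2) \<partial>lborel)"
      by (intro nn_integral_cong) (simp add: nn_integral_cmult nn_integral_normal_density[OF s])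
    also have "(\<integral>\<^sup>+y. \<integral>\<^sup>+y'. ennreal ((cmod (F y))\<^sup>2 / 2) * ennreal (?K y y') \<partial>lborel \<partial>lborel)
        = (\<integral>\<^sup>+y'. ennreal ((cmod (F y'))\<^sup>2 / 2) \<partial>lborel)"
      by (intro nn_integral_cong) (simp add: nn_integral_cmult nn_integral_normal_density[OF s])
    also have "(\<integral>\<^sup>+y'. ennreal ((cmod (F y'))\<^sup>2 / 2) \<partial>lborel) + (\<integral>\<^sup>+y'. ennreal ((cmod (F y'))\<^sup>2 / 2) \<partial>lborel) = ?N"
      by (subst nn_integral_add[symmetric]) (auto intro!: nn_integral_cong simp: ennreal_plus[symmetric] simp del: ennreal_plus)
    finally have "ennreal ?I \<le> ?N" .
    thus ?thesis by (subst nn_integral_eq_integral[OF gw]) (auto simp: gauss_weight_bounds)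
  qed
  have "(\<integral>\<^sup>+\<eta>. ennreal ((cmod (line_ft F \<eta>))\<^sup>2) \<partial>lborel)
      = (\<integral>\<^sup>+\<eta>. liminf (\<lambda>n. ennreal (gauss_weight (1 / real (Suc n)) \<eta> * (cmod (line_ft F \<eta>))\<^sup>2)) \<partial>lborel)"
  proof (rule nn_integral_cong)
    fix \<eta>
    have "(\<lambda>n. gauss_weight (1 / real (Suc n)) \<eta>) \<longlonglongrightarrow> exp (- (2 * pi * 0 * \<eta>)\<^sup>2 / 2)"
      unfolding gauss_weight_def
      by (intro tendsto_intros LIMSEQ_Suc[OF lim_1_over_n]) simp
    hence "(\<lambda>n. gauss_weight (1 / real (Suc n)) \<eta>) \<longlonglongrightarrow> 1" by simp
    hence "(\<lambda>n. ennreal (gauss_weight (1 / real (Suc n)) \<eta> * (cmod (line_ft F \<eta>))\<^sup>2)) \<longlonglongrightarrow> ennreal (1 * (cmod (line_ft F \<eta>))\<^sup>2)"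
      by (intro tendsto_ennrealI tendsto_mult tendsto_const)
    from lim_imp_Liminf[OF trivial_limit_sequentially this]
    show "ennreal ((cmod (line_ft F \<eta>))\<^sup>2)
      = liminf (\<lambda>n. ennreal (gauss_weight (1 / real (Suc n)) \<eta> * (cmod (line_ft F \<eta>))\<^sup>2))" by simp
  qed
  also have "\<dots> \<le> liminf (\<lambda>n. \<integral>\<^sup>+\<eta>. ennreal (gauss_weight (1 / real (Suc n)) \<eta> * (cmod (line_ft F \<eta>))\<^sup>2) \<partial>lborel)"
    by (rule nn_integral_liminf) measurable
  also have "\<dots> \<le> limsup (\<lambda>n. \<integral>\<^sup>+\<eta>. ennreal (gauss_weight (1 / real (Suc n)) \<eta> * (cmod (line_ft F \<eta>))\<^sup>2) \<partial>lborel)"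
    by (rule Liminf_le_Limsup) simp
  also have "\<dots> \<le> ?N" by (rule Limsup_bounded) (intro always_eventually allI w, simp)
  finally have le: "(\<integral>\<^sup>+\<eta>. ennreal ((cmod (line_ft F \<eta>))\<^sup>2) \<partial>lborel) \<le> ennreal ((l2norm lborel F)\<^sup>2)"
    using nn_integral_eq_l2norm[OF F2] by simp
  show s: "square_integrable lborel (line_ft F)"
    using le by (subst square_integrable_iff_nn_integral) (measurable, erule le_less_trans, simp)
  have "(l2norm lborel (line_ft F))\<^sup>2 \<le> (l2norm lborel F)\<^sup>2"
    using le unfolding nn_integral_eq_l2norm[OF s] by (subst (asm) ennreal_le_iff) simp_all
  thus "l2norm lborel (line_ft F) \<le> l2norm lborel F" by (rule power2_le_imp_le) simp
qed

lemma line_kernel_int: "kernel_int lborel A (\<lambda>y \<eta>. phase (- (\<eta> * y))) f = line_ft (\<lambda>y. indicator A y * f y)"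
  by (simp add: kernel_int_def line_ft_def fun_eq_iff)

lemma line_contractive: "l2_contractive lborel lborel (\<lambda>y \<eta>. phase (- (\<eta> * y))) real_box"
  unfolding l2_contractive_def line_kernel_int
  by (auto intro!: line_ft_contractive line.integrable_indicator_A square_integrable_indicator(1))

text \<open>The substitution y' = y - \<sigma> x replaces the varying density by the standard one;
  the indicator at y - \<sigma> x is eventually constant along the sequence because \<open>y\<close>
  is not an end point.\<close>

lemma gauss_convolution_tendsto:
  assumes y: "y \<noteq> a" "y \<noteq> b"
  shows "(\<lambda>n. LINT y'|lborel. indicator {a<..b} y' * normal_density 0 (1 / real (Suc n)) (y - y'))
      \<longlonglongrightarrow> indicator {a<..b} y"
proof -
  have eq: "(LINT y'|lborel. indicator {a<..b} y' * normal_density 0 \<sigma> (y - y'))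
      = (LINT x|lborel. indicator {a<..b} (y + (- \<sigma>) * x) * std_normal_density x)" if s: "\<sigma> > 0" for \<sigma>
  proof -
    have "(LINT y'|lborel. indicator {a<..b} y' * normal_density 0 \<sigma> (y - y'))
      = \<bar>- \<sigma>\<bar> *\<^sub>R (LINT x|lborel. indicator {a<..b} (y + (- \<sigma>) * x) * normal_density 0 \<sigma> (y - (y + (- \<sigma>) * x)))"
      by (rule lborel_integral_real_affine) (use s in simp)
    also have "\<dots> = (LINT x|lborel. indicator {a<..b} (y + (- \<sigma>) * x) * (\<sigma> * normal_density 0 \<sigma> (\<sigma> * x)))"
      using s by (simp add: mult_ac flip: integral_mult_right_zero)
    also have "(\<lambda>x. \<sigma> * normal_density 0 \<sigma> (\<sigma> * x)) = std_normal_density"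
      using s by (simp add: normal_density_def fun_eq_iff real_sqrt_mult power_mult_distrib field_simps)
    finally show ?thesis .
  qed
  have "(\<lambda>n. LINT x|lborel. indicator {a<..b} (y + (- (1 / real (Suc n))) * x) * std_normal_density x)
      \<longlonglongrightarrow> (LINT x|lborel. indicator {a<..b} y * std_normal_density x)"
  proof (rule integral_dominated_convergence[where w=std_normal_density])
    show "AE x in lborel. (\<lambda>n. indicator {a<..b} (y + (- (1 / real (Suc n))) * x) * std_normal_density x)
        \<longlonglongrightarrow> indicator {a<..b} y * std_normal_density x"
    proof (intro AE_I2 tendsto_mult_right)
      fix x
      have l: "(\<lambda>n. y + (- (1 / real (Suc n))) * x) \<longlonglongrightarrow> y + (- 0) * x"
        by (intro tendsto_intros LIMSEQ_Suc[OF lim_1_over_n])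
      hence l: "(\<lambda>n. y + (- (1 / real (Suc n))) * x) \<longlonglongrightarrow> y" by simp
      have "\<forall>\<^sub>F n in sequentially. indicator {a<..b} (y + (- (1 / real (Suc n))) * x) = (indicator {a<..b} y :: real)"
      proof -
        consider "y < a" | "a < y" "y < b" | "b < y" using y by linarith
        thus ?thesis
        proof cases
          case 1 from order_tendstoD(2)[OF l 1] show ?thesis by eventually_elim (use 1 in \<open>auto simp: indicator_def\<close>)
        next
          case 2 from order_tendstoD(2)[OF l 2(2)] order_tendstoD(1)[OF l 2(1)]
          show ?thesis by eventually_elim (use 2 in \<open>auto simp: indicator_def\<close>)
        next
          case 3 from order_tendstoD(1)[OF l 3] show ?thesis by eventually_elim (use 3 in \<open>auto simp: indicator_def\<close>)
        qed
      qed
      thus "(\<lambda>n. indicator {a<..b} (y + (- (1 / real (Suc n))) * x)) \<longlonglongrightarrow> (indicator {a<..b} y :: real)"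
        by (rule tendsto_eventually)
    qed
    show "AE x in lborel. norm (indicator {a<..b} (y + (- (1 / real (Suc n))) * x) * std_normal_density x) \<le> std_normal_density x" for n
      by (intro AE_I2) (auto simp: indicator_def)
  qed auto
  moreover have "(LINT x|lborel. indicator {a<..b} y * std_normal_density x) = indicator {a<..b} y" by simp
  ultimately show ?thesis by (simp only: eq[of "1 / real (Suc n)" for n] zero_less_divide_1_iff of_nat_0_less_iff zero_less_Suc)
qed

text \<open>Parseval against indicators is enough to recognise a function. On the left the weight is
  removed with the product of the two transforms as majorant, integrable by contractivity; on the
  right the smoothed indicator has modulus at most 1, so |F| is a majorant.\<close>

lemma line_parseval_interval:
  fixes F :: "real \<Rightarrow> complex"
  assumes F: "integrable lborel F" and F2: "square_integrable lborel F"
  shows "(LINT \<eta>|lborel. line_ft F \<eta> * cnj (line_ft (indicator {a<..b}) \<eta>)) = (LINT y|lborel. F y * indicator {a<..b} y)"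
proof -
  have [measurable]: "F \<in> borel_measurable borel" using F by auto
  let ?h = "indicator {a<..b} :: real \<Rightarrow> complex"
  have hr: "integrable lborel (indicator {a<..b} :: real \<Rightarrow> real)"
    by (cases "a \<le> b") auto
  have hi: "integrable lborel ?h"
    using hr by (rule Bochner_Integration.integrable_bound) (auto simp: indicator_def)
  have h2: "square_integrable lborel ?h"
    unfolding square_integrable_def
    using hr by (auto intro!: Bochner_Integration.integrable_bound[OF hr] simp: indicator_def)
  note FF = line_ft_contractive[OF F F2] line_ft_contractive[OF hi h2]
  let ?s = "\<lambda>n. 1 / real (Suc n)"
  have 1: "(\<lambda>n. LINT \<eta>|lborel. of_real (gauss_weight (?s n) \<eta>) * cnj (line_ft ?h \<eta>) * line_ft F \<eta>)
      \<longlonglongrightarrow> (LINT \<eta>|lborel. line_ft F \<eta> * cnj (line_ft ?h \<eta>))"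
  proof (rule integral_dominated_convergence[where w="\<lambda>\<eta>. cmod (line_ft F \<eta>) * cmod (line_ft ?h \<eta>)"])
    show "integrable lborel (\<lambda>\<eta>. cmod (line_ft F \<eta>) * cmod (line_ft ?h \<eta>))"
      by (rule square_integrable_prod(1)[OF FF(1) FF(3)])
    show "AE \<eta> in lborel. (\<lambda>n. of_real (gauss_weight (?s n) \<eta>) * cnj (line_ft ?h \<eta>) * line_ft F \<eta>)
        \<longlonglongrightarrow> line_ft F \<eta> * cnj (line_ft ?h \<eta>)"
    proof (rule AE_I2)
      fix \<eta>
      have "(\<lambda>n. gauss_weight (?s n) \<eta>) \<longlonglongrightarrow> exp (- (2 * pi * 0 * \<eta>)\<^sup>2 / 2)"
        unfolding gauss_weight_def by (intro tendsto_intros LIMSEQ_Suc[OF lim_1_over_n]) simp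
      hence "(\<lambda>n. gauss_weight (?s n) \<eta>) \<longlonglongrightarrow> 1" by simp
      hence "(\<lambda>n. complex_of_real (gauss_weight (?s n) \<eta>) * cnj (line_ft ?h \<eta>) * line_ft F \<eta>)
          \<longlonglongrightarrow> of_real 1 * cnj (line_ft ?h \<eta>) * line_ft F \<eta>"
        by (intro tendsto_intros)
      thus "(\<lambda>n. of_real (gauss_weight (?s n) \<eta>) * cnj (line_ft ?h \<eta>) * line_ft F \<eta>)
        \<longlonglongrightarrow> line_ft F \<eta> * cnj (line_ft ?h \<eta>)" by (simp add: mult.commute)
    qed
    show "AE \<eta> in lborel. cmod (of_real (gauss_weight (?s n) \<eta>) * cnj (line_ft ?h \<eta>) * line_ft F \<eta>)
        \<le> cmod (line_ft F \<eta>) * cmod (line_ft ?h \<eta>)" for n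
    proof (rule AE_I2)
      fix \<eta>
      have "\<bar>gauss_weight (?s n) \<eta>\<bar> * (cmod (line_ft ?h \<eta>) * cmod (line_ft F \<eta>)) \<le> cmod (line_ft ?h \<eta>) * cmod (line_ft F \<eta>)"
        using gauss_weight_bounds[of "?s n" \<eta>] by (intro mult_left_le_one_le) auto
      thus "cmod (of_real (gauss_weight (?s n) \<eta>) * cnj (line_ft ?h \<eta>) * line_ft F \<eta>)
        \<le> cmod (line_ft F \<eta>) * cmod (line_ft ?h \<eta>)" by (simp add: norm_mult mult_ac)
    qed
  qed measurable
  have 2: "(\<lambda>n. LINT y|lborel. F y * (LINT y'|lborel. cnj (?h y') * of_real (normal_density 0 (?s n) (y - y'))))
      \<longlonglongrightarrow> (LINT y|lborel. F y * ?h y)"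
  proof -
    let ?c = "\<lambda>n y. LINT y'|lborel. indicator {a<..b} y' * normal_density 0 (?s n) (y - y')"
    have c: "(LINT y'|lborel. cnj (?h y') * of_real (normal_density 0 (?s n) (y - y'))) = of_real (?c n y)" for n y
      by (subst integral_complex_of_real[symmetric]) (rule Bochner_Integration.integral_cong, auto simp: indicator_def)
    have c1: "\<bar>?c n y\<bar> \<le> 1" for n y
    proof -
      have i: "integrable lborel (\<lambda>y'. normal_density 0 (?s n) (y - y'))"
        using lborel_integrable_real_affine[OF integrable_normal_density, of "?s n" "-1" 0 y] by simp
      have "(LINT y'|lborel. normal_density 0 (?s n) (y - y')) = 1"
        using lborel_integral_real_affine[of "-1" "normal_density 0 (?s n)" y] by simp
      moreover have "norm (?c n y) \<le> (LINT y'|lborel. normal_density 0 (?s n) (y - y'))"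
        by (rule order_trans[OF Bochner_Integration.integral_norm_bound], rule integral_mono[OF _ i])
           (auto simp: indicator_def intro!: Bochner_Integration.integrable_bound[OF i])
      ultimately show ?thesis by simp
    qed
    show ?thesis unfolding c
    proof (rule integral_dominated_convergence[where w="\<lambda>y. cmod (F y)"])
      show "AE y in lborel. (\<lambda>n. F y * of_real (?c n y)) \<longlonglongrightarrow> F y * ?h y"
        using AE_lborel_singleton[of a] AE_lborel_singleton[of b]
      proof eventually_elim
        case (elim y)
        from gauss_convolution_tendsto[OF elim]
        have "(\<lambda>n. complex_of_real (?c n y)) \<longlonglongrightarrow> of_real (indicator {a<..b} y)" by (rule tendsto_of_real)
        hence "(\<lambda>n. F y * complex_of_real (?c n y)) \<longlonglongrightarrow> F y * of_real (indicator {a<..b} y)" by (rule tendsto_mult_left)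
        moreover have "complex_of_real (indicator {a<..b} y) = ?h y" by (simp add: indicator_def)
        ultimately show ?case by simp
      qed
      show "AE y in lborel. cmod (F y * of_real (?c n y)) \<le> cmod (F y)" for n
        using c1 by (intro AE_I2) (auto simp: norm_mult intro!: mult_left_le)
    qed (use F in auto)
  qed
  show ?thesis
    by (rule LIMSEQ_unique[OF 1]) (use 2 gauss_parseval[OF F hi] in simp)
qed

text \<open>Let \<open>K\<close> be the transform of the truncated function \<open>F\<close> and
  \<open>w\<close> the adjoint transform of \<open>K\<close>, which exists by contractivity.
  Parseval against intervals gives w = F almost everywhere, and then ||K||^2 = <w, F> =
  ||F||^2.\<close>

lemma line_isometric: "l2_isometric lborel lborel (\<lambda>y \<eta>. phase (- (\<eta> * y))) real_box"
  unfolding l2_isometric_def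
proof (intro allI impI)
  interpret S: l2_kernel lborel lborel "\<lambda>\<eta> y. cnj (phase (- (\<eta> * y)))" real_box real_box
    by (rule line.swap)
  fix n and f :: "real \<Rightarrow> complex" assume f: "square_integrable lborel f"
  define F where "F = (\<lambda>y. indicator (real_box n) y * f y)"
  have Fi: "integrable lborel F" unfolding F_def by (rule line.integrable_indicator_A[OF f])
  have F2: "square_integrable lborel F" unfolding F_def by (intro square_integrable_indicator(1) f) (simp add: real_box_def)
  define K where "K = line_ft F"
  have K: "square_integrable lborel K" "l2norm lborel K \<le> l2norm lborel F"
    unfolding K_def using line_ft_contractive[OF Fi F2] .
  have Kk: "kernel_int lborel (real_box n) (\<lambda>y \<eta>. phase (- (\<eta> * y))) f = K"
    unfolding K_def F_def line_kernel_int ..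
  have c': "l2_contractive lborel lborel (\<lambda>\<eta> y. cnj (phase (- (\<eta> * y)))) real_box"
    by (rule line.contractive_swap[OF line_contractive])
  obtain w where w: "l2_transform lborel lborel (\<lambda>\<eta> y. cnj (phase (- (\<eta> * y)))) real_box K w"
    using S.transform_exists[OF c' K(1)] .
  have ws: "square_integrable lborel w" using w by (simp add: l2_transform_def)
  have inner: "(LINT y|lborel. w y * cnj (indicator (real_box m) y * h y))
      = (LINT \<eta>|lborel. K \<eta> * cnj (line_ft (\<lambda>y. indicator (real_box m) y * h y) \<eta>))"
    if "square_integrable lborel h" for m h
    using S.transform_inner[OF c' K(1) w that, of m] by (simp add: line_kernel_int)
  have "AE y in lborel. indicator (real_box m) y * (w y - F y) = 0" for m
  proof (rule AE_zero_of_Ioc_integrals)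
    show i: "integrable lborel (\<lambda>y. indicator (real_box m) y * (w y - F y))"
      by (intro line.integrable_indicator_A square_integrable_diff ws F2)
    fix a b
    define a' where "a' = max a (- real m)"
    define b' where "b' = min b (real m)"
    let ?h = "indicator {a'<..b'} :: real \<Rightarrow> complex"
    have hm: "(\<lambda>y. indicator (real_box m) y * ?h y) = ?h"
      by (auto simp: real_box_def indicator_def a'_def b'_def fun_eq_iff)
    have [measurable]: "w \<in> borel_measurable borel" "F \<in> borel_measurable borel"
      using ws F2 by (simp_all add: square_integrable_def)
    \<comment> \<open>Clipping the half-open interval to the closed box may lose the left end -m of
      the box, a null set.\<close>
    have "AE y in lborel. y \<noteq> - real m" by (rule AE_lborel_singleton)
    hence "(LINT y:{a<..b}|lborel. indicator (real_box m) y * (w y - F y)) = (LINT y|lborel. w y * ?h y - F y * ?h y)"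
      unfolding set_lebesgue_integral_def
    proof (intro integral_cong_AE, goal_cases)
      case 3 thus ?case
      proof eventually_elim
        case (elim y)
        have "y \<in> {a<..b} \<and> y \<in> real_box m \<longleftrightarrow> y \<in> {a'<..b'}"
          using elim by (auto simp: real_box_def a'_def b'_def)
        thus ?case by (auto simp: indicator_def)
      qed
    qed measurable
    also have "\<dots> = 0"
    proof -
      have h2: "square_integrable lborel ?h"
      proof -
        have hr: "integrable lborel (indicator {a'<..b'} :: real \<Rightarrow> real)" by (cases "a' \<le> b'") auto
        show ?thesis unfolding square_integrable_def
          using hr by (auto intro!: Bochner_Integration.integrable_bound[OF hr] simp: indicator_def)
      qed
      have ch: "cnj (?h y) = ?h y" for y by (simp add: indicator_def)
      have "(LINT y|lborel. w y * ?h y) = (LINT y|lborel. F y * ?h y)"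
        using inner[OF h2, of m] line_parseval_interval[OF Fi F2, of a' b']
        unfolding hm fun_cong[OF hm] ch K_def by simp
      thus ?thesis
        using square_integrable_prod(2)[OF ws h2] square_integrable_prod(2)[OF F2 h2] unfolding ch by simp
    qed
    finally show "(LINT y:{a<..b}|lborel. indicator (real_box m) y * (w y - F y)) = 0" .
  qed
  hence "AE y in lborel. \<forall>m. indicator (real_box m) y * (w y - F y) = 0" unfolding AE_all_countable by blast
  hence wF: "AE y in lborel. w y = F y"
  proof eventually_elim
    case (elim y)
    obtain m where "y \<in> real_box m" using real_box_exhausts(2) by blast
    thus ?case using elim[rule_format, of m] by simp
  qed
  have FF: "(\<lambda>y. indicator (real_box n) y * F y) = F" by (auto simp: F_def indicator_def)
  have "complex_of_real ((l2norm lborel K)\<^sup>2) = (LINT \<eta>|lborel. K \<eta> * cnj (K \<eta>))" by (rule l2norm_sq_inner)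
  also have "\<dots> = (LINT y|lborel. w y * cnj (F y))" using inner[OF F2, of n] unfolding FF fun_cong[OF FF] K_def[symmetric] by simp
  also have "\<dots> = (LINT y|lborel. F y * cnj (F y))"
    by (rule integral_cong_AE) (use wF ws F2 in \<open>auto simp: square_integrable_def\<close>)
  also have "\<dots> = complex_of_real ((l2norm lborel F)\<^sup>2)" by (rule l2norm_sq_inner[symmetric])
  finally have "(l2norm lborel K)\<^sup>2 = (l2norm lborel F)\<^sup>2" by (simp only: of_real_eq_iff)
  hence "l2norm lborel K = l2norm lborel F" by simp
  thus "square_integrable lborel (kernel_int lborel (real_box n) (\<lambda>y \<eta>. phase (- (\<eta> * y))) f) \<and>
      l2norm lborel (kernel_int lborel (real_box n) (\<lambda>y \<eta>. phase (- (\<eta> * y))) f) = l2norm lborel (\<lambda>y. indicator (real_box n) y * f y)"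
    using K(1) unfolding Kk F_def by simp
qed

text \<open>Conjugating input and output turns the inverse kernel into the forward one, since
  \<open>phase (- (\<eta> * y))\<close> is symmetric in its two variables.\<close>

lemma line_isometric_inverse: "l2_isometric lborel lborel (\<lambda>\<eta> y. cnj (phase (- (\<eta> * y)))) real_box"
proof -
  have k: "kernel_int lborel A (\<lambda>\<eta> y. cnj (phase (- (\<eta> * y)))) f
      = (\<lambda>y. cnj (kernel_int lborel A (\<lambda>y \<eta>. phase (- (\<eta> * y))) (\<lambda>y. cnj (f y)) y))" for A f
  proof
    fix y
    have "cnj (kernel_int lborel A (\<lambda>y \<eta>. phase (- (\<eta> * y))) (\<lambda>y. cnj (f y)) y)
        = (LINT x|lborel. cnj (indicator A x * cnj (f x) * phase (- (y * x))))"
      unfolding kernel_int_def by (rule Bochner_Integration.integral_cnj[symmetric])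
    also have "\<dots> = kernel_int lborel A (\<lambda>\<eta> y. cnj (phase (- (\<eta> * y)))) f y"
      unfolding kernel_int_def by (rule Bochner_Integration.integral_cong) (auto simp: indicator_def mult_ac)
    finally show "kernel_int lborel A (\<lambda>\<eta> y. cnj (phase (- (\<eta> * y)))) f y
      = cnj (kernel_int lborel A (\<lambda>y \<eta>. phase (- (\<eta> * y))) (\<lambda>y. cnj (f y)) y)" ..
  qed
  have sc: "square_integrable M (\<lambda>y. cnj (g y)) \<longleftrightarrow> square_integrable M g" for M :: "real measure" and g
  proof -
    have "(\<lambda>y. cnj (g y)) \<in> borel_measurable M \<longleftrightarrow> g \<in> borel_measurable M"
    proof
      assume [measurable]: "(\<lambda>y. cnj (g y)) \<in> borel_measurable M"
      have "(\<lambda>y. cnj (cnj (g y))) \<in> borel_measurable M" by measurable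
      thus "g \<in> borel_measurable M" by simp
    qed measurable
    thus ?thesis by (simp add: square_integrable_def)
  qed
  have lc: "l2norm M (\<lambda>y. cnj (g y)) = l2norm M g" for M :: "real measure" and g by (simp add: l2norm_def)
  show ?thesis unfolding l2_isometric_def k sc lc
  proof (intro allI impI)
    fix n and f :: "real \<Rightarrow> complex" assume "square_integrable lborel f"
    hence "square_integrable lborel (\<lambda>y. cnj (f y))" by (simp add: sc)
    from line_isometric[unfolded l2_isometric_def, rule_format, OF this, of n]
    show "square_integrable lborel (kernel_int lborel (real_box n) (\<lambda>y \<eta>. phase (- (\<eta> * y))) (\<lambda>y. cnj (f y))) \<and>
        l2norm lborel (kernel_int lborel (real_box n) (\<lambda>y \<eta>. phase (- (\<eta> * y))) (\<lambda>y. cnj (f y)))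
        = l2norm lborel (\<lambda>x. indicator (real_box n) x * f x)"
      by (simp add: l2norm_def norm_mult)
  qed
qed

section \<open>The Fourier transform on the period cell\<close>

text \<open>The identity map is measurable in both directions, which equates the sigma-algebras; on
  rectangles both measures are the product of the side measures.\<close>

lemma restrict_space_pair_measure:
  assumes sf: "sigma_finite_measure M1" "sigma_finite_measure M2"
    and A[measurable]: "A \<in> sets M1" and B[measurable]: "B \<in> sets M2"
  shows "restrict_space M1 A \<Otimes>\<^sub>M restrict_space M2 B = restrict_space (M1 \<Otimes>\<^sub>M M2) (A \<times> B)"
    (is "?L = ?R")
proof (rule pair_measure_eqI)
  show "sigma_finite_measure (restrict_space M1 A)" "sigma_finite_measure (restrict_space M2 B)"
    using sf A B by (auto intro!: sigma_finite_measure_restrict_space)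
  have sp: "space ?L = A \<times> B" "space ?R = A \<times> B"
    using sets.sets_into_space[OF A] sets.sets_into_space[OF B]
    by (auto simp: space_pair_measure space_restrict_space)
  have 1: "(\<lambda>x. x) \<in> measurable ?L ?R"
  proof (rule measurable_restrict_space2)
    have "(\<lambda>x. (fst x, snd x)) \<in> measurable ?L (M1 \<Otimes>\<^sub>M M2)"
      by (intro measurable_Pair measurable_compose[OF measurable_fst] measurable_compose[OF measurable_snd]
          measurable_restrict_space1 measurable_ident_sets refl)
    thus "(\<lambda>x. x) \<in> measurable ?L (M1 \<Otimes>\<^sub>M M2)" by simp
  qed (use sp in auto)
  have 2: "(\<lambda>x. x) \<in> measurable ?R ?L"
  proof -
    have "(\<lambda>x. (fst x, snd x)) \<in> measurable ?R ?L"
      by (intro measurable_Pair measurable_restrict_space2 measurable_restrict_space1 measurable_fst measurable_snd)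
         (auto simp: space_restrict_space)
    thus ?thesis by simp
  qed
  show "sets ?L = sets ?R"
  proof (intro equalityI subsetI)
    fix X assume X: "X \<in> sets ?L"
    from measurable_sets[OF 2 X] sets.sets_into_space[OF X] show "X \<in> sets ?R" by (simp add: sp Int_absorb2)
  next
    fix X assume X: "X \<in> sets ?R"
    from measurable_sets[OF 1 X] sets.sets_into_space[OF X] show "X \<in> sets ?L" by (simp add: sp Int_absorb2)
  qed
  fix X Y assume XY: "X \<in> sets (restrict_space M1 A)" "Y \<in> sets (restrict_space M2 B)"
  hence "X \<in> sets M1" "X \<subseteq> A" "Y \<in> sets M2" "Y \<subseteq> B"
    by (auto simp: sets_restrict_space_iff)
  thus "emeasure (restrict_space M1 A) X * emeasure (restrict_space M2 B) Y = emeasure ?R (X \<times> Y)"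
    using sigma_finite_measure.emeasure_pair_measure_Times[OF sf(2), of X M1 Y]
    by (subst (1 2 3) emeasure_restrict_space) auto
qed

text \<open>The period cell is given as a restriction of Lebesgue measure on three-space; the tensor
  product results apply to it in this product form.\<close>

lemma cell_eq: "cell = unit_interval \<Otimes>\<^sub>M (lborel \<Otimes>\<^sub>M unit_interval)"
proof -
  have u: "(lborel :: real measure) = restrict_space lborel UNIV"
    by (rule measure_eqI) (auto simp: sets_restrict_space emeasure_restrict_space)
  have "(lborel :: real measure) \<Otimes>\<^sub>M unit_interval = restrict_space (lborel \<Otimes>\<^sub>M lborel) (UNIV \<times> {0..1::real})"
    using restrict_space_pair_measure[of lborel lborel "UNIV :: real set" "{0..1::real}"]
    unfolding unit_interval_def u[symmetric] by (simp add: sigma_finite_lborel)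
  also have "unit_interval \<Otimes>\<^sub>M \<dots> = restrict_space (lborel \<Otimes>\<^sub>M (lborel \<Otimes>\<^sub>M lborel)) ({0..1} \<times> UNIV \<times> {0..1})"
    unfolding unit_interval_def
    by (rule restrict_space_pair_measure) (auto simp: sigma_finite_lborel lborel_prod)
  finally show ?thesis by (simp add: cell_def lborel_prod)
qed

lemma space_cell: "space cell = {0..1} \<times> UNIV \<times> {0..1}"
  by (simp add: cell_def space_restrict_space)

lemma measurable_cell [measurable (raw)]: "f \<in> borel_measurable borel \<Longrightarrow> f \<in> borel_measurable cell"
  unfolding cell_def by (rule measurable_restrict_space1) simp

section \<open>The Fourier kernel of the cell as a tensor product\<close>

abbreviation circle_kernel :: "real \<Rightarrow> int \<Rightarrow> complex" where
  "circle_kernel \<equiv> (\<lambda>x k. wave (- k) x)"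

abbreviation line_kernel :: "real \<Rightarrow> real \<Rightarrow> complex" where
  "line_kernel \<equiv> (\<lambda>y \<eta>. phase (- (\<eta> * y)))"

definition fkernel :: "point \<Rightarrow> freq \<Rightarrow> complex" where
  "fkernel = pair_kernel circle_kernel (pair_kernel line_kernel circle_kernel)"

definition slab :: "nat \<Rightarrow> point set" where
  "slab n = {0..1} \<times> real_box n \<times> {0..1}"

definition freq_box :: "nat \<Rightarrow> freq set" where
  "freq_box n = int_box n \<times> real_box n \<times> int_box n"

interpretation yz: l2_kernel_pair lborel lborel line_kernel real_box real_box
    unit_interval "count_space UNIV" circle_kernel "\<lambda>n. {0..1}" int_box
  by (intro l2_kernel_pair.intro line.l2_kernel_axioms circle.l2_kernel_axioms)

interpretation xyz: l2_kernel_pair unit_interval "count_space UNIV" circle_kernel "\<lambda>n. {0..1}" int_box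
    "lborel \<Otimes>\<^sub>M unit_interval" "lborel \<Otimes>\<^sub>M count_space UNIV" "pair_kernel line_kernel circle_kernel"
    "\<lambda>n. real_box n \<times> {0..1}" "\<lambda>n. real_box n \<times> int_box n"
  by (intro l2_kernel_pair.intro yz.l2_kernel_axioms circle.l2_kernel_axioms)

text \<open>The inverse kernel is the tensor product of the inverse kernels; this second chain of
  interpretations makes \<open>isometric_pair\<close> available for it as well.\<close>

interpretation yz': l2_kernel_pair lborel lborel "\<lambda>\<eta> y. cnj (line_kernel y \<eta>)" real_box real_box
    "count_space UNIV" unit_interval "\<lambda>k x. cnj (circle_kernel x k)" int_box "\<lambda>n. {0..1}"
  by (intro l2_kernel_pair.intro line.swap circle.swap)

interpretation xyz': l2_kernel_pair "count_space UNIV" unit_interval "\<lambda>k x. cnj (circle_kernel x k)" int_box "\<lambda>n. {0..1}"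
    "lborel \<Otimes>\<^sub>M count_space UNIV" "lborel \<Otimes>\<^sub>M unit_interval"
    "pair_kernel (\<lambda>\<eta> y. cnj (line_kernel y \<eta>)) (\<lambda>k x. cnj (circle_kernel x k))"
    "\<lambda>n. real_box n \<times> int_box n" "\<lambda>n. real_box n \<times> {0..1}"
  by (intro l2_kernel_pair.intro yz'.l2_kernel_axioms circle.swap)

interpretation ft: l2_kernel cell freq_measure fkernel slab freq_box
  unfolding cell_eq freq_measure_def fkernel_def slab_def[abs_def] freq_box_def[abs_def]
  by (rule xyz.l2_kernel_axioms)

lemma ft_isometric: "l2_isometric cell freq_measure fkernel slab"
  unfolding cell_eq freq_measure_def fkernel_def slab_def[abs_def]
  by (intro xyz.isometric_pair yz.isometric_pair circle_isometric line_isometric)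

lemma ft_isometric_inverse: "l2_isometric freq_measure cell (\<lambda>\<xi> p. cnj (fkernel p \<xi>)) freq_box"
proof -
  have "(\<lambda>\<xi> p. cnj (fkernel p \<xi>)) = pair_kernel (\<lambda>k x. cnj (circle_kernel x k))
      (pair_kernel (\<lambda>\<eta> y. cnj (line_kernel y \<eta>)) (\<lambda>k x. cnj (circle_kernel x k)))"
    by (simp add: fkernel_def pair_kernel_def fun_eq_iff)
  thus ?thesis
    unfolding cell_eq freq_measure_def freq_box_def[abs_def]
    using xyz'.isometric_pair[OF circle_isometric_inverse yz'.isometric_pair[OF line_isometric_inverse circle_isometric_inverse]]
    by simp
qed

lemma ft_contractive: "l2_contractive cell freq_measure fkernel slab"
  by (rule l2_isometric_imp_contractive[OF ft_isometric])

lemma fkernel_eq: "fkernel (x, y, z) (k, \<eta>, l) = phase (- (of_int k * x + \<eta> * y + of_int l * z))"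
  by (simp add: fkernel_def pair_kernel_def wave_eq_phase phase_add[symmetric] algebra_simps)

lemma fourier_trunc_eq: "fourier_trunc (real n) f = kernel_int cell (slab n) fkernel f"
proof
  fix \<xi> :: freq
  obtain k \<eta> l where \<xi>: "\<xi> = (k, \<eta>, l)" by (cases \<xi>)
  show "fourier_trunc (real n) f \<xi> = kernel_int cell (slab n) fkernel f \<xi>"
    unfolding fourier_trunc_def kernel_int_def \<xi> prod.case set_lebesgue_integral_def
  proof (rule Bochner_Integration.integral_cong)
    fix p assume p: "p \<in> space cell"
    obtain x y z where p': "p = (x, y, z)" by (cases p)
    have "exp (- 2 * of_real pi * \<i> * of_real (of_int k * x + \<eta> * y + of_int l * z)) = fkernel p (k, \<eta>, l)"
      unfolding p' fkernel_eq phase_def of_real_minus by (simp only: mult_minus_left mult_minus_right)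
    thus "indicator {(x, y, z). \<bar>y\<bar> \<le> real n} p *\<^sub>R
        (case p of (x, y, z) \<Rightarrow> exp (- 2 * of_real pi * \<i> * of_real (of_int k * x + \<eta> * y + of_int l * z)) * f (x, y, z))
      = indicator (slab n) p * f p * fkernel p (k, \<eta>, l)"
      using p by (auto simp: p' space_cell indicator_def slab_def real_box_def)
  qed simp
qed

lemma trunc_square_integrable: "square_integrable cell f \<Longrightarrow> square_integrable freq_measure (kernel_int cell (slab n) fkernel f)"
  using ft_contractive by (simp add: l2_contractive_def)

text \<open>Bridge between the definition through extended nonnegative integrals of squares and the
  limit in mean expressed by norms.\<close>

lemma is_fourier_iff:
  assumes f: "square_integrable cell f"
  shows "is_fourier f g \<longleftrightarrow> l2_transform cell freq_measure fkernel slab f g"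
proof (cases "square_integrable freq_measure g")
  case g: True
  let ?d = "\<lambda>n \<xi>. kernel_int cell (slab n) fkernel f \<xi> - g \<xi>"
  have e: "(\<integral>\<^sup>+\<xi>. ennreal ((cmod (?d n \<xi>))\<^sup>2) \<partial>freq_measure) = ennreal ((l2norm freq_measure (?d n))\<^sup>2)" for n
    by (rule nn_integral_eq_l2norm[OF square_integrable_diff(1)[OF trunc_square_integrable[OF f] g]])
  have "((\<lambda>n. ennreal ((l2norm freq_measure (?d n))\<^sup>2)) \<longlonglongrightarrow> ennreal 0)
     \<longleftrightarrow> ((\<lambda>n. l2norm freq_measure (?d n)) \<longlonglongrightarrow> 0)"
  proof
    assume "(\<lambda>n. ennreal ((l2norm freq_measure (?d n))\<^sup>2)) \<longlonglongrightarrow> ennreal 0"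
    hence "(\<lambda>n. (l2norm freq_measure (?d n))\<^sup>2) \<longlonglongrightarrow> 0" by (subst (asm) tendsto_ennreal_iff) auto
    from tendsto_real_sqrt[OF this] show "(\<lambda>n. l2norm freq_measure (?d n)) \<longlonglongrightarrow> 0" by simp
  next
    assume "(\<lambda>n. l2norm freq_measure (?d n)) \<longlonglongrightarrow> 0"
    from tendsto_power[OF this, of 2] have "(\<lambda>n. (l2norm freq_measure (?d n))\<^sup>2) \<longlonglongrightarrow> 0" by simp
    thus "(\<lambda>n. ennreal ((l2norm freq_measure (?d n))\<^sup>2)) \<longlonglongrightarrow> ennreal 0" by (rule tendsto_ennrealI)
  qed
  thus ?thesis using g by (simp add: is_fourier_def l2_transform_def fourier_trunc_eq e)
qed (simp add: is_fourier_def l2_transform_def)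

text \<open>Existence of a limit in mean guarantees that the choice in \<open>fourier\<close> lands
  on a true transform.\<close>

lemma l2_transform_fourier:
  assumes f: "square_integrable cell f"
  shows "l2_transform cell freq_measure fkernel slab f (fourier f)"
proof -
  obtain g where "l2_transform cell freq_measure fkernel slab f g"
    using ft.transform_exists[OF ft_contractive f] .
  hence "is_fourier f g" by (simp add: is_fourier_iff[OF f])
  hence "is_fourier f (fourier f)" unfolding fourier_def by (rule someI[of "is_fourier f"])
  thus ?thesis by (simp add: is_fourier_iff[OF f])
qed

lemma fourier_square_integrable: "square_integrable cell f \<Longrightarrow> square_integrable freq_measure (fourier f)"
  using l2_transform_fourier by (auto simp: l2_transform_def)

lemma fourier_eqI:
  assumes f: "square_integrable cell f" and g: "l2_transform cell freq_measure fkernel slab f g"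
  shows "AE \<xi> in freq_measure. fourier f \<xi> = g \<xi>"
  by (rule ft.transform_unique[OF ft_contractive f l2_transform_fourier[OF f] g])

lemma l2norm_fourier: "square_integrable cell f \<Longrightarrow> l2norm freq_measure (fourier f) = l2norm cell f"
  by (rule ft.l2_transform_l2norm_eq[OF ft_isometric _ l2_transform_fourier])

text \<open>One linear combination serves all later uses: c = 1 gives differences, and a negated
  \<open>c\<close> gives sums.\<close>

lemma l2_transform_scale_diff:
  assumes f: "square_integrable cell f" "l2_transform cell freq_measure fkernel slab f F"
    and g: "square_integrable cell g" "l2_transform cell freq_measure fkernel slab g G"
  shows "l2_transform cell freq_measure fkernel slab (\<lambda>p. f p - c * g p) (\<lambda>\<xi>. F \<xi> - c * G \<xi>)"
proof -
  let ?T = "\<lambda>n f. kernel_int cell (slab n) fkernel f"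
  have Fs: "square_integrable freq_measure F" "square_integrable freq_measure G"
    using assms by (auto simp: l2_transform_def)
  have cg: "square_integrable cell (\<lambda>p. c * g p)" by (rule square_integrable_scale(1)[OF g(1)])
  have Tc: "?T n (\<lambda>p. c * g p) \<xi> = c * ?T n g \<xi>" for n \<xi>
    unfolding kernel_int_def by (subst integral_mult_right_zero[symmetric]) (simp add: mult_ac)
  have le: "l2norm freq_measure (\<lambda>\<xi>. ?T n (\<lambda>p. f p - c * g p) \<xi> - (F \<xi> - c * G \<xi>))
      \<le> l2norm freq_measure (\<lambda>\<xi>. ?T n f \<xi> - F \<xi>) + cmod c * l2norm freq_measure (\<lambda>\<xi>. ?T n g \<xi> - G \<xi>)" for n
  proof -
    have sf: "square_integrable freq_measure (\<lambda>\<xi>. ?T n f \<xi> - F \<xi>)" "square_integrable freq_measure (\<lambda>\<xi>. ?T n g \<xi> - G \<xi>)"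
      by (intro square_integrable_diff(1) trunc_square_integrable f g Fs)+
    have "l2norm freq_measure (\<lambda>\<xi>. ?T n (\<lambda>p. f p - c * g p) \<xi> - (F \<xi> - c * G \<xi>))
        = l2norm freq_measure (\<lambda>\<xi>. (?T n f \<xi> - F \<xi>) - c * (?T n g \<xi> - G \<xi>))"
      unfolding l2norm_def
      by (rule arg_cong[where f=sqrt], rule Bochner_Integration.integral_cong)
         (auto simp: ft.kernel_int_diff[OF f(1) cg] Tc algebra_simps)
    also have "\<dots> \<le> l2norm freq_measure (\<lambda>\<xi>. ?T n f \<xi> - F \<xi>) + l2norm freq_measure (\<lambda>\<xi>. c * (?T n g \<xi> - G \<xi>))"
      by (intro square_integrable_diff(2) sf square_integrable_scale)
    also have "\<dots> \<le> l2norm freq_measure (\<lambda>\<xi>. ?T n f \<xi> - F \<xi>) + cmod c * l2norm freq_measure (\<lambda>\<xi>. ?T n g \<xi> - G \<xi>)"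
      by (intro add_left_mono square_integrable_scale sf)
    finally show ?thesis .
  qed
  have "(\<lambda>n. l2norm freq_measure (\<lambda>\<xi>. ?T n f \<xi> - F \<xi>) + cmod c * l2norm freq_measure (\<lambda>\<xi>. ?T n g \<xi> - G \<xi>)) \<longlonglongrightarrow> 0 + cmod c * 0"
    using assms by (intro tendsto_intros) (auto simp: l2_transform_def)
  hence l: "(\<lambda>n. l2norm freq_measure (\<lambda>\<xi>. ?T n f \<xi> - F \<xi>) + cmod c * l2norm freq_measure (\<lambda>\<xi>. ?T n g \<xi> - G \<xi>)) \<longlonglongrightarrow> 0" by simp
  show ?thesis unfolding l2_transform_def
  proof
    show "square_integrable freq_measure (\<lambda>\<xi>. F \<xi> - c * G \<xi>)"
      by (intro square_integrable_diff(1) square_integrable_scale(1) Fs)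
    show "(\<lambda>n. l2norm freq_measure (\<lambda>\<xi>. ?T n (\<lambda>p. f p - c * g p) \<xi> - (F \<xi> - c * G \<xi>))) \<longlonglongrightarrow> 0"
      by (rule tendsto_sandwich[OF _ _ tendsto_const l]) (auto intro!: always_eventually le)
  qed
qed

lemma fourier_scale_diff:
  assumes f: "square_integrable cell f" and g: "square_integrable cell g"
  shows "AE \<xi> in freq_measure. fourier (\<lambda>p. f p - c * g p) \<xi> = fourier f \<xi> - c * fourier g \<xi>"
  by (intro fourier_eqI l2_transform_scale_diff f g l2_transform_fourier square_integrable_diff(1) square_integrable_scale(1))

lemma fourier_diff:
  assumes f: "square_integrable cell f" and g: "square_integrable cell g"
  shows "AE \<xi> in freq_measure. fourier (\<lambda>p. f p - g p) \<xi> = fourier f \<xi> - fourier g \<xi>"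
  using fourier_scale_diff[OF f g, of 1] by simp

lemma l2norm_fourier_diff:
  assumes f: "square_integrable cell f" and g: "square_integrable cell g"
  shows "l2norm freq_measure (\<lambda>\<xi>. fourier f \<xi> - fourier g \<xi>) = l2norm cell (\<lambda>p. f p - g p)"
proof -
  have d: "square_integrable cell (\<lambda>p. f p - g p)" by (rule square_integrable_diff(1)[OF f g])
  have "l2norm freq_measure (\<lambda>\<xi>. fourier f \<xi> - fourier g \<xi>) = l2norm freq_measure (fourier (\<lambda>p. f p - g p))"
    by (rule l2norm_cong_AE)
       (use fourier_diff[OF f g] fourier_square_integrable[OF f] fourier_square_integrable[OF g] fourier_square_integrable[OF d]
        in \<open>auto simp: square_integrable_def\<close>)
  thus ?thesis using l2norm_fourier[OF d] by simp
qed

lemma fourier_inject: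
  assumes f: "square_integrable cell f" and g: "square_integrable cell g"
    and e: "AE \<xi> in freq_measure. fourier f \<xi> = fourier g \<xi>"
  shows "AE p in cell. f p = g p"
proof -
  have "l2norm freq_measure (\<lambda>\<xi>. fourier f \<xi> - fourier g \<xi>) = l2norm freq_measure (\<lambda>\<xi>. 0)"
    by (rule l2norm_cong_AE)
       (use e fourier_square_integrable[OF f] fourier_square_integrable[OF g] in \<open>auto simp: square_integrable_def\<close>)
  hence "l2norm cell (\<lambda>p. f p - g p) = 0" by (simp add: l2norm_fourier_diff[OF f g])
  from l2norm_eq_0D[OF square_integrable_diff(1)[OF f g] this] show ?thesis by simp
qed

lemma fourier_cong_AE:
  assumes f: "square_integrable cell f" and g: "square_integrable cell g" and e: "AE p in cell. f p = g p"
  shows "AE \<xi> in freq_measure. fourier f \<xi> = fourier g \<xi>"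
proof -
  have "l2norm cell (\<lambda>p. f p - g p) = l2norm cell (\<lambda>p. 0)"
    by (rule l2norm_cong_AE) (use f g e in \<open>auto simp: square_integrable_def\<close>)
  hence "l2norm freq_measure (\<lambda>\<xi>. fourier f \<xi> - fourier g \<xi>) = 0" by (simp add: l2norm_fourier_diff[OF f g])
  from l2norm_eq_0D[OF square_integrable_diff(1)[OF fourier_square_integrable[OF f] fourier_square_integrable[OF g]] this]
  show ?thesis by simp
qed

text \<open>Surjectivity of the transform provides a function whose transform is the symbol times
  \<open>fourier f\<close>, so the choice in \<open>multiplier\<close> has a witness.\<close>

lemma multiplier_correct:
  assumes "square_integrable freq_measure (\<lambda>\<xi>. m \<xi> * fourier f \<xi>)"
  shows "square_integrable cell (multiplier m f)"
    and "AE \<xi> in freq_measure. fourier (multiplier m f) \<xi> = m \<xi> * fourier f \<xi>"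
proof -
  obtain g where g: "square_integrable cell g"
      "l2_transform cell freq_measure fkernel slab g (\<lambda>\<xi>. m \<xi> * fourier f \<xi>)"
    using ft.transform_surj[OF ft_contractive ft_isometric_inverse assms] .
  hence "square_integrable cell g \<and> (AE \<xi> in freq_measure. fourier g \<xi> = m \<xi> * fourier f \<xi>)"
    using fourier_eqI by blast
  hence "square_integrable cell (multiplier m f) \<and> (AE \<xi> in freq_measure. fourier (multiplier m f) \<xi> = m \<xi> * fourier f \<xi>)"
    unfolding multiplier_def
    by (rule someI[of "\<lambda>g. square_integrable cell g \<and> (AE \<xi> in freq_measure. fourier g \<xi> = m \<xi> * fourier f \<xi>)"])
  thus "square_integrable cell (multiplier m f)"
    "AE \<xi> in freq_measure. fourier (multiplier m f) \<xi> = m \<xi> * fourier f \<xi>" by auto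
qed

lemma multiplier_bounded:
  assumes f: "square_integrable cell f" and m: "m \<in> borel_measurable freq_measure"
    and C: "\<And>\<xi>. cmod (m \<xi>) \<le> C"
  shows "square_integrable cell (multiplier m f)"
    and "AE \<xi> in freq_measure. fourier (multiplier m f) \<xi> = m \<xi> * fourier f \<xi>"
    and "l2norm cell (multiplier m f) \<le> C * l2norm cell f"
proof -
  have C0: "0 \<le> C" using C[of undefined] norm_ge_zero order_trans by blast
  note F = fourier_square_integrable[OF f]
  note M = square_integrable_mult_bounded[OF F m C0 AE_I2[OF C]]
  show s: "square_integrable cell (multiplier m f)" by (rule multiplier_correct(1)[OF M(1)])
  show ae: "AE \<xi> in freq_measure. fourier (multiplier m f) \<xi> = m \<xi> * fourier f \<xi>"
    by (rule multiplier_correct(2)[OF M(1)])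
  have "l2norm cell (multiplier m f) = l2norm freq_measure (\<lambda>\<xi>. m \<xi> * fourier f \<xi>)"
    unfolding l2norm_fourier[OF s, symmetric]
    by (rule l2norm_cong_AE)
       (use ae M(1) fourier_square_integrable[OF s] in \<open>auto simp: square_integrable_def\<close>)
  thus "l2norm cell (multiplier m f) \<le> C * l2norm cell f" using M(2) l2norm_fourier[OF f] by simp
qed

text \<open>The truncated integral is the Fourier transform of the truncated function, so Plancherel
  converts the error into one in physical space.\<close>

lemma trunc_fourier_diff:
  assumes h: "square_integrable cell h" and f: "square_integrable cell f"
  shows "l2norm freq_measure (\<lambda>\<xi>. kernel_int cell (slab n) fkernel h \<xi> - fourier f \<xi>)
    \<le> l2norm cell (\<lambda>p. indicator (slab n) p * h p - f p)"
proof -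
  let ?h = "\<lambda>p. indicator (slab n) p * h p" and ?T = "kernel_int cell (slab n) fkernel h"
  have hs: "square_integrable cell ?h" by (intro square_integrable_indicator h ft.A_sets)
  have T: "l2_transform cell freq_measure fkernel slab ?h ?T"
    unfolding l2_transform_def
  proof
    show "square_integrable freq_measure ?T" by (rule trunc_square_integrable[OF h])
    have "kernel_int cell (slab m) fkernel ?h = ?T" if "m \<ge> n" for m
      using that by (simp add: ft.kernel_int_indicator min_absorb2)
    hence "l2norm freq_measure (\<lambda>\<xi>. kernel_int cell (slab m) fkernel ?h \<xi> - ?T \<xi>) = 0" if "m \<ge> n" for m
      using that by simp
    thus "(\<lambda>m. l2norm freq_measure (\<lambda>\<xi>. kernel_int cell (slab m) fkernel ?h \<xi> - ?T \<xi>)) \<longlonglongrightarrow> 0"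
      by (intro tendsto_eventually eventually_sequentiallyI)
  qed
  have "l2norm freq_measure (\<lambda>\<xi>. ?T \<xi> - fourier f \<xi>) = l2norm freq_measure (\<lambda>\<xi>. fourier ?h \<xi> - fourier f \<xi>)"
  proof (rule l2norm_cong_AE)
    show "AE \<xi> in freq_measure. ?T \<xi> - fourier f \<xi> = fourier ?h \<xi> - fourier f \<xi>"
      using fourier_eqI[OF hs T] by eventually_elim simp
  qed (use trunc_square_integrable[OF h, of n] fourier_square_integrable[OF f] fourier_square_integrable[OF hs]
        in \<open>auto simp: square_integrable_def\<close>)
  thus ?thesis by (simp add: l2norm_fourier_diff[OF hs f])
qed

section \<open>The moving frame and the mean in the first variable\<close>

text \<open>The half-open form lets the interval be cut and reassembled without overlaps.\<close>

lemma nn_integral_unit_interval: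
  assumes [measurable]: "g \<in> borel_measurable borel"
  shows "(\<integral>\<^sup>+x. g x \<partial>unit_interval) = (\<integral>\<^sup>+x. g x * indicator {0..<1} x \<partial>lborel)"
proof -
  have "(\<integral>\<^sup>+x. g x \<partial>unit_interval) = (\<integral>\<^sup>+x. g x * indicator {0..1} x \<partial>lborel)"
    unfolding unit_interval_def by (rule nn_integral_restrict_space) simp
  also have "\<dots> = (\<integral>\<^sup>+x. g x * indicator {0..<1} x \<partial>lborel)"
    by (rule nn_integral_cong_AE, use AE_lborel_singleton[of 1] in eventually_elim) (auto simp: indicator_def)
  finally show ?thesis .
qed

lemma periodic_add_int:
  assumes "\<And>x. g (x + 1) = g (x::real)"
  shows "g (x + of_int n) = g x"
proof -
  have nat: "g (x + real m) = g x" for x m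
  proof (induction m)
    case (Suc m) thus ?case using assms[of "x + real m"] by (simp add: add_ac)
  qed simp
  show ?thesis
  proof (cases "n \<ge> 0")
    case True thus ?thesis using nat[of x "nat n"] by simp
  next
    case False thus ?thesis using nat[of "x + of_int n" "nat (- n)"] by simp
  qed
qed

text \<open>Only the fractional part \<open>b\<close> of the shift matters. The interval from
  \<open>b\<close> to \<open>b + 1\<close> is cut at 1 and its upper piece is moved back by one
  period.\<close>

lemma nn_integral_periodic_shift:
  fixes g :: "real \<Rightarrow> ennreal"
  assumes [measurable]: "g \<in> borel_measurable borel" and per: "\<And>x. g (x + 1) = g x"
  shows "(\<integral>\<^sup>+x. g (x + a) \<partial>unit_interval) = (\<integral>\<^sup>+x. g x \<partial>unit_interval)"
proof -
  define b where "b = frac a"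
  have b: "0 \<le> b" "b < 1" by (simp_all add: b_def frac_lt_1)
  have ga: "g (x + a) = g (x + b)" for x
    using periodic_add_int[of g "x + b" "\<lfloor>a\<rfloor>"] per by (simp add: b_def frac_def)
  have tr: "(\<integral>\<^sup>+x. h (x + c) \<partial>lborel) = (\<integral>\<^sup>+x. h x \<partial>lborel)" if "h \<in> borel_measurable borel"
    for h :: "real \<Rightarrow> ennreal" and c
    using nn_integral_real_affine[OF that, of 1 c] by (simp add: add.commute)
  have "(\<integral>\<^sup>+x. g (x + a) \<partial>unit_interval) = (\<integral>\<^sup>+x. g (x + b) * indicator {b..<b+1} (x + b) \<partial>lborel)"
    unfolding ga by (subst nn_integral_unit_interval) (auto intro!: nn_integral_cong simp: indicator_def)
  also have "\<dots> = (\<integral>\<^sup>+x. g x * indicator {b..<b+1} x \<partial>lborel)"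
    by (rule tr) measurable
  also have "\<dots> = (\<integral>\<^sup>+x. g x * indicator {b..<1} x + g x * indicator {1..<b+1} x \<partial>lborel)"
    using b by (intro nn_integral_cong) (auto simp: indicator_def)
  also have "\<dots> = (\<integral>\<^sup>+x. g x * indicator {b..<1} x \<partial>lborel) + (\<integral>\<^sup>+x. g x * indicator {1..<b+1} x \<partial>lborel)"
    by (rule nn_integral_add) measurable
  also have "(\<integral>\<^sup>+x. g x * indicator {1..<b+1} x \<partial>lborel) = (\<integral>\<^sup>+x. g (x + 1) * indicator {1..<b+1} (x + 1) \<partial>lborel)"
    by (rule tr[symmetric]) measurable
  also have "\<dots> = (\<integral>\<^sup>+x. g x * indicator {0..<b} x \<partial>lborel)"
    unfolding per by (intro nn_integral_cong) (auto simp: indicator_def)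
  also have "(\<integral>\<^sup>+x. g x * indicator {b..<1} x \<partial>lborel) + (\<integral>\<^sup>+x. g x * indicator {0..<b} x \<partial>lborel)
      = (\<integral>\<^sup>+x. g x * indicator {b..<1} x + g x * indicator {0..<b} x \<partial>lborel)"
    by (rule nn_integral_add[symmetric]) measurable
  also have "\<dots> = (\<integral>\<^sup>+x. g x * indicator {0..<1} x \<partial>lborel)"
    using b by (intro nn_integral_cong) (auto simp: indicator_def)
  also have "\<dots> = (\<integral>\<^sup>+x. g x \<partial>unit_interval)" by (rule nn_integral_unit_interval[symmetric]) measurable
  finally show ?thesis .
qed

text \<open>Both sides integrate \<open>g\<close> against the image of \<open>unit_interval\<close>
  under \<open>frac\<close>, with and without the shift; these image measures agree by the
  nonnegative case. Arguing with measures also covers functions that fail to be integrable, where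
  both integrals take the default value 0.\<close>

lemma integral_periodic_shift:
  fixes g :: "real \<Rightarrow> complex"
  assumes [measurable]: "g \<in> borel_measurable borel" and per: "\<And>x. g (x + 1) = g x"
  shows "(LINT x|unit_interval. g (x + a)) = (LINT x|unit_interval. g x)"
proof -
  have frac_per: "frac (x + 1) = frac x" for x :: real by (simp add: frac_def)
  have gf: "g (frac x) = g x" for x
    using periodic_add_int[of g x "- \<lfloor>x\<rfloor>"] per by (simp add: frac_def)
  have [measurable]: "(frac :: real \<Rightarrow> real) \<in> borel_measurable borel" unfolding frac_def by measurable
  have D: "distr unit_interval borel (\<lambda>x. frac (x + a)) = distr unit_interval borel (\<lambda>x. frac x)"
  proof (rule measure_eqI)
    fix A :: "real set" assume "A \<in> sets (distr unit_interval borel (\<lambda>x. frac (x + a)))"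
    hence [measurable]: "A \<in> sets borel" by simp
    have e: "emeasure (distr unit_interval borel f) A = (\<integral>\<^sup>+x. indicator A (f x) \<partial>unit_interval)"
      if [measurable]: "f \<in> borel_measurable borel" for f :: "real \<Rightarrow> real"
      by (subst nn_integral_indicator[symmetric], simp, subst nn_integral_distr) auto
    show "emeasure (distr unit_interval borel (\<lambda>x. frac (x + a))) A = emeasure (distr unit_interval borel (\<lambda>x. frac x)) A"
      using nn_integral_periodic_shift[of "\<lambda>x. indicator A (frac x)" a] by (simp add: e frac_per)
  qed simp
  have "(LINT x|unit_interval. g (x + a)) = (LINT x|unit_interval. g (frac (x + a)))" by (simp add: gf)
  also have "\<dots> = (LINT x|distr unit_interval borel (\<lambda>x. frac (x + a)). g x)"
    by (rule integral_distr[symmetric]) measurable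
  also have "\<dots> = (LINT x|unit_interval. g (frac x))"
    unfolding D by (rule integral_distr) measurable
  finally show ?thesis by (simp add: gf)
qed

text \<open>Action of the moving frame on frequencies: the coefficient of the moved function at (k,
  \<eta>, l) is the original one at (k, \<eta> - k t, l).\<close>

definition shear :: "real \<Rightarrow> freq \<Rightarrow> freq" where
  "shear t = (\<lambda>(k, \<eta>, l). (k, \<eta> - of_int k * t, l))"

lemma shear_measurable [measurable]: "shear t \<in> measurable freq_measure freq_measure"
  unfolding shear_def freq_measure_def split_beta by measurable

lemma sigma_finite_count_int: "sigma_finite_measure (count_space (UNIV :: int set))"
  by (rule sigma_finite_measure_count_space)

text \<open>For fixed \<open>k\<close> and \<open>l\<close> the map is a translation in \<eta>,
  which preserves Lebesgue measure.\<close>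

lemma nn_integral_shear:
  assumes [measurable]: "H \<in> borel_measurable freq_measure"
  shows "(\<integral>\<^sup>+\<xi>. H (shear t \<xi>) \<partial>freq_measure) = (\<integral>\<^sup>+\<xi>. H \<xi> \<partial>freq_measure)"
proof -
  interpret C: sigma_finite_measure "count_space (UNIV :: int set)" by (rule sigma_finite_count_int)
  interpret LC: pair_sigma_finite "lborel :: real measure" "count_space (UNIV :: int set)"
    by (intro pair_sigma_finite.intro sigma_finite_lborel sigma_finite_count_int)
  have sf: "sigma_finite_measure (lborel \<Otimes>\<^sub>M count_space (UNIV :: int set) :: (real \<times> int) measure)"
    by (rule sigma_finite_pair_measure[OF sigma_finite_lborel sigma_finite_count_int])
  note fst = sigma_finite_measure.nn_integral_fst[OF sf]
  have Hm[measurable]: "H \<in> borel_measurable (count_space UNIV \<Otimes>\<^sub>M (lborel \<Otimes>\<^sub>M count_space UNIV))"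
    using assms by (simp add: freq_measure_def)
  have Sm: "(\<lambda>\<xi>. H (shear t \<xi>)) \<in> borel_measurable (count_space UNIV \<Otimes>\<^sub>M (lborel \<Otimes>\<^sub>M count_space UNIV))"
    using measurable_compose[OF shear_measurable assms] by (simp add: freq_measure_def)
  have inner: "(\<integral>\<^sup>+q. H (shear t (k, q)) \<partial>(lborel \<Otimes>\<^sub>M count_space UNIV)) = (\<integral>\<^sup>+q. H (k, q) \<partial>(lborel \<Otimes>\<^sub>M count_space UNIV))" for k
  proof -
    have "(\<integral>\<^sup>+q. H (shear t (k, q)) \<partial>(lborel \<Otimes>\<^sub>M count_space UNIV))
        = (\<integral>\<^sup>+l. \<integral>\<^sup>+\<eta>. H (shear t (k, (\<eta>, l))) \<partial>lborel \<partial>count_space UNIV)"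
      by (rule LC.nn_integral_snd[symmetric]) (use Sm in measurable)
    also have "\<dots> = (\<integral>\<^sup>+l. \<integral>\<^sup>+\<eta>. H (k, (\<eta>, l)) \<partial>lborel \<partial>count_space UNIV)"
    proof (rule nn_integral_cong)
      fix l :: int
      show "(\<integral>\<^sup>+\<eta>. H (shear t (k, (\<eta>, l))) \<partial>lborel) = (\<integral>\<^sup>+\<eta>. H (k, (\<eta>, l)) \<partial>lborel)"
        using nn_integral_real_affine[of "\<lambda>\<eta>. H (k, (\<eta>, l))" 1 "- (of_int k * t)"] by (simp add: shear_def)
    qed
    also have "\<dots> = (\<integral>\<^sup>+q. H (k, q) \<partial>(lborel \<Otimes>\<^sub>M count_space UNIV))"
      by (rule LC.nn_integral_snd) measurable
    finally show ?thesis .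
  qed
  show ?thesis unfolding freq_measure_def
    by (simp add: fst[symmetric, OF Sm] fst[symmetric, OF Hm] inner)
qed

lemma square_integrable_shear:
  assumes g: "square_integrable freq_measure g"
  shows "square_integrable freq_measure (\<lambda>\<xi>. g (shear t \<xi>))"
    and "l2norm freq_measure (\<lambda>\<xi>. g (shear t \<xi>)) = l2norm freq_measure g"
proof -
  have [measurable]: "g \<in> borel_measurable freq_measure" using g by (simp add: square_integrable_def)
  have "(\<integral>\<^sup>+\<xi>. ennreal ((cmod (g (shear t \<xi>)))\<^sup>2) \<partial>freq_measure) = ennreal ((l2norm freq_measure g)\<^sup>2)"
    unfolding nn_integral_eq_l2norm[OF g, symmetric]
    by (rule nn_integral_shear[of "\<lambda>\<xi>. ennreal ((cmod (g \<xi>))\<^sup>2)" t]) measurable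
  moreover have "(\<lambda>\<xi>. g (shear t \<xi>)) \<in> borel_measurable freq_measure" by measurable
  note * = this calculation
  show "square_integrable freq_measure (\<lambda>\<xi>. g (shear t \<xi>))"
    "l2norm freq_measure (\<lambda>\<xi>. g (shear t \<xi>)) = l2norm freq_measure g"
    by (rule l2norm_eq_of_nn_integral[OF *(1,2) l2norm_nonneg])+
qed

definition x_periodic :: "(point \<Rightarrow> complex) \<Rightarrow> bool" where
  "x_periodic f \<longleftrightarrow> (\<forall>x y z. f (x + 1, y, z) = f (x, y, z))"

definition moved :: "real \<Rightarrow> (point \<Rightarrow> complex) \<Rightarrow> point \<Rightarrow> complex" where
  "moved t f = (\<lambda>(x, y, z). f (x + t * y, y, z))"

lemma moved_measurable [measurable]:
  assumes [measurable]: "f \<in> borel_measurable borel"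
  shows "moved t f \<in> borel_measurable borel"
proof -
  have "(\<lambda>(x, y, z). (x + t * y, y, z)) \<in> measurable borel (borel :: point measure)"
    unfolding split_beta by (intro borel_measurable_continuous_onI continuous_intros)
  from measurable_compose[OF this assms] show ?thesis by (simp add: moved_def case_prod_unfold)
qed

lemma sigma_finite_lborel_unit: "sigma_finite_measure (lborel \<Otimes>\<^sub>M unit_interval :: (real \<times> real) measure)"
  using yz.sf by simp

lemma pair_sigma_finite_cell: "pair_sigma_finite unit_interval (lborel \<Otimes>\<^sub>M unit_interval :: (real \<times> real) measure)"
  by (intro pair_sigma_finite.intro sigma_finite_lborel_unit unit_interval.sigma_finite_measure_axioms)

lemma measurable_unit_pair [measurable (raw)]:
  fixes f :: "point \<Rightarrow> 'b::topological_space"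
  shows "f \<in> borel_measurable borel \<Longrightarrow> f \<in> borel_measurable (unit_interval \<Otimes>\<^sub>M (lborel \<Otimes>\<^sub>M unit_interval))"
  by (rule measurable_cell[unfolded cell_eq])

text \<open>With \<open>x\<close> as the inner variable, the change of frame is for fixed
  \<open>y\<close> a shift of a periodic function.\<close>

lemma nn_integral_moved:
  assumes [measurable]: "f \<in> borel_measurable borel" and per: "x_periodic f"
  shows "(\<integral>\<^sup>+p. ennreal ((cmod (moved t f p))\<^sup>2) \<partial>cell) = (\<integral>\<^sup>+p. ennreal ((cmod (f p))\<^sup>2) \<partial>cell)"
proof -
  interpret P: pair_sigma_finite unit_interval "lborel \<Otimes>\<^sub>M unit_interval :: (real \<times> real) measure"
    by (rule pair_sigma_finite_cell)
  have "(\<integral>\<^sup>+p. ennreal ((cmod (moved t f p))\<^sup>2) \<partial>cell)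
      = (\<integral>\<^sup>+q. \<integral>\<^sup>+x. ennreal ((cmod (moved t f (x, q)))\<^sup>2) \<partial>unit_interval \<partial>(lborel \<Otimes>\<^sub>M unit_interval))"
    unfolding cell_eq by (rule P.nn_integral_snd[symmetric]) measurable
  also have "\<dots> = (\<integral>\<^sup>+q. \<integral>\<^sup>+x. ennreal ((cmod (f (x, q)))\<^sup>2) \<partial>unit_interval \<partial>(lborel \<Otimes>\<^sub>M unit_interval))"
  proof (rule nn_integral_cong)
    fix q :: "real \<times> real"
    obtain y z where q: "q = (y, z)" by (cases q)
    show "(\<integral>\<^sup>+x. ennreal ((cmod (moved t f (x, q)))\<^sup>2) \<partial>unit_interval) = (\<integral>\<^sup>+x. ennreal ((cmod (f (x, q)))\<^sup>2) \<partial>unit_interval)"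
      unfolding q moved_def prod.case
      by (rule nn_integral_periodic_shift[of "\<lambda>x. ennreal ((cmod (f (x, y, z)))\<^sup>2)" "t * y"])
         (use per in \<open>auto simp: x_periodic_def\<close>)
  qed
  also have "\<dots> = (\<integral>\<^sup>+p. ennreal ((cmod (f p))\<^sup>2) \<partial>cell)"
    unfolding cell_eq by (rule P.nn_integral_snd) measurable
  finally show ?thesis .
qed

lemma moved_square_integrable:
  assumes f: "f \<in> borel_measurable borel" "x_periodic f" "square_integrable cell f"
  shows "square_integrable cell (moved t f)"
  using l2norm_eq_of_nn_integral(1)[of "moved t f" cell "l2norm cell f"] nn_integral_moved[OF f(1,2), of t]
    nn_integral_eq_l2norm[OF f(3)] f(1) by simp

lemma trunc_as_iterated:
  assumes f: "square_integrable cell f"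
  shows "kernel_int cell (slab n) fkernel f \<xi>
    = (LINT q|(lborel \<Otimes>\<^sub>M unit_interval). LINT x|unit_interval. indicator (slab n) (x, q) * f (x, q) * fkernel (x, q) \<xi>)"
proof -
  interpret P: pair_sigma_finite unit_interval "lborel \<Otimes>\<^sub>M unit_interval :: (real \<times> real) measure"
    by (rule pair_sigma_finite_cell)
  have "space freq_measure = UNIV" by (simp add: freq_measure_def space_pair_measure)
  hence "integrable cell (\<lambda>p. indicator (slab n) p * f p * fkernel p \<xi>)"
    using ft.integrable_kernel[OF f, of \<xi> n] by simp
  hence i: "integrable (unit_interval \<Otimes>\<^sub>M (lborel \<Otimes>\<^sub>M unit_interval)) (case_prod (\<lambda>x q. indicator (slab n) (x, q) * f (x, q) * fkernel (x, q) \<xi>))"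
    by (simp add: cell_eq case_prod_unfold)
  show ?thesis unfolding kernel_int_def cell_eq using P.integral_snd[OF i] by (simp add: case_prod_unfold)
qed

text \<open>Shifting \<open>x\<close> by \<open>t * y\<close> multiplies the k-th coefficient by a
  phase linear in \<open>y\<close>, which is absorbed into the y-frequency. The truncation involves
  only \<open>y\<close>, so the identity is exact before any limit is taken.\<close>

lemma trunc_moved:
  assumes f: "f \<in> borel_measurable borel" "x_periodic f" "square_integrable cell f"
  shows "kernel_int cell (slab n) fkernel (moved t f) \<xi> = kernel_int cell (slab n) fkernel f (shear t \<xi>)"
  unfolding trunc_as_iterated[OF f(3)] trunc_as_iterated[OF moved_square_integrable[OF f]]
proof (rule Bochner_Integration.integral_cong)
  note [measurable] = f(1)
  fix q assume "q \<in> space (lborel \<Otimes>\<^sub>M unit_interval :: (real \<times> real) measure)"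
  obtain y z where q: "q = (y, z)" by (cases q)
  obtain k \<eta> l where \<xi>: "\<xi> = (k, \<eta>, l)" by (cases \<xi>)
  define h where "h x = f (x, y, z) * wave (- k) x" for x
  define c where "c = indicator (real_box n) y * indicator {0..1} z * phase (- ((\<eta> - of_int k * t) * y + of_int l * z))"
  have hp: "h (x + 1) = h x" for x using f(2) by (simp add: h_def wave_periodic x_periodic_def)
  have hm: "h \<in> borel_measurable borel" unfolding h_def by measurable
  have "(LINT x|unit_interval. indicator (slab n) (x, q) * moved t f (x, q) * fkernel (x, q) \<xi>)
      = (LINT x|unit_interval. c * h (x + t * y))"
  proof (rule Bochner_Integration.integral_cong)
    fix x assume "x \<in> space unit_interval"
    moreover have "phase (- (of_int k * x + \<eta> * y + of_int l * z))
        = phase (- ((\<eta> - of_int k * t) * y + of_int l * z)) * wave (- k) (x + t * y)"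
      unfolding wave_eq_phase phase_add[symmetric] by (rule arg_cong[where f=phase]) (simp add: algebra_simps)
    ultimately show "indicator (slab n) (x, q) * moved t f (x, q) * fkernel (x, q) \<xi> = c * h (x + t * y)"
      by (simp add: q \<xi> fkernel_eq moved_def h_def c_def slab_def indicator_def)
  qed simp
  also have "\<dots> = c * (LINT x|unit_interval. h (x + t * y))" by simp
  also have "(LINT x|unit_interval. h (x + t * y)) = (LINT x|unit_interval. h x)"
    by (rule integral_periodic_shift[OF hm hp])
  also have "c * (LINT x|unit_interval. h x) = (LINT x|unit_interval. c * h x)" by simp
  also have "\<dots> = (LINT x|unit_interval. indicator (slab n) (x, q) * f (x, q) * fkernel (x, q) (shear t \<xi>))"
  proof (rule Bochner_Integration.integral_cong)
    fix x assume "x \<in> space unit_interval"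
    moreover have "phase (- (of_int k * x + (\<eta> - of_int k * t) * y + of_int l * z))
        = phase (- ((\<eta> - of_int k * t) * y + of_int l * z)) * wave (- k) x"
      unfolding wave_eq_phase phase_add[symmetric] by (rule arg_cong[where f=phase]) (simp add: algebra_simps)
    ultimately show "c * h x = indicator (slab n) (x, q) * f (x, q) * fkernel (x, q) (shear t \<xi>)"
      by (simp add: q \<xi> fkernel_eq h_def c_def slab_def indicator_def shear_def)
  qed simp
  finally show "(LINT x|unit_interval. indicator (slab n) (x, q) * moved t f (x, q) * fkernel (x, q) \<xi>)
      = (LINT x|unit_interval. indicator (slab n) (x, q) * f (x, q) * fkernel (x, q) (shear t \<xi>))" .
qed simp

lemma fourier_moved:
  assumes f: "f \<in> borel_measurable borel" "x_periodic f" "square_integrable cell f"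
  shows "AE \<xi> in freq_measure. fourier (moved t f) \<xi> = fourier f (shear t \<xi>)"
proof (rule fourier_eqI[OF moved_square_integrable[OF f]], unfold l2_transform_def, intro conjI)
  show "square_integrable freq_measure (\<lambda>\<xi>. fourier f (shear t \<xi>))"
    by (intro square_integrable_shear fourier_square_integrable f)
  have "l2norm freq_measure (\<lambda>\<xi>. kernel_int cell (slab n) fkernel f (shear t \<xi>) - fourier f (shear t \<xi>))
      = l2norm freq_measure (\<lambda>\<xi>. kernel_int cell (slab n) fkernel f \<xi> - fourier f \<xi>)" for n
    by (rule square_integrable_shear(2)) (intro square_integrable_diff(1) trunc_square_integrable fourier_square_integrable f)
  thus "(\<lambda>n. l2norm freq_measure (\<lambda>\<xi>. kernel_int cell (slab n) fkernel (moved t f) \<xi> - fourier f (shear t \<xi>))) \<longlonglongrightarrow> 0"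
    using l2_transform_fourier[OF f(3)] by (simp add: trunc_moved[OF f] l2_transform_def)
qed

section \<open>The mean in x as the projection to frequency zero\<close>

definition x_mean :: "(point \<Rightarrow> complex) \<Rightarrow> point \<Rightarrow> complex" where
  "x_mean f = (\<lambda>(x, y, z). LINT x'|unit_interval. f (x', y, z))"

lemma x_mean_measurable [measurable]:
  assumes [measurable]: "f \<in> borel_measurable borel"
  shows "x_mean f \<in> borel_measurable borel"
proof -
  have m: "(\<lambda>(q, x). f (x, q)) \<in> borel_measurable ((borel :: (real \<times> real) measure) \<Otimes>\<^sub>M unit_interval)"
  proof -
    have "(\<lambda>(q, x). f (x, q)) \<in> borel_measurable ((borel :: (real \<times> real) measure) \<Otimes>\<^sub>M (borel :: real measure))"
      unfolding split_beta borel_prod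
      by (rule measurable_compose[OF _ assms]) (intro borel_measurable_continuous_onI continuous_intros)
    moreover have "(\<lambda>z. (fst z, snd z)) \<in> measurable ((borel :: (real \<times> real) measure) \<Otimes>\<^sub>M unit_interval) (borel \<Otimes>\<^sub>M borel)"
      by (intro measurable_Pair measurable_fst measurable_compose[OF measurable_snd] measurable_unit_interval) simp_all
    ultimately show ?thesis using measurable_compose by fastforce
  qed
  have "(\<lambda>q. LINT x|unit_interval. f (x, q)) \<in> borel_measurable borel"
    by (rule unit_interval.borel_measurable_lebesgue_integral[OF m])
  from measurable_compose[OF borel_measurable_continuous_onI[OF continuous_on_snd[OF continuous_on_id]] this]
  show ?thesis by (simp add: x_mean_def case_prod_unfold)
qed

text \<open>Cauchy--Schwarz in \<open>x\<close> on an interval of length 1. Where a slice has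
  infinite integral the pointwise bound is trivial.\<close>

lemma x_mean_square_integrable:
  assumes f: "f \<in> borel_measurable borel" "square_integrable cell f"
  shows "square_integrable cell (x_mean f)"
proof -
  note [measurable] = f(1)
  interpret P: pair_sigma_finite unit_interval "lborel \<Otimes>\<^sub>M unit_interval :: (real \<times> real) measure"
    by (rule pair_sigma_finite_cell)
  have le: "ennreal ((cmod (x_mean f (x, q)))\<^sup>2) \<le> (\<integral>\<^sup>+x'. ennreal ((cmod (f (x', q)))\<^sup>2) \<partial>unit_interval)" for x q
  proof (cases "(\<integral>\<^sup>+x'. ennreal ((cmod (f (x', q)))\<^sup>2) \<partial>unit_interval) < \<infinity>")
    case True
    have s: "square_integrable unit_interval (\<lambda>x'. f (x', q))"
      by (subst square_integrable_iff_nn_integral) (use True in measurable)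
    have one: "square_integrable unit_interval (\<lambda>x. 1::complex)" "l2norm unit_interval (\<lambda>x. 1::complex) = 1"
      using unit_interval.prob_space by (simp_all add: square_integrable_def l2norm_def)
    have "x_mean f (x, q) = (LINT x'|unit_interval. f (x', q) * cnj 1)" by (simp add: x_mean_def split_beta)
    hence "cmod (x_mean f (x, q)) \<le> l2norm unit_interval (\<lambda>x'. f (x', q))"
      using square_integrable_prod(4)[OF s one(1)] one(2) by simp
    hence "(cmod (x_mean f (x, q)))\<^sup>2 \<le> (l2norm unit_interval (\<lambda>x'. f (x', q)))\<^sup>2" by (intro power_mono) auto
    thus ?thesis unfolding nn_integral_eq_l2norm[OF s] by (rule ennreal_leI)
  next
    case False
    hence "(\<integral>\<^sup>+x'. ennreal ((cmod (f (x', q)))\<^sup>2) \<partial>unit_interval) = \<top>" by (simp add: not_less top.extremum_unique)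
    thus ?thesis by simp
  qed
  have "(\<integral>\<^sup>+p. ennreal ((cmod (x_mean f p))\<^sup>2) \<partial>cell)
      = (\<integral>\<^sup>+q. \<integral>\<^sup>+x. ennreal ((cmod (x_mean f (x, q)))\<^sup>2) \<partial>unit_interval \<partial>(lborel \<Otimes>\<^sub>M unit_interval))"
    unfolding cell_eq by (rule P.nn_integral_snd[symmetric]) measurable
  also have "\<dots> \<le> (\<integral>\<^sup>+q. \<integral>\<^sup>+x. (\<integral>\<^sup>+x'. ennreal ((cmod (f (x', q)))\<^sup>2) \<partial>unit_interval) \<partial>unit_interval \<partial>(lborel \<Otimes>\<^sub>M unit_interval))"
    by (intro nn_integral_mono le)
  also have "\<dots> = (\<integral>\<^sup>+q. \<integral>\<^sup>+x'. ennreal ((cmod (f (x', q)))\<^sup>2) \<partial>unit_interval \<partial>(lborel \<Otimes>\<^sub>M unit_interval))"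
    by (simp add: unit_interval.emeasure_space_1[simplified])
  also have "\<dots> = (\<integral>\<^sup>+p. ennreal ((cmod (f p))\<^sup>2) \<partial>cell)"
    unfolding cell_eq by (rule P.nn_integral_snd) measurable
  also have "\<dots> < \<infinity>" using f(2) by (simp add: nn_integral_eq_l2norm)
  finally show ?thesis by (subst square_integrable_iff_nn_integral) measurable
qed

definition zero_ind :: "freq \<Rightarrow> complex" where
  "zero_ind = (\<lambda>(k, \<eta>, l). if k = 0 then 1 else 0)"

lemma mode_ind_measurable [measurable]: "(\<lambda>(k, \<eta>, l). if k = j then 1 else 0 :: complex) \<in> borel_measurable freq_measure"
  unfolding freq_measure_def split_beta by measurable

lemma trunc_x_mean:
  assumes f: "f \<in> borel_measurable borel" "square_integrable cell f"
  shows "kernel_int cell (slab n) fkernel (x_mean f) \<xi> = zero_ind \<xi> * kernel_int cell (slab n) fkernel f \<xi>"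
  unfolding trunc_as_iterated[OF f(2)] trunc_as_iterated[OF x_mean_square_integrable[OF f]]
proof (subst integral_mult_right_zero[symmetric], rule Bochner_Integration.integral_cong)
  note [measurable] = f(1)
  fix q assume "q \<in> space (lborel \<Otimes>\<^sub>M unit_interval :: (real \<times> real) measure)"
  obtain y z where q: "q = (y, z)" by (cases q)
  obtain k \<eta> l where \<xi>: "\<xi> = (k, \<eta>, l)" by (cases \<xi>)
  define c where "c = indicator (real_box n) y * indicator {0..1} z * phase (- (\<eta> * y + of_int l * z))"
  have w: "indicator (slab n) (x, q) * g * fkernel (x, q) \<xi> = c * g * wave (- k) x" if "x \<in> {0..1}" for x g
  proof -
    have "phase (- (of_int k * x + \<eta> * y + of_int l * z)) = phase (- (\<eta> * y + of_int l * z)) * wave (- k) x"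
      unfolding wave_eq_phase phase_add[symmetric] by (rule arg_cong[where f=phase]) (simp add: algebra_simps)
    thus ?thesis using that by (simp add: q \<xi> fkernel_eq c_def slab_def indicator_def)
  qed
  have "(LINT x|unit_interval. indicator (slab n) (x, q) * x_mean f (x, q) * fkernel (x, q) \<xi>)
      = (LINT x|unit_interval. c * x_mean f (0, q) * wave (- k) x)"
    by (rule Bochner_Integration.integral_cong) (auto simp: w, simp add: x_mean_def split_beta)
  also have "\<dots> = c * x_mean f (0, q) * (if k = 0 then 1 else 0)" using wave_orthonormal[of "- k"] by simp
  also have "\<dots> = zero_ind \<xi> * (LINT x|unit_interval. indicator (slab n) (x, q) * f (x, q) * fkernel (x, q) \<xi>)"
  proof (cases "k = 0")
    case True
    have "(LINT x|unit_interval. indicator (slab n) (x, q) * f (x, q) * fkernel (x, q) \<xi>) = (LINT x|unit_interval. c * f (x, q))"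
      by (rule Bochner_Integration.integral_cong) (auto simp: w True)
    thus ?thesis using True by (simp add: zero_ind_def \<xi> x_mean_def split_beta)
  qed (simp add: zero_ind_def \<xi>)
  finally show "(LINT x|unit_interval. indicator (slab n) (x, q) * x_mean f (x, q) * fkernel (x, q) \<xi>)
      = zero_ind \<xi> * (LINT x|unit_interval. indicator (slab n) (x, q) * f (x, q) * fkernel (x, q) \<xi>)" .
qed simp

lemma fourier_x_mean:
  assumes f: "f \<in> borel_measurable borel" "square_integrable cell f"
  shows "AE \<xi> in freq_measure. fourier (x_mean f) \<xi> = zero_ind \<xi> * fourier f \<xi>"
proof (rule fourier_eqI[OF x_mean_square_integrable[OF f]], unfold l2_transform_def, intro conjI)
  have zm: "zero_ind \<in> borel_measurable freq_measure" unfolding zero_ind_def by measurable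
  have z1: "AE \<xi> in freq_measure. cmod (zero_ind \<xi>) \<le> 1" by (intro AE_I2) (simp add: zero_ind_def split_beta)
  show "square_integrable freq_measure (\<lambda>\<xi>. zero_ind \<xi> * fourier f \<xi>)"
    by (rule square_integrable_mult_bounded(1)[OF fourier_square_integrable[OF f(2)] zm _ z1]) simp
  have le: "l2norm freq_measure (\<lambda>\<xi>. kernel_int cell (slab n) fkernel (x_mean f) \<xi> - zero_ind \<xi> * fourier f \<xi>)
      \<le> 1 * l2norm freq_measure (\<lambda>\<xi>. kernel_int cell (slab n) fkernel f \<xi> - fourier f \<xi>)" for n
    unfolding trunc_x_mean[OF f] right_diff_distrib[symmetric]
    by (rule square_integrable_mult_bounded(2)[OF _ zm _ z1])
       (auto intro!: square_integrable_diff(1) trunc_square_integrable fourier_square_integrable f)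
  show "(\<lambda>n. l2norm freq_measure (\<lambda>\<xi>. kernel_int cell (slab n) fkernel (x_mean f) \<xi> - zero_ind \<xi> * fourier f \<xi>)) \<longlonglongrightarrow> 0"
    by (rule tendsto_sandwich[OF _ _ tendsto_const])
       (use le l2_transform_fourier[OF f(2)] in \<open>auto simp: l2_transform_def\<close>)
qed

section \<open>Plane waves carried by the shear\<close>

lemma phase_has_vector_derivative:
  assumes "(g has_real_derivative g') (at t within S)"
  shows "((\<lambda>t. phase (g t)) has_vector_derivative (2 * of_real pi * \<i> * of_real g') * phase (g t)) (at t within S)"
proof -
  have "((\<lambda>t. 2 * of_real pi * \<i> * complex_of_real (g t)) has_vector_derivative (2 * of_real pi * \<i> * of_real g')) (at t within S)"
    using assms by (intro has_vector_derivative_mult_right has_vector_derivative_of_real)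
      (simp add: has_real_derivative_iff_has_vector_derivative)
  from field_vector_diff_chain_within[OF this, of exp "exp (2 * of_real pi * \<i> * complex_of_real (g t))"]
  show ?thesis by (auto simp: phase_def o_def intro: has_field_derivative_at_within DERIV_exp)
qed

lemma continuous_on_phase [continuous_intros]:
  "continuous_on S g \<Longrightarrow> continuous_on S (\<lambda>x. phase (g x))"
  unfolding phase_def by (intro continuous_intros)

section \<open>Integration by parts on a box\<close>

abbreviation box3 :: "real \<Rightarrow> point set" where
  "box3 R \<equiv> cbox (0, - R, 0) (1, R, 1)"

text \<open>One of three forms of the fundamental theorem on the box. In \<open>x\<close> and
  \<open>z\<close> the boundary terms cancel by periodicity; in \<open>y\<close> they have to
  vanish, and the cutoff is built to achieve this.\<close>

lemma integral_x_derivative_zero: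
  fixes G :: "point \<Rightarrow> complex"
  assumes c: "continuous_on (box3 R) Gx"
    and d: "\<And>x y z. (x, y, z) \<in> box3 R \<Longrightarrow> ((\<lambda>s. G (s, y, z)) has_vector_derivative Gx (x, y, z)) (at x)"
    and b: "\<And>y z. G (1, y, z) = G (0, y, z)"
  shows "integral (box3 R) Gx = 0"
proof -
  have "integral (box3 R) Gx = integral (cbox 0 1) (\<lambda>x. integral (cbox (-R, 0) (R, 1)) (\<lambda>q. Gx (x, q)))"
    by (rule integral_prod_continuous[OF c])
  also have "\<dots> = integral (cbox (-R, 0) (R, 1)) (\<lambda>q. integral (cbox 0 1) (\<lambda>x. Gx (x, q)))"
    by (rule integral_swap_continuous) (use c in \<open>simp add: case_prod_unfold\<close>)
  also have "\<dots> = integral (cbox (-R, 0) (R, 1)) (\<lambda>q::real\<times>real. 0)"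
  proof (rule Henstock_Kurzweil_Integration.integral_cong)
    fix q :: "real \<times> real" assume q: "q \<in> cbox (-R, 0) (R, 1)"
    obtain y z where yz: "q = (y, z)" by (cases q)
    have "((\<lambda>x. Gx (x, y, z)) has_integral (G (1, y, z) - G (0, y, z))) {0..1}"
      by (rule fundamental_theorem_of_calculus)
         (use q in \<open>auto simp: yz cbox_Pair_eq intro!: has_vector_derivative_at_within d\<close>)
    thus "integral (cbox 0 1) (\<lambda>x. Gx (x, q)) = 0" by (simp add: b yz integral_unique)
  qed
  finally show ?thesis by simp
qed

lemma integral_y_derivative_zero:
  fixes G :: "point \<Rightarrow> complex"
  assumes R: "R \<ge> 0" and c: "continuous_on (box3 R) Gy"
    and d: "\<And>x y z. (x, y, z) \<in> box3 R \<Longrightarrow> ((\<lambda>s. G (x, s, z)) has_vector_derivative Gy (x, y, z)) (at y)"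
    and b: "\<And>x z. G (x, R, z) = 0" "\<And>x z. G (x, - R, z) = 0"
  shows "integral (box3 R) Gy = 0"
proof -
  have "integral (box3 R) Gy = integral (cbox 0 1) (\<lambda>x. integral (cbox (-R, 0) (R, 1)) (\<lambda>q. Gy (x, q)))"
    by (rule integral_prod_continuous[OF c])
  also have "\<dots> = integral (cbox 0 1) (\<lambda>x::real. 0)"
  proof (rule Henstock_Kurzweil_Integration.integral_cong)
    fix x :: real assume x: "x \<in> cbox 0 1"
    have c': "continuous_on (cbox (-R, 0) (R, 1)) (\<lambda>q. Gy (x, q))"
      by (rule continuous_on_compose2[OF c]) (use x in \<open>auto intro!: continuous_intros simp: cbox_Pair_eq\<close>)
    have "integral (cbox (-R, 0) (R, 1)) (\<lambda>q. Gy (x, q)) = integral (cbox (-R) R) (\<lambda>y. integral (cbox 0 1) (\<lambda>z. Gy (x, y, z)))"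
      by (rule integral_prod_continuous[OF c'])
    also have "\<dots> = integral (cbox 0 1) (\<lambda>z. integral (cbox (-R) R) (\<lambda>y. Gy (x, y, z)))"
      by (rule integral_swap_continuous) (use c' in \<open>simp add: case_prod_unfold\<close>)
    also have "\<dots> = integral (cbox 0 1) (\<lambda>z::real. 0)"
    proof (rule Henstock_Kurzweil_Integration.integral_cong)
      fix z :: real assume z: "z \<in> cbox 0 1"
      have "((\<lambda>y. Gy (x, y, z)) has_integral (G (x, R, z) - G (x, -R, z))) {-R..R}"
        by (rule fundamental_theorem_of_calculus)
           (use x z R in \<open>auto simp: cbox_Pair_eq intro!: has_vector_derivative_at_within d\<close>)
      thus "integral (cbox (-R) R) (\<lambda>y. Gy (x, y, z)) = 0" by (simp add: b integral_unique)
    qed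
    finally show "integral (cbox (-R, 0) (R, 1)) (\<lambda>q. Gy (x, q)) = 0" by simp
  qed
  finally show ?thesis by simp
qed

lemma integral_z_derivative_zero:
  fixes G :: "point \<Rightarrow> complex"
  assumes c: "continuous_on (box3 R) Gz"
    and d: "\<And>x y z. (x, y, z) \<in> box3 R \<Longrightarrow> ((\<lambda>s. G (x, y, s)) has_vector_derivative Gz (x, y, z)) (at z)"
    and b: "\<And>x y. G (x, y, 1) = G (x, y, 0)"
  shows "integral (box3 R) Gz = 0"
proof -
  have "integral (box3 R) Gz = integral (cbox 0 1) (\<lambda>x. integral (cbox (-R, 0) (R, 1)) (\<lambda>q. Gz (x, q)))"
    by (rule integral_prod_continuous[OF c])
  also have "\<dots> = integral (cbox 0 1) (\<lambda>x::real. 0)"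
  proof (rule Henstock_Kurzweil_Integration.integral_cong)
    fix x :: real assume x: "x \<in> cbox 0 1"
    have c': "continuous_on (cbox (-R, 0) (R, 1)) (\<lambda>q. Gz (x, q))"
      by (rule continuous_on_compose2[OF c]) (use x in \<open>auto intro!: continuous_intros simp: cbox_Pair_eq\<close>)
    have "integral (cbox (-R, 0) (R, 1)) (\<lambda>q. Gz (x, q)) = integral (cbox (-R) R) (\<lambda>y. integral (cbox 0 1) (\<lambda>z. Gz (x, y, z)))"
      by (rule integral_prod_continuous[OF c'])
    also have "\<dots> = integral (cbox (-R) R) (\<lambda>y::real. 0)"
    proof (rule Henstock_Kurzweil_Integration.integral_cong)
      fix y :: real assume y: "y \<in> cbox (-R) R"
      have "((\<lambda>z. Gz (x, y, z)) has_integral (G (x, y, 1) - G (x, y, 0))) {0..1}"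
        by (rule fundamental_theorem_of_calculus)
           (use x y in \<open>auto simp: cbox_Pair_eq intro!: has_vector_derivative_at_within d\<close>)
      thus "integral (cbox 0 1) (\<lambda>z. Gz (x, y, z)) = 0" by (simp add: b integral_unique)
    qed
    finally show "integral (cbox (-R, 0) (R, 1)) (\<lambda>q. Gz (x, q)) = 0" by simp
  qed
  finally show ?thesis by simp
qed

text \<open>The weight and its derivative vanish at \<open>y = \<plusminus>R\<close>, so that it cuts off in \<open>y\<close> without boundary terms.\<close>

definition cutoff :: "real \<Rightarrow> real \<Rightarrow> real" where
  "cutoff R y = (1 - (y / R)\<^sup>2)\<^sup>2"

definition cutoff1 :: "real \<Rightarrow> real \<Rightarrow> real" where
  "cutoff1 R y = - (4 * y / R\<^sup>2) * (1 - (y / R)\<^sup>2)"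

definition cutoff2 :: "real \<Rightarrow> real \<Rightarrow> real" where
  "cutoff2 R y = 12 * y\<^sup>2 / R ^ 4 - 4 / R\<^sup>2"

lemma cutoff_deriv:
  assumes "R > 0"
  shows "(cutoff R has_real_derivative cutoff1 R y) (at y)" "(cutoff1 R has_real_derivative cutoff2 R y) (at y)"
proof -
  have "((\<lambda>y. (1 - (y / R)\<^sup>2)\<^sup>2) has_real_derivative 2 * (1 - (y / R)\<^sup>2) * (- (2 * (y / R) * (1 / R)))) (at y)"
    using assms by (auto intro!: derivative_eq_intros)
  thus "(cutoff R has_real_derivative cutoff1 R y) (at y)"
    by (simp add: cutoff_def[abs_def] cutoff1_def power2_eq_square mult_ac)
  have d1: "((\<lambda>y. - (4 * y / R\<^sup>2)) has_real_derivative - (4 / R\<^sup>2)) (at y)"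
    using assms by (auto intro!: derivative_eq_intros simp: field_simps power2_eq_square power4_eq_xxxx)
  have d2: "((\<lambda>y. 1 - (y / R)\<^sup>2) has_real_derivative - (2 * (y / R) * (1 / R))) (at y)"
    using assms by (auto intro!: derivative_eq_intros)
  note DERIV_mult[OF d1 d2]
  moreover have "- (4 / R\<^sup>2) * (1 - (y / R)\<^sup>2) + (- (2 * (y / R) * (1 / R))) * (- (4 * y / R\<^sup>2)) = cutoff2 R y"
  proof -
    define u where "u = y / R"
    have y: "y = u * R" using assms by (simp add: u_def)
    show ?thesis unfolding y using assms by (simp add: cutoff2_def field_simps power2_eq_square power4_eq_xxxx)
  qed
  ultimately show "(cutoff1 R has_real_derivative cutoff2 R y) (at y)" by (simp add: cutoff1_def[abs_def])
qed

lemma cutoff_boundary: "R > 0 \<Longrightarrow> cutoff R R = 0" "R > 0 \<Longrightarrow> cutoff R (- R) = 0"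
    "R > 0 \<Longrightarrow> cutoff1 R R = 0" "R > 0 \<Longrightarrow> cutoff1 R (- R) = 0"
  by (simp_all add: cutoff_def cutoff1_def)

lemma cutoff_continuous [continuous_intros]:
  assumes "continuous_on S g"
  shows "continuous_on S (\<lambda>x. cutoff R (g x))" "continuous_on S (\<lambda>x. cutoff1 R (g x))" "continuous_on S (\<lambda>x. cutoff2 R (g x))"
  using assms unfolding cutoff_def cutoff1_def cutoff2_def divide_inverse by (auto intro!: continuous_intros)

lemma cutoff_bounds:
  assumes "R > 0" "\<bar>y\<bar> \<le> R"
  shows "0 \<le> cutoff R y" "cutoff R y \<le> 1" "\<bar>cutoff1 R y\<bar> \<le> 4 / R" "\<bar>cutoff2 R y\<bar> \<le> 12 / R\<^sup>2"
proof -
  have q: "0 \<le> (y / R)\<^sup>2" "(y / R)\<^sup>2 \<le> 1"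
    using assms by (auto simp: abs_square_le_1 divide_le_eq)
  show "0 \<le> cutoff R y" by (simp add: cutoff_def)
  show "cutoff R y \<le> 1" using q by (simp add: cutoff_def power_le_one)
  have "\<bar>cutoff1 R y\<bar> = (4 / R) * (\<bar>y\<bar> / R * (1 - (y / R)\<^sup>2))"
    using q assms by (simp add: cutoff1_def abs_mult power2_eq_square)
  also have "\<dots> \<le> (4 / R) * 1"
    using q assms by (intro mult_left_mono mult_le_one) auto
  finally show "\<bar>cutoff1 R y\<bar> \<le> 4 / R" by simp
  have "cutoff2 R y = (1 / R\<^sup>2) * (12 * (y / R)\<^sup>2 - 4)"
    using assms by (simp add: cutoff2_def field_simps power2_eq_square power4_eq_xxxx)
  hence "\<bar>cutoff2 R y\<bar> = (1 / R\<^sup>2) * \<bar>12 * (y / R)\<^sup>2 - 4\<bar>" by (simp add: abs_mult)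
  also have "\<dots> \<le> (1 / R\<^sup>2) * 12"
  proof (rule mult_left_mono)
    show "\<bar>12 * (y / R)\<^sup>2 - 4\<bar> \<le> 12" using q by linarith
  qed simp
  finally show "\<bar>cutoff2 R y\<bar> \<le> 12 / R\<^sup>2" by simp
qed

text \<open>The plane wave carried by the flow \<open>(y, 0, 0)\<close>: it solves \<open>\<partial>\<^sub>t E + y \<partial>\<^sub>x E = 0\<close>.\<close>

definition carried :: "int \<Rightarrow> int \<Rightarrow> real \<Rightarrow> real \<Rightarrow> point \<Rightarrow> complex" where
  "carried k l \<eta> t p = phase (- (of_int k * (fst p - t * fst (snd p)) + \<eta> * fst (snd p) + of_int l * snd (snd p)))"

lemma continuous_on_carried [continuous_intros]:
  assumes "continuous_on S g" "continuous_on S h" "continuous_on S q"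
  shows "continuous_on S (\<lambda>x. carried k l (g x) (h x) (q x))"
  unfolding carried_def using assms by (intro continuous_intros)

lemma norm_carried [simp]: "cmod (carried k l \<eta> t p) = 1"
  by (simp add: carried_def)

lemma carried_periodic: "carried k l \<eta> t (x + 1, y, z) = carried k l \<eta> t (x, y, z)"
    "carried k l \<eta> t (x, y, z + 1) = carried k l \<eta> t (x, y, z)"
proof -
  have p: "phase (a - of_int j) = phase a" for a j
  proof -
    have "phase (a - of_int j) = phase a * wave (- j) 1" by (simp add: wave_eq_phase phase_add[symmetric])
    thus ?thesis using wave_periodic[of "- j" 0] by (simp add: wave_eq_phase)
  qed
  show "carried k l \<eta> t (x + 1, y, z) = carried k l \<eta> t (x, y, z)"
    unfolding carried_def by (subst p[of _ k, symmetric]) (simp add: algebra_simps)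
  show "carried k l \<eta> t (x, y, z + 1) = carried k l \<eta> t (x, y, z)"
    unfolding carried_def by (subst p[of _ l, symmetric]) (simp add: algebra_simps)
qed

abbreviation "tau \<equiv> 2 * complex_of_real pi * \<i>"

lemma carried_derivs:
  "((\<lambda>t. carried k l \<eta> t p) has_vector_derivative tau * of_real (of_int k * fst (snd p)) * carried k l \<eta> t p) (at t)"
  "((\<lambda>x. carried k l \<eta> t (x, y, z)) has_vector_derivative tau * of_real (- of_int k) * carried k l \<eta> t (x, y, z)) (at x)"
  "((\<lambda>y. carried k l \<eta> t (x, y, z)) has_vector_derivative tau * of_real (- (\<eta> - of_int k * t)) * carried k l \<eta> t (x, y, z)) (at y)"
  "((\<lambda>z. carried k l \<eta> t (x, y, z)) has_vector_derivative tau * of_real (- of_int l) * carried k l \<eta> t (x, y, z)) (at z)"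
  unfolding carried_def fst_conv snd_conv
  by (rule phase_has_vector_derivative, (auto intro!: derivative_eq_intros simp: algebra_simps)[1])+

lemma shift_has_vector_derivative: "((\<lambda>s. s + 1 :: real) has_vector_derivative 1) (at x)"
  unfolding has_real_derivative_iff_has_vector_derivative[symmetric] by (auto intro!: derivative_eq_intros)

text \<open>The derivatives are recorded as separate functions along coordinate lines, so that
  integration by parts is one-dimensional calculus. All conditions are for positive times, as the
  solution is assumed differentiable only there.\<close>

locale shear_field =
  fixes f ft fx fy fz fxx fyy fzz :: "real \<Rightarrow> point \<Rightarrow> complex"
  assumes dt: "t > 0 \<Longrightarrow> ((\<lambda>s. f s p) has_vector_derivative ft t p) (at t)"
    and dx: "t > 0 \<Longrightarrow> ((\<lambda>s. f t (s, y, z)) has_vector_derivative fx t (x, y, z)) (at x)"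
    and dy: "t > 0 \<Longrightarrow> ((\<lambda>s. f t (x, s, z)) has_vector_derivative fy t (x, y, z)) (at y)"
    and dz: "t > 0 \<Longrightarrow> ((\<lambda>s. f t (x, y, s)) has_vector_derivative fz t (x, y, z)) (at z)"
    and dxx: "t > 0 \<Longrightarrow> ((\<lambda>s. fx t (s, y, z)) has_vector_derivative fxx t (x, y, z)) (at x)"
    and dyy: "t > 0 \<Longrightarrow> ((\<lambda>s. fy t (x, s, z)) has_vector_derivative fyy t (x, y, z)) (at y)"
    and dzz: "t > 0 \<Longrightarrow> ((\<lambda>s. fz t (x, y, s)) has_vector_derivative fzz t (x, y, z)) (at z)"
    and cont: "continuous_on ({0<..} \<times> UNIV) (\<lambda>(t, p). f t p)"
      "continuous_on ({0<..} \<times> UNIV) (\<lambda>(t, p). ft t p)"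
      "continuous_on ({0<..} \<times> UNIV) (\<lambda>(t, p). fx t p)"
      "continuous_on ({0<..} \<times> UNIV) (\<lambda>(t, p). fxx t p)"
      "continuous_on ({0<..} \<times> UNIV) (\<lambda>(t, p). fyy t p)"
      "continuous_on ({0<..} \<times> UNIV) (\<lambda>(t, p). fzz t p)"
    and per: "t > 0 \<Longrightarrow> f t (x + 1, y, z) = f t (x, y, z)" "t > 0 \<Longrightarrow> f t (x, y, z + 1) = f t (x, y, z)"
begin

lemma cont_compose:
  assumes "continuous_on ({0<..} \<times> UNIV) (\<lambda>(t, p). h t (p :: point) :: complex)"
    and "continuous_on S a" "continuous_on S b" "\<And>x. x \<in> S \<Longrightarrow> a x > 0"
  shows "continuous_on S (\<lambda>x. h (a x) (b x))"
proof -
  have "continuous_on S (\<lambda>x. (\<lambda>(t, p). h t p) (a x, b x))"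
    by (rule continuous_on_compose2[OF assms(1)]) (use assms in \<open>auto intro!: continuous_intros\<close>)
  thus ?thesis by simp
qed

lemmas conts = cont[THEN cont_compose]

lemma fx_per: assumes t: "t > 0" shows "fx t (x + 1, y, z) = fx t (x, y, z)"
proof -
  have "((\<lambda>s. f t (s + 1, y, z)) has_vector_derivative fx t (x + 1, y, z)) (at x)"
    using vector_diff_chain_at[of "\<lambda>s. s + 1" 1 x "\<lambda>s. f t (s, y, z)" "fx t (x + 1, y, z)"] dx[OF t]
    by (simp add: o_def shift_has_vector_derivative)
  hence "((\<lambda>s. f t (s, y, z)) has_vector_derivative fx t (x + 1, y, z)) (at x)" by (simp add: per[OF t])
  from vector_derivative_unique_at[OF this dx[OF t]] show ?thesis .
qed

lemma fz_per: assumes t: "t > 0" shows "fz t (x, y, z + 1) = fz t (x, y, z)"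
proof -
  have "((\<lambda>s. f t (x, y, s + 1)) has_vector_derivative fz t (x, y, z + 1)) (at z)"
    using vector_diff_chain_at[of "\<lambda>s. s + 1" 1 z "\<lambda>s. f t (x, y, s)" "fz t (x, y, z + 1)"] dz[OF t]
    by (simp add: o_def shift_has_vector_derivative)
  hence "((\<lambda>s. f t (x, y, s)) has_vector_derivative fz t (x, y, z + 1)) (at z)" by (simp add: per[OF t])
  from vector_derivative_unique_at[OF this dz[OF t]] show ?thesis .
qed

abbreviation "lapl t p \<equiv> fxx t p + fyy t p + fzz t p"

text \<open>Each identity integrates an exact derivative over the box. The first one trades the
  transport term for the time derivative of the carried wave. In the second, Green's formula in
  \<open>x\<close> and \<open>z\<close> produces eigenvalues only, because the cutoff depends on
  \<open>y\<close> alone; the \<open>y\<close> direction adds the commutator with the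
  cutoff.\<close>

lemma green:
  fixes t \<eta> R :: real and k l :: int
  assumes t: "t > 0" and R: "R > 0"
  defines "\<psi> \<equiv> (\<lambda>p. of_real (cutoff R (fst (snd p))) * carried k l \<eta> t p)"
  shows "integral (box3 R) (\<lambda>p. of_real (fst (snd p)) * fx t p * \<psi> p)
       = integral (box3 R) (\<lambda>p. f t p * (tau * of_real (of_int k * fst (snd p)) * \<psi> p))"
    and "integral (box3 R) (\<lambda>p. lapl t p * \<psi> p)
       = - of_real (4 * pi\<^sup>2 * ((of_int k)\<^sup>2 + (\<eta> - of_int k * t)\<^sup>2 + (of_int l)\<^sup>2)) * integral (box3 R) (\<lambda>p. f t p * \<psi> p)
         + integral (box3 R) (\<lambda>p. f t p * ((of_real (cutoff2 R (fst (snd p)))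
             - 2 * tau * of_real (\<eta> - of_int k * t) * of_real (cutoff1 R (fst (snd p)))) * carried k l \<eta> t p))"
proof -
  let ?E = "carried k l \<eta> t" and ?B = "box3 R"
  define w w1 w2 where "w p = complex_of_real (cutoff R (fst (snd p)))"
    and "w1 p = complex_of_real (cutoff1 R (fst (snd p)))" and "w2 p = complex_of_real (cutoff2 R (fst (snd p)))" for p :: point
  define \<zeta> where "\<zeta> = \<eta> - of_int k * t"
  \<comment> \<open>Eigenvalues of the three partial derivatives on the carried wave; \<zeta> is
    minus its y-frequency's coefficient in the exponent, that is, the sheared y-frequency at time
    \<open>t\<close>.\<close>
  define a b c where "a = tau * complex_of_real (- of_int k)" and "b = tau * complex_of_real (- \<zeta>)"
    and "c = tau * complex_of_real (- of_int l)"
  have \<psi>: "\<psi> p = w p * ?E p" for p by (simp add: \<psi>_def w_def)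
  have cw: "continuous_on S w" "continuous_on S w1" "continuous_on S w2" for S
    unfolding w_def w1_def w2_def by (intro continuous_intros)+
  have cE: "continuous_on S ?E" for S by (intro continuous_intros)
  have cf: "continuous_on S (\<lambda>p. f t p)" "continuous_on S (\<lambda>p. fx t p)" "continuous_on S (\<lambda>p. fxx t p)"
      "continuous_on S (\<lambda>p. fyy t p)" "continuous_on S (\<lambda>p. fzz t p)" for S
    using t by (auto intro!: conts continuous_intros)
  note ci = continuous_intros cw cE cf
  have dEx: "((\<lambda>s. ?E (s, y, z)) has_vector_derivative a * ?E (x, y, z)) (at x)" for x y z
    unfolding a_def by (rule carried_derivs)
  have dEy: "((\<lambda>s. ?E (x, s, z)) has_vector_derivative b * ?E (x, y, z)) (at y)" for x y z
    unfolding b_def \<zeta>_def by (rule carried_derivs)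
  have dEz: "((\<lambda>s. ?E (x, y, s)) has_vector_derivative c * ?E (x, y, z)) (at z)" for x y z
    unfolding c_def by (rule carried_derivs)
  have dwy: "((\<lambda>s. w (x, s, z)) has_vector_derivative w1 (x, y, z)) (at y)"
      "((\<lambda>s. w1 (x, s, z)) has_vector_derivative w2 (x, y, z)) (at y)" for x y z
    unfolding w_def w1_def w2_def fst_conv snd_conv using cutoff_deriv[OF R]
    by (auto intro!: has_vector_derivative_of_real simp: has_real_derivative_iff_has_vector_derivative)
  have int: "g integrable_on ?B" if "continuous_on ?B g" for g :: "point \<Rightarrow> complex"
    using that by (rule integrable_continuous)
  have px: "?E (1, y, z) = ?E (0, y, z)" "f t (1, y, z) = f t (0, y, z)" "fx t (1, y, z) = fx t (0, y, z)" for y z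
    using carried_periodic(1)[of k l \<eta> t 0 y z] per(1)[OF t, of 0 y z] fx_per[OF t, of 0 y z] by simp_all
  have pz: "?E (x, y, 1) = ?E (x, y, 0)" "f t (x, y, 1) = f t (x, y, 0)" "fz t (x, y, 1) = fz t (x, y, 0)" for x y
    using carried_periodic(2)[of k l \<eta> t x y 0] per(2)[OF t, of x y 0] fz_per[OF t, of x y 0] by simp_all
  have wx: "w (x, y, z) = w (0, y, 0)" for x y z by (simp add: w_def)
  show "integral ?B (\<lambda>p. of_real (fst (snd p)) * fx t p * \<psi> p)
       = integral ?B (\<lambda>p. f t p * (tau * of_real (of_int k * fst (snd p)) * \<psi> p))"
  proof -
    have "integral ?B (\<lambda>p. of_real (fst (snd p)) * fx t p * \<psi> p - f t p * (tau * of_real (of_int k * fst (snd p)) * \<psi> p)) = 0"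
    proof (rule integral_x_derivative_zero[where G = "\<lambda>p. of_real (fst (snd p)) * w p * (f t p * ?E p)"])
      show "continuous_on ?B (\<lambda>p. of_real (fst (snd p)) * fx t p * \<psi> p - f t p * (tau * of_real (of_int k * fst (snd p)) * \<psi> p))"
        unfolding \<psi> by (intro ci)
      fix x y z
      have "((\<lambda>s. of_real y * w (0, y, 0) * (f t (s, y, z) * ?E (s, y, z))) has_vector_derivative
          of_real y * w (0, y, 0) * (f t (x, y, z) * (a * ?E (x, y, z)) + fx t (x, y, z) * ?E (x, y, z))) (at x)"
        by (intro has_vector_derivative_mult_right has_vector_derivative_mult dx[OF t] dEx)
      thus "((\<lambda>s. of_real (fst (snd (s, y, z))) * w (s, y, z) * (f t (s, y, z) * ?E (s, y, z))) has_vector_derivative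
          of_real (fst (snd (x, y, z))) * fx t (x, y, z) * \<psi> (x, y, z) - f t (x, y, z) * (tau * of_real (of_int k * fst (snd (x, y, z))) * \<psi> (x, y, z))) (at x)"
        unfolding \<psi> wx[of _ y z] by (simp add: a_def algebra_simps)
    qed (simp add: px w_def)
    thus ?thesis by (subst (asm) integral_diff) (auto intro!: int ci simp: \<psi>)
  qed
  have X: "integral ?B (\<lambda>p. fxx t p * \<psi> p - f t p * (a\<^sup>2 * \<psi> p)) = 0"
  proof (rule integral_x_derivative_zero[where G = "\<lambda>p. w p * (fx t p * ?E p - f t p * (a * ?E p))"])
    show "continuous_on ?B (\<lambda>p. fxx t p * \<psi> p - f t p * (a\<^sup>2 * \<psi> p))" unfolding \<psi> by (intro ci)
    fix x y z
    have "((\<lambda>s. w (0, y, 0) * (fx t (s, y, z) * ?E (s, y, z) - f t (s, y, z) * (a * ?E (s, y, z)))) has_vector_derivative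
        w (0, y, 0) * ((fx t (x, y, z) * (a * ?E (x, y, z)) + fxx t (x, y, z) * ?E (x, y, z))
          - (f t (x, y, z) * (a * (a * ?E (x, y, z))) + fx t (x, y, z) * (a * ?E (x, y, z))))) (at x)"
      by (intro has_vector_derivative_mult_right has_vector_derivative_diff has_vector_derivative_mult dx[OF t] dxx[OF t] dEx)
    thus "((\<lambda>s. w (s, y, z) * (fx t (s, y, z) * ?E (s, y, z) - f t (s, y, z) * (a * ?E (s, y, z)))) has_vector_derivative
        fxx t (x, y, z) * \<psi> (x, y, z) - f t (x, y, z) * (a\<^sup>2 * \<psi> (x, y, z))) (at x)"
      unfolding \<psi> wx[of _ y z] by (simp add: power2_eq_square algebra_simps)
  qed (simp add: px w_def)
  have Z: "integral ?B (\<lambda>p. fzz t p * \<psi> p - f t p * (c\<^sup>2 * \<psi> p)) = 0"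
  proof (rule integral_z_derivative_zero[where G = "\<lambda>p. w p * (fz t p * ?E p - f t p * (c * ?E p))"])
    show "continuous_on ?B (\<lambda>p. fzz t p * \<psi> p - f t p * (c\<^sup>2 * \<psi> p))" unfolding \<psi> by (intro ci)
    fix x y z
    have "((\<lambda>s. w (0, y, 0) * (fz t (x, y, s) * ?E (x, y, s) - f t (x, y, s) * (c * ?E (x, y, s)))) has_vector_derivative
        w (0, y, 0) * ((fz t (x, y, z) * (c * ?E (x, y, z)) + fzz t (x, y, z) * ?E (x, y, z))
          - (f t (x, y, z) * (c * (c * ?E (x, y, z))) + fz t (x, y, z) * (c * ?E (x, y, z))))) (at z)"
      by (intro has_vector_derivative_mult_right has_vector_derivative_diff has_vector_derivative_mult dz[OF t] dzz[OF t] dEz)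
    thus "((\<lambda>s. w (x, y, s) * (fz t (x, y, s) * ?E (x, y, s) - f t (x, y, s) * (c * ?E (x, y, s)))) has_vector_derivative
        fzz t (x, y, z) * \<psi> (x, y, z) - f t (x, y, z) * (c\<^sup>2 * \<psi> (x, y, z))) (at z)"
      unfolding \<psi> wx[of x y] by (simp add: power2_eq_square algebra_simps)
  qed (simp add: pz w_def)
  \<comment> \<open>What two y-derivatives of cutoff times wave leave besides
    \<open>b\<^sup>2 * \<psi>\<close>.\<close>
  define e where "e p = (w2 p + 2 * b * w1 p) * ?E p" for p
  \<comment> \<open>Both \<open>w\<close> and \<open>w1\<close> vanish at the two ends, so neither
    \<open>fy\<close> nor \<open>f\<close> leaves a boundary term.\<close>
  have Y: "integral ?B (\<lambda>p. fyy t p * \<psi> p - f t p * (b\<^sup>2 * \<psi> p + e p)) = 0"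
  proof (rule integral_y_derivative_zero[where G = "\<lambda>p. fy t p * (w p * ?E p) - f t p * ((w1 p + b * w p) * ?E p)"])
    show "continuous_on ?B (\<lambda>p. fyy t p * \<psi> p - f t p * (b\<^sup>2 * \<psi> p + e p))" unfolding \<psi> e_def by (intro ci)
    fix x y z
    have "((\<lambda>s. fy t (x, s, z) * (w (x, s, z) * ?E (x, s, z)) - f t (x, s, z) * ((w1 (x, s, z) + b * w (x, s, z)) * ?E (x, s, z))) has_vector_derivative
        (fy t (x, y, z) * (w (x, y, z) * (b * ?E (x, y, z)) + w1 (x, y, z) * ?E (x, y, z)) + fyy t (x, y, z) * (w (x, y, z) * ?E (x, y, z)))
        - (f t (x, y, z) * ((w1 (x, y, z) + b * w (x, y, z)) * (b * ?E (x, y, z)) + (w2 (x, y, z) + b * w1 (x, y, z)) * ?E (x, y, z))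
           + fy t (x, y, z) * ((w1 (x, y, z) + b * w (x, y, z)) * ?E (x, y, z)))) (at y)"
      by (intro has_vector_derivative_mult_right has_vector_derivative_diff has_vector_derivative_add has_vector_derivative_mult
          dy[OF t] dyy[OF t] dEy dwy)
    thus "((\<lambda>s. fy t (x, s, z) * (w (x, s, z) * ?E (x, s, z)) - f t (x, s, z) * ((w1 (x, s, z) + b * w (x, s, z)) * ?E (x, s, z))) has_vector_derivative
        fyy t (x, y, z) * \<psi> (x, y, z) - f t (x, y, z) * (b\<^sup>2 * \<psi> (x, y, z) + e (x, y, z))) (at y)"
      unfolding \<psi> e_def by (simp add: power2_eq_square algebra_simps)
  qed (use R cutoff_boundary[OF R] in \<open>auto simp: w_def w1_def\<close>)
  have iX: "integral ?B (\<lambda>p. fxx t p * \<psi> p) = a\<^sup>2 * integral ?B (\<lambda>p. f t p * \<psi> p)"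
    using X by (subst (asm) integral_diff) (auto intro!: int ci simp: \<psi> mult.left_commute[of _ "a\<^sup>2"])
  have iZ: "integral ?B (\<lambda>p. fzz t p * \<psi> p) = c\<^sup>2 * integral ?B (\<lambda>p. f t p * \<psi> p)"
    using Z by (subst (asm) integral_diff) (auto intro!: int ci simp: \<psi> mult.left_commute[of _ "c\<^sup>2"])
  have iY: "integral ?B (\<lambda>p. fyy t p * \<psi> p) = b\<^sup>2 * integral ?B (\<lambda>p. f t p * \<psi> p) + integral ?B (\<lambda>p. f t p * e p)"
  proof -
    have "integral ?B (\<lambda>p. fyy t p * \<psi> p) = integral ?B (\<lambda>p. f t p * (b\<^sup>2 * \<psi> p + e p))"
      using Y by (subst (asm) integral_diff) (auto intro!: int ci simp: \<psi> e_def)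
    also have "\<dots> = integral ?B (\<lambda>p. b\<^sup>2 * (f t p * \<psi> p) + f t p * e p)" by (simp add: algebra_simps)
    also have "\<dots> = integral ?B (\<lambda>p. b\<^sup>2 * (f t p * \<psi> p)) + integral ?B (\<lambda>p. f t p * e p)"
      by (rule integral_add) (auto intro!: int ci simp: \<psi> e_def)
    finally show ?thesis by simp
  qed
  have "integral ?B (\<lambda>p. lapl t p * \<psi> p) = integral ?B (\<lambda>p. fxx t p * \<psi> p + fyy t p * \<psi> p + fzz t p * \<psi> p)"
    by (simp add: algebra_simps)
  also have "\<dots> = integral ?B (\<lambda>p. fxx t p * \<psi> p + fyy t p * \<psi> p) + integral ?B (\<lambda>p. fzz t p * \<psi> p)"
    by (rule integral_add) (auto intro!: int ci simp: \<psi>)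
  also have "integral ?B (\<lambda>p. fxx t p * \<psi> p + fyy t p * \<psi> p) = integral ?B (\<lambda>p. fxx t p * \<psi> p) + integral ?B (\<lambda>p. fyy t p * \<psi> p)"
    by (rule integral_add) (auto intro!: int ci simp: \<psi>)
  finally have "integral ?B (\<lambda>p. lapl t p * \<psi> p) = a\<^sup>2 * integral ?B (\<lambda>p. f t p * \<psi> p)
      + (b\<^sup>2 * integral ?B (\<lambda>p. f t p * \<psi> p) + integral ?B (\<lambda>p. f t p * e p)) + c\<^sup>2 * integral ?B (\<lambda>p. f t p * \<psi> p)"
    by (simp only: iX iY iZ)
  also have "\<dots> = (a\<^sup>2 + b\<^sup>2 + c\<^sup>2) * integral ?B (\<lambda>p. f t p * \<psi> p) + integral ?B (\<lambda>p. f t p * e p)"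
    by (simp add: distrib_right)
  finally have "integral ?B (\<lambda>p. lapl t p * \<psi> p) = (a\<^sup>2 + b\<^sup>2 + c\<^sup>2) * integral ?B (\<lambda>p. f t p * \<psi> p) + integral ?B (\<lambda>p. f t p * e p)" .
  moreover have "a\<^sup>2 + b\<^sup>2 + c\<^sup>2 = - of_real (4 * pi\<^sup>2 * ((of_int k)\<^sup>2 + (\<eta> - of_int k * t)\<^sup>2 + (of_int l)\<^sup>2))"
  proof -
    have sq: "(tau * complex_of_real (- r))\<^sup>2 = - of_real (4 * pi\<^sup>2 * r\<^sup>2)" for r
      by (simp add: power_mult_distrib)
    show ?thesis unfolding a_def b_def c_def sq \<zeta>_def[symmetric] by (simp add: ring_distribs)
  qed
  moreover have "e p = (of_real (cutoff2 R (fst (snd p)))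
             - 2 * tau * of_real (\<eta> - of_int k * t) * of_real (cutoff1 R (fst (snd p)))) * carried k l \<eta> t p" for p
    by (simp add: e_def w1_def w2_def b_def \<zeta>_def algebra_simps)
  ultimately show "integral ?B (\<lambda>p. lapl t p * \<psi> p)
       = - of_real (4 * pi\<^sup>2 * ((of_int k)\<^sup>2 + (\<eta> - of_int k * t)\<^sup>2 + (of_int l)\<^sup>2)) * integral ?B (\<lambda>p. f t p * \<psi> p)
         + integral ?B (\<lambda>p. f t p * ((of_real (cutoff2 R (fst (snd p)))
             - 2 * tau * of_real (\<eta> - of_int k * t) * of_real (cutoff1 R (fst (snd p)))) * carried k l \<eta> t p))"
    by simp
qed

end

section \<open>Windowed Fourier transforms\<close>

text \<open>\<open>f\<close> is only locally integrable, so it is cut off to [-m, m] before the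
  criterion with half-open intervals is applied; clipped intervals that degenerate carry no
  mass.\<close>

lemma AE_zero_of_Icc_integrals:
  fixes f :: "real \<Rightarrow> complex"
  assumes i: "\<And>a b. set_integrable lborel {a..b} f" and z: "\<And>a b. a < b \<Longrightarrow> (LINT x:{a..b}|lborel. f x) = 0"
  shows "AE x in lborel. f x = 0"
proof -
  have "AE x in lborel. indicator {- real m..real m} x *\<^sub>R f x = 0" for m :: nat
  proof (rule AE_zero_of_Ioc_integrals)
    show m: "integrable lborel (\<lambda>x. indicator {- real m..real m} x *\<^sub>R f x)"
      using i[of "- real m" "real m"] by (simp add: set_integrable_def)
    fix a b
    define c d where "c = max a (- real m)" and "d = min b (real m)"
    have "(LINT x:{a<..b}|lborel. indicator {- real m..real m} x *\<^sub>R f x) = (LINT x:{c..d}|lborel. f x)"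
      unfolding set_lebesgue_integral_def
    proof (intro integral_cong_AE, goal_cases)
      case 1 show ?case using m by measurable
    next
      case 2 show ?case using i[of c d] by (simp add: set_integrable_def)
    next
      case 3
      show ?case using AE_lborel_singleton[of a]
      proof eventually_elim
        case (elim x)
        have "x \<in> {a<..b} \<and> x \<in> {- real m..real m} \<longleftrightarrow> x \<in> {c..d}" using elim by (auto simp: c_def d_def)
        thus ?case by (auto simp: indicator_def)
      qed
    qed
    also have "\<dots> = 0"
    proof (cases "c < d")
      case False
      have "AE x in lborel. indicator {c..d} x *\<^sub>R f x = 0"
        using AE_lborel_singleton[of c] by eventually_elim (use False in \<open>auto simp: indicator_def\<close>)
      thus ?thesis unfolding set_lebesgue_integral_def by (rule integral_eq_zero_AE)
    qed (rule z)
    finally show "(LINT x:{a<..b}|lborel. indicator {- real m..real m} x *\<^sub>R f x) = 0" .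
  qed
  hence "AE x in lborel. \<forall>m::nat. indicator {- real m..real m} x *\<^sub>R f x = 0" unfolding AE_all_countable by blast
  thus ?thesis
  proof eventually_elim
    case (elim x)
    obtain m :: nat where "\<bar>x\<bar> \<le> real m" using real_arch_simple by blast
    thus ?case using elim[rule_format, of m] by (auto simp: indicator_def)
  qed
qed

section \<open>Restriction of transforms to single lines of frequencies\<close>

lemma space_freq [simp]: "space freq_measure = UNIV"
  by (simp add: freq_measure_def space_pair_measure)

lemma freq_slice_measurable:
  assumes "X \<in> borel_measurable freq_measure" "g \<in> borel_measurable borel"
  shows "(\<lambda>\<eta>. X (k, g \<eta>, l)) \<in> borel_measurable borel"
proof -
  have "(\<lambda>\<eta>. (k, g \<eta>, l)) \<in> measurable borel freq_measure"
    unfolding freq_measure_def using assms(2) by measurable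
  from measurable_compose[OF this assms(1)] show ?thesis .
qed

text \<open>Counting measure gives each pair \<open>(k, l)\<close> mass one, so a single line of
  frequencies contributes one term of a sum of nonnegative terms.\<close>

lemma nn_integral_freq_slice_le:
  assumes [measurable]: "H \<in> borel_measurable freq_measure"
  shows "(\<integral>\<^sup>+\<eta>. H (k, \<eta>, l) \<partial>lborel) \<le> (\<integral>\<^sup>+\<xi>. H \<xi> \<partial>freq_measure)"
proof -
  have Hm[measurable]: "H \<in> borel_measurable (count_space UNIV \<Otimes>\<^sub>M (lborel \<Otimes>\<^sub>M count_space UNIV))"
    using assms by (simp add: freq_measure_def)
  have sf: "sigma_finite_measure (lborel \<Otimes>\<^sub>M count_space (UNIV :: int set) :: (real \<times> int) measure)"
    by (rule sigma_finite_pair_measure[OF sigma_finite_lborel sigma_finite_count_int])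
  have "(\<integral>\<^sup>+\<eta>. H (k, \<eta>, l) \<partial>lborel) \<le> (\<integral>\<^sup>+\<eta>. \<integral>\<^sup>+l. H (k, \<eta>, l) \<partial>count_space UNIV \<partial>lborel)"
    by (intro nn_integral_mono nn_integral_ge_point) simp
  also have "\<dots> = (\<integral>\<^sup>+q. H (k, q) \<partial>(lborel \<Otimes>\<^sub>M count_space UNIV))"
    by (rule sigma_finite_measure.nn_integral_fst[OF sigma_finite_count_int]) measurable
  also have "\<dots> \<le> (\<integral>\<^sup>+k. \<integral>\<^sup>+q. H (k, q) \<partial>(lborel \<Otimes>\<^sub>M count_space UNIV) \<partial>count_space UNIV)"
    by (rule nn_integral_ge_point) simp
  also have "\<dots> = (\<integral>\<^sup>+\<xi>. H \<xi> \<partial>freq_measure)"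
    unfolding freq_measure_def by (rule sigma_finite_measure.nn_integral_fst[OF sf]) measurable
  finally show ?thesis .
qed

lemma square_integrable_freq_slice:
  assumes X: "square_integrable freq_measure X"
  shows "square_integrable lborel (\<lambda>\<eta>. X (shear t (k, \<eta>, l)))"
    and "l2norm lborel (\<lambda>\<eta>. X (shear t (k, \<eta>, l))) \<le> l2norm freq_measure X"
proof -
  have [measurable]: "X \<in> borel_measurable freq_measure" using X by (simp add: square_integrable_def)
  have m: "(\<lambda>\<eta>. X (shear t (k, \<eta>, l))) \<in> borel_measurable lborel"
    using freq_slice_measurable[of X "\<lambda>\<eta>. \<eta> - of_int k * t" k l] by (simp add: shear_def)
  have "(\<integral>\<^sup>+\<eta>. ennreal ((cmod (X (shear t (k, \<eta>, l))))\<^sup>2) \<partial>lborel) \<le> (\<integral>\<^sup>+\<xi>. ennreal ((cmod (X (shear t \<xi>)))\<^sup>2) \<partial>freq_measure)"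
    by (rule nn_integral_freq_slice_le[of "\<lambda>\<xi>. ennreal ((cmod (X (shear t \<xi>)))\<^sup>2)"]) measurable
  also have "\<dots> = (\<integral>\<^sup>+\<xi>. ennreal ((cmod (X \<xi>))\<^sup>2) \<partial>freq_measure)"
    by (rule nn_integral_shear[of "\<lambda>\<xi>. ennreal ((cmod (X \<xi>))\<^sup>2)"]) measurable
  also have "\<dots> = ennreal ((l2norm freq_measure X)\<^sup>2)" by (rule nn_integral_eq_l2norm[OF X])
  finally have le: "(\<integral>\<^sup>+\<eta>. ennreal ((cmod (X (shear t (k, \<eta>, l))))\<^sup>2) \<partial>lborel) \<le> ennreal ((l2norm freq_measure X)\<^sup>2)" .
  show s: "square_integrable lborel (\<lambda>\<eta>. X (shear t (k, \<eta>, l)))"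
    by (subst square_integrable_iff_nn_integral[OF m]) (rule le_less_trans[OF le], simp)
  have "(l2norm lborel (\<lambda>\<eta>. X (shear t (k, \<eta>, l))))\<^sup>2 \<le> (l2norm freq_measure X)\<^sup>2"
    using le unfolding nn_integral_eq_l2norm[OF s] by (subst (asm) ennreal_le_iff) simp_all
  thus "l2norm lborel (\<lambda>\<eta>. X (shear t (k, \<eta>, l))) \<le> l2norm freq_measure X" by (rule power2_le_imp_le) simp
qed

text \<open>On a fixed line of frequencies a transform is known only almost everywhere in \<eta>.
  Integrating it against a continuous weight over [a, b] gives a number that depends continuously on
  the transform in the mean.\<close>

definition slice :: "int \<Rightarrow> int \<Rightarrow> real \<Rightarrow> real \<Rightarrow> real \<Rightarrow> (real \<Rightarrow> complex) \<Rightarrow> (freq \<Rightarrow> complex) \<Rightarrow> complex" where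
  "slice k l a b t \<beta> X = (LINT \<eta>:{a..b}|lborel. \<beta> \<eta> * X (shear t (k, \<eta>, l)))"

lemma slice_bound:
  assumes X: "square_integrable freq_measure X" and \<beta>: "continuous_on {a..b} \<beta>"
    and B: "\<And>\<eta>. \<eta> \<in> {a..b} \<Longrightarrow> cmod (\<beta> \<eta>) \<le> B" and ab: "a \<le> b"
  shows "set_integrable lborel {a..b} (\<lambda>\<eta>. \<beta> \<eta> * X (shear t (k, \<eta>, l)))"
    and "cmod (slice k l a b t \<beta> X) \<le> B * sqrt (b - a) * l2norm freq_measure X"
proof -
  let ?b = "\<lambda>\<eta>. cnj (indicator {a..b} \<eta> *\<^sub>R \<beta> \<eta>)" and ?X = "\<lambda>\<eta>. X (shear t (k, \<eta>, l))"
  have B0: "0 \<le> B" using B[of a] ab norm_ge_zero[of "\<beta> a"] by (simp del: norm_ge_zero)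
  have bm: "?b \<in> borel_measurable lborel"
    using measurable_compose[OF borel_measurable_continuous_on_indicator[OF _ \<beta>] borel_measurable_cnj] by simp
  have i1: "square_integrable lborel (indicator {a..b} :: real \<Rightarrow> complex)"
  proof -
    have "integrable lborel (\<lambda>x. (cmod (indicator {a..b} x))\<^sup>2) \<longleftrightarrow> integrable lborel (indicator {a..b} :: real \<Rightarrow> real)"
      by (rule Bochner_Integration.integrable_cong) (auto simp: indicator_def)
    moreover have "integrable lborel (indicator {a..b} :: real \<Rightarrow> real)"
      using ab by (intro integrable_real_indicator) (auto simp: emeasure_lborel_Icc_eq)
    ultimately show ?thesis by (simp add: square_integrable_def)
  qed
  have i2: "l2norm lborel (indicator {a..b} :: real \<Rightarrow> complex) = sqrt (b - a)"
  proof -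
    have "(LINT x|lborel. (cmod (indicator {a..b} x))\<^sup>2) = (LINT x|lborel. indicator {a..b} x :: real)"
      by (rule Bochner_Integration.integral_cong) (auto simp: indicator_def)
    thus ?thesis using ab by (simp add: l2norm_def)
  qed
  have le: "AE \<eta> in lborel. cmod (?b \<eta>) \<le> B * cmod (indicator {a..b} \<eta> :: complex)"
    using B by (auto simp: indicator_def)
  note D = square_integrable_dominated[OF i1 bm B0 le]
  note S = square_integrable_freq_slice[OF X, of t k l]
  have eq: "?X \<eta> * cnj (?b \<eta>) = indicator {a..b} \<eta> *\<^sub>R (\<beta> \<eta> * ?X \<eta>)" for \<eta> by (simp add: indicator_def)
  show "set_integrable lborel {a..b} (\<lambda>\<eta>. \<beta> \<eta> * X (shear t (k, \<eta>, l)))"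
    using square_integrable_prod(2)[OF S(1) D(1)] unfolding eq by (simp add: set_integrable_def)
  have "cmod (slice k l a b t \<beta> X) \<le> l2norm lborel ?X * l2norm lborel ?b"
    using square_integrable_prod(4)[OF S(1) D(1)] unfolding eq by (simp add: slice_def set_lebesgue_integral_def)
  also have "\<dots> \<le> l2norm freq_measure X * (B * sqrt (b - a))"
    using S(2) D(2) by (intro mult_mono) (auto simp: i2)
  finally show "cmod (slice k l a b t \<beta> X) \<le> B * sqrt (b - a) * l2norm freq_measure X" by (simp add: mult_ac)
qed

lemma slice_diff:
  assumes X: "square_integrable freq_measure X" "square_integrable freq_measure Y" and \<beta>: "continuous_on {a..b} \<beta>" and ab: "a \<le> b"
  shows "slice k l a b t \<beta> (\<lambda>\<xi>. X \<xi> - Y \<xi>) = slice k l a b t \<beta> X - slice k l a b t \<beta> Y"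
proof -
  have "compact (\<beta> ` {a..b})" by (intro compact_continuous_image \<beta>) simp
  then obtain B where B: "\<And>\<eta>. \<eta> \<in> {a..b} \<Longrightarrow> cmod (\<beta> \<eta>) \<le> B"
    by (meson bounded_iff compact_imp_bounded imageI)
  show ?thesis unfolding slice_def right_diff_distrib
    by (rule set_integral_diff(2)[OF slice_bound(1)[OF X(1) \<beta> B ab] slice_bound(1)[OF X(2) \<beta> B ab]])
qed

text \<open>The polynomial \<open>cutoff\<close> grows again outside the slab, hence the
  indicator.\<close>

definition window :: "nat \<Rightarrow> point \<Rightarrow> complex" where
  "window n p = indicator (slab n) p * of_real (cutoff (real n) (fst (snd p)))"

lemma window_measurable [measurable]: "window n \<in> borel_measurable cell"
proof -
  have "(\<lambda>p :: point. complex_of_real (cutoff (real n) (fst (snd p)))) \<in> borel_measurable borel"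
    by (intro borel_measurable_continuous_onI continuous_intros)
  thus ?thesis unfolding window_def using ft.A_sets[of n] by measurable
qed

lemma window_bounds: "n > 0 \<Longrightarrow> cmod (window n p) \<le> 1" "n > 0 \<Longrightarrow> cmod (window n p - 1) \<le> 1"
proof -
  assume n: "n > 0"
  have *: "0 \<le> cutoff (real n) (fst (snd p)) \<and> cutoff (real n) (fst (snd p)) \<le> 1" if "p \<in> slab n"
    using cutoff_bounds[of "real n" "fst (snd p)"] that n by (auto simp: slab_def real_box_def)
  show "cmod (window n p) \<le> 1" using * by (auto simp: window_def indicator_def)
  have "cmod (complex_of_real (cutoff (real n) (fst (snd p))) - 1) = \<bar>cutoff (real n) (fst (snd p)) - 1\<bar>"
    by (metis norm_of_real of_real_1 of_real_diff)
  thus "cmod (window n p - 1) \<le> 1" using * by (auto simp: window_def indicator_def)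
qed

text \<open>The index is raised by one because the half-width of the window is a divisor in
  \<open>cutoff\<close>.\<close>

definition window_error :: "nat \<Rightarrow> (point \<Rightarrow> complex) \<Rightarrow> real" where
  "window_error n f = l2norm cell (\<lambda>p. (window (Suc n) p - 1) * f p)"

lemma window_error_le: "square_integrable cell f \<Longrightarrow> window_error n f \<le> l2norm cell f"
  unfolding window_error_def
  using square_integrable_mult_bounded(2)[of cell f "\<lambda>p. window (Suc n) p - 1" 1] window_bounds(2)[of "Suc n"] by auto

lemma window_error_tendsto:
  assumes f: "square_integrable cell f"
  shows "(\<lambda>n. window_error n f) \<longlonglongrightarrow> 0"
  unfolding window_error_def
proof (rule l2norm_dominated_tendsto[OF f])
  fix p :: point
  assume p: "p \<in> space cell"
  obtain N where N: "p \<in> slab N" using ft.A_un p by blast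
  define y where "y = fst (snd p)"
  have "(\<lambda>n. (1 - (y * (1 / real (Suc n)))\<^sup>2)\<^sup>2) \<longlonglongrightarrow> (1 - (y * 0)\<^sup>2)\<^sup>2"
    by (intro tendsto_intros LIMSEQ_Suc[OF lim_1_over_n])
  hence "(\<lambda>n. cutoff (real (Suc n)) y) \<longlonglongrightarrow> 1" by (simp add: cutoff_def)
  hence "(\<lambda>n. complex_of_real (cutoff (real (Suc n)) y)) \<longlonglongrightarrow> of_real 1" by (rule tendsto_of_real)
  moreover have "\<forall>\<^sub>F n in sequentially. complex_of_real (cutoff (real (Suc n)) y) = window (Suc n) p"
  proof (rule eventually_sequentiallyI[of N])
    fix n assume "N \<le> n"
    hence "slab N \<subseteq> slab (Suc n)" using ft.A_inc by (simp add: incseq_def)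
    thus "complex_of_real (cutoff (real (Suc n)) y) = window (Suc n) p" using N by (auto simp: window_def y_def)
  qed
  ultimately have "(\<lambda>n. window (Suc n) p) \<longlonglongrightarrow> 1" using tendsto_cong by force
  from tendsto_diff[OF this tendsto_const[of 1]] show "(\<lambda>n. window (Suc n) p - 1) \<longlonglongrightarrow> 0" by simp
qed (use window_bounds(2) in auto)

definition windowed_ft :: "nat \<Rightarrow> (point \<Rightarrow> complex) \<Rightarrow> freq \<Rightarrow> complex" where
  "windowed_ft n f = kernel_int cell (slab n) fkernel (\<lambda>p. window n p * f p)"

lemma windowed_square_integrable:
  assumes f: "square_integrable cell f" and n: "n > 0"
  shows "square_integrable cell (\<lambda>p. window n p * f p)"
  using square_integrable_mult_bounded(1)[OF f, of "window n" 1] window_bounds(1)[OF n] by auto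

lemma windowed_ft_square_integrable:
  "square_integrable cell f \<Longrightarrow> n > 0 \<Longrightarrow> square_integrable freq_measure (windowed_ft n f)"
  unfolding windowed_ft_def by (intro trunc_square_integrable windowed_square_integrable)

lemma windowed_ft_error:
  assumes f: "square_integrable cell f"
  shows "l2norm freq_measure (\<lambda>\<xi>. windowed_ft (Suc n) f \<xi> - fourier f \<xi>) \<le> window_error n f"
proof -
  have "indicator (slab (Suc n)) p * (window (Suc n) p * f p) - f p = (window (Suc n) p - 1) * f p" for p
    by (auto simp: window_def indicator_def algebra_simps)
  thus ?thesis
    using trunc_fourier_diff[OF windowed_square_integrable[OF f] f, of "Suc n" "Suc n"]
    unfolding windowed_ft_def window_error_def by simp
qed

text \<open>The windowed coefficient in the moving frame as an integral over a compact box, where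
  differentiation under the integral and integration by parts are at hand;
  \<open>pairing_eq_windowed_ft\<close> recovers its form as a transform.\<close>

definition pairing :: "real \<Rightarrow> int \<Rightarrow> int \<Rightarrow> real \<Rightarrow> real \<Rightarrow> (point \<Rightarrow> complex) \<Rightarrow> complex" where
  "pairing R k l \<eta> t g = integral (box3 R) (\<lambda>p. g p * (of_real (cutoff R (fst (snd p))) * carried k l \<eta> t p))"

lemma slab_eq_box3: "slab n = box3 (real n)"
  by (auto simp: slab_def real_box_def cbox_Pair_eq)

lemma box_integral_eq_cell:
  fixes h :: "point \<Rightarrow> complex"
  assumes "continuous_on (box3 (real n)) h"
  shows "integral (box3 (real n)) h = (LINT p|cell. indicator (slab n) p * h p)"
proof -
  have i: "set_integrable lborel (box3 (real n)) h"
    unfolding set_integrable_def using assms by (intro borel_integrable_compact) auto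
  have "integral (box3 (real n)) h = (LINT p:box3 (real n)|lborel. h p)"
    using set_borel_integral_eq_integral(2)[OF i] by simp
  also have "\<dots> = (LINT p|lborel. indicator ({0..1} \<times> UNIV \<times> {0..1}) p *\<^sub>R (indicator (slab n) p * h p))"
    unfolding set_lebesgue_integral_def slab_eq_box3[symmetric]
    by (rule Bochner_Integration.integral_cong) (auto simp: indicator_def slab_def)
  also have "\<dots> = (LINT p|cell. indicator (slab n) p * h p)"
    unfolding cell_def by (rule integral_restrict_space[symmetric]) (auto intro!: borel_closed closed_Times)
  finally show ?thesis .
qed

text \<open>The carried wave at time \<open>t\<close> is the Fourier kernel at the sheared
  frequency, and on the slab the cutoff is the window.\<close>

lemma pairing_eq_windowed_ft:
  assumes "continuous_on UNIV g"
  shows "pairing (real n) k l \<eta> t g = windowed_ft n g (shear t (k, \<eta>, l))"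
proof -
  have "pairing (real n) k l \<eta> t g
      = (LINT p|cell. indicator (slab n) p * (g p * (of_real (cutoff (real n) (fst (snd p))) * carried k l \<eta> t p)))"
    unfolding pairing_def
    by (rule box_integral_eq_cell) (intro continuous_intros continuous_on_subset[OF assms] subset_UNIV)
  also have "\<dots> = windowed_ft n g (shear t (k, \<eta>, l))"
    unfolding windowed_ft_def kernel_int_def
  proof (rule Bochner_Integration.integral_cong)
    fix p :: point
    obtain x y z where p: "p = (x, y, z)" by (cases p)
    have "carried k l \<eta> t p = fkernel p (shear t (k, \<eta>, l))"
      unfolding p carried_def shear_def prod.case fkernel_eq by (rule arg_cong[where f=phase]) (simp add: algebra_simps)
    thus "indicator (slab n) p * (g p * (of_real (cutoff (real n) (fst (snd p))) * carried k l \<eta> t p))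
        = indicator (slab n) p * (window n p * g p) * fkernel p (shear t (k, \<eta>, l))"
      by (auto simp: window_def indicator_def)
  qed simp
  finally show ?thesis .
qed

lemma l2norm_slab: "l2norm cell (indicator (slab n) :: point \<Rightarrow> complex) = sqrt (2 * real n)"
proof -
  interpret LU: pair_sigma_finite "lborel :: real measure" unit_interval
    by (intro pair_sigma_finite.intro sigma_finite_lborel unit_interval.sigma_finite_measure_axioms)
  interpret P: pair_sigma_finite unit_interval "lborel \<Otimes>\<^sub>M unit_interval :: (real \<times> real) measure"
    by (rule pair_sigma_finite_cell)
  have "emeasure cell (slab n) = emeasure unit_interval {0..1} * (emeasure lborel (real_box n) * emeasure unit_interval {0..1})"
    unfolding cell_eq slab_def
    by (subst sigma_finite_measure.emeasure_pair_measure_Times[OF sigma_finite_lborel_unit], simp, simp,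
        subst unit_interval.emeasure_pair_measure_Times) auto
  also have "\<dots> = ennreal (2 * real n)" by (simp add: real_box_def emeasure_lborel_Icc_eq)
  finally have "measure cell (slab n) = 2 * real n" by (simp add: measure_def)
  moreover have "(LINT x|cell. (cmod (indicator (slab n) x))\<^sup>2) = (LINT x|cell. indicator (slab n) x :: real)"
    by (rule Bochner_Integration.integral_cong) (auto simp: indicator_def)
  moreover have "slab n \<inter> space cell = slab n" by (auto simp: slab_def space_cell)
  ultimately show ?thesis by (simp add: l2norm_def)
qed

text \<open>Cauchy--Schwarz on a slab of measure 2n. The growing factor sqrt (2 n) has to be beaten
  by \<open>C\<close>.\<close>

lemma box_integral_bound:
  assumes g: "continuous_on UNIV g" "square_integrable cell g" and h: "continuous_on (box3 (real n)) h"
    and C: "\<And>p. p \<in> box3 (real n) \<Longrightarrow> cmod (h p) \<le> C" and C0: "0 \<le> C"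
  shows "cmod (integral (box3 (real n)) (\<lambda>p. g p * h p)) \<le> C * sqrt (2 * real n) * l2norm cell g"
proof -
  have "integral (box3 (real n)) (\<lambda>p. g p * h p) = (LINT p|cell. indicator (slab n) p * (g p * h p))"
    by (rule box_integral_eq_cell) (intro continuous_intros h continuous_on_subset[OF g(1)] subset_UNIV)
  also have "\<dots> = (LINT p|cell. g p * cnj (cnj (indicator (slab n) p *\<^sub>R h p)))"
    by (rule Bochner_Integration.integral_cong) (auto simp: indicator_def)
  finally have eq: "integral (box3 (real n)) (\<lambda>p. g p * h p) = (LINT p|cell. g p * cnj (cnj (indicator (slab n) p *\<^sub>R h p)))" .
  have "(\<lambda>p. indicator (slab n) p *\<^sub>R h p) \<in> borel_measurable borel"
    unfolding slab_eq_box3 by (rule borel_measurable_continuous_on_indicator) (use h in auto)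
  hence m: "(\<lambda>p. cnj (indicator (slab n) p *\<^sub>R h p)) \<in> borel_measurable cell" by measurable
  have le: "AE p in cell. cmod (cnj (indicator (slab n) p *\<^sub>R h p)) \<le> C * cmod (indicator (slab n) p :: complex)"
    using C by (intro AE_I2) (auto simp: slab_eq_box3 indicator_def)
  note D = square_integrable_dominated[OF ft.square_integrable_indicator_A m C0 le]
  have "cmod (integral (box3 (real n)) (\<lambda>p. g p * h p)) \<le> l2norm cell g * l2norm cell (\<lambda>p. cnj (indicator (slab n) p *\<^sub>R h p))"
    unfolding eq by (rule square_integrable_prod(4)[OF g(2) D(1)])
  also have "\<dots> \<le> l2norm cell g * (C * sqrt (2 * real n))"
    using D(2) by (intro mult_left_mono) (auto simp: l2norm_slab)
  finally show ?thesis by (simp add: mult_ac)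
qed

section \<open>Evolution of the Fourier coefficients\<close>

text \<open>Joint continuity in time and frequency is what differentiation in time under the
  integral over \<eta> asks for.\<close>

lemma continuous_on_pairing:
  assumes "continuous_on (T \<times> UNIV) (\<lambda>(t, p). h t p)"
  shows "continuous_on (T \<times> S) (\<lambda>(t, \<eta>). pairing R k l \<eta> t (h t))"
proof -
  have c: "continuous_on ((T \<times> S) \<times> box3 R) (\<lambda>x. h (fst (fst x)) (snd x))"
  proof -
    have "continuous_on ((T \<times> S) \<times> box3 R) (\<lambda>x. (\<lambda>(t, p). h t p) (fst (fst x), snd x))"
      by (rule continuous_on_compose2[OF assms]) (auto intro!: continuous_intros)
    thus ?thesis by simp
  qed
  have "continuous_on (T \<times> S) (\<lambda>x. integral (box3 R)
      (\<lambda>p. h (fst x) p * (of_real (cutoff R (fst (snd p))) * carried k l (snd x) (fst x) p)))"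
    by (rule integral_continuous_on_param, unfold case_prod_unfold) (intro continuous_intros c)
  thus ?thesis by (simp add: pairing_def case_prod_unfold)
qed

lemma pairing_scaleR_diff:
  assumes "continuous_on UNIV g" "continuous_on UNIV h"
  shows "pairing R k l \<eta> t (\<lambda>p. g p + c * h p) = pairing R k l \<eta> t g + c * pairing R k l \<eta> t h"
proof -
  have i: "(\<lambda>p. f p * (of_real (cutoff R (fst (snd p))) * carried k l \<eta> t p)) integrable_on box3 R"
    if "continuous_on UNIV f" for f
    by (rule integrable_continuous) (intro continuous_intros continuous_on_subset[OF that] subset_UNIV)
  have "pairing R k l \<eta> t (\<lambda>p. g p + c * h p)
      = integral (box3 R) (\<lambda>p. g p * (of_real (cutoff R (fst (snd p))) * carried k l \<eta> t p)
          + c * (h p * (of_real (cutoff R (fst (snd p))) * carried k l \<eta> t p)))"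
    unfolding pairing_def by (simp add: algebra_simps)
  also have "\<dots> = pairing R k l \<eta> t g + integral (box3 R) (\<lambda>p. c * (h p * (of_real (cutoff R (fst (snd p))) * carried k l \<eta> t p)))"
    unfolding pairing_def by (rule integral_add) (intro i assms integrable_on_mult_right)+
  finally show ?thesis by (simp add: pairing_def)
qed

text \<open>The commutator of the Laplacian with the cutoff, tested on the carried wave.\<close>

definition pairing_error :: "real \<Rightarrow> int \<Rightarrow> int \<Rightarrow> real \<Rightarrow> real \<Rightarrow> (point \<Rightarrow> complex) \<Rightarrow> complex" where
  "pairing_error R k l \<eta> t g = integral (box3 R) (\<lambda>p. g p * ((of_real (cutoff2 R (fst (snd p)))
      - 2 * tau * of_real (\<eta> - of_int k * t) * of_real (cutoff1 R (fst (snd p)))) * carried k l \<eta> t p))"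

text \<open>Derivatives of the cutoff gain 1/n while the slab costs sqrt (2 n), so for fixed
  frequency and time the error decays like n^(-1/2). The factor 16 \<pi> is 4 \<pi> from the
  commutator times 4 from the bound on \<open>cutoff1\<close>.\<close>

lemma pairing_error_bound:
  assumes g: "continuous_on UNIV g" "square_integrable cell g" and n: "n > 0"
  shows "cmod (pairing_error (real n) k l \<eta> t g)
    \<le> (12 + 16 * pi * \<bar>\<eta> - of_int k * t\<bar>) / real n * sqrt (2 * real n) * l2norm cell g"
  unfolding pairing_error_def
proof (rule box_integral_bound[OF g])
  fix p assume "p \<in> box3 (real n)"
  hence y: "\<bar>fst (snd p)\<bar> \<le> real n" by (cases p) (auto simp: cbox_Pair_eq)
  have n0: "real n > 0" using n by simp
  note b = cutoff_bounds(3,4)[OF n0 y]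
  have "cmod ((of_real (cutoff2 (real n) (fst (snd p))) - 2 * tau * of_real (\<eta> - of_int k * t) * of_real (cutoff1 (real n) (fst (snd p)))) * carried k l \<eta> t p)
      \<le> cmod (complex_of_real (cutoff2 (real n) (fst (snd p)))) + cmod (2 * tau * of_real (\<eta> - of_int k * t) * complex_of_real (cutoff1 (real n) (fst (snd p))))"
    unfolding norm_mult[of _ "carried k l \<eta> t p"] norm_carried mult_1_right by (rule norm_triangle_ineq4)
  also have "\<dots> = \<bar>cutoff2 (real n) (fst (snd p))\<bar> + 4 * pi * \<bar>\<eta> - of_int k * t\<bar> * \<bar>cutoff1 (real n) (fst (snd p))\<bar>"
    unfolding norm_mult norm_of_real by simp
  also have "\<dots> \<le> 12 / (real n)\<^sup>2 + 4 * pi * \<bar>\<eta> - of_int k * t\<bar> * (4 / real n)"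
    using b by (intro add_mono mult_left_mono) auto
  also have "12 / (real n)\<^sup>2 \<le> 12 / real n"
    using n by (intro divide_left_mono) (auto simp: power2_eq_square)
  finally show "cmod ((of_real (cutoff2 (real n) (fst (snd p))) - 2 * tau * of_real (\<eta> - of_int k * t) * of_real (cutoff1 (real n) (fst (snd p)))) * carried k l \<eta> t p)
      \<le> (12 + 16 * pi * \<bar>\<eta> - of_int k * t\<bar>) / real n"
    by (simp add: add_divide_distrib mult_ac)
qed (auto intro!: continuous_intros)

context shear_field
begin

lemma continuous_on_section:
  assumes "continuous_on ({0<..} \<times> UNIV) (\<lambda>(t, p). h t (p :: point) :: complex)" "t > 0"
  shows "continuous_on S (h t)"
  using cont_compose[OF assms(1), of S "\<lambda>_. t" "\<lambda>p. p"] assms(2) by (simp add: continuous_intros)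

text \<open>Differentiating the carried wave in time brings down a factor proportional to
  \<open>k * y\<close>. Integrated by parts in \<open>x\<close> it becomes \<open>y * fx\<close>, so
  that only the derivative along the shear remains under the pairing.\<close>

lemma pairing_deriv:
  assumes t: "t > 0" and R: "R > 0"
  shows "((\<lambda>s. pairing R k l \<eta> s (f s)) has_vector_derivative
      pairing R k l \<eta> t (\<lambda>p. ft t p + of_real (fst (snd p)) * fx t p)) (at t)"
proof -
  let ?w = "\<lambda>p :: point. complex_of_real (cutoff R (fst (snd p)))" and ?E = "carried k l \<eta>"
  let ?kt = "\<lambda>p :: point. tau * of_real (of_int k * fst (snd p))"
  have c1: "continuous_on ({0<..} \<times> box3 R) (\<lambda>x. f (fst x) (snd x))"
    and c2: "continuous_on ({0<..} \<times> box3 R) (\<lambda>x. ft (fst x) (snd x))"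
    by (auto intro!: conts continuous_intros)
  note cf = continuous_on_section[OF cont(1) t] continuous_on_section[OF cont(2) t] continuous_on_section[OF cont(3) t]
  have "((\<lambda>s. integral (box3 R) (\<lambda>p. f s p * (?w p * ?E s p))) has_vector_derivative
      integral (box3 R) (\<lambda>p. f t p * (?w p * (?kt p * ?E t p)) + ft t p * (?w p * ?E t p))) (at t within {0<..})"
  proof (rule leibniz_rule_vector_derivative)
    fix s :: real and p assume s: "s \<in> {0<..}"
    show "((\<lambda>s. f s p * (?w p * ?E s p)) has_vector_derivative
        f s p * (?w p * (?kt p * ?E s p)) + ft s p * (?w p * ?E s p)) (at s within {0<..})"
      by (rule has_vector_derivative_at_within)
         (use s in \<open>intro has_vector_derivative_mult has_vector_derivative_mult_right dt carried_derivs, simp\<close>)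
    show "(\<lambda>p. f s p * (?w p * ?E s p)) integrable_on box3 R"
      by (rule integrable_continuous) (use s in \<open>auto intro!: continuous_intros continuous_on_section[OF cont(1)]\<close>)
  next
    show "continuous_on ({0<..} \<times> box3 R) (\<lambda>(s, p). f s p * (?w p * (?kt p * ?E s p)) + ft s p * (?w p * ?E s p))"
      unfolding case_prod_unfold by (intro continuous_intros c1 c2)
  qed (use t in auto)
  hence "((\<lambda>s. pairing R k l \<eta> s (f s)) has_vector_derivative
      integral (box3 R) (\<lambda>p. f t p * (?kt p * (?w p * ?E t p)) + ft t p * (?w p * ?E t p))) (at t)"
    using t by (simp add: pairing_def at_within_open[of t "{0<..}"] mult.left_commute)
  also have "integral (box3 R) (\<lambda>p. f t p * (?kt p * (?w p * ?E t p)) + ft t p * (?w p * ?E t p))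
     = integral (box3 R) (\<lambda>p. f t p * (?kt p * (?w p * ?E t p))) + integral (box3 R) (\<lambda>p. ft t p * (?w p * ?E t p))"
    by (rule integral_add; rule integrable_continuous; intro continuous_intros cf)
  also have "integral (box3 R) (\<lambda>p. f t p * (?kt p * (?w p * ?E t p)))
     = integral (box3 R) (\<lambda>p. of_real (fst (snd p)) * fx t p * (?w p * ?E t p))"
    by (rule green(1)[OF t R, symmetric])
  also have "\<dots> + integral (box3 R) (\<lambda>p. ft t p * (?w p * ?E t p))
     = integral (box3 R) (\<lambda>p. of_real (fst (snd p)) * fx t p * (?w p * ?E t p) + ft t p * (?w p * ?E t p))"
    by (rule integral_add[symmetric]; rule integrable_continuous; intro continuous_intros cf)
  also have "\<dots> = pairing R k l \<eta> t (\<lambda>p. ft t p + of_real (fst (snd p)) * fx t p)"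
    unfolding pairing_def by (simp add: algebra_simps)
  finally show ?thesis .
qed

end

lemma riesz_symbol_measurable [measurable]: "riesz_symbol i j \<in> borel_measurable freq_measure"
proof -
  have "(\<lambda>\<xi>. freq_vec \<xi> $ i) \<in> borel_measurable freq_measure" for i
    using exhaust_3[of i] unfolding freq_measure_def freq_vec_def case_prod_unfold by auto
  moreover have "(\<lambda>\<xi>. (norm (freq_vec \<xi>))\<^sup>2) \<in> borel_measurable freq_measure"
  proof -
    have "(norm (freq_vec \<xi>))\<^sup>2 = (\<Sum>i\<in>UNIV. (freq_vec \<xi> $ i)\<^sup>2)" for \<xi>
      by (simp add: norm_vec_def L2_set_def sum_nonneg)
    thus ?thesis using calculation by simp
  qed
  ultimately show ?thesis unfolding riesz_symbol_def by measurable
qed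

lemma riesz_symbol_bound: "cmod (riesz_symbol i j \<xi>) \<le> 1"
proof -
  let ?v = "freq_vec \<xi>"
  have "\<bar>?v $ i\<bar> * \<bar>?v $ j\<bar> \<le> (norm ?v)\<^sup>2"
    unfolding power2_eq_square by (intro mult_mono component_le_norm_cart) auto
  moreover have "cmod (riesz_symbol i j \<xi>) = \<bar>?v $ i\<bar> * \<bar>?v $ j\<bar> / (norm ?v)\<^sup>2"
    by (simp add: riesz_symbol_def norm_mult norm_divide power2_eq_square)
  ultimately show ?thesis by (simp add: divide_le_eq)
qed

definition freq_sq :: "int \<Rightarrow> int \<Rightarrow> real \<Rightarrow> real \<Rightarrow> real" where
  "freq_sq k l \<eta> t = (of_int k)\<^sup>2 + (\<eta> - of_int k * t)\<^sup>2 + (of_int l)\<^sup>2"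

text \<open>\<open>q\<close> stands for the nonlocal terms. It enters in two ways: as a continuous
  function in the pointwise equation, so that it can be paired over boxes, and through its
  transform, where it is a combination of Riesz multipliers.\<close>

locale shear_system =
  fixes f ft fx fy fz fxx fyy fzz q :: "3 \<Rightarrow> real \<Rightarrow> point \<Rightarrow> complex" and \<nu> :: real
  assumes field: "shear_field (f j) (ft j) (fx j) (fy j) (fz j) (fxx j) (fyy j) (fzz j)"
    and eqn: "t > 0 \<Longrightarrow> ft j t p + of_real (fst (snd p)) * fx j t p
        = of_real \<nu> * (fxx j t p + fyy j t p + fzz j t p) + ((if j = 2 then - f 1 t p else 0) - q j t p)"
    and q_cont: "continuous_on ({0<..} \<times> UNIV) (\<lambda>(t, p). q j t p)"
    and f0_cont: "continuous_on UNIV (f j 0)"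
    and f_sq: "t \<ge> 0 \<Longrightarrow> square_integrable cell (f j t)"
    and f_lim: "t \<ge> 0 \<Longrightarrow> ((\<lambda>s. l2norm cell (\<lambda>p. f j s p - f j t p)) \<longlongrightarrow> 0) (at t within {0..})"
    and q_sq: "t > 0 \<Longrightarrow> square_integrable cell (q j t)"
    and q_norm: "t > 0 \<Longrightarrow> l2norm cell (q j t) \<le> l2norm cell (f 2 t) + l2norm cell (f 1 t)"
    and q_ft: "t > 0 \<Longrightarrow> AE \<xi> in freq_measure. fourier (q j t) \<xi>
        = riesz_symbol j 1 \<xi> * fourier (f 2 t) \<xi> + riesz_symbol j 2 \<xi> * fourier (f 1 t) \<xi>"
begin

lemma f_cont: "t \<ge> 0 \<Longrightarrow> continuous_on UNIV (f j t)"
  using f0_cont shear_field.continuous_on_section[OF field shear_field.cont(1)[OF field], of t]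
  by (cases "t = 0") auto

lemma q_section: "t > 0 \<Longrightarrow> continuous_on UNIV (q j t)"
  by (rule shear_field.continuous_on_section[OF field q_cont])

abbreviation "F R k l j t \<eta> \<equiv> pairing R k l \<eta> t (f j t)"

text \<open>The equation passes to the windowed coefficients exactly, except for the commutator. The
  nonlocal term stays paired as it is, since a multiplier does not commute with a window.\<close>

lemma F_deriv:
  assumes t: "t > 0" and R: "R > 0"
  shows "((\<lambda>s. F R k l j s \<eta>) has_vector_derivative
      - of_real (4 * pi\<^sup>2 * \<nu> * freq_sq k l \<eta> t) * F R k l j t \<eta> + of_real \<nu> * pairing_error R k l \<eta> t (f j t)
      - (if j = 2 then F R k l 1 t \<eta> else 0) - pairing R k l \<eta> t (q j t)) (at t)"
proof -
  interpret shear_field "f j" "ft j" "fx j" "fy j" "fz j" "fxx j" "fyy j" "fzz j" by (rule field)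
  let ?L = "\<lambda>p. fxx j t p + fyy j t p + fzz j t p"
  have cL: "continuous_on UNIV ?L"
    by (intro continuous_intros continuous_on_section[OF cont(4) t] continuous_on_section[OF cont(5) t] continuous_on_section[OF cont(6) t])
  have cq: "continuous_on UNIV (q j t)" by (rule q_section[OF t])
  have c1: "continuous_on UNIV (\<lambda>p. if j = 2 then f 1 t p else 0)"
    using f_cont[of t 1] t by (cases "j = 2") auto
  have "pairing R k l \<eta> t (\<lambda>p. ft j t p + of_real (fst (snd p)) * fx j t p)
      = pairing R k l \<eta> t (\<lambda>p. ((if j = 2 then - f 1 t p else 0) + (-1) * q j t p) + of_real \<nu> * ?L p)"
    by (simp add: eqn[OF t] algebra_simps)
  also have "\<dots> = pairing R k l \<eta> t (\<lambda>p. (if j = 2 then - f 1 t p else 0) + (-1) * q j t p) + of_real \<nu> * pairing R k l \<eta> t ?L"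
  proof (rule pairing_scaleR_diff[OF _ cL])
    show "continuous_on UNIV (\<lambda>p. (if j = 2 then - f 1 t p else 0) + (-1) * q j t p)"
      using f_cont[of t 1] t cq by (cases "j = 2") (auto intro!: continuous_intros)
  qed
  also have "pairing R k l \<eta> t (\<lambda>p. (if j = 2 then - f 1 t p else 0) + (-1) * q j t p)
      = pairing R k l \<eta> t (\<lambda>p. if j = 2 then - f 1 t p else 0) + (-1) * pairing R k l \<eta> t (q j t)"
    by (rule pairing_scaleR_diff[OF _ cq])
       (use f_cont[of t 1] t in \<open>cases "j = 2"; auto intro!: continuous_intros\<close>)
  also have "pairing R k l \<eta> t (\<lambda>p. if j = 2 then - f 1 t p else 0) = - (if j = 2 then F R k l 1 t \<eta> else 0)"
    by (simp add: pairing_def)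
  also have "pairing R k l \<eta> t ?L = - of_real (4 * pi\<^sup>2 * freq_sq k l \<eta> t) * F R k l j t \<eta> + pairing_error R k l \<eta> t (f j t)"
    unfolding pairing_def pairing_error_def freq_sq_def by (rule green(2)[OF t R])
  finally have eq: "pairing R k l \<eta> t (\<lambda>p. ft j t p + of_real (fst (snd p)) * fx j t p)
     = - of_real (4 * pi\<^sup>2 * \<nu> * freq_sq k l \<eta> t) * F R k l j t \<eta> + of_real \<nu> * pairing_error R k l \<eta> t (f j t)
      - (if j = 2 then F R k l 1 t \<eta> else 0) - pairing R k l \<eta> t (q j t)"
    by (simp add: algebra_simps)
  show ?thesis unfolding eq[symmetric] by (rule pairing_deriv[OF t R])
qed

text \<open>The Riesz relation between \<open>q\<close> and the first two components holds for full
  transforms; this is its failure for windowed ones.\<close>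

definition defect :: "nat \<Rightarrow> 3 \<Rightarrow> real \<Rightarrow> freq \<Rightarrow> complex" where
  "defect n j t \<xi> = riesz_symbol j 1 \<xi> * windowed_ft (Suc n) (f 2 t) \<xi>
     + riesz_symbol j 2 \<xi> * windowed_ft (Suc n) (f 1 t) \<xi> - windowed_ft (Suc n) (q j t) \<xi>"

text \<open>Subtracting the exact relation \<open>q_ft\<close> turns the defect into a combination
  of three differences between windowed and full transforms, with coefficients of modulus at most
  1.\<close>

lemma defect_square_integrable:
  assumes t: "t > 0"
  shows "square_integrable freq_measure (defect n j t)"
    and "l2norm freq_measure (defect n j t) \<le> window_error n (f 2 t) + window_error n (f 1 t) + window_error n (q j t)"
proof -
  have b: "AE \<xi> in freq_measure. cmod (riesz_symbol i j \<xi>) \<le> 1" for i j by (intro AE_I2 riesz_symbol_bound)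
  note m = square_integrable_mult_bounded[OF _ riesz_symbol_measurable zero_le_one b]
  have W: "square_integrable freq_measure (windowed_ft (Suc n) (f i t))" "square_integrable freq_measure (fourier (f i t))" for i
    using t by (auto intro!: windowed_ft_square_integrable fourier_square_integrable f_sq)
  have Q: "square_integrable freq_measure (windowed_ft (Suc n) (q j t))" "square_integrable freq_measure (fourier (q j t))"
    using t by (auto intro!: windowed_ft_square_integrable fourier_square_integrable q_sq)
  show s: "square_integrable freq_measure (defect n j t)"
    unfolding defect_def[abs_def] by (intro square_integrable_diff(1) square_integrable_add(1) m(1) W Q)
  let ?D = "\<lambda>g \<xi>. windowed_ft (Suc n) g \<xi> - fourier g \<xi>"
  have D: "square_integrable freq_measure (?D (f i t))" for i by (intro square_integrable_diff(1) W)
  have DQ: "square_integrable freq_measure (?D (q j t))" by (intro square_integrable_diff(1) Q)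
  let ?S = "\<lambda>\<xi>. (riesz_symbol j 1 \<xi> * ?D (f 2 t) \<xi> + riesz_symbol j 2 \<xi> * ?D (f 1 t) \<xi>) - ?D (q j t) \<xi>"
  have sS: "square_integrable freq_measure ?S"
    by (intro square_integrable_diff(1)[of _ "\<lambda>\<xi>. riesz_symbol j 1 \<xi> * ?D (f 2 t) \<xi> + riesz_symbol j 2 \<xi> * ?D (f 1 t) \<xi>"]
        square_integrable_add(1) m(1) D DQ)
  have "l2norm freq_measure (defect n j t) = l2norm freq_measure ?S"
  proof (rule l2norm_cong_AE)
    show "AE \<xi> in freq_measure. defect n j t \<xi> = ?S \<xi>"
      using q_ft[OF t, of j] by eventually_elim (simp add: defect_def algebra_simps)
  qed (use s sS in \<open>auto simp: square_integrable_def\<close>)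
  also have "\<dots> \<le> l2norm freq_measure (\<lambda>\<xi>. riesz_symbol j 1 \<xi> * ?D (f 2 t) \<xi> + riesz_symbol j 2 \<xi> * ?D (f 1 t) \<xi>)
      + l2norm freq_measure (?D (q j t))"
    by (rule square_integrable_diff(2)[OF square_integrable_add(1)[OF m(1)[OF D] m(1)[OF D]] DQ])
  also have "l2norm freq_measure (\<lambda>\<xi>. riesz_symbol j 1 \<xi> * ?D (f 2 t) \<xi> + riesz_symbol j 2 \<xi> * ?D (f 1 t) \<xi>)
      \<le> l2norm freq_measure (\<lambda>\<xi>. riesz_symbol j 1 \<xi> * ?D (f 2 t) \<xi>) + l2norm freq_measure (\<lambda>\<xi>. riesz_symbol j 2 \<xi> * ?D (f 1 t) \<xi>)"
    by (rule square_integrable_add(2)[OF m(1)[OF D] m(1)[OF D]])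
  also have "l2norm freq_measure (\<lambda>\<xi>. riesz_symbol j 1 \<xi> * ?D (f 2 t) \<xi>) \<le> 1 * l2norm freq_measure (?D (f 2 t))"
    by (rule m(2)[OF D])
  also have "l2norm freq_measure (\<lambda>\<xi>. riesz_symbol j 2 \<xi> * ?D (f 1 t) \<xi>) \<le> 1 * l2norm freq_measure (?D (f 1 t))"
    by (rule m(2)[OF D])
  finally show "l2norm freq_measure (defect n j t) \<le> window_error n (f 2 t) + window_error n (f 1 t) + window_error n (q j t)"
    using windowed_ft_error[OF f_sq[OF less_imp_le[OF t]], of n 2] windowed_ft_error[OF f_sq[OF less_imp_le[OF t]], of n 1]
      windowed_ft_error[OF q_sq[OF t], of n j] by simp
qed

text \<open>Continuity in time with values in square integrable functions, on a compact interval.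
  The bound serves as a majorant in time when the window is removed.\<close>

lemma f_norm_bounded:
  assumes T: "T \<ge> 0"
  obtains M where "M \<ge> 0" "\<And>t j. t \<in> {0..T} \<Longrightarrow> l2norm cell (f j t) \<le> M"
proof -
  have "\<exists>M. \<forall>t\<in>{0..T}. l2norm cell (f j t) \<le> M" for j
  proof -
    have "continuous_on {0..T} (\<lambda>t. l2norm cell (f j t))"
      unfolding continuous_on_def
    proof
      fix t assume t: "t \<in> {0..T}"
      have l: "((\<lambda>s. l2norm cell (\<lambda>p. f j s p - f j t p)) \<longlongrightarrow> 0) (at t within {0..T})"
        by (rule tendsto_within_subset[OF f_lim]) (use t in auto)
      show "((\<lambda>s. l2norm cell (f j s)) \<longlongrightarrow> l2norm cell (f j t)) (at t within {0..T})"
      proof (rule LIM_zero_cancel, rule tendsto_rabs_zero_cancel, rule tendsto_sandwich[OF _ _ tendsto_const l])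
        show "\<forall>\<^sub>F s in at t within {0..T}. \<bar>l2norm cell (f j s) - l2norm cell (f j t)\<bar> \<le> l2norm cell (\<lambda>p. f j s p - f j t p)"
          unfolding eventually_at_filter by (rule always_eventually) (use t in \<open>auto intro!: l2norm_diff_abs f_sq\<close>)
      qed auto
    qed
    hence "compact ((\<lambda>t. l2norm cell (f j t)) ` {0..T})" by (rule compact_continuous_image) simp
    then obtain B where "\<forall>x\<in>(\<lambda>t. l2norm cell (f j t)) ` {0..T}. norm x \<le> B"
      using bounded_iff compact_imp_bounded by blast
    thus ?thesis by fastforce
  qed
  then obtain M where M: "\<And>j t. t \<in> {0..T} \<Longrightarrow> l2norm cell (f j t) \<le> M j" by metis
  have M0: "M j \<ge> 0" for j by (rule order_trans[OF l2norm_nonneg M[of 0 j]]) (use T in simp)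
  hence "M j \<le> (\<Sum>j\<in>UNIV. M j)" for j by (intro member_le_sum) auto
  hence "l2norm cell (f j t) \<le> (\<Sum>j\<in>UNIV. M j)" if "t \<in> {0..T}" for j t using M[OF that, of j] order_trans by blast
  thus ?thesis using that M0 by (meson sum_nonneg)
qed

end

lemma continuous_on_pairing_error:
  assumes "continuous_on (T \<times> UNIV) (\<lambda>(t, p). h t p)"
  shows "continuous_on (T \<times> S) (\<lambda>(t, \<eta>). pairing_error R k l \<eta> t (h t))"
proof -
  have c: "continuous_on ((T \<times> S) \<times> box3 R) (\<lambda>x. h (fst (fst x)) (snd x))"
  proof -
    have "continuous_on ((T \<times> S) \<times> box3 R) (\<lambda>x. (\<lambda>(t, p). h t p) (fst (fst x), snd x))"
      by (rule continuous_on_compose2[OF assms]) (auto intro!: continuous_intros)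
    thus ?thesis by simp
  qed
  have "continuous_on (T \<times> S) (\<lambda>x. integral (box3 R)
      (\<lambda>p. h (fst x) p * ((of_real (cutoff2 R (fst (snd p)))
      - 2 * tau * of_real (snd x - of_int k * fst x) * of_real (cutoff1 R (fst (snd p)))) * carried k l (snd x) (fst x) p)))"
    by (rule integral_continuous_on_param, unfold case_prod_unfold) (intro continuous_intros c)
  thus ?thesis by (simp add: pairing_error_def case_prod_unfold)
qed

lemma continuous_on_snd_section:
  assumes "continuous_on (T \<times> S) (\<lambda>x. g (fst x) (snd x))" "t \<in> T"
  shows "continuous_on S (g t)"
proof -
  have "continuous_on S ((\<lambda>x. g (fst x) (snd x)) \<circ> (\<lambda>y. (t, y)))"
    by (rule continuous_on_compose, intro continuous_on_Pair continuous_on_const continuous_on_id,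
        rule continuous_on_subset[OF assms(1)]) (use assms(2) in auto)
  thus ?thesis by (simp add: o_def)
qed

lemma windowed_ft_diff_le:
  assumes f: "square_integrable cell f" and g: "square_integrable cell g" and n: "n > 0"
  shows "l2norm freq_measure (\<lambda>\<xi>. windowed_ft n f \<xi> - windowed_ft n g \<xi>) \<le> l2norm cell (\<lambda>p. f p - g p)"
proof -
  note W = windowed_square_integrable[OF f n] windowed_square_integrable[OF g n]
  have D: "square_integrable cell (\<lambda>p. window n p * (f p - g p))"
    by (intro windowed_square_integrable square_integrable_diff(1) f g n)
  have "windowed_ft n f \<xi> - windowed_ft n g \<xi> = kernel_int cell (slab n) fkernel (\<lambda>p. window n p * (f p - g p)) \<xi>" for \<xi>
    unfolding windowed_ft_def right_diff_distrib by (rule ft.kernel_int_diff[OF W, symmetric]) simp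
  hence "l2norm freq_measure (\<lambda>\<xi>. windowed_ft n f \<xi> - windowed_ft n g \<xi>)
      = l2norm freq_measure (kernel_int cell (slab n) fkernel (\<lambda>p. window n p * (f p - g p)))" by simp
  also have "\<dots> \<le> l2norm cell (\<lambda>p. indicator (slab n) p * (window n p * (f p - g p)))"
    using ft_contractive D unfolding l2_contractive_def by blast
  also have "\<dots> \<le> l2norm cell (\<lambda>p. window n p * (f p - g p))"
    by (rule square_integrable_indicator(2)[OF D ft.A_sets])
  also have "\<dots> \<le> 1 * l2norm cell (\<lambda>p. f p - g p)"
    by (rule square_integrable_mult_bounded(2)) (auto intro!: square_integrable_diff(1) f g window_bounds(1) n)
  finally show ?thesis by simp
qed

text \<open>The Lebesgue form suits almost everywhere statements, the gauge form suits the Leibniz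
  rule; this connects the two.\<close>

lemma slice_eq_integral:
  assumes X: "square_integrable freq_measure X" and \<beta>: "continuous_on {a..b} \<beta>" and ab: "a \<le> b"
  shows "(\<lambda>\<eta>. \<beta> \<eta> * X (shear t (k, \<eta>, l))) integrable_on {a..b}"
    and "slice k l a b t \<beta> X = integral {a..b} (\<lambda>\<eta>. \<beta> \<eta> * X (shear t (k, \<eta>, l)))"
proof -
  have "compact (\<beta> ` {a..b})" by (intro compact_continuous_image \<beta>) simp
  then obtain B where B: "\<And>\<eta>. \<eta> \<in> {a..b} \<Longrightarrow> cmod (\<beta> \<eta>) \<le> B"
    by (meson bounded_iff compact_imp_bounded imageI)
  note set_borel_integral_eq_integral[OF slice_bound(1)[OF X \<beta> B ab, of t k l]]
  thus "(\<lambda>\<eta>. \<beta> \<eta> * X (shear t (k, \<eta>, l))) integrable_on {a..b}"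
    "slice k l a b t \<beta> X = integral {a..b} (\<lambda>\<eta>. \<beta> \<eta> * X (shear t (k, \<eta>, l)))" by (simp_all add: slice_def)
qed

text \<open>The weights solve the adjoint system: requiring the identity for every \<open>V\<close>
  is a compact way to equate the coefficients of \<open>V 1\<close>, \<open>V 2\<close> and
  \<open>V 3\<close>. The sum of weights times Fourier coefficients is then formally constant in
  time.\<close>

locale adjoint_solution = shear_system +
  fixes \<beta> \<beta>' :: "3 \<Rightarrow> real \<Rightarrow> real \<Rightarrow> complex" and k l :: int
  assumes d\<beta>: "((\<lambda>s. \<beta> j s \<eta>) has_vector_derivative \<beta>' j t \<eta>) (at t)"
    and cont\<beta>: "continuous_on UNIV (\<lambda>(t, \<eta>). \<beta> j t \<eta>)" "continuous_on UNIV (\<lambda>(t, \<eta>). \<beta>' j t \<eta>)"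
    and adjoint_eqn: "(\<Sum>j\<in>UNIV. \<beta>' j t \<eta> * V j) = of_real (4 * pi\<^sup>2 * \<nu> * freq_sq k l \<eta> t) * (\<Sum>j\<in>UNIV. \<beta> j t \<eta> * V j)
        + \<beta> 2 t \<eta> * V 1
        + (\<Sum>j\<in>UNIV. \<beta> j t \<eta> * (riesz_symbol j 1 (shear t (k, \<eta>, l)) * V 2 + riesz_symbol j 2 (shear t (k, \<eta>, l)) * V 1))"
begin

lemma cont\<beta>_compose: "continuous_on S x \<Longrightarrow> continuous_on S y \<Longrightarrow> continuous_on S (\<lambda>s. \<beta> j (x s) (y s))"
    "continuous_on S x \<Longrightarrow> continuous_on S y \<Longrightarrow> continuous_on S (\<lambda>s. \<beta>' j (x s) (y s))"
  using continuous_on_compose2[OF cont\<beta>(1), of S "\<lambda>s. (x s, y s)"]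
    continuous_on_compose2[OF cont\<beta>(2), of S "\<lambda>s. (x s, y s)"]
  by (auto intro!: continuous_intros)

text \<open>The field \<open>g\<close> is an argument separate from the time, so that the time
  dependence of the weights and that of the field can be varied independently.\<close>

definition G :: "real \<Rightarrow> real \<Rightarrow> nat \<Rightarrow> real \<Rightarrow> (3 \<Rightarrow> point \<Rightarrow> complex) \<Rightarrow> complex" where
  "G a b n t g = integral {a..b} (\<lambda>\<eta>. \<Sum>j\<in>UNIV. \<beta> j t \<eta> * pairing (real (Suc n)) k l \<eta> t (g j))"

lemma G_eq_slices:
  assumes g: "\<And>j. continuous_on UNIV (g j)" "\<And>j. square_integrable cell (g j)" and ab: "a \<le> b"
  shows "G a b n t g = (\<Sum>j\<in>UNIV. slice k l a b t (\<beta> j t) (windowed_ft (Suc n) (g j)))"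
proof -
  note s = slice_eq_integral[OF windowed_ft_square_integrable[OF g(2) zero_less_Suc] cont\<beta>_compose(1)[OF continuous_on_const continuous_on_id] ab]
  have "G a b n t g = integral {a..b} (\<lambda>\<eta>. \<Sum>j\<in>UNIV. \<beta> j t \<eta> * windowed_ft (Suc n) (g j) (shear t (k, \<eta>, l)))"
    unfolding G_def by (simp only: pairing_eq_windowed_ft[OF g(1)])
  also have "\<dots> = (\<Sum>j\<in>UNIV. integral {a..b} (\<lambda>\<eta>. \<beta> j t \<eta> * windowed_ft (Suc n) (g j) (shear t (k, \<eta>, l))))"
    by (rule integral_sum) (auto intro!: s(1))
  finally show ?thesis by (simp only: s(2))
qed

lemma slice_sum_bound:
  assumes X: "\<And>j. square_integrable freq_measure (X j)" and ab: "a \<le> b"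
    and B: "\<And>j \<eta>. \<eta> \<in> {a..b} \<Longrightarrow> cmod (\<beta> j t \<eta>) \<le> B"
  shows "cmod (\<Sum>j\<in>UNIV. slice k l a b t (\<beta> j t) (X j)) \<le> (\<Sum>j\<in>UNIV. B * sqrt (b - a) * l2norm freq_measure (X j))"
  by (rule sum_norm_le) (rule slice_bound(2)[OF X cont\<beta>_compose(1)[OF continuous_on_const continuous_on_id] B ab])

lemma \<beta>_bounded:
  obtains B where "B \<ge> 0" "\<And>j t \<eta>. t \<in> {0..T} \<Longrightarrow> \<eta> \<in> {a..b} \<Longrightarrow> cmod (\<beta> j t \<eta>) \<le> B"
proof -
  have "\<exists>B. \<forall>t\<in>{0..T}. \<forall>\<eta>\<in>{a..b}. cmod (\<beta> j t \<eta>) \<le> B" for j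
  proof -
    have "compact ((\<lambda>(t, \<eta>). \<beta> j t \<eta>) ` ({0..T} \<times> {a..b}))"
      by (intro compact_continuous_image continuous_on_subset[OF cont\<beta>(1)] compact_Times) auto
    then obtain B where "\<forall>x\<in>(\<lambda>(t, \<eta>). \<beta> j t \<eta>) ` ({0..T} \<times> {a..b}). norm x \<le> B"
      using bounded_iff compact_imp_bounded by blast
    thus ?thesis by fastforce
  qed
  then obtain B where B: "\<And>j t \<eta>. t \<in> {0..T} \<Longrightarrow> \<eta> \<in> {a..b} \<Longrightarrow> cmod (\<beta> j t \<eta>) \<le> B j" by metis
  have "B j \<le> (\<Sum>j\<in>UNIV. \<bar>B j\<bar>)" for j
    using member_le_sum[of j UNIV "\<lambda>j. \<bar>B j\<bar>"] abs_ge_self[of "B j"] by auto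
  hence le: "cmod (\<beta> j t \<eta>) \<le> (\<Sum>j\<in>UNIV. \<bar>B j\<bar>)" if "t \<in> {0..T}" "\<eta> \<in> {a..b}" for j t \<eta>
    using B[OF that, of j] order_trans by blast
  show ?thesis by (rule that[OF sum_nonneg le]) auto
qed

text \<open>At the initial time the field is continuous in time only in the mean. Freezing the field
  leaves an integral that depends continuously on time; the remaining change is controlled by the
  mean distance of the fields.\<close>

lemma G_continuous:
  assumes T: "T \<ge> 0" and ab: "a \<le> b"
  shows "continuous_on {0..T} (\<lambda>t. G a b n t (\<lambda>j. f j t))"
  unfolding continuous_on_def
proof
  fix t assume t: "t \<in> {0..T}"
  obtain B where B: "B \<ge> 0" "\<And>j t \<eta>. t \<in> {0..T} \<Longrightarrow> \<eta> \<in> {a..b} \<Longrightarrow> cmod (\<beta> j t \<eta>) \<le> B"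
    using \<beta>_bounded[of T a b] by blast
  let ?g = "\<lambda>j. f j t"
  have cg: "continuous_on UNIV (?g j)" and sg: "square_integrable cell (?g j)" for j
    using t by (auto intro!: f_cont f_sq)
  have "continuous_on {0..T} (\<lambda>s. G a b n s ?g)"
  proof -
    have "continuous_on ({0..T} \<times> {a..b}) (\<lambda>x. pairing (real (Suc n)) k l (snd x) (fst x) (?g j))" for j
    proof -
      have "continuous_on (UNIV \<times> UNIV) (\<lambda>(s, p). ?g j p)" unfolding case_prod_unfold
        by (rule continuous_on_compose2[OF cg]) (auto intro!: continuous_intros)
      hence "continuous_on ({0..T} \<times> UNIV) (\<lambda>(s, p). ?g j p)" by (rule continuous_on_subset) auto
      from continuous_on_pairing[OF this, of "{a..b}" "real (Suc n)" k l] show ?thesis by (simp add: case_prod_unfold)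
    qed
    hence "continuous_on ({0..T} \<times> cbox a b) (\<lambda>(s, \<eta>). \<Sum>j\<in>UNIV. \<beta> j s \<eta> * pairing (real (Suc n)) k l \<eta> s (?g j))"
      unfolding case_prod_unfold by (intro continuous_intros cont\<beta>_compose) auto
    from integral_continuous_on_param[OF this] show ?thesis by (simp add: G_def)
  qed
  hence c: "((\<lambda>s. G a b n s ?g) \<longlongrightarrow> G a b n t ?g) (at t within {0..T})" using t by (simp add: continuous_on_def)
  have lim: "((\<lambda>s. \<Sum>j\<in>UNIV. B * sqrt (b - a) * l2norm cell (\<lambda>p. f j s p - f j t p)) \<longlongrightarrow> (\<Sum>j\<in>(UNIV::3 set). B * sqrt (b - a) * 0)) (at t within {0..T})"
    by (intro tendsto_intros tendsto_within_subset[OF f_lim]) (use t in auto)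
  have "((\<lambda>s. G a b n s (\<lambda>j. f j s) - G a b n s ?g) \<longlongrightarrow> 0) (at t within {0..T})"
  proof (rule Lim_null_comparison[OF _ lim[simplified]])
    show "\<forall>\<^sub>F s in at t within {0..T}. norm (G a b n s (\<lambda>j. f j s) - G a b n s ?g)
        \<le> (\<Sum>j\<in>UNIV. B * sqrt (b - a) * l2norm cell (\<lambda>p. f j s p - f j t p))"
      unfolding eventually_at_filter
    proof (rule always_eventually, intro allI impI)
      fix s assume s: "s \<in> {0..T}"
      have cs: "continuous_on UNIV (f j s)" and ss: "square_integrable cell (f j s)" for j
        using s by (auto intro!: f_cont f_sq)
      have W: "square_integrable freq_measure (windowed_ft (Suc n) (f j s))" "square_integrable freq_measure (windowed_ft (Suc n) (?g j))" for j
        by (intro windowed_ft_square_integrable ss sg zero_less_Suc)+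
      have "G a b n s (\<lambda>j. f j s) - G a b n s ?g
          = (\<Sum>j\<in>UNIV. slice k l a b s (\<beta> j s) (\<lambda>\<xi>. windowed_ft (Suc n) (f j s) \<xi> - windowed_ft (Suc n) (?g j) \<xi>))"
        unfolding G_eq_slices[OF cs ss ab] G_eq_slices[OF cg sg ab] sum_subtractf[symmetric]
        by (intro sum.cong refl slice_diff[OF W cont\<beta>_compose(1)[OF continuous_on_const continuous_on_id] ab, symmetric])
      also have "norm \<dots> \<le> (\<Sum>j\<in>UNIV. B * sqrt (b - a) * l2norm freq_measure (\<lambda>\<xi>. windowed_ft (Suc n) (f j s) \<xi> - windowed_ft (Suc n) (?g j) \<xi>))"
        by (rule slice_sum_bound[OF square_integrable_diff(1)[OF W] ab B(2)[OF s]])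
      also have "\<dots> \<le> (\<Sum>j\<in>UNIV. B * sqrt (b - a) * l2norm cell (\<lambda>p. f j s p - f j t p))"
        using B(1) ab by (intro sum_mono mult_left_mono windowed_ft_diff_le ss sg) auto
      finally show "norm (G a b n s (\<lambda>j. f j s) - G a b n s ?g) \<le> (\<Sum>j\<in>UNIV. B * sqrt (b - a) * l2norm cell (\<lambda>p. f j s p - f j t p))" .
    qed
  qed
  from tendsto_add[OF this c] show "((\<lambda>s. G a b n s (\<lambda>j. f j s)) \<longlongrightarrow> G a b n t ?g) (at t within {0..T})" by simp
qed

definition G' :: "real \<Rightarrow> real \<Rightarrow> nat \<Rightarrow> real \<Rightarrow> complex" where
  "G' a b n t = integral {a..b} (\<lambda>\<eta>. \<Sum>j\<in>UNIV. \<beta> j t \<eta> * (of_real \<nu> * pairing_error (real (Suc n)) k l \<eta> t (f j t)))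
     + (\<Sum>j\<in>UNIV. slice k l a b t (\<beta> j t) (defect n j t))"

text \<open>The adjoint equation, applied to the vector of windowed coefficients, cancels the
  dissipation, the coupling of the second component to the first and the Riesz terms. Left over are
  the commutator with the cutoff and the defect of the Riesz relation, the two parts of
  \<open>G'\<close>.\<close>

lemma G_deriv:
  assumes t: "t > 0" and ab: "a \<le> b"
  shows "((\<lambda>s. G a b n s (\<lambda>j. f j s)) has_vector_derivative G' a b n t) (at t)"
proof -
  let ?R = "real (Suc n)"
  define H where "H s \<eta> = (\<Sum>j\<in>UNIV. \<beta> j s \<eta> * (- of_real (4 * pi\<^sup>2 * \<nu> * freq_sq k l \<eta> s) * F ?R k l j s \<eta> + of_real \<nu> * pairing_error ?R k l \<eta> s (f j s)
      - (if j = 2 then F ?R k l 1 s \<eta> else 0) - pairing ?R k l \<eta> s (q j s)) + \<beta>' j s \<eta> * F ?R k l j s \<eta>)" for s \<eta>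
  have cF: "continuous_on ({0<..} \<times> {a..b}) (\<lambda>x. F ?R k l j (fst x) (snd x))"
      "continuous_on ({0<..} \<times> {a..b}) (\<lambda>x. pairing ?R k l (snd x) (fst x) (q j (fst x)))"
      "continuous_on ({0<..} \<times> {a..b}) (\<lambda>x. pairing_error ?R k l (snd x) (fst x) (f j (fst x)))" for j
    using continuous_on_pairing[OF shear_field.cont(1)[OF field], of "{a..b}" ?R k l j]
      continuous_on_pairing[OF q_cont, of "{a..b}" ?R k l j]
      continuous_on_pairing_error[OF shear_field.cont(1)[OF field], of "{a..b}" ?R k l j]
    by (simp_all add: case_prod_unfold)
  have cif: "continuous_on ({0<..} \<times> {a..b}) (\<lambda>x. if j = 2 then F ?R k l 1 (fst x) (snd x) else 0)" for j :: 3
    using cF(1)[of 1] by (cases "j = 2") auto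
  have "((\<lambda>s. integral (cbox a b) (\<lambda>\<eta>. \<Sum>j\<in>UNIV. \<beta> j s \<eta> * F ?R k l j s \<eta>)) has_vector_derivative integral (cbox a b) (H t)) (at t within {0<..})"
  proof (rule leibniz_rule_vector_derivative)
    fix s \<eta> assume s: "s \<in> {0::real<..}"
    show "((\<lambda>s. \<Sum>j\<in>UNIV. \<beta> j s \<eta> * F ?R k l j s \<eta>) has_vector_derivative H s \<eta>) (at s within {0<..})"
      unfolding H_def
      by (rule has_vector_derivative_at_within, rule has_vector_derivative_sum, rule has_vector_derivative_mult[OF d\<beta> F_deriv])
         (use s in auto)
    have "continuous_on {a..b} (\<lambda>\<eta>. F ?R k l j s \<eta>)" for j
      by (rule continuous_on_snd_section[OF cF(1) s])
    thus "(\<lambda>\<eta>. \<Sum>j\<in>UNIV. \<beta> j s \<eta> * F ?R k l j s \<eta>) integrable_on cbox a b"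
      by (intro integrable_continuous continuous_intros cont\<beta>_compose) auto
  next
    show "continuous_on ({0<..} \<times> cbox a b) (\<lambda>(s, \<eta>). H s \<eta>)"
      unfolding H_def case_prod_unfold freq_sq_def by (intro continuous_intros cont\<beta>_compose) (use cF cif in auto)
  qed (use t in auto)
  hence "((\<lambda>s. G a b n s (\<lambda>j. f j s)) has_vector_derivative integral {a..b} (H t)) (at t)"
    using t by (simp add: G_def at_within_open[of t "{0<..}"])
  also have "integral {a..b} (H t) = G' a b n t"
  proof -
    have cs: "continuous_on UNIV (f j t)" for j using t by (auto intro!: f_cont)
    have H: "H t \<eta> = (\<Sum>j\<in>UNIV. \<beta> j t \<eta> * (of_real \<nu> * pairing_error ?R k l \<eta> t (f j t)))
        + (\<Sum>j\<in>UNIV. \<beta> j t \<eta> * defect n j t (shear t (k, \<eta>, l)))" for \<eta>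
    proof -
      let ?F = "\<lambda>j. F ?R k l j t \<eta>" and ?P = "4 * pi\<^sup>2 * \<nu> * freq_sq k l \<eta> t"
      let ?r = "\<lambda>i j. riesz_symbol i j (shear t (k, \<eta>, l))"
      have F: "windowed_ft (Suc n) (f j t) (shear t (k, \<eta>, l)) = ?F j" for j
        by (rule pairing_eq_windowed_ft[OF cs, symmetric])
      have Q: "windowed_ft (Suc n) (q j t) (shear t (k, \<eta>, l)) = pairing ?R k l \<eta> t (q j t)" for j
        by (rule pairing_eq_windowed_ft[OF q_section[OF t], symmetric])
      have if2: "(\<Sum>j\<in>UNIV. \<beta> j t \<eta> * (if j = 2 then ?F 1 else 0)) = \<beta> 2 t \<eta> * ?F 1"
        by (simp add: if_distrib[of "(*) _"] sum.delta cong: if_cong)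
      have "H t \<eta> = (\<Sum>j\<in>UNIV. \<beta> j t \<eta> * (of_real \<nu> * pairing_error ?R k l \<eta> t (f j t)))
          - of_real ?P * (\<Sum>j\<in>UNIV. \<beta> j t \<eta> * ?F j) - (\<Sum>j\<in>UNIV. \<beta> j t \<eta> * (if j = 2 then ?F 1 else 0))
          - (\<Sum>j\<in>UNIV. \<beta> j t \<eta> * pairing ?R k l \<eta> t (q j t)) + (\<Sum>j\<in>UNIV. \<beta>' j t \<eta> * ?F j)"
        unfolding H_def sum_distrib_left sum_subtractf[symmetric] sum.distrib[symmetric]
        by (rule sum.cong) (simp_all add: algebra_simps)
      also have "\<dots> = (\<Sum>j\<in>UNIV. \<beta> j t \<eta> * (of_real \<nu> * pairing_error ?R k l \<eta> t (f j t)))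
          + ((\<Sum>j\<in>UNIV. \<beta> j t \<eta> * (?r j 1 * ?F 2 + ?r j 2 * ?F 1)) - (\<Sum>j\<in>UNIV. \<beta> j t \<eta> * pairing ?R k l \<eta> t (q j t)))"
        unfolding adjoint_eqn if2 by simp
      also have "(\<Sum>j\<in>UNIV. \<beta> j t \<eta> * (?r j 1 * ?F 2 + ?r j 2 * ?F 1)) - (\<Sum>j\<in>UNIV. \<beta> j t \<eta> * pairing ?R k l \<eta> t (q j t))
          = (\<Sum>j\<in>UNIV. \<beta> j t \<eta> * defect n j t (shear t (k, \<eta>, l)))"
        unfolding sum_subtractf[symmetric] defect_def F Q by (simp only: right_diff_distrib)
      finally show ?thesis .
    qed
    have ce: "continuous_on {a..b} (\<lambda>\<eta>. pairing_error ?R k l \<eta> t (f j t))" for j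
      using continuous_on_snd_section[OF cF(3)[of j], of t] t by simp
    note s = slice_eq_integral[OF defect_square_integrable(1)[OF t] cont\<beta>_compose(1)[OF continuous_on_const continuous_on_id] ab]
    have "integral {a..b} (H t) = integral {a..b} (\<lambda>\<eta>. \<Sum>j\<in>UNIV. \<beta> j t \<eta> * (of_real \<nu> * pairing_error ?R k l \<eta> t (f j t)))
        + integral {a..b} (\<lambda>\<eta>. \<Sum>j\<in>UNIV. \<beta> j t \<eta> * defect n j t (shear t (k, \<eta>, l)))"
      unfolding H
    proof (rule integral_add)
      show "(\<lambda>\<eta>. \<Sum>j\<in>UNIV. \<beta> j t \<eta> * (of_real \<nu> * pairing_error ?R k l \<eta> t (f j t))) integrable_on {a..b}"
        by (intro integrable_continuous_real continuous_intros cont\<beta>_compose ce)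
      show "(\<lambda>\<eta>. \<Sum>j\<in>UNIV. \<beta> j t \<eta> * defect n j t (shear t (k, \<eta>, l))) integrable_on {a..b}"
        by (intro integrable_sum s(1)) auto
    qed
    also have "integral {a..b} (\<lambda>\<eta>. \<Sum>j\<in>UNIV. \<beta> j t \<eta> * defect n j t (shear t (k, \<eta>, l)))
        = (\<Sum>j\<in>UNIV. integral {a..b} (\<lambda>\<eta>. \<beta> j t \<eta> * defect n j t (shear t (k, \<eta>, l))))"
      by (rule integral_sum) (auto intro!: s(1))
    finally show ?thesis unfolding G'_def by (simp only: s(2))
  qed
  finally show ?thesis .
qed

text \<open>The commutator part decays uniformly in time, while the defect part is bounded by window
  errors that are known to tend to zero only at each fixed time.\<close>

lemma G'_bound:
  assumes ab: "a \<le> b" and \<nu>: "\<nu> \<ge> 0"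
    and B: "B \<ge> 0" "\<And>j t \<eta>. t \<in> {0..T} \<Longrightarrow> \<eta> \<in> {a..b} \<Longrightarrow> cmod (\<beta> j t \<eta>) \<le> B"
    and M: "M \<ge> 0" "\<And>t j. t \<in> {0..T} \<Longrightarrow> l2norm cell (f j t) \<le> M"
  obtains C where "C \<ge> 0"
    "\<And>n t. t \<in> {0<..<T} \<Longrightarrow> cmod (G' a b n t) \<le> C / sqrt (real (Suc n)) + B * sqrt (b - a) *
        (\<Sum>j\<in>UNIV. window_error n (f 2 t) + window_error n (f 1 t) + window_error n (q j t))"
proof -
  \<comment> \<open>Bounds the sheared y-frequency for \<eta> in [a, b] and times up to
    \<open>T\<close>. The 3 in \<open>K\<close> counts the components.\<close>
  define Z where "Z = \<bar>a\<bar> + \<bar>b\<bar> + \<bar>of_int k\<bar> * \<bar>T\<bar>"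
  define K where "K = 3 * (B * (\<nu> * ((12 + 16 * pi * Z) * sqrt 2 * M)))"
  have Z0: "Z \<ge> 0" by (simp add: Z_def)
  have K0: "K \<ge> 0" unfolding K_def using Z0 B(1) M(1) \<nu> by (intro mult_nonneg_nonneg add_nonneg_nonneg) auto
  have le: "cmod (G' a b n t) \<le> (K * (b - a)) / sqrt (real (Suc n)) + B * sqrt (b - a) *
        (\<Sum>j\<in>UNIV. window_error n (f 2 t) + window_error n (f 1 t) + window_error n (q j t))"
    if t: "t \<in> {0<..<T}" for n t
  proof -
    let ?R = "real (Suc n)"
    have t': "t > 0" "t \<in> {0..T}" "t \<ge> 0" using t by auto
    have pt: "cmod (\<Sum>j\<in>UNIV. \<beta> j t \<eta> * (of_real \<nu> * pairing_error ?R k l \<eta> t (f j t))) \<le> K / sqrt ?R"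
      if \<eta>: "\<eta> \<in> {a..b}" for \<eta>
    proof -
      have z: "\<bar>\<eta> - of_int k * t\<bar> \<le> Z"
      proof -
        have "\<bar>\<eta> - of_int k * t\<bar> \<le> \<bar>\<eta>\<bar> + \<bar>of_int k\<bar> * \<bar>t\<bar>" by (metis abs_mult abs_triangle_ineq4)
        also have "\<dots> \<le> (\<bar>a\<bar> + \<bar>b\<bar>) + \<bar>of_int k\<bar> * \<bar>T\<bar>"
          using \<eta> t by (intro add_mono mult_left_mono) auto
        finally show ?thesis by (simp add: Z_def)
      qed
      have "sqrt (2 * r) / r = sqrt 2 / sqrt r" if "r > 0" for r :: real
        using that by (simp add: real_sqrt_mult divide_simps)
      from this[of ?R] have sR: "sqrt (2 * ?R) / ?R = sqrt 2 / sqrt ?R" by simp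
      have "cmod (pairing_error ?R k l \<eta> t (f j t)) \<le> (12 + 16 * pi * Z) * (sqrt 2 / sqrt ?R) * M" for j
      proof -
        have "cmod (pairing_error ?R k l \<eta> t (f j t))
            \<le> (12 + 16 * pi * \<bar>\<eta> - of_int k * t\<bar>) / ?R * sqrt (2 * ?R) * l2norm cell (f j t)"
          by (rule pairing_error_bound[OF f_cont[OF t'(3)] f_sq[OF t'(3)] zero_less_Suc])
        also have "\<dots> = (12 + 16 * pi * \<bar>\<eta> - of_int k * t\<bar>) * (sqrt (2 * ?R) / ?R) * l2norm cell (f j t)" by simp
        also have "\<dots> \<le> (12 + 16 * pi * Z) * (sqrt (2 * ?R) / ?R) * M"
          using z M(2)[OF t'(2)] Z0 by (intro mult_mono add_mono mult_left_mono mult_nonneg_nonneg add_nonneg_nonneg) auto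
        finally show ?thesis unfolding sR .
      qed
      hence "cmod (\<beta> j t \<eta> * (of_real \<nu> * pairing_error ?R k l \<eta> t (f j t))) \<le> B * (\<nu> * ((12 + 16 * pi * Z) * (sqrt 2 / sqrt ?R) * M))" for j
        using B(2)[OF t'(2) \<eta>] B(1) \<nu> unfolding norm_mult norm_of_real by (intro mult_mono) auto
      hence "cmod (\<Sum>j\<in>UNIV. \<beta> j t \<eta> * (of_real \<nu> * pairing_error ?R k l \<eta> t (f j t)))
          \<le> (\<Sum>j\<in>(UNIV :: 3 set). B * (\<nu> * ((12 + 16 * pi * Z) * (sqrt 2 / sqrt ?R) * M)))"
        by (intro sum_norm_le) auto
      also have "\<dots> = K / sqrt ?R" by (simp add: K_def)
      finally show ?thesis .
    qed
    have "continuous_on {a..b} (\<lambda>\<eta>. pairing_error ?R k l \<eta> t (f j t))" for j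
      using continuous_on_snd_section[OF continuous_on_pairing_error[OF shear_field.cont(1)[OF field], of "{a..b}" ?R k l j, unfolded case_prod_unfold], of t] t'(1)
      by simp
    hence 1: "cmod (integral {a..b} (\<lambda>\<eta>. \<Sum>j\<in>UNIV. \<beta> j t \<eta> * (of_real \<nu> * pairing_error ?R k l \<eta> t (f j t)))) \<le> K / sqrt ?R * (b - a)"
      by (intro integral_bound ab pt continuous_intros cont\<beta>_compose)
    have "cmod (\<Sum>j\<in>UNIV. slice k l a b t (\<beta> j t) (defect n j t)) \<le> (\<Sum>j\<in>UNIV. B * sqrt (b - a) * l2norm freq_measure (defect n j t))"
      by (rule slice_sum_bound[OF defect_square_integrable(1)[OF t'(1)] ab B(2)[OF t'(2)]])
    also have "\<dots> \<le> (\<Sum>j\<in>UNIV. B * sqrt (b - a) * (window_error n (f 2 t) + window_error n (f 1 t) + window_error n (q j t)))"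
      using B(1) ab by (intro sum_mono mult_left_mono defect_square_integrable(2)[OF t'(1)]) auto
    finally have 2: "cmod (\<Sum>j\<in>UNIV. slice k l a b t (\<beta> j t) (defect n j t))
        \<le> B * sqrt (b - a) * (\<Sum>j\<in>UNIV. window_error n (f 2 t) + window_error n (f 1 t) + window_error n (q j t))"
      by (simp only: sum_distrib_left)
    show ?thesis unfolding G'_def
      using norm_triangle_mono[OF 1 2] by simp
  qed
  show ?thesis by (rule that[of "K * (b - a)"]) (use K0 ab le in auto)
qed

text \<open>The increment of \<open>G\<close> over [0, T] is the integral of its derivative. As the
  window widens, the increment tends to that of the full functional, while the integral tends to
  zero by dominated convergence in time.\<close>

lemma slice_conserved:
  assumes ab: "a < b" and T: "T \<ge> 0" and \<nu>: "\<nu> \<ge> 0"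
  shows "(\<Sum>j\<in>UNIV. slice k l a b T (\<beta> j T) (fourier (f j T))) = (\<Sum>j\<in>UNIV. slice k l a b 0 (\<beta> j 0) (fourier (f j 0)))"
proof -
  have ab': "a \<le> b" using ab by simp
  obtain B where B: "B \<ge> 0" "\<And>j t \<eta>. t \<in> {0..T} \<Longrightarrow> \<eta> \<in> {a..b} \<Longrightarrow> cmod (\<beta> j t \<eta>) \<le> B"
    using \<beta>_bounded[of T a b] by blast
  obtain M where M: "M \<ge> 0" "\<And>t j. t \<in> {0..T} \<Longrightarrow> l2norm cell (f j t) \<le> M"
    using f_norm_bounded[OF T] by blast
  obtain C where C: "C \<ge> 0" "\<And>n t. t \<in> {0<..<T} \<Longrightarrow> cmod (G' a b n t) \<le> C / sqrt (real (Suc n)) + B * sqrt (b - a) *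
        (\<Sum>j\<in>UNIV. window_error n (f 2 t) + window_error n (f 1 t) + window_error n (q j t))"
    using G'_bound[OF ab' \<nu> B M] by blast
  let ?G = "\<lambda>n t. G a b n t (\<lambda>j. f j t)"
  let ?S = "\<lambda>t. \<Sum>j\<in>UNIV. slice k l a b t (\<beta> j t) (fourier (f j t))"
  have GS: "(\<lambda>n. ?G n t) \<longlonglongrightarrow> ?S t" if t: "t \<in> {0..T}" for t
  proof -
    have cs: "continuous_on UNIV (f j t)" and ss: "square_integrable cell (f j t)" for j
      using t by (auto intro!: f_cont f_sq)
    have W: "square_integrable freq_measure (windowed_ft (Suc n) (f j t))" "square_integrable freq_measure (fourier (f j t))" for n j
      by (intro windowed_ft_square_integrable fourier_square_integrable ss zero_less_Suc)+
    have le: "cmod (?G n t - ?S t) \<le> (\<Sum>j\<in>UNIV. B * sqrt (b - a) * window_error n (f j t))" for n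
    proof -
      have "?G n t - ?S t = (\<Sum>j\<in>UNIV. slice k l a b t (\<beta> j t) (\<lambda>\<xi>. windowed_ft (Suc n) (f j t) \<xi> - fourier (f j t) \<xi>))"
        unfolding G_eq_slices[OF cs ss ab'] sum_subtractf[symmetric]
        by (intro sum.cong refl slice_diff[OF W cont\<beta>_compose(1)[OF continuous_on_const continuous_on_id] ab', symmetric])
      also have "cmod \<dots> \<le> (\<Sum>j\<in>UNIV. B * sqrt (b - a) * l2norm freq_measure (\<lambda>\<xi>. windowed_ft (Suc n) (f j t) \<xi> - fourier (f j t) \<xi>))"
        by (rule slice_sum_bound[OF square_integrable_diff(1)[OF W] ab' B(2)[OF t]])
      also have "\<dots> \<le> (\<Sum>j\<in>UNIV. B * sqrt (b - a) * window_error n (f j t))"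
        using B(1) ab' by (intro sum_mono mult_left_mono windowed_ft_error ss) auto
      finally show ?thesis .
    qed
    have "(\<lambda>n. \<Sum>j\<in>UNIV. B * sqrt (b - a) * window_error n (f j t)) \<longlonglongrightarrow> (\<Sum>j\<in>(UNIV :: 3 set). B * sqrt (b - a) * 0)"
      by (intro tendsto_intros window_error_tendsto ss)
    hence l: "(\<lambda>n. \<Sum>j\<in>UNIV. B * sqrt (b - a) * window_error n (f j t)) \<longlonglongrightarrow> 0" by simp
    show ?thesis by (rule LIM_zero_cancel, rule Lim_null_comparison[OF _ l]) (use le in auto)
  qed
  \<comment> \<open>Set to zero at the end points, where the derivative is not controlled; the
    fundamental theorem is used in the form that asks for it only in the interior.\<close>
  define D where "D n t = (if t \<in> {0<..<T} then G' a b n t else 0)" for n t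
  have Dint: "(D n has_integral (?G n T - ?G n 0)) {0..T}" for n
    by (rule fundamental_theorem_of_calculus_interior[OF T G_continuous[OF T ab']])
       (use G_deriv[OF _ ab'] in \<open>auto simp: D_def\<close>)
  have D0: "(\<lambda>n. D n t) \<longlonglongrightarrow> 0" if "t \<in> {0..T}" for t
  proof (cases "t \<in> {0<..<T}")
    case True
    have s: "square_integrable cell (f j t)" "square_integrable cell (q j t)" for j
      using True by (auto intro!: f_sq q_sq)
    have r: "(\<lambda>n. 1 / sqrt (real (Suc n))) \<longlonglongrightarrow> sqrt 0"
      using tendsto_real_sqrt[OF LIMSEQ_Suc[OF lim_1_over_n]] by (simp add: real_sqrt_divide)
    have "(\<lambda>n. C * (1 / sqrt (real (Suc n))) + B * sqrt (b - a) * (\<Sum>j\<in>UNIV. window_error n (f 2 t) + window_error n (f 1 t) + window_error n (q j t)))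
       \<longlonglongrightarrow> C * sqrt 0 + B * sqrt (b - a) * (\<Sum>j\<in>(UNIV :: 3 set). 0 + 0 + 0)"
      by (intro tendsto_intros r window_error_tendsto s)
    hence l: "(\<lambda>n. C / sqrt (real (Suc n)) + B * sqrt (b - a) * (\<Sum>j\<in>UNIV. window_error n (f 2 t) + window_error n (f 1 t) + window_error n (q j t))) \<longlonglongrightarrow> 0" by simp
    show ?thesis by (rule Lim_null_comparison[OF _ l]) (use C(2)[OF True] True in \<open>auto simp: D_def\<close>)
  next
    case False
    hence "D n t = 0" for n by (simp only: D_def if_False)
    thus ?thesis by simp
  qed
  \<comment> \<open>The window error of a component is at most \<open>M\<close> and that of
    \<open>q\<close> at most \<open>2 * M\<close>, by \<open>q_norm\<close>; two components and
    \<open>q\<close> make \<open>4 * M\<close>.\<close>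
  define K where "K = C + B * sqrt (b - a) * (\<Sum>j\<in>(UNIV :: 3 set). 4 * M)"
  have K: "cmod (D n t) \<le> K" if "t \<in> {0..T}" for n t
  proof (cases "t \<in> {0<..<T}")
    case True
    hence t: "t > 0" "t \<in> {0..T}" by auto
    have we: "window_error n (f j t) \<le> M" for j
      using window_error_le[OF f_sq, of t n j] M(2)[OF t(2), of j] t by simp
    have wq: "window_error n (q j t) \<le> 2 * M" for j
      using window_error_le[OF q_sq[OF t(1)], of n j] q_norm[OF t(1), of j] M(2)[OF t(2), of 1] M(2)[OF t(2), of 2] by simp
    have "cmod (D n t) \<le> C / sqrt (real (Suc n)) + B * sqrt (b - a) *
        (\<Sum>j\<in>UNIV. window_error n (f 2 t) + window_error n (f 1 t) + window_error n (q j t))"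
      using C(2)[OF True] True by (simp add: D_def)
    also have "\<dots> \<le> C + B * sqrt (b - a) * (\<Sum>j\<in>(UNIV :: 3 set). 4 * M)"
    proof (intro add_mono mult_left_mono sum_mono)
      have "1 \<le> sqrt (real (Suc n))" by simp
      thus "C / sqrt (real (Suc n)) \<le> C" using C(1) by (simp add: divide_le_eq mult_le_cancel_left1)
      show "window_error n (f 2 t) + window_error n (f 1 t) + window_error n (q j t) \<le> 4 * M" for j
        using we[of 2] we[of 1] wq[of j] by linarith
    qed (use B(1) ab in simp)
    finally show ?thesis by (simp add: K_def)
  next
    case False
    hence "D n t = 0" by (simp only: D_def if_False)
    thus ?thesis using B(1) C(1) M(1) ab by (simp add: K_def)
  qed
  have "(\<lambda>n. integral {0..T} (D n)) \<longlonglongrightarrow> integral {0..T} (\<lambda>t. 0)"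
    by (rule dominated_convergence(2)[where h = "\<lambda>t. K"]) (use Dint K D0 in \<open>auto simp: integrable_on_def intro: has_integral_const_real\<close>)
  hence "(\<lambda>n. ?G n T - ?G n 0) \<longlonglongrightarrow> 0" by (simp only: integral_unique[OF Dint] integral_0)
  moreover have "(\<lambda>n. ?G n T - ?G n 0) \<longlonglongrightarrow> ?S T - ?S 0" using T by (intro tendsto_diff GS) auto
  ultimately have "?S T - ?S 0 = 0" using LIMSEQ_unique by blast
  thus ?thesis by simp
qed

text \<open>The interval [a, b] in \<open>slice_conserved\<close> is arbitrary, so the integrands
  over \<eta> agree almost everywhere.\<close>

theorem conserved:
  assumes T: "T \<ge> 0" and \<nu>: "\<nu> \<ge> 0"
  shows "AE \<eta> in lborel. (\<Sum>j\<in>UNIV. \<beta> j T \<eta> * fourier (f j T) (shear T (k, \<eta>, l)))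
     = (\<Sum>j\<in>UNIV. \<beta> j 0 \<eta> * fourier (f j 0) (k, \<eta>, l))"
proof -
  let ?h = "\<lambda>j t \<eta>. \<beta> j t \<eta> * fourier (f j t) (shear t (k, \<eta>, l))"
  have s: "set_integrable lborel {a..b} (?h j t)" if t: "t \<in> {0..T}" for j t a b
  proof (cases "a \<le> b")
    case True
    obtain B where "B \<ge> 0" and B: "\<And>j t \<eta>. t \<in> {0..T} \<Longrightarrow> \<eta> \<in> {a..b} \<Longrightarrow> cmod (\<beta> j t \<eta>) \<le> B"
      using \<beta>_bounded[of T a b] by blast
    show ?thesis
      by (rule slice_bound(1)[OF _ cont\<beta>_compose(1)[OF continuous_on_const continuous_on_id] B[OF t] True])
         (use t in \<open>auto intro!: fourier_square_integrable f_sq\<close>)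
  qed (simp add: set_integrable_def)
  have i: "set_integrable lborel {a..b} (\<lambda>\<eta>. \<Sum>j\<in>UNIV. ?h j t \<eta>)" if "t \<in> {0..T}" for t a b
    using s[OF that] unfolding set_integrable_def scaleR_sum_right by (intro Bochner_Integration.integrable_sum) auto
  have sl: "(LINT \<eta>:{a..b}|lborel. (\<Sum>j\<in>UNIV. ?h j t \<eta>)) = (\<Sum>j\<in>UNIV. slice k l a b t (\<beta> j t) (fourier (f j t)))"
    if "t \<in> {0..T}" for t a b
    using s[OF that] unfolding set_integrable_def set_lebesgue_integral_def scaleR_sum_right slice_def
    by (intro Bochner_Integration.integral_sum) auto
  have "AE \<eta> in lborel. (\<Sum>j\<in>UNIV. ?h j T \<eta>) - (\<Sum>j\<in>UNIV. ?h j 0 \<eta>) = 0"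
  proof (rule AE_zero_of_Icc_integrals)
    show "set_integrable lborel {a..b} (\<lambda>\<eta>. (\<Sum>j\<in>UNIV. ?h j T \<eta>) - (\<Sum>j\<in>UNIV. ?h j 0 \<eta>))" for a b
      by (intro set_integral_diff(1) i) (use T in auto)
    fix a b :: real assume "a < b"
    thus "(LINT \<eta>:{a..b}|lborel. (\<Sum>j\<in>UNIV. ?h j T \<eta>) - (\<Sum>j\<in>UNIV. ?h j 0 \<eta>)) = 0"
      using slice_conserved[OF _ T \<nu>, of a b] T by (subst set_integral_diff(2)) (auto simp: i sl)
  qed
  thus ?thesis by (simp add: shear_def)
qed

end

section \<open>Solutions of the linearized equation\<close>

lemma square_integrable_component:
  fixes v :: "point \<Rightarrow> real^3"
  assumes "square_integrable M v"
  shows "square_integrable M (component v j)"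
    and "(l2norm M (component v j))\<^sup>2 \<le> (LINT p|M. (norm (v p))\<^sup>2)"
proof -
  have [measurable]: "v \<in> borel_measurable M" and i: "integrable M (\<lambda>p. (norm (v p))\<^sup>2)"
    using assms by (auto simp: square_integrable_def)
  have "(\<lambda>p. v p $ j) \<in> borel_measurable M"
    using borel_measurable_continuous_onI[of "\<lambda>x :: real^3. x $ j"]
    by (intro measurable_compose[OF \<open>v \<in> borel_measurable M\<close>]) (auto intro!: continuous_intros)
  hence m: "component v j \<in> borel_measurable M" unfolding component_def[abs_def] by measurable
  have le: "(cmod (component v j p))\<^sup>2 \<le> (norm (v p))\<^sup>2" for p
    unfolding component_def norm_of_real using component_le_norm_cart[of "v p" j] by (intro power_mono) auto
  have ci: "integrable M (\<lambda>p. (cmod (component v j p))\<^sup>2)"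
    by (rule Bochner_Integration.integrable_bound[OF i]) (use m le in auto)
  show "square_integrable M (component v j)" using m ci by (simp add: square_integrable_def)
  show "(l2norm M (component v j))\<^sup>2 \<le> (LINT p|M. (norm (v p))\<^sup>2)"
    unfolding l2norm_power2 by (rule integral_mono[OF ci i le])
qed

lemma square_integrable_vec_diff:
  fixes v w :: "point \<Rightarrow> real^3"
  assumes "square_integrable M v" "square_integrable M w"
  shows "square_integrable M (\<lambda>p. v p - w p)"
proof -
  have [measurable]: "v \<in> borel_measurable M" "w \<in> borel_measurable M"
    and i: "integrable M (\<lambda>p. (norm (v p))\<^sup>2)" "integrable M (\<lambda>p. (norm (w p))\<^sup>2)"
    using assms by (auto simp: square_integrable_def)
  have le: "(norm (v p - w p))\<^sup>2 \<le> 2 * (norm (v p))\<^sup>2 + 2 * (norm (w p))\<^sup>2" for p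
  proof -
    have "(norm (v p - w p))\<^sup>2 \<le> (norm (v p) + norm (w p))\<^sup>2" by (intro power_mono norm_triangle_ineq4) simp
    also have "\<dots> \<le> 2 * (norm (v p))\<^sup>2 + 2 * (norm (w p))\<^sup>2"
      using zero_le_power2[of "norm (v p) - norm (w p)"] by (simp add: power2_sum power2_diff)
    finally show ?thesis .
  qed
  have "integrable M (\<lambda>p. 2 * (norm (v p))\<^sup>2 + 2 * (norm (w p))\<^sup>2)" using i by simp
  hence "integrable M (\<lambda>p. (norm (v p - w p))\<^sup>2)"
    by (rule Bochner_Integration.integrable_bound) (use le in auto)
  thus ?thesis by (simp add: square_integrable_def)
qed

lemma dir_deriv_has_vector_derivative:
  assumes "(\<lambda>h. V (P + h *\<^sub>R b)) differentiable (at 0)"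
  shows "((\<lambda>s. V (P + (s - x) *\<^sub>R b)) has_vector_derivative dir_deriv b V P) (at x)"
proof -
  have d: "((\<lambda>h. V (P + h *\<^sub>R b)) has_vector_derivative dir_deriv b V P) (at (x - x))"
    using assms unfolding vector_derivative_works dir_deriv_def by simp
  have "((\<lambda>s. s - x) has_vector_derivative 1) (at x)"
    unfolding has_real_derivative_iff_has_vector_derivative[symmetric] by (auto intro!: derivative_eq_intros)
  from vector_diff_chain_at[OF this d] show ?thesis by (simp add: o_def)
qed

lemma Basis_point: "(Basis :: point set) = {(1, 0, 0), (0, 1, 0), (0, 0, 1)}"
  by (auto simp: Basis_prod_def zero_prod_def)

lemma Ck_on_2D:
  assumes "Ck_on 2 S V" "b \<in> Basis"
  shows "continuous_on S V" "continuous_on S (dir_deriv b V)"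
    "P \<in> S \<Longrightarrow> (\<lambda>h. V (P + h *\<^sub>R b)) differentiable (at 0)"
    "P \<in> S \<Longrightarrow> (\<lambda>h. dir_deriv b V (P + h *\<^sub>R b)) differentiable (at 0)"
    "continuous_on S (dir_deriv b (dir_deriv b V))"
  using assms by (auto simp: numeral_2_eq_2)

locale linearized =
  fixes \<nu> :: real and u_in :: "point \<Rightarrow> real^3" and u :: "real \<Rightarrow> point \<Rightarrow> real^3"
  assumes \<nu>_pos: "\<nu> > 0" and init: "initial_datum u_in" and sol: "linearized_solution \<nu> u_in u"
begin

text \<open>Space and time joined in one variable, so that one notion of directional derivative
  covers both.\<close>

definition V :: "real \<times> point \<Rightarrow> real^3" where
  "V = (\<lambda>(t, p). u t p)"

definition cpt :: "(real \<times> point \<Rightarrow> real^3) \<Rightarrow> 3 \<Rightarrow> real \<Rightarrow> point \<Rightarrow> complex" where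
  "cpt W j t p = of_real (W (t, p) $ j)"

abbreviation "ex \<equiv> (0, 1, 0, 0) :: real \<times> point"
abbreviation "ey \<equiv> (0, 0, 1, 0) :: real \<times> point"
abbreviation "ez \<equiv> (0, 0, 0, 1) :: real \<times> point"

abbreviation "f j t \<equiv> component (u t) j"

lemma f_eq: "cpt V j t = f j t"
  by (simp add: cpt_def V_def component_def fun_eq_iff)

lemma u_0: "u 0 = u_in"
  using sol by (simp add: linearized_solution_def)

lemma V_C2: "Ck_on 2 ({0<..} \<times> UNIV) V"
  using sol by (simp add: linearized_solution_def V_def)

lemma basis: "(1, 0) \<in> (Basis :: (real \<times> point) set)" "ex \<in> Basis" "ey \<in> Basis" "ez \<in> Basis"
  by (auto simp: Basis_prod_def zero_prod_def)

lemma cpt_continuous: "continuous_on ({0<..} \<times> UNIV) W \<Longrightarrow> continuous_on ({0<..} \<times> UNIV) (\<lambda>(t, p). cpt W j t p)"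
  unfolding cpt_def case_prod_unfold prod.collapse by (intro continuous_intros)

lemma cpt_deriv:
  assumes "(\<lambda>h. W ((t, p) + h *\<^sub>R b)) differentiable (at 0)" "\<And>s. (t, p) + (s - x) *\<^sub>R b = (g s, h s)"
  shows "((\<lambda>s. cpt W j (g s) (h s)) has_vector_derivative cpt (dir_deriv b W) j t p) (at x)"
proof -
  have bl: "bounded_linear (\<lambda>v :: real^3. complex_of_real (v $ j))"
    by (intro bounded_linear_compose[OF bounded_linear_of_real bounded_linear_vec_nth])
  show ?thesis
    using bounded_linear.has_vector_derivative[OF bl dir_deriv_has_vector_derivative[OF assms(1), of x]]
    unfolding assms(2) cpt_def .
qed

lemma f_per: "t \<ge> 0 \<Longrightarrow> f j t (x + 1, y, z) = f j t (x, y, z)" "t \<ge> 0 \<Longrightarrow> f j t (x, y, z + 1) = f j t (x, y, z)"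
  using sol by (auto simp: linearized_solution_def periodic_xz_def component_def)

lemma field: "shear_field (f j) (cpt (dir_deriv (1, 0) V) j) (cpt (dir_deriv ex V) j) (cpt (dir_deriv ey V) j) (cpt (dir_deriv ez V) j)
    (cpt (dir_deriv ex (dir_deriv ex V)) j) (cpt (dir_deriv ey (dir_deriv ey V)) j) (cpt (dir_deriv ez (dir_deriv ez V)) j)"
  unfolding f_eq[symmetric]
proof
  fix t x y z :: real and p :: point assume t: "t > 0"
  have P: "(t, p) \<in> {0<..} \<times> UNIV" for p :: point using t by simp
  note D = Ck_on_2D(3)[OF V_C2 _ P] and DD = Ck_on_2D(4)[OF V_C2 _ P]
  show "((\<lambda>s. cpt V j s p) has_vector_derivative cpt (dir_deriv (1, 0) V) j t p) (at t)"
    by (rule cpt_deriv[OF D[OF basis(1)]]) simp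
  show "((\<lambda>s. cpt V j t (s, y, z)) has_vector_derivative cpt (dir_deriv ex V) j t (x, y, z)) (at x)"
    by (rule cpt_deriv[OF D[OF basis(2)]]) simp
  show "((\<lambda>s. cpt V j t (x, s, z)) has_vector_derivative cpt (dir_deriv ey V) j t (x, y, z)) (at y)"
    by (rule cpt_deriv[OF D[OF basis(3)]]) simp
  show "((\<lambda>s. cpt V j t (x, y, s)) has_vector_derivative cpt (dir_deriv ez V) j t (x, y, z)) (at z)"
    by (rule cpt_deriv[OF D[OF basis(4)]]) simp
  show "((\<lambda>s. cpt (dir_deriv ex V) j t (s, y, z)) has_vector_derivative cpt (dir_deriv ex (dir_deriv ex V)) j t (x, y, z)) (at x)"
    by (rule cpt_deriv[OF DD[OF basis(2)]]) simp
  show "((\<lambda>s. cpt (dir_deriv ey V) j t (x, s, z)) has_vector_derivative cpt (dir_deriv ey (dir_deriv ey V)) j t (x, y, z)) (at y)"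
    by (rule cpt_deriv[OF DD[OF basis(3)]]) simp
  show "((\<lambda>s. cpt (dir_deriv ez V) j t (x, y, s)) has_vector_derivative cpt (dir_deriv ez (dir_deriv ez V)) j t (x, y, z)) (at z)"
    by (rule cpt_deriv[OF DD[OF basis(4)]]) simp
  show "cpt V j t (x + 1, y, z) = cpt V j t (x, y, z)" "cpt V j t (x, y, z + 1) = cpt V j t (x, y, z)"
    unfolding f_eq using f_per t by auto
qed (rule cpt_continuous, rule Ck_on_2D(1)[OF V_C2 basis(1)] Ck_on_2D(2)[OF V_C2 basis(1)] Ck_on_2D(2)[OF V_C2 basis(2)]
    Ck_on_2D(5)[OF V_C2 basis(2)] Ck_on_2D(5)[OF V_C2 basis(3)] Ck_on_2D(5)[OF V_C2 basis(4)])+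

text \<open>The nonlocal terms are defined only almost everywhere. The equation is therefore solved
  for them: this expression in classical derivatives is continuous for positive times and agrees
  with them almost everywhere.\<close>

definition q :: "3 \<Rightarrow> real \<Rightarrow> point \<Rightarrow> complex" where
  "q j t p = of_real \<nu> * (cpt (dir_deriv ex (dir_deriv ex V)) j t p + cpt (dir_deriv ey (dir_deriv ey V)) j t p
      + cpt (dir_deriv ez (dir_deriv ez V)) j t p) + (if j = 2 then - f 1 t p else 0)
      - cpt (dir_deriv (1, 0) V) j t p - of_real (fst (snd p)) * cpt (dir_deriv ex V) j t p"

lemma q_cont: "continuous_on ({0<..} \<times> UNIV) (\<lambda>(t, p). q j t p)"
proof -
  note c = shear_field.cont[OF field, unfolded case_prod_unfold]
  have "continuous_on ({0<..} \<times> UNIV) (\<lambda>x. if j = 2 then - f 1 (fst x) (snd x) else 0)"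
    using c(1)[of 1] by (cases "j = 2") (auto intro!: continuous_intros)
  thus ?thesis unfolding q_def case_prod_unfold by (intro continuous_intros c)
qed

lemma u_sq: "t \<ge> 0 \<Longrightarrow> square_integrable cell (u t)"
  using sol by (simp add: linearized_solution_def)

lemma f_sq: "t \<ge> 0 \<Longrightarrow> square_integrable cell (f j t)"
  by (intro square_integrable_component(1) u_sq)

lemma dir_deriv_section: "dir_deriv (0, b) V (t, p) = dir_deriv b (u t) p"
  by (simp add: dir_deriv_def V_def)

lemma dir_deriv_section2: "dir_deriv (0, b) (dir_deriv (0, b) V) (t, p) = dir_deriv b (dir_deriv b (u t)) p"
proof -
  have "dir_deriv (0, b) (dir_deriv (0, b) V) (t, p) = vector_derivative (\<lambda>h. dir_deriv (0, b) V (t, p + h *\<^sub>R b)) (at 0)"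
    by (simp add: dir_deriv_def[of "(0, b)" "dir_deriv (0, b) V"])
  thus ?thesis unfolding dir_deriv_section by (simp add: dir_deriv_def[of b "dir_deriv b (u t)"])
qed

lemma time_deriv:
  assumes "t > 0" shows "dir_deriv (1, 0) V (t, p) = vector_derivative (\<lambda>\<tau>. u \<tau> p) (at t)"
proof -
  have "(\<lambda>h. V ((t, p) + h *\<^sub>R (1, 0))) differentiable (at 0)"
    by (rule Ck_on_2D(3)[OF V_C2 basis(1)]) (use assms in simp)
  from dir_deriv_has_vector_derivative[OF this, of t]
  have "((\<lambda>\<tau>. u \<tau> p) has_vector_derivative dir_deriv (1, 0) V (t, p)) (at t)" by (simp add: V_def)
  thus ?thesis by (rule vector_derivative_at[symmetric])
qed

abbreviation "riesz_term j t p \<equiv> multiplier (riesz_symbol j 1) (f 2 t) p + multiplier (riesz_symbol j 2) (f 1 t) p"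

lemma q_AE:
  assumes t: "t > 0"
  shows "AE p in cell. q j t p = riesz_term j t p"
proof -
  have "AE (x, y, z) in cell. \<forall>j.
        complex_of_real
          (vector_derivative (\<lambda>\<tau>. u \<tau> (x, y, z)) (at t) $ j
           + y * dir_deriv (1, 0, 0) (u t) (x, y, z) $ j
           + (if j = 2 then u t (x, y, z) $ 1 else 0)
           - \<nu> * laplacian (u t) (x, y, z) $ j)
        + multiplier (riesz_symbol j 1) (component (u t) 2) (x, y, z)
        + multiplier (riesz_symbol j 2) (component (u t) 1) (x, y, z) = 0"
    using sol t by (simp add: linearized_solution_def)
  thus ?thesis
  proof eventually_elim
    case (elim p)
    obtain x y z where p: "p = (x, y, z)" by (cases p)
    have lap: "laplacian (u t) p $ j = dir_deriv ex (dir_deriv ex V) (t, p) $ j + dir_deriv ey (dir_deriv ey V) (t, p) $ j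
        + dir_deriv ez (dir_deriv ez V) (t, p) $ j"
      by (simp add: laplacian_def Basis_point dir_deriv_section2)
    from elim[unfolded p prod.case, rule_format, of j]
    have "complex_of_real (dir_deriv (1, 0) V (t, p) $ j + y * dir_deriv ex V (t, p) $ j + (if j = 2 then u t p $ 1 else 0)
         - \<nu> * (dir_deriv ex (dir_deriv ex V) (t, p) $ j + dir_deriv ey (dir_deriv ey V) (t, p) $ j
        + dir_deriv ez (dir_deriv ez V) (t, p) $ j)) + riesz_term j t p = 0"
      unfolding lap[symmetric] unfolding p time_deriv[OF t] dir_deriv_section by (simp add: add.assoc)
    moreover have "q j t p = - complex_of_real (dir_deriv (1, 0) V (t, p) $ j + y * dir_deriv ex V (t, p) $ j + (if j = 2 then u t p $ 1 else 0)
         - \<nu> * (dir_deriv ex (dir_deriv ex V) (t, p) $ j + dir_deriv ey (dir_deriv ey V) (t, p) $ j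
        + dir_deriv ez (dir_deriv ez V) (t, p) $ j))"
      by (simp add: q_def cpt_def component_def p algebra_simps)
    ultimately show ?case by (metis add_eq_0_iff2 minus_unique)
  qed
qed

lemma q_props:
  assumes t: "t > 0"
  shows "square_integrable cell (q j t)"
    and "l2norm cell (q j t) \<le> l2norm cell (f 2 t) + l2norm cell (f 1 t)"
    and "AE \<xi> in freq_measure. fourier (q j t) \<xi> = riesz_symbol j 1 \<xi> * fourier (f 2 t) \<xi> + riesz_symbol j 2 \<xi> * fourier (f 1 t) \<xi>"
proof -
  have fs: "square_integrable cell (f i t)" for i using t by (intro f_sq) simp
  note m = multiplier_bounded[OF fs riesz_symbol_measurable riesz_symbol_bound]
  have rs: "square_integrable cell (riesz_term j t)" by (intro square_integrable_add(1) m(1))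
  have "continuous_on UNIV (q j t)" by (rule shear_field.continuous_on_section[OF field q_cont t])
  hence qm: "q j t \<in> borel_measurable cell" by (intro measurable_cell borel_measurable_continuous_onI)
  have ae: "AE p in cell. riesz_term j t p = q j t p" using q_AE[OF t, of j] by eventually_elim simp
  show qs: "square_integrable cell (q j t)" by (rule square_integrable_cong_AE[OF rs qm ae])
  have "l2norm cell (q j t) = l2norm cell (riesz_term j t)"
    by (rule l2norm_cong_AE[OF qm square_integrable_measurable[OF rs] q_AE[OF t]])
  also have "\<dots> \<le> l2norm cell (multiplier (riesz_symbol j 1) (f 2 t)) + l2norm cell (multiplier (riesz_symbol j 2) (f 1 t))"
    by (intro square_integrable_add(2) m(1))
  also have "\<dots> \<le> 1 * l2norm cell (f 2 t) + 1 * l2norm cell (f 1 t)" by (intro add_mono m(3))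
  finally show "l2norm cell (q j t) \<le> l2norm cell (f 2 t) + l2norm cell (f 1 t)" by simp
  show "AE \<xi> in freq_measure. fourier (q j t) \<xi> = riesz_symbol j 1 \<xi> * fourier (f 2 t) \<xi> + riesz_symbol j 2 \<xi> * fourier (f 1 t) \<xi>"
  proof -
    let ?a = "multiplier (riesz_symbol j 1) (f 2 t)" and ?b = "multiplier (riesz_symbol j 2) (f 1 t)"
    have sab: "square_integrable cell ?a" "square_integrable cell ?b" by (rule m(1))+
    have fab: "AE \<xi> in freq_measure. fourier ?a \<xi> = riesz_symbol j 1 \<xi> * fourier (f 2 t) \<xi>"
      "AE \<xi> in freq_measure. fourier ?b \<xi> = riesz_symbol j 2 \<xi> * fourier (f 1 t) \<xi>" by (rule m(2))+
    show ?thesis using fourier_cong_AE[OF qs rs q_AE[OF t]] fourier_scale_diff[OF sab, of "-1"] fab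
      by eventually_elim simp
  qed
qed

lemma u_in_continuous: "continuous_on UNIV u_in"
proof -
  have "Ck_on 0 UNIV u_in" using init unfolding initial_datum_def by blast
  thus ?thesis by simp
qed

lemma f_lim:
  assumes t: "t \<ge> 0"
  shows "((\<lambda>s. l2norm cell (\<lambda>p. f j s p - f j t p)) \<longlongrightarrow> 0) (at t within {0..})"
proof -
  have "((\<lambda>\<tau>. LINT p|cell. (norm (u \<tau> p - u t p))\<^sup>2) \<longlongrightarrow> 0) (at t within {0..})"
    using sol t by (simp add: linearized_solution_def)
  from tendsto_real_sqrt[OF this]
  have l: "((\<lambda>\<tau>. sqrt (LINT p|cell. (norm (u \<tau> p - u t p))\<^sup>2)) \<longlongrightarrow> 0) (at t within {0..})" by simp
  show ?thesis
  proof (rule tendsto_sandwich[OF _ _ tendsto_const l])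
    show "\<forall>\<^sub>F s in at t within {0..}. l2norm cell (\<lambda>p. f j s p - f j t p) \<le> sqrt (LINT p|cell. (norm (u s p - u t p))\<^sup>2)"
      unfolding eventually_at_filter
    proof (rule always_eventually, intro allI impI)
      fix s :: real assume s: "s \<in> {0..}"
      have "(\<lambda>p. f j s p - f j t p) = component (\<lambda>p. u s p - u t p) j" by (simp add: component_def fun_eq_iff)
      thus "l2norm cell (\<lambda>p. f j s p - f j t p) \<le> sqrt (LINT p|cell. (norm (u s p - u t p))\<^sup>2)"
        using square_integrable_component(2)[OF square_integrable_vec_diff[OF u_sq u_sq], of s t j] s t
        by (intro real_le_rsqrt) auto
    qed
  qed auto
qed

sublocale shear_system f "\<lambda>j. cpt (dir_deriv (1, 0) V) j" "\<lambda>j. cpt (dir_deriv ex V) j" "\<lambda>j. cpt (dir_deriv ey V) j"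
    "\<lambda>j. cpt (dir_deriv ez V) j" "\<lambda>j. cpt (dir_deriv ex (dir_deriv ex V)) j"
    "\<lambda>j. cpt (dir_deriv ey (dir_deriv ey V)) j" "\<lambda>j. cpt (dir_deriv ez (dir_deriv ez V)) j" q \<nu>
proof (rule shear_system.intro)
  show "continuous_on UNIV (f j 0)" for j
    unfolding u_0 component_def[abs_def] by (intro continuous_intros u_in_continuous)
qed (rule field q_cont f_sq f_lim q_props | assumption | simp add: q_def)+

end

section \<open>Conserved functionals and the solution formula\<close>

lemma riesz_symbol_real: "riesz_symbol i j \<xi> = - of_real (freq_vec \<xi> $ i * freq_vec \<xi> $ j / (norm (freq_vec \<xi>))\<^sup>2)"
proof -
  have "(2 * of_real pi * \<i> * complex_of_real a) * (2 * of_real pi * \<i> * of_real b) / of_real (4 * pi\<^sup>2 * c)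
      = - of_real (a * b / c)" for a b c
  proof -
    have "(2 * of_real pi * \<i> * complex_of_real a) * (2 * of_real pi * \<i> * of_real b) = - of_real (4 * pi\<^sup>2 * (a * b))"
      by (simp add: power2_eq_square)
    also have "\<dots> / of_real (4 * pi\<^sup>2 * c) = - of_real ((4 * pi\<^sup>2 * (a * b)) / (4 * pi\<^sup>2 * c))"
      by (simp only: of_real_divide minus_divide_left)
    also have "(4 * pi\<^sup>2 * (a * b)) / (4 * pi\<^sup>2 * c) = a * b / c" by simp
    finally show ?thesis .
  qed
  thus ?thesis unfolding riesz_symbol_def .
qed

lemma freq_vec_components: "freq_vec (k, \<eta>, l) $ 1 = of_int k" "freq_vec (k, \<eta>, l) $ 2 = \<eta>" "freq_vec (k, \<eta>, l) $ 3 = of_int l"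
  by (simp_all add: freq_vec_def)

lemma freq_vec_norm: "(norm (freq_vec (k, \<eta>, l)))\<^sup>2 = (of_int k)\<^sup>2 + \<eta>\<^sup>2 + (of_int l)\<^sup>2"
  by (simp add: norm_vec_def L2_set_def sum_nonneg sum_3 freq_vec_components)

lemma norm_freq_vec_shear: "(norm (freq_vec (shear t (k, \<eta>, l))))\<^sup>2 = freq_sq k l \<eta> t"
  by (simp add: shear_def freq_vec_norm freq_sq_def)

text \<open>The integral of \<open>freq_sq\<close> over [0, t], the exponent of the dissipation up
  to the factor 4 \<pi>^2 \<nu>.\<close>

definition action :: "int \<Rightarrow> int \<Rightarrow> real \<Rightarrow> real \<Rightarrow> real" where
  "action k l \<eta> t = ((of_int k)\<^sup>2 + (of_int l)\<^sup>2 + \<eta>\<^sup>2) * t - \<eta> * of_int k * t\<^sup>2 + (of_int k)\<^sup>2 * t ^ 3 / 3"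

lemma action_deriv: "((\<lambda>s. action k l \<eta> s) has_real_derivative freq_sq k l \<eta> t) (at t)"
  unfolding action_def freq_sq_def
  by (auto intro!: derivative_eq_intros simp: power2_eq_square algebra_simps)

text \<open>
  The functionals that are constant along the flow, without the dissipative factor. They were found
  by solving the inviscid system of the coefficients in closed form; at \<open>t = 0\<close> they are
  the components themselves, times the squared initial frequency.
\<close>

definition invariant :: "int \<Rightarrow> int \<Rightarrow> 3 \<Rightarrow> 3 \<Rightarrow> real \<Rightarrow> real \<Rightarrow> real" where
  "invariant k l i j t \<eta> =
    (let K = of_int k; L = of_int l; p = K\<^sup>2 + \<eta>\<^sup>2 + L\<^sup>2; c = p - \<eta> * K * t in
     if i = 1 then (if j = 1 then c else if j = 2 then - K\<^sup>2 * t else 0)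
     else if i = 2 then (if j = 1 then (K\<^sup>2 + L\<^sup>2) * t else if j = 2 then c else 0)
     else (if j = 1 then - L * t * \<eta> else if j = 2 then - L * t * K else p))"

definition invariant' :: "int \<Rightarrow> int \<Rightarrow> 3 \<Rightarrow> 3 \<Rightarrow> real \<Rightarrow> real" where
  "invariant' k l i j \<eta> =
    (let K = of_int k; L = of_int l in
     if i = 1 then (if j = 1 then - \<eta> * K else if j = 2 then - K\<^sup>2 else 0)
     else if i = 2 then (if j = 1 then K\<^sup>2 + L\<^sup>2 else if j = 2 then - \<eta> * K else 0)
     else (if j = 1 then - L * \<eta> else if j = 2 then - L * K else 0))"

lemma invariant_deriv: "((\<lambda>s. invariant k l i j s \<eta>) has_real_derivative invariant' k l i j \<eta>) (at t)"
  using exhaust_3[of i] exhaust_3[of j]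
  by (auto simp: invariant_def invariant'_def Let_def intro!: derivative_eq_intros)

lemma invariant_continuous [continuous_intros]:
  assumes "continuous_on S y"
  shows "continuous_on S (\<lambda>s. invariant' k l i j (y s))"
    and "continuous_on S x \<Longrightarrow> continuous_on S (\<lambda>s. invariant k l i j (x s) (y s))"
    and "continuous_on S x \<Longrightarrow> continuous_on S (\<lambda>s. action k l (y s) (x s))"
    and "continuous_on S x \<Longrightarrow> continuous_on S (\<lambda>s. freq_sq k l (y s) (x s))"
  using assms exhaust_3[of i] exhaust_3[of j]
  by (auto simp: invariant_def invariant'_def Let_def action_def freq_sq_def intro!: continuous_intros)

text \<open>The product \<open>s\<close> of the weights with the current frequency is a constant
  \<sigma>, the i-th entry of the initial frequency, times the squared frequency \<open>p\<close>.
  This cancels the denominators of the Riesz symbols, which is why polynomial weights can solve the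
  adjoint system.\<close>

lemma invariant_transport:
  fixes k l :: int and \<eta> t :: real and i :: 3
  defines "\<zeta> \<equiv> \<eta> - of_int k * t" and "p \<equiv> freq_sq k l \<eta> t" and "b \<equiv> (\<lambda>j. invariant k l i j t \<eta>)"
  defines "s \<equiv> b 1 * of_int k + b 2 * \<zeta> + b 3 * of_int l"
  shows "invariant' k l i 1 \<eta> = b 2 - s * \<zeta> / p" "invariant' k l i 2 \<eta> = - (s * of_int k / p)" "invariant' k l i 3 \<eta> = 0"
proof -
  define K L where "K = real_of_int k" and "L = real_of_int l"
  define \<sigma> where "\<sigma> = (if i = 1 then K else if i = 2 then \<eta> else L)"
  have \<eta>: "\<eta> = \<zeta> + K * t" by (simp add: \<zeta>_def K_def)
  have p: "p = K\<^sup>2 + \<zeta>\<^sup>2 + L\<^sup>2" by (simp add: p_def freq_sq_def \<zeta>_def K_def L_def)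
  have s: "s = \<sigma> * p"
    using exhaust_3[of i]
    by (auto simp: s_def b_def invariant_def Let_def \<sigma>_def p \<eta> K_def[symmetric] L_def[symmetric] power2_eq_square algebra_simps)
  have sp: "s * x / p = \<sigma> * x" for x
  proof (cases "p = 0")
    \<comment> \<open>At zero frequency the quotient is 0 by convention, and \<sigma> vanishes as
      well.\<close>
    case True
    hence "K = 0" "\<zeta> = 0" "L = 0" unfolding p by (auto simp: add_nonneg_eq_0_iff)
    hence "\<sigma> = 0" by (simp add: \<sigma>_def \<eta>)
    thus ?thesis using True by simp
  qed (simp add: s)
  show "invariant' k l i 1 \<eta> = b 2 - s * \<zeta> / p" "invariant' k l i 2 \<eta> = - (s * of_int k / p)" "invariant' k l i 3 \<eta> = 0"
    unfolding sp using exhaust_3[of i]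
    by (auto simp: b_def invariant_def invariant'_def Let_def \<sigma>_def \<eta> K_def[symmetric] L_def[symmetric] power2_eq_square algebra_simps)
qed

context linearized
begin

definition \<beta> :: "int \<Rightarrow> int \<Rightarrow> 3 \<Rightarrow> 3 \<Rightarrow> real \<Rightarrow> real \<Rightarrow> complex" where
  "\<beta> k l i j t \<eta> = of_real (exp (4 * pi\<^sup>2 * \<nu> * action k l \<eta> t) * invariant k l i j t \<eta>)"

definition \<beta>' :: "int \<Rightarrow> int \<Rightarrow> 3 \<Rightarrow> 3 \<Rightarrow> real \<Rightarrow> real \<Rightarrow> complex" where
  "\<beta>' k l i j t \<eta> = of_real (exp (4 * pi\<^sup>2 * \<nu> * action k l \<eta> t) *
     (4 * pi\<^sup>2 * \<nu> * freq_sq k l \<eta> t * invariant k l i j t \<eta> + invariant' k l i j \<eta>))"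

text \<open>Differentiating the exponential factor produces the dissipative term; the rest of the
  adjoint equation is \<open>invariant_transport\<close>.\<close>

lemma adjoint: "adjoint_solution f (\<lambda>j. cpt (dir_deriv (1, 0) V) j) (\<lambda>j. cpt (dir_deriv ex V) j) (\<lambda>j. cpt (dir_deriv ey V) j)
    (\<lambda>j. cpt (dir_deriv ez V) j) (\<lambda>j. cpt (dir_deriv ex (dir_deriv ex V)) j)
    (\<lambda>j. cpt (dir_deriv ey (dir_deriv ey V)) j) (\<lambda>j. cpt (dir_deriv ez (dir_deriv ez V)) j) q \<nu> (\<beta> k l i) (\<beta>' k l i) k l"
proof
  fix j t \<eta> and W :: "3 \<Rightarrow> complex"
  show "((\<lambda>s. \<beta> k l i j s \<eta>) has_vector_derivative \<beta>' k l i j t \<eta>) (at t)"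
    unfolding \<beta>_def \<beta>'_def
    by (rule has_vector_derivative_of_real) (auto intro!: derivative_eq_intros action_deriv invariant_deriv simp: algebra_simps)
  show "continuous_on UNIV (\<lambda>(t, \<eta>). \<beta> k l i j t \<eta>)" "continuous_on UNIV (\<lambda>(t, \<eta>). \<beta>' k l i j t \<eta>)"
    unfolding \<beta>_def \<beta>'_def case_prod_unfold by (intro continuous_intros continuous_on_fst continuous_on_snd continuous_on_id)+
  define e where "e = complex_of_real (exp (4 * pi\<^sup>2 * \<nu> * action k l \<eta> t))"
  define b where "b j = complex_of_real (invariant k l i j t \<eta>)" for j
  define P where "P = complex_of_real (4 * pi\<^sup>2 * \<nu> * freq_sq k l \<eta> t)"
  define x where "x j = complex_of_real (freq_vec (shear t (k, \<eta>, l)) $ j)" for j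
  define p where "p = complex_of_real (freq_sq k l \<eta> t)"
  define s where "s = b 1 * x 1 + b 2 * x 2 + b 3 * x 3"
  have x: "x 1 = of_int k" "x 2 = of_real (\<eta> - of_int k * t)" "x 3 = of_int l"
    by (simp_all add: x_def shear_def freq_vec_components)
  have r: "riesz_symbol j1 j2 (shear t (k, \<eta>, l)) = - (x j1 * x j2 / p)" for j1 j2
    by (simp add: riesz_symbol_real norm_freq_vec_shear x_def p_def)
  have \<beta>: "\<beta> k l i j t \<eta> = e * b j" for j by (simp add: \<beta>_def e_def b_def)
  have \<beta>': "\<beta>' k l i j t \<eta> = e * (P * b j + of_real (invariant' k l i j \<eta>))" for j
    by (simp add: \<beta>'_def e_def b_def P_def)
  have i': "complex_of_real (invariant' k l i 1 \<eta>) = b 2 - s * x 2 / p"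
      "complex_of_real (invariant' k l i 2 \<eta>) = - (s * x 1 / p)" "complex_of_real (invariant' k l i 3 \<eta>) = 0"
    unfolding invariant_transport(1,2)[where t = t] invariant_transport(3) by (simp_all add: b_def s_def x p_def)
  show "(\<Sum>j\<in>UNIV. \<beta>' k l i j t \<eta> * W j) = of_real (4 * pi\<^sup>2 * \<nu> * freq_sq k l \<eta> t) * (\<Sum>j\<in>UNIV. \<beta> k l i j t \<eta> * W j)
        + \<beta> k l i 2 t \<eta> * W 1
        + (\<Sum>j\<in>UNIV. \<beta> k l i j t \<eta> * (riesz_symbol j 1 (shear t (k, \<eta>, l)) * W 2 + riesz_symbol j 2 (shear t (k, \<eta>, l)) * W 1))"
    unfolding \<beta> \<beta>' r sum_3 i' P_def[symmetric] s_def divide_inverse by (simp add: algebra_simps)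
qed

lemma conserved:
  assumes "T \<ge> 0"
  shows "AE \<eta> in lborel. (\<Sum>j\<in>UNIV. \<beta> k l i j T \<eta> * fourier (f j T) (shear T (k, \<eta>, l)))
     = (\<Sum>j\<in>UNIV. \<beta> k l i j 0 \<eta> * fourier (f j 0) (k, \<eta>, l))"
  by (rule adjoint_solution.conserved[OF adjoint assms]) (use \<nu>_pos in simp)

text \<open>The three conservation laws are solved for the coefficients at time \<open>T\<close>:
  the first two form a block of determinant \<open>p0 * p\<close>, and the third then gives the last
  coefficient. Every common factor \<open>p0\<close> cancels.\<close>

lemma solution_formula_mode:
  assumes T: "T \<ge> 0"
  defines "e \<equiv> (\<lambda>k l \<eta>. complex_of_real (exp (- 4 * pi\<^sup>2 * \<nu> * action k l \<eta> T)))"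
    and "c \<equiv> (\<lambda>k l \<eta>. complex_of_real ((of_int k)\<^sup>2 + \<eta>\<^sup>2 + (of_int l)\<^sup>2 - \<eta> * of_int k * T))"
  shows "AE \<eta> in lborel.
      fourier (f 1 T) (shear T (k, \<eta>, l)) = e k l \<eta> * (c k l \<eta> * fourier (f 1 0) (k, \<eta>, l)
          + of_real ((of_int k)\<^sup>2 * T) * fourier (f 2 0) (k, \<eta>, l)) / of_real (freq_sq k l \<eta> T)
    \<and> fourier (f 2 T) (shear T (k, \<eta>, l)) = e k l \<eta> * (c k l \<eta> * fourier (f 2 0) (k, \<eta>, l)
          - of_real (((of_int k)\<^sup>2 + (of_int l)\<^sup>2) * T) * fourier (f 1 0) (k, \<eta>, l)) / of_real (freq_sq k l \<eta> T)
    \<and> fourier (f 3 T) (shear T (k, \<eta>, l)) = e k l \<eta> * (fourier (f 3 0) (k, \<eta>, l)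
          + of_real (of_int l * T) * (of_real (\<eta> - of_int k * T) * fourier (f 1 0) (k, \<eta>, l)
              + of_int k * fourier (f 2 0) (k, \<eta>, l)) / of_real (freq_sq k l \<eta> T))"
  using conserved[OF T, of k l 1] conserved[OF T, of k l 2] conserved[OF T, of k l 3] AE_lborel_singleton[of 0]
proof eventually_elim
  case (elim \<eta>)
  define K L t where "K = complex_of_int k" and "L = complex_of_int l" and "t = complex_of_real T"
  define h where "h = complex_of_real \<eta>"
  define W where "W j = fourier (f j T) (shear T (k, \<eta>, l))" for j
  define X where "X j = fourier (f j 0) (k, \<eta>, l)" for j
  define E where "E = complex_of_real (exp (4 * pi\<^sup>2 * \<nu> * action k l \<eta> T))"
  define p0 where "p0 = K\<^sup>2 + h\<^sup>2 + L\<^sup>2"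
  define p where "p = K\<^sup>2 + (h - K * t)\<^sup>2 + L\<^sup>2"
  define C where "C = p0 - h * K * t"
  have eE: "e k l \<eta> * E = 1" by (simp add: e_def E_def flip: of_real_mult exp_add)
  have E0: "E \<noteq> 0" using eE by auto
  have cC: "c k l \<eta> = C" by (simp add: c_def C_def p0_def K_def L_def h_def t_def)
  have pp: "complex_of_real (freq_sq k l \<eta> T) = p" by (simp add: freq_sq_def p_def K_def L_def h_def t_def)
  have p0r: "p0 = of_real ((of_int k)\<^sup>2 + \<eta>\<^sup>2 + (of_int l)\<^sup>2)" by (simp add: p0_def K_def L_def h_def)
  \<comment> \<open>A nonzero \<eta> excludes the zero frequency at the start; the frequency at time
    \<open>T\<close> could vanish only if \<open>k\<close> does, and then \<eta> would vanish
    too.\<close>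
  have p00: "p0 \<noteq> 0" unfolding p0r of_real_eq_0_iff using elim(4) by (simp add: add_nonneg_eq_0_iff)
  have pn0: "p \<noteq> 0"
  proof
    assume "p = 0"
    hence "freq_sq k l \<eta> T = 0" using pp by simp
    hence "of_int k = (0::real)" "\<eta> - of_int k * T = 0" unfolding freq_sq_def by (auto simp: add_nonneg_eq_0_iff)
    thus False using elim(4) by simp
  qed
  have a0: "action k l \<eta> 0 = 0" by (simp add: action_def)
  have 1: "E * (C * W 1 - K\<^sup>2 * t * W 2) = p0 * X 1"
    using elim(1) by (simp add: sum_3 \<beta>_def invariant_def Let_def a0 W_def X_def E_def C_def p0_def K_def L_def h_def t_def algebra_simps)
  have 2: "E * ((K\<^sup>2 + L\<^sup>2) * t * W 1 + C * W 2) = p0 * X 2"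
    using elim(2) by (simp add: sum_3 \<beta>_def invariant_def Let_def a0 W_def X_def E_def C_def p0_def K_def L_def h_def t_def algebra_simps)
  have 3: "E * (- L * t * h * W 1 - L * t * K * W 2 + p0 * W 3) = p0 * X 3"
    using elim(3) by (simp add: sum_3 \<beta>_def invariant_def Let_def a0 W_def X_def E_def C_def p0_def K_def L_def h_def t_def algebra_simps)
  \<comment> \<open>Since p = p0 - 2 h K t + K^2 t^2, comparing \<open>p0 * p\<close> with
    \<open>C * C\<close> leaves K^2 t^2 (p0 - h^2), and p0 - h^2 = K^2 + L^2.\<close>
  have det: "C * C + K\<^sup>2 * t * ((K\<^sup>2 + L\<^sup>2) * t) = p0 * p"
    unfolding C_def p0_def p_def by (simp add: power2_eq_square algebra_simps)
  have "p0 * (E * p * W 1) = E * (C * C + K\<^sup>2 * t * ((K\<^sup>2 + L\<^sup>2) * t)) * W 1" unfolding det by (simp add: mult_ac)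
  also have "\<dots> = C * (E * (C * W 1 - K\<^sup>2 * t * W 2)) + K\<^sup>2 * t * (E * ((K\<^sup>2 + L\<^sup>2) * t * W 1 + C * W 2))"
    by (simp add: algebra_simps)
  also have "\<dots> = p0 * (C * X 1 + K\<^sup>2 * t * X 2)" unfolding 1 2 by (simp add: algebra_simps)
  finally have w1: "E * p * W 1 = C * X 1 + K\<^sup>2 * t * X 2" using p00 by simp
  have "p0 * (E * p * W 2) = E * (C * C + K\<^sup>2 * t * ((K\<^sup>2 + L\<^sup>2) * t)) * W 2" unfolding det by (simp add: mult_ac)
  also have "\<dots> = C * (E * ((K\<^sup>2 + L\<^sup>2) * t * W 1 + C * W 2)) - (K\<^sup>2 + L\<^sup>2) * t * (E * (C * W 1 - K\<^sup>2 * t * W 2))"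
    by (simp add: algebra_simps)
  also have "\<dots> = p0 * (C * X 2 - (K\<^sup>2 + L\<^sup>2) * t * X 1)" unfolding 1 2 by (simp add: algebra_simps)
  finally have w2: "E * p * W 2 = C * X 2 - (K\<^sup>2 + L\<^sup>2) * t * X 1" using p00 by simp
  have "p0 * (E * p * W 3) = p * (E * (- L * t * h * W 1 - L * t * K * W 2 + p0 * W 3))
      + L * t * h * (E * p * W 1) + L * t * K * (E * p * W 2)"
    by (simp add: algebra_simps)
  also have "\<dots> = p * (p0 * X 3) + L * t * h * (C * X 1 + K\<^sup>2 * t * X 2) + L * t * K * (C * X 2 - (K\<^sup>2 + L\<^sup>2) * t * X 1)"
    unfolding 3 w1 w2 ..
  also have "\<dots> = p0 * (p * X 3 + L * t * ((h - K * t) * X 1 + K * X 2))"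
    unfolding C_def p0_def by (simp add: power2_eq_square algebra_simps)
  finally have w3: "E * p * W 3 = p * X 3 + L * t * ((h - K * t) * X 1 + K * X 2)" using p00 by simp
  have div: "w = e k l \<eta> * y / p" if "E * p * w = y" for w y
  proof -
    have "e k l \<eta> * y / p = (e k l \<eta> * E) * w" using pn0 unfolding that[symmetric] by simp
    thus ?thesis by (simp add: eE)
  qed
  have "W 3 = e k l \<eta> * (X 3 + L * t * ((h - K * t) * X 1 + K * X 2) / p)"
    using div[OF w3] pn0 by (simp add: add_divide_distrib distrib_left)
  thus ?case using div[OF w1] div[OF w2] unfolding pp cC
    by (simp add: W_def X_def K_def L_def h_def t_def)
qed

end

text \<open>There are only countably many pairs \<open>(k, l)\<close>, so the exceptional sets on
  the single lines add up to a null set; measurability of \<open>P\<close> lets Fubini assemble the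
  lines.\<close>

lemma AE_freq_measureI:
  assumes m: "Measurable.pred freq_measure P" and ae: "\<And>k l. AE \<eta> in lborel. P (k, \<eta>, l)"
  shows "AE \<xi> in freq_measure. P \<xi>"
proof -
  have sf: "sigma_finite_measure (lborel \<Otimes>\<^sub>M count_space (UNIV :: int set) :: (real \<times> int) measure)"
    by (rule sigma_finite_pair_measure[OF sigma_finite_lborel sigma_finite_count_int])
  have m'[measurable]: "Measurable.pred (count_space UNIV \<Otimes>\<^sub>M (lborel \<Otimes>\<^sub>M count_space UNIV)) P"
    using m by (simp add: freq_measure_def)
  have "AE q in lborel \<Otimes>\<^sub>M count_space (UNIV :: int set). P (k, q)" for k
  proof (rule pair_sigma_finite.AE_pair_measure[OF pair_sigma_finite.intro[OF sigma_finite_lborel sigma_finite_count_int]])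
    show "{q \<in> space (lborel \<Otimes>\<^sub>M count_space UNIV). P (k, q)} \<in> sets (lborel \<Otimes>\<^sub>M count_space UNIV)"
      by measurable
    have "AE \<eta> in lborel. \<forall>l. P (k, \<eta>, l)" unfolding AE_all_countable using ae by blast
    thus "AE \<eta> in lborel. AE l in count_space UNIV. P (k, \<eta>, l)" by eventually_elim (simp add: AE_count_space)
  qed
  hence "AE k in count_space UNIV. AE q in lborel \<Otimes>\<^sub>M count_space (UNIV :: int set). P (k, q)"
    by (simp add: AE_count_space)
  moreover have "{\<xi> \<in> space (count_space UNIV \<Otimes>\<^sub>M (lborel \<Otimes>\<^sub>M count_space UNIV)). P \<xi>}
      \<in> sets (count_space UNIV \<Otimes>\<^sub>M (lborel \<Otimes>\<^sub>M count_space UNIV))" by measurable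
  ultimately show ?thesis unfolding freq_measure_def
    by (intro pair_sigma_finite.AE_pair_measure[OF pair_sigma_finite.intro[OF sigma_finite_count_int sf]]) auto
qed

lemma freq_borel_measurable:
  assumes "continuous_on UNIV (\<lambda>x :: real \<times> real \<times> real. g (fst x) (fst (snd x)) (snd (snd x)) :: 'b::real_normed_vector)"
  shows "(\<lambda>(k, \<eta>, l). g (of_int k) \<eta> (of_int l)) \<in> borel_measurable freq_measure"
proof -
  have "(\<lambda>\<xi>. (real_of_int (fst \<xi>), fst (snd \<xi>), real_of_int (snd (snd \<xi>)))) \<in> measurable freq_measure (borel :: (real \<times> real \<times> real) measure)"
    unfolding freq_measure_def by measurable
  from measurable_compose[OF this borel_measurable_continuous_onI[OF assms]]
  show ?thesis by (simp add: case_prod_unfold)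
qed

section \<open>Elementary bounds for the solution formula\<close>

text \<open>Completing the square in \<eta> leaves K^2 t^3 / 12 as a lower bound for the action.
  Multiplied by 4 \<pi>^2, of which only a factor 2 is kept, this gives the rate 1/6.\<close>

lemma decay_bound:
  assumes \<nu>: "\<nu> > 0" and t: "t \<ge> 0"
  shows "exp (- 4 * pi\<^sup>2 * \<nu> * action k l \<eta> t) \<le> exp (- (\<nu> / 6) * (of_int k)\<^sup>2 * t ^ 3)"
proof -
  define K L where "K = real_of_int k" and "L = real_of_int l"
  have "action k l \<eta> t = (K\<^sup>2 + L\<^sup>2) * t + t * (\<eta> - K * t / 2)\<^sup>2 + K\<^sup>2 * t ^ 3 / 12"
    unfolding action_def K_def[symmetric] L_def[symmetric] by (simp add: power2_eq_square power3_eq_cube field_simps)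
  hence a: "action k l \<eta> t \<ge> K\<^sup>2 * t ^ 3 / 12" using t by simp
  have "pi\<^sup>2 \<ge> 2\<^sup>2" using pi_ge_two by (intro power_mono) auto
  hence "4 * pi\<^sup>2 * (K\<^sup>2 * t ^ 3 / 12) \<ge> 2 * (K\<^sup>2 * t ^ 3 / 12)" using t by (intro mult_right_mono) auto
  moreover have "4 * pi\<^sup>2 * action k l \<eta> t \<ge> 4 * pi\<^sup>2 * (K\<^sup>2 * t ^ 3 / 12)" using a by (intro mult_left_mono) auto
  ultimately have "4 * pi\<^sup>2 * action k l \<eta> t \<ge> K\<^sup>2 * t ^ 3 / 6" by linarith
  hence "\<nu> * (4 * pi\<^sup>2 * action k l \<eta> t) \<ge> \<nu> * (K\<^sup>2 * t ^ 3 / 6)" using \<nu> by (intro mult_left_mono) auto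
  thus ?thesis by (simp add: K_def mult_ac)
qed

lemma abs_mult_le_sum_squares: "\<bar>a\<bar> * \<bar>b\<bar> \<le> a\<^sup>2 + b\<^sup>2" for a b :: real
proof -
  have "2 * (\<bar>a\<bar> * \<bar>b\<bar>) \<le> a\<^sup>2 + b\<^sup>2"
    using zero_le_power2[of "\<bar>a\<bar> - \<bar>b\<bar>"] by (simp add: power2_diff)
  moreover have "0 \<le> \<bar>a\<bar> * \<bar>b\<bar>" by simp
  ultimately show ?thesis by linarith
qed

text \<open>From K t = \<eta> - \<zeta> and |K| >= 1 one has t <= |\<eta>| + |\<zeta>|. Each power
  of \<open>t\<close> is thus paid for through \<eta>^2 <= J or \<zeta>^2 <= p, and
  \<open>J * p\<close> is two derivatives of the data times the denominator of the solution formula.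
  The 9 is a rounded common constant.\<close>

lemma coefficient_bounds:
  fixes K L \<eta> t :: real
  assumes K: "\<bar>K\<bar> \<ge> 1" and t: "t \<ge> 0"
  defines "\<zeta> \<equiv> \<eta> - K * t" and "J \<equiv> 1 + K\<^sup>2 + \<eta>\<^sup>2 + L\<^sup>2"
  defines "p \<equiv> K\<^sup>2 + \<zeta>\<^sup>2 + L\<^sup>2"
  shows "p > 0" "(K\<^sup>2 + L\<^sup>2) * t * (1 + t) \<le> 9 * (J * p)"
    "\<bar>K\<^sup>2 + \<eta>\<^sup>2 + L\<^sup>2 - \<eta> * K * t\<bar> * (1 + t) \<le> 9 * (J * p)"
    "\<bar>L * t * \<zeta>\<bar> \<le> 9 * (J * p)" "\<bar>L * t * K\<bar> \<le> 9 * (J * p)"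
proof -
  define a where "a = K\<^sup>2 + L\<^sup>2"
  have K2: "K\<^sup>2 \<ge> 1" using K by (simp add: abs_le_square_iff[of 1 K, simplified])
  have a: "a \<ge> 1" "a \<le> p" "a \<le> J" using K2 zero_le_power2[of L] zero_le_power2[of \<eta>] zero_le_power2[of \<zeta>] unfolding a_def p_def J_def by linarith+
  have p1: "p \<ge> 1" and J1: "J \<ge> 1" using a by linarith+
  show "p > 0" using p1 by linarith
  have z2: "\<zeta>\<^sup>2 \<le> p" and e2: "\<eta>\<^sup>2 \<le> J" by (auto simp: p_def J_def)
  \<comment> \<open>Lets a bound on a square control the first power too, as both \<open>p\<close>
    and \<open>J\<close> are at least 1.\<close>
  have sq: "\<bar>x\<bar> \<le> y" if "x\<^sup>2 \<le> y" "y \<ge> 1" for x y :: real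
  proof -
    have "x\<^sup>2 \<le> y\<^sup>2" using that self_le_power[of y 2] by simp
    thus ?thesis using that(2) by (simp add: power2_le_iff_abs_le)
  qed
  have z: "\<bar>\<zeta>\<bar> \<le> p" and e: "\<bar>\<eta>\<bar> \<le> J" by (rule sq[OF z2 p1] sq[OF e2 J1])+
  have tb: "t \<le> \<bar>\<eta>\<bar> + \<bar>\<zeta>\<bar>"
  proof -
    have "t \<le> \<bar>K\<bar> * t" using K t by (simp add: mult_le_cancel_right1)
    also have "\<dots> = \<bar>\<eta> - \<zeta>\<bar>" using t by (simp add: \<zeta>_def abs_mult)
    finally show ?thesis by linarith
  qed
  have t2: "t\<^sup>2 \<le> 2 * \<eta>\<^sup>2 + 2 * \<zeta>\<^sup>2"
  proof -
    have "t\<^sup>2 \<le> (\<bar>\<eta>\<bar> + \<bar>\<zeta>\<bar>)\<^sup>2" using tb t by (intro power_mono) auto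
    also have "\<dots> \<le> 2 * \<eta>\<^sup>2 + 2 * \<zeta>\<^sup>2"
      using zero_le_power2[of "\<bar>\<eta>\<bar> - \<bar>\<zeta>\<bar>"] by (simp add: power2_sum power2_diff)
    finally show ?thesis .
  qed
  have ae: "a * \<eta>\<^sup>2 \<le> p * J" and az: "a * \<zeta>\<^sup>2 \<le> J * p" using a e2 z2 p1 J1 by (auto intro!: mult_mono)
  have ap: "a \<le> J * p" using mult_mono[of 1 J a p] a p1 J1 by simp
  have at2: "a * t\<^sup>2 \<le> 4 * (J * p)"
  proof -
    have "a * t\<^sup>2 \<le> a * (2 * \<eta>\<^sup>2 + 2 * \<zeta>\<^sup>2)" using t2 a by (intro mult_left_mono) auto
    thus ?thesis using ae az by (simp add: algebra_simps)
  qed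
  have tt: "2 * t \<le> 1 + t\<^sup>2" using zero_le_power2[of "t - 1"] by (simp add: power2_diff)
  have at: "2 * (a * t) \<le> 5 * (J * p)"
  proof -
    have "a * (2 * t) \<le> a * (1 + t\<^sup>2)" using tt a by (intro mult_left_mono) auto
    thus ?thesis using at2 ap by (simp add: algebra_simps)
  qed
  have "a * t * (1 + t) = a * t + a * t\<^sup>2" by (simp add: power2_eq_square algebra_simps)
  thus "(K\<^sup>2 + L\<^sup>2) * t * (1 + t) \<le> 9 * (J * p)" using at at2 ap a unfolding a_def[symmetric] by linarith
  have ez: "\<bar>\<eta>\<bar> * \<bar>\<zeta>\<bar> \<le> J * p" using e z J1 by (intro mult_mono) auto
  have eze: "\<bar>\<eta>\<bar> * \<bar>\<zeta>\<bar> * \<bar>\<eta>\<bar> \<le> J * p"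
  proof -
    have "\<bar>\<eta>\<bar> * \<bar>\<zeta>\<bar> * \<bar>\<eta>\<bar> = \<eta>\<^sup>2 * \<bar>\<zeta>\<bar>" by (simp add: power2_eq_square)
    also have "\<dots> \<le> J * p" using e2 z J1 by (intro mult_mono) auto
    finally show ?thesis .
  qed
  have ezz: "\<bar>\<eta>\<bar> * \<bar>\<zeta>\<bar> * \<bar>\<zeta>\<bar> \<le> J * p"
  proof -
    have "\<bar>\<eta>\<bar> * \<bar>\<zeta>\<bar> * \<bar>\<zeta>\<bar> = \<bar>\<eta>\<bar> * \<zeta>\<^sup>2" by (simp add: power2_eq_square mult.assoc)
    also have "\<dots> \<le> J * p" using e z2 J1 by (intro mult_mono) auto
    finally show ?thesis .
  qed
  \<comment> \<open>Written with \<zeta>, the dangerous part \<eta>^2 - \<eta> K t is the product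
    \<eta> \<zeta>, in which one factor is controlled by \<open>J\<close> and the other by
    \<open>p\<close>.\<close>
  have "K\<^sup>2 + \<eta>\<^sup>2 + L\<^sup>2 - \<eta> * K * t = a + \<eta> * \<zeta>" by (simp add: a_def \<zeta>_def power2_eq_square algebra_simps)
  hence "\<bar>K\<^sup>2 + \<eta>\<^sup>2 + L\<^sup>2 - \<eta> * K * t\<bar> \<le> a + \<bar>\<eta>\<bar> * \<bar>\<zeta>\<bar>"
    using abs_triangle_ineq[of a "\<eta> * \<zeta>"] a by (simp add: abs_mult)
  hence "\<bar>K\<^sup>2 + \<eta>\<^sup>2 + L\<^sup>2 - \<eta> * K * t\<bar> * (1 + t) \<le> (a + \<bar>\<eta>\<bar> * \<bar>\<zeta>\<bar>) * (1 + t)"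
    using t by (intro mult_right_mono) auto
  also have "\<dots> = a + a * t + \<bar>\<eta>\<bar> * \<bar>\<zeta>\<bar> + \<bar>\<eta>\<bar> * \<bar>\<zeta>\<bar> * t" by (simp add: algebra_simps)
  also have "\<bar>\<eta>\<bar> * \<bar>\<zeta>\<bar> * t \<le> \<bar>\<eta>\<bar> * \<bar>\<zeta>\<bar> * (\<bar>\<eta>\<bar> + \<bar>\<zeta>\<bar>)" using tb by (intro mult_left_mono) auto
  also have "\<bar>\<eta>\<bar> * \<bar>\<zeta>\<bar> * (\<bar>\<eta>\<bar> + \<bar>\<zeta>\<bar>) = \<bar>\<eta>\<bar> * \<bar>\<zeta>\<bar> * \<bar>\<eta>\<bar> + \<bar>\<eta>\<bar> * \<bar>\<zeta>\<bar> * \<bar>\<zeta>\<bar>" by (rule distrib_left)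
  finally show "\<bar>K\<^sup>2 + \<eta>\<^sup>2 + L\<^sup>2 - \<eta> * K * t\<bar> * (1 + t) \<le> 9 * (J * p)"
    using eze ezz ez ap at a by linarith
  have LK: "\<bar>L\<bar> * \<bar>K\<bar> \<le> a" using abs_mult_le_sum_squares[of L K] by (simp add: a_def)
  have "\<bar>L * t * K\<bar> = \<bar>L\<bar> * \<bar>K\<bar> * t" using t by (simp add: abs_mult)
  also have "\<dots> \<le> a * t" using LK t by (intro mult_right_mono) auto
  finally show "\<bar>L * t * K\<bar> \<le> 9 * (J * p)" using at ap a by linarith
  have Lz: "\<bar>L\<bar> * \<bar>\<zeta>\<bar> \<le> p" using abs_mult_le_sum_squares[of L \<zeta>] zero_le_power2[of K] unfolding p_def by linarith
  have LJ: "\<bar>L\<bar> \<le> J" using J1 K2 by (intro sq) (auto simp: J_def)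
  have "\<bar>L * t * \<zeta>\<bar> = \<bar>L\<bar> * \<bar>\<zeta>\<bar> * t" using t by (simp add: abs_mult)
  also have "\<dots> \<le> \<bar>L\<bar> * \<bar>\<zeta>\<bar> * (\<bar>\<eta>\<bar> + \<bar>\<zeta>\<bar>)" using tb by (intro mult_left_mono) auto
  also have "\<dots> = \<bar>\<eta>\<bar> * (\<bar>L\<bar> * \<bar>\<zeta>\<bar>) + \<bar>L\<bar> * \<zeta>\<^sup>2" by (simp add: power2_eq_square algebra_simps)
  also have "\<dots> \<le> J * p + J * p" using e Lz LJ z2 J1 p1 by (intro add_mono mult_mono) auto
  finally show "\<bar>L * t * \<zeta>\<bar> \<le> 9 * (J * p)" using ap a by linarith
qed

section \<open>Sobolev norms of vector fields\<close>

lemma borel_measurable_vec: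
  fixes g :: "'a \<Rightarrow> complex^'n"
  assumes "\<And>j. (\<lambda>x. g x $ j) \<in> borel_measurable M"
  shows "g \<in> borel_measurable M"
proof (rule borel_measurable_euclidean_space[THEN iffD2], rule ballI)
  fix b :: "complex^'n" assume "b \<in> Basis"
  then obtain i c where "b = axis i c" by (auto simp: Basis_vec_def)
  thus "(\<lambda>x. g x \<bullet> b) \<in> borel_measurable M" using assms[of i] by (simp add: inner_axis)
qed

lemma norm_vec_power2: "(norm (v :: complex^'n))\<^sup>2 = (\<Sum>j\<in>UNIV. (cmod (v $ j))\<^sup>2)"
  by (simp add: norm_vec_def L2_set_def sum_nonneg)

lemma square_integrable_vec:
  fixes g :: "'a \<Rightarrow> complex^'n"
  assumes "\<And>j. square_integrable M (\<lambda>x. g x $ j)"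
  shows "square_integrable M g"
  unfolding square_integrable_def norm_vec_power2
  using assms by (auto intro!: borel_measurable_vec simp: square_integrable_def)

lemma square_integrable_vec_component:
  fixes g :: "'a \<Rightarrow> complex^'n"
  assumes "square_integrable M g"
  shows "square_integrable M (\<lambda>x. g x $ j)"
proof -
  have m[measurable]: "g \<in> borel_measurable M" and i: "integrable M (\<lambda>x. (norm (g x))\<^sup>2)"
    using assms by (auto simp: square_integrable_def)
  have c: "(\<lambda>x. g x $ j) \<in> borel_measurable M"
    by (intro measurable_compose[OF m] borel_measurable_continuous_onI continuous_intros)
  moreover have "integrable M (\<lambda>x. (cmod (g x $ j))\<^sup>2)"
    by (rule Bochner_Integration.integrable_bound[OF i])
       (use c in \<open>auto intro!: AE_I2 power_mono Finite_Cartesian_Product.norm_nth_le\<close>)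
  ultimately show ?thesis by (simp add: square_integrable_def)
qed

lemma fourier_vec_component: "fourier_vec f \<xi> $ j = fourier (\<lambda>p. f p $ j) \<xi>"
  by (simp add: fourier_vec_def)

lemma fourier_vec_measurable:
  fixes f :: "point \<Rightarrow> complex^'n"
  assumes "square_integrable cell f"
  shows "fourier_vec f \<in> borel_measurable freq_measure"
  by (rule borel_measurable_vec, unfold fourier_vec_component)
     (intro square_integrable_measurable fourier_square_integrable square_integrable_vec_component assms)

lemma japanese_eq: "japanese (k, \<eta>, l) = sqrt (1 + (of_int k)\<^sup>2 + \<eta>\<^sup>2 + (of_int l)\<^sup>2)"
  by (simp add: japanese_def freq_vec_norm add.assoc)

lemma japanese_ge_1: "japanese \<xi> \<ge> 1"
  by (simp add: japanese_def)

lemma japanese_measurable [measurable]: "japanese \<in> borel_measurable freq_measure"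
proof -
  have "(\<lambda>(k, \<eta>, l). sqrt (1 + (of_int k)\<^sup>2 + \<eta>\<^sup>2 + (of_int l)\<^sup>2)) \<in> borel_measurable freq_measure"
    by (rule freq_borel_measurable[of "\<lambda>k \<eta> l. sqrt (1 + k\<^sup>2 + \<eta>\<^sup>2 + l\<^sup>2)"]) (intro continuous_intros)
  moreover have "japanese = (\<lambda>(k, \<eta>, l). sqrt (1 + (of_int k)\<^sup>2 + \<eta>\<^sup>2 + (of_int l)\<^sup>2))"
    by (auto simp: fun_eq_iff japanese_eq)
  ultimately show ?thesis by simp
qed

text \<open>In the moving frame the solution at a frequency is compared with the data at the same
  frequency, so the weight of order \<open>s\<close> is common to both sides and the factor
  \<open>(japanese \<xi>)\<^sup>2\<close> is exactly the loss of two derivatives.\<close>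

lemma sobolev_transfer:
  fixes f :: "point \<Rightarrow> complex^'n" and g :: "point \<Rightarrow> complex^'m"
  assumes f: "in_sobolev (s + 2) f" and g: "square_integrable cell g" and C: "C \<ge> 0"
    and le: "AE \<xi> in freq_measure. norm (fourier_vec g \<xi>) \<le> C * (japanese \<xi>)\<^sup>2 * norm (fourier_vec f \<xi>)"
  shows "in_sobolev s g" "sobolev_norm s g \<le> C * sobolev_norm (s + 2) f"
proof -
  let ?F = "\<lambda>\<xi>. japanese \<xi> powr (s + 2) *\<^sub>R fourier_vec f \<xi>" and ?G = "\<lambda>\<xi>. japanese \<xi> powr s *\<^sub>R fourier_vec g \<xi>"
  have fi: "integrable freq_measure (\<lambda>\<xi>. (norm (?F \<xi>))\<^sup>2)" using f by (simp add: in_sobolev_def square_integrable_def)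
  have [measurable]: "fourier_vec g \<in> borel_measurable freq_measure" by (rule fourier_vec_measurable[OF g])
  have G[measurable]: "?G \<in> borel_measurable freq_measure" by measurable
  have le2: "AE \<xi> in freq_measure. (norm (?G \<xi>))\<^sup>2 \<le> C\<^sup>2 * (norm (?F \<xi>))\<^sup>2"
    using le
  proof eventually_elim
    case (elim \<xi>)
    have J: "japanese \<xi> > 0" using japanese_ge_1[of \<xi>] by linarith
    have "norm (?G \<xi>) \<le> japanese \<xi> powr s * (C * (japanese \<xi>)\<^sup>2 * norm (fourier_vec f \<xi>))"
      using elim by (simp add: mult_left_mono)
    also have "\<dots> = C * norm (?F \<xi>)" using J by (simp add: powr_add powr_numeral mult_ac)
    finally have "(norm (?G \<xi>))\<^sup>2 \<le> (C * norm (?F \<xi>))\<^sup>2" by (intro power_mono) auto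
    thus ?case by (simp add: power_mult_distrib)
  qed
  have gi: "integrable freq_measure (\<lambda>\<xi>. (norm (?G \<xi>))\<^sup>2)"
    by (rule Bochner_Integration.integrable_bound[OF integrable_mult_right[OF fi, of "C\<^sup>2"]]) (use le2 in auto)
  show "in_sobolev s g" using g G gi by (simp add: in_sobolev_def square_integrable_def)
  have "(LINT \<xi>|freq_measure. (norm (?G \<xi>))\<^sup>2) \<le> (LINT \<xi>|freq_measure. C\<^sup>2 * (norm (?F \<xi>))\<^sup>2)"
    by (rule integral_mono_AE[OF gi integrable_mult_right[OF fi] le2])
  hence "sqrt (LINT \<xi>|freq_measure. (norm (?G \<xi>))\<^sup>2) \<le> sqrt (C\<^sup>2 * (LINT \<xi>|freq_measure. (norm (?F \<xi>))\<^sup>2))" by simp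
  thus "sobolev_norm s g \<le> C * sobolev_norm (s + 2) f"
    using C by (simp add: sobolev_norm_def real_sqrt_mult)
qed

section \<open>Symbols, mode estimates and zero-mode formulas for a solution\<close>

context linearized
begin

lemma f_borel: "t \<ge> 0 \<Longrightarrow> f j t \<in> borel_measurable borel"
  by (intro borel_measurable_continuous_onI f_cont)

lemma f_x_periodic: "t \<ge> 0 \<Longrightarrow> x_periodic (f j t)"
  by (simp add: x_periodic_def f_per)

lemma fourier_f_measurable: "t \<ge> 0 \<Longrightarrow> fourier (f j t) \<in> borel_measurable freq_measure"
  by (intro square_integrable_measurable fourier_square_integrable f_sq)

text \<open>One of the symbols of the solution formula as functions of the whole frequency:
  measurability in all variables is required to pass from single lines to almost every
  frequency.\<close>

definition coef :: "real \<Rightarrow> freq \<Rightarrow> complex" where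
  "coef T = (\<lambda>(k, \<eta>, l). of_real ((of_int k)\<^sup>2 + \<eta>\<^sup>2 + (of_int l)\<^sup>2 - \<eta> * of_int k * T))"

definition decay :: "real \<Rightarrow> freq \<Rightarrow> complex" where
  "decay T = (\<lambda>(k, \<eta>, l). of_real (exp (- 4 * pi\<^sup>2 * \<nu> * action k l \<eta> T)))"

definition sqf :: "real \<Rightarrow> freq \<Rightarrow> complex" where
  "sqf T = (\<lambda>(k, \<eta>, l). of_real (freq_sq k l \<eta> T))"

definition fk :: "freq \<Rightarrow> complex" where "fk = (\<lambda>(k, \<eta>, l). of_int k)"
definition fl :: "freq \<Rightarrow> complex" where "fl = (\<lambda>(k, \<eta>, l). of_int l)"
definition fz :: "real \<Rightarrow> freq \<Rightarrow> complex" where "fz T = (\<lambda>(k, \<eta>, l). of_real (\<eta> - of_int k * T))"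

lemma symbols_measurable [measurable]: "coef T \<in> borel_measurable freq_measure" "decay T \<in> borel_measurable freq_measure"
  "sqf T \<in> borel_measurable freq_measure" "fk \<in> borel_measurable freq_measure" "fl \<in> borel_measurable freq_measure"
  "fz T \<in> borel_measurable freq_measure"
proof -
  show "coef T \<in> borel_measurable freq_measure" unfolding coef_def
    by (rule freq_borel_measurable[of "\<lambda>k \<eta> l. complex_of_real (k\<^sup>2 + \<eta>\<^sup>2 + l\<^sup>2 - \<eta> * k * T)"]) (intro continuous_intros)
  show "decay T \<in> borel_measurable freq_measure" unfolding decay_def action_def
    by (rule freq_borel_measurable[of "\<lambda>k \<eta> l. complex_of_real (exp (- 4 * pi\<^sup>2 * \<nu> * ((k\<^sup>2 + l\<^sup>2 + \<eta>\<^sup>2) * T - \<eta> * k * T\<^sup>2 + k\<^sup>2 * T ^ 3 / 3)))"])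
       (intro continuous_intros, auto)
  show "sqf T \<in> borel_measurable freq_measure" unfolding sqf_def freq_sq_def
    by (rule freq_borel_measurable[of "\<lambda>k \<eta> l. complex_of_real (k\<^sup>2 + (\<eta> - k * T)\<^sup>2 + l\<^sup>2)"]) (intro continuous_intros)
  show "fk \<in> borel_measurable freq_measure" unfolding fk_def
    using freq_borel_measurable[of "\<lambda>k \<eta> l. complex_of_real k"] by (simp add: continuous_intros)
  show "fl \<in> borel_measurable freq_measure" unfolding fl_def
    using freq_borel_measurable[of "\<lambda>k \<eta> l. complex_of_real l"] by (simp add: continuous_intros)
  show "fz T \<in> borel_measurable freq_measure" unfolding fz_def
    by (rule freq_borel_measurable[of "\<lambda>k \<eta> l. complex_of_real (\<eta> - k * T)"]) (intro continuous_intros)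
qed

lemma solution_formula:
  assumes T: "T \<ge> 0"
  shows "AE \<xi> in freq_measure.
      fourier (f 1 T) (shear T \<xi>) = decay T \<xi> * (coef T \<xi> * fourier (f 1 0) \<xi>
          + fk \<xi> ^ 2 * of_real T * fourier (f 2 0) \<xi>) / sqf T \<xi>
    \<and> fourier (f 2 T) (shear T \<xi>) = decay T \<xi> * (coef T \<xi> * fourier (f 2 0) \<xi>
          - (fk \<xi> ^ 2 + fl \<xi> ^ 2) * of_real T * fourier (f 1 0) \<xi>) / sqf T \<xi>
    \<and> fourier (f 3 T) (shear T \<xi>) = decay T \<xi> * (fourier (f 3 0) \<xi>
          + fl \<xi> * of_real T * (fz T \<xi> * fourier (f 1 0) \<xi> + fk \<xi> * fourier (f 2 0) \<xi>) / sqf T \<xi>)"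
proof (rule AE_freq_measureI)
  note [measurable] = fourier_f_measurable[OF T] fourier_f_measurable[OF order_refl]
  show "Measurable.pred freq_measure (\<lambda>\<xi>.
      fourier (f 1 T) (shear T \<xi>) = decay T \<xi> * (coef T \<xi> * fourier (f 1 0) \<xi>
          + fk \<xi> ^ 2 * of_real T * fourier (f 2 0) \<xi>) / sqf T \<xi>
    \<and> fourier (f 2 T) (shear T \<xi>) = decay T \<xi> * (coef T \<xi> * fourier (f 2 0) \<xi>
          - (fk \<xi> ^ 2 + fl \<xi> ^ 2) * of_real T * fourier (f 1 0) \<xi>) / sqf T \<xi>
    \<and> fourier (f 3 T) (shear T \<xi>) = decay T \<xi> * (fourier (f 3 0) \<xi>
          + fl \<xi> * of_real T * (fz T \<xi> * fourier (f 1 0) \<xi> + fk \<xi> * fourier (f 2 0) \<xi>) / sqf T \<xi>))"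
    by measurable
  show "AE \<eta> in lborel.
      fourier (f 1 T) (shear T (k, \<eta>, l)) = decay T (k, \<eta>, l) * (coef T (k, \<eta>, l) * fourier (f 1 0) (k, \<eta>, l)
          + fk (k, \<eta>, l) ^ 2 * of_real T * fourier (f 2 0) (k, \<eta>, l)) / sqf T (k, \<eta>, l)
    \<and> fourier (f 2 T) (shear T (k, \<eta>, l)) = decay T (k, \<eta>, l) * (coef T (k, \<eta>, l) * fourier (f 2 0) (k, \<eta>, l)
          - (fk (k, \<eta>, l) ^ 2 + fl (k, \<eta>, l) ^ 2) * of_real T * fourier (f 1 0) (k, \<eta>, l)) / sqf T (k, \<eta>, l)
    \<and> fourier (f 3 T) (shear T (k, \<eta>, l)) = decay T (k, \<eta>, l) * (fourier (f 3 0) (k, \<eta>, l)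
          + fl (k, \<eta>, l) * of_real T * (fz T (k, \<eta>, l) * fourier (f 1 0) (k, \<eta>, l) + fk (k, \<eta>, l) * fourier (f 2 0) (k, \<eta>, l)) / sqf T (k, \<eta>, l))" for k l
    using solution_formula_mode[OF T, of k l]
    by eventually_elim (simp add: decay_def coef_def sqf_def fk_def fl_def fz_def)
qed

lemma component_set_integral:
  fixes v :: "real \<Rightarrow> real^3"
  assumes "continuous_on {0..1} v"
  shows "complex_of_real ((LINT x:{0..1}|lborel. v x) $ j) = (LINT x|unit_interval. complex_of_real (v x $ j))"
proof -
  have bl: "bounded_linear (\<lambda>v :: real^3. complex_of_real (v $ j))"
    by (intro bounded_linear_compose[OF bounded_linear_of_real bounded_linear_vec_nth])
  have i: "integrable lborel (\<lambda>x. indicator {0..1} x *\<^sub>R v x)"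
    by (intro borel_integrable_compact assms) simp
  have "complex_of_real ((LINT x:{0..1}|lborel. v x) $ j) = (LINT x|lborel. complex_of_real ((indicator {0..1} x *\<^sub>R v x) $ j))"
    unfolding set_lebesgue_integral_def by (rule integral_bounded_linear[OF bl i, symmetric])
  also have "\<dots> = (LINT x|unit_interval. complex_of_real (v x $ j))"
    unfolding unit_interval_integral set_lebesgue_integral_def by (simp add: scaleR_conv_of_real[where 'a = complex])
  finally show ?thesis .
qed

text \<open>The zero mode is a vector valued integral. Continuity makes it convergent, so that
  taking a component commutes with it.\<close>

lemma component_zero_mode:
  fixes v :: "point \<Rightarrow> real^3"
  assumes "continuous_on UNIV v"
  shows "component (zero_mode v) j = x_mean (component v j)"
proof
  fix p :: point
  obtain x y z where p: "p = (x, y, z)" by (cases p)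
  have "continuous_on {0..1} (\<lambda>x'. v (x', y, z))"
    by (rule continuous_on_compose2[OF assms]) (auto intro!: continuous_intros)
  from component_set_integral[OF this, of j] show "component (zero_mode v) j p = x_mean (component v j) p"
    by (simp add: component_def zero_mode_def x_mean_def p)
qed

lemma u_cont: "t \<ge> 0 \<Longrightarrow> continuous_on UNIV (u t)"
proof (cases "t = 0")
  case True thus ?thesis using u_in_continuous u_0 by simp
next
  case False
  assume "t \<ge> 0"
  hence t: "t > 0" using False by simp
  have "continuous_on UNIV (\<lambda>p. V (t, p))"
    by (rule continuous_on_compose2[OF Ck_on_2D(1)[OF V_C2 basis(1)]]) (use t in \<open>auto intro!: continuous_intros\<close>)
  thus ?thesis by (simp add: V_def)
qed

text \<open>For nonzero \<open>k\<close> subtracting the mean has no effect on the mode; the moving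
  frame shears the frequency, and the mode symbol selects \<open>k\<close>.\<close>

lemma fourier_U_mode:
  assumes t: "t \<ge> 0" and k: "k \<noteq> 0"
  shows "square_integrable cell (U_mode u k j t)"
    and "AE \<xi> in freq_measure. fourier (U_mode u k j t) \<xi> = (if fst \<xi> = k then fourier (f j t) (shear t \<xi>) else 0)"
proof -
  let ?m = "moved t (f j t)"
  have c: "continuous_on UNIV (moving_frame u t)"
    unfolding moving_frame_def case_prod_unfold
    by (rule continuous_on_compose2[OF u_cont[OF t]]) (auto intro!: continuous_intros)
  have m: "component (moving_frame u t) j = ?m" by (auto simp: component_def moving_frame_def moved_def fun_eq_iff)
  have h: "component (nonzero_modes (moving_frame u t)) j = (\<lambda>p. ?m p - x_mean ?m p)"
    using component_zero_mode[OF c, of j] m by (simp add: nonzero_modes_def component_def fun_eq_iff)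
  note fb = f_borel[OF t, of j] and fp = f_x_periodic[OF t, of j] and fs = f_sq[OF t, of j]
  have ms: "square_integrable cell ?m" by (rule moved_square_integrable[OF fb fp fs])
  have mb: "?m \<in> borel_measurable borel" by (rule moved_measurable[OF fb])
  have xs: "square_integrable cell (x_mean ?m)" by (rule x_mean_square_integrable[OF mb ms])
  have hs: "square_integrable cell (\<lambda>p. ?m p - x_mean ?m p)" by (rule square_integrable_diff(1)[OF ms xs])
  note M = multiplier_bounded[OF hs mode_ind_measurable[of k], of 1]
  have b1: "cmod (case \<xi> of (k', \<eta>, l) \<Rightarrow> if k' = k then 1 else 0) \<le> 1" for \<xi> :: freq by (auto simp: case_prod_unfold)
  show "square_integrable cell (U_mode u k j t)" unfolding U_mode_def x_mode_def h by (rule M(1)[OF b1])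
  show "AE \<xi> in freq_measure. fourier (U_mode u k j t) \<xi> = (if fst \<xi> = k then fourier (f j t) (shear t \<xi>) else 0)"
    unfolding U_mode_def x_mode_def h
    using M(2)[OF b1] fourier_diff[OF ms xs] fourier_moved[OF fb fp fs, of t] fourier_x_mean[OF mb ms]
  proof eventually_elim
    case (elim \<xi>)
    thus ?case using k by (cases \<xi>) (auto simp: zero_ind_def)
  qed
qed

text \<open>Combines two symbol bounds from \<open>coefficient_bounds\<close>: \<open>P\<close> is
  the denominator of the solution formula, and \<open>r\<close> is the time factor to be gained, or
  1 where no algebraic decay is claimed.\<close>

lemma cmod_combination:
  assumes "cmod a * r \<le> B" "cmod b * r \<le> B" "r > 0" "P > 0"
  shows "cmod (a * x + b * y) / P \<le> B / (P * r) * (cmod x + cmod y)"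
proof -
  have "cmod (a * x + b * y) * r \<le> (cmod a * cmod x + cmod b * cmod y) * r"
    using assms(3) norm_triangle_ineq[of "a * x" "b * y"] by (intro mult_right_mono) (auto simp: norm_mult)
  also have "\<dots> = cmod a * r * cmod x + cmod b * r * cmod y" by (simp add: algebra_simps)
  also have "\<dots> \<le> B * cmod x + B * cmod y" using assms by (intro add_mono mult_right_mono) auto
  finally have "cmod (a * x + b * y) * r \<le> B * (cmod x + cmod y)" by (simp add: distrib_left)
  hence "cmod (a * x + b * y) \<le> B * (cmod x + cmod y) / r" using assms(3) by (simp add: pos_le_divide_eq)
  hence "cmod (a * x + b * y) / P \<le> (B * (cmod x + cmod y) / r) / P" using assms(4) by (intro divide_right_mono) auto
  thus ?thesis by (simp add: field_simps)
qed

text \<open>Each initial coefficient is at most the norm \<open>N\<close> of the vector, so two of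
  them with the constant 9 of \<open>coefficient_bounds\<close> give 18.\<close>

lemma mode_bounds:
  assumes t: "t \<ge> 0"
  shows "AE \<xi> in freq_measure. fst \<xi> \<noteq> 0 \<longrightarrow>
     (let D = exp (- (\<nu> / 6) * (of_int (fst \<xi>))\<^sup>2 * t ^ 3); N = norm (fourier_vec (complexify u_in) \<xi>) in
      cmod (fourier (f 1 t) (shear t \<xi>)) \<le> 18 * (1 / sqrt (1 + t\<^sup>2)) * D * (japanese \<xi>)\<^sup>2 * N \<and>
      cmod (fourier (f 2 t) (shear t \<xi>)) \<le> 18 * (1 / sqrt (1 + t\<^sup>2)) * D * (japanese \<xi>)\<^sup>2 * N \<and>
      cmod (fourier (f 3 t) (shear t \<xi>)) \<le> 36 * D * (japanese \<xi>)\<^sup>2 * N)"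
  using solution_formula[OF t]
proof eventually_elim
  case (elim \<xi>)
  show ?case
  proof (intro impI)
    assume k0: "fst \<xi> \<noteq> 0"
    obtain k \<eta> l where \<xi>: "\<xi> = (k, \<eta>, l)" by (cases \<xi>)
    define K L where "K = real_of_int k" and "L = real_of_int l"
    define J where "J = 1 + K\<^sup>2 + \<eta>\<^sup>2 + L\<^sup>2"
    define p where "p = K\<^sup>2 + (\<eta> - K * t)\<^sup>2 + L\<^sup>2"
    define D where "D = exp (- (\<nu> / 6) * K\<^sup>2 * t ^ 3)"
    define N where "N = norm (fourier_vec (complexify u_in) \<xi>)"
    define X where "X j = fourier (f j 0) \<xi>" for j
    define r where "r = sqrt (1 + t\<^sup>2)"
    have K1: "\<bar>K\<bar> \<ge> 1" using k0 by (simp add: \<xi> K_def)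
    note b = coefficient_bounds[OF K1 t, where L = L and \<eta> = \<eta>, folded J_def p_def]
    have XN: "cmod (X j) \<le> N" for j
    proof -
      have "X j = fourier_vec (complexify u_in) \<xi> $ j"
        by (simp add: X_def fourier_vec_component u_0 component_def[abs_def] complexify_def)
      thus ?thesis unfolding N_def by (simp add: Finite_Cartesian_Product.norm_nth_le)
    qed
    have J2: "(japanese \<xi>)\<^sup>2 = J" unfolding \<xi> japanese_eq J_def K_def L_def by (simp add: add_nonneg_nonneg)
    have J0: "J \<ge> 1" by (simp add: J_def)
    \<comment> \<open>\<open>coefficient_bounds\<close> gains 1 + t, which dominates the required
      sqrt (1 + t^2).\<close>
    have r: "r \<ge> 1" "r \<le> 1 + t"
      using t by (auto simp: r_def power2_eq_square algebra_simps intro!: real_le_lsqrt)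
    have dc: "cmod (decay t \<xi>) \<le> D"
      unfolding \<xi> decay_def D_def K_def prod.case norm_of_real abs_exp_cancel by (rule decay_bound[OF \<nu>_pos t])
    have D0: "D > 0" by (simp add: D_def)
    have sq: "sqf t \<xi> = of_real p" by (simp add: \<xi> sqf_def freq_sq_def p_def K_def L_def)
    have div: "cmod (decay t \<xi> * w / sqf t \<xi>) \<le> D * (cmod w / p)" for w
      unfolding sq norm_divide norm_mult using dc b(1) by (simp add: mult_right_mono divide_right_mono times_divide_eq_right[symmetric] del: times_divide_eq_right)
    have c1: "cmod (coef t \<xi>) * r \<le> 9 * (J * p)"
    proof -
      have "cmod (coef t \<xi>) * r \<le> \<bar>K\<^sup>2 + \<eta>\<^sup>2 + L\<^sup>2 - \<eta> * K * t\<bar> * (1 + t)"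
        unfolding \<xi> coef_def prod.case norm_of_real K_def L_def using r by (intro mult_left_mono) auto
      thus ?thesis using b(3) by linarith
    qed
    have at: "(K\<^sup>2 + L\<^sup>2) * t * r \<le> 9 * (J * p)"
    proof -
      have "(K\<^sup>2 + L\<^sup>2) * t * r \<le> (K\<^sup>2 + L\<^sup>2) * t * (1 + t)" using r t by (intro mult_left_mono) auto
      thus ?thesis using b(2) by linarith
    qed
    have c2: "cmod (fk \<xi> ^ 2 * of_real t) * r \<le> 9 * (J * p)"
    proof -
      have "cmod (fk \<xi> ^ 2 * of_real t) = K\<^sup>2 * t" using t by (simp add: \<xi> fk_def K_def norm_mult norm_power)
      also have "K\<^sup>2 * t * r \<le> (K\<^sup>2 + L\<^sup>2) * t * r" using r t by (intro mult_right_mono) auto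
      finally show ?thesis using at by linarith
    qed
    have c3: "cmod (- ((fk \<xi> ^ 2 + fl \<xi> ^ 2) * of_real t)) * r \<le> 9 * (J * p)"
    proof -
      have "(fk \<xi> ^ 2 + fl \<xi> ^ 2) * of_real t = complex_of_real ((K\<^sup>2 + L\<^sup>2) * t)" by (simp add: \<xi> fk_def fl_def K_def L_def)
      hence "cmod (- ((fk \<xi> ^ 2 + fl \<xi> ^ 2) * of_real t)) = (K\<^sup>2 + L\<^sup>2) * t" using t unfolding norm_minus_cancel by (simp only: norm_of_real) (simp add: abs_mult)
      thus ?thesis using at by simp
    qed
    have fin: "D * (9 * (J * p) / (p * r') * (cmod (X i) + cmod (X j))) \<le> 18 * (1 / r') * D * J * N" if "r' \<ge> 1" for i j r'
    proof -
      have "9 * (J * p) / (p * r') = 9 * J / r'" using b(1) by simp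
      moreover have "D * (9 * J / r' * (cmod (X i) + cmod (X j))) \<le> D * (9 * J / r' * (N + N))"
        using D0 J0 that XN by (intro mult_left_mono add_mono) auto
      ultimately show ?thesis by (simp add: field_simps)
    qed
    have r0: "r > 0" using r by linarith
    have 1: "cmod (fourier (f 1 t) (shear t \<xi>)) \<le> 18 * (1 / r) * D * J * N"
    proof -
      have "cmod (fourier (f 1 t) (shear t \<xi>)) \<le> D * (cmod (coef t \<xi> * X 1 + fk \<xi> ^ 2 * of_real t * X 2) / p)"
        using elim div unfolding X_def by simp
      also have "\<dots> \<le> D * (9 * (J * p) / (p * r) * (cmod (X 1) + cmod (X 2)))"
        using cmod_combination[OF c1 c2 r0 b(1)] D0 by (intro mult_left_mono) auto
      finally show ?thesis using fin[OF r(1), of 1 2] by linarith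
    qed
    have 2: "cmod (fourier (f 2 t) (shear t \<xi>)) \<le> 18 * (1 / r) * D * J * N"
    proof -
      have "cmod (fourier (f 2 t) (shear t \<xi>)) \<le> D * (cmod (coef t \<xi> * X 2 + (- ((fk \<xi> ^ 2 + fl \<xi> ^ 2) * of_real t)) * X 1) / p)"
        using elim div unfolding X_def by simp
      also have "\<dots> \<le> D * (9 * (J * p) / (p * r) * (cmod (X 2) + cmod (X 1)))"
        using cmod_combination[OF c1 c3 r0 b(1)] D0 by (intro mult_left_mono) auto
      finally show ?thesis using fin[OF r(1), of 2 1] by linarith
    qed
    have 3: "cmod (fourier (f 3 t) (shear t \<xi>)) \<le> 36 * D * J * N"
    proof -
      have c4: "cmod (fl \<xi> * of_real t * fz t \<xi>) * 1 \<le> 9 * (J * p)" "cmod (fl \<xi> * of_real t * fk \<xi>) * 1 \<le> 9 * (J * p)"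
      proof -
        have "fl \<xi> * of_real t * fz t \<xi> = of_real (L * t * (\<eta> - K * t))" "fl \<xi> * of_real t * fk \<xi> = of_real (L * t * K)"
          by (simp_all add: \<xi> fl_def fz_def fk_def K_def L_def)
        thus "cmod (fl \<xi> * of_real t * fz t \<xi>) * 1 \<le> 9 * (J * p)" "cmod (fl \<xi> * of_real t * fk \<xi>) * 1 \<le> 9 * (J * p)"
          using b(4,5) by (simp_all only: norm_of_real mult_1_right)
      qed
      have "cmod (fourier (f 3 t) (shear t \<xi>))
          = cmod (decay t \<xi>) * cmod (X 3 + (fl \<xi> * of_real t * fz t \<xi> * X 1 + fl \<xi> * of_real t * fk \<xi> * X 2) / of_real p)"
        using elim unfolding X_def sq norm_mult[symmetric] by (simp add: distrib_left mult.assoc)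
      also have "\<dots> \<le> D * (cmod (X 3) + cmod (fl \<xi> * of_real t * fz t \<xi> * X 1 + fl \<xi> * of_real t * fk \<xi> * X 2) / p)"
      proof (rule mult_mono[OF dc])
        show "cmod (X 3 + (fl \<xi> * of_real t * fz t \<xi> * X 1 + fl \<xi> * of_real t * fk \<xi> * X 2) / of_real p)
            \<le> cmod (X 3) + cmod (fl \<xi> * of_real t * fz t \<xi> * X 1 + fl \<xi> * of_real t * fk \<xi> * X 2) / p"
          by (rule order_trans[OF norm_triangle_ineq]) (use b(1) in \<open>simp add: norm_divide\<close>)
      qed (use D0 in auto)
      also have "\<dots> = D * cmod (X 3) + D * (cmod (fl \<xi> * of_real t * fz t \<xi> * X 1 + fl \<xi> * of_real t * fk \<xi> * X 2) / p)"
        by (rule distrib_left)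
      also have "\<dots> \<le> D * (1 * N) + D * (9 * (J * p) / (p * 1) * (cmod (X 1) + cmod (X 2)))"
        using cmod_combination[OF c4 zero_less_one b(1)] D0 XN[of 3] by (intro add_mono mult_left_mono) auto
      also have "\<dots> \<le> D * (J * N) + 18 * (1 / 1) * D * J * N"
        using fin[of 1 1 2] J0 D0 by (intro add_mono mult_left_mono mult_right_mono) (auto simp: N_def)
      \<comment> \<open>One comes from the initial third component and 18 from the other two. It is
        rounded up to 36, the constant that the pair of the first two components will need.\<close>
      also have "\<dots> = 19 * (D * J * N)" by simp
      also have "\<dots> \<le> 36 * (D * J * N)" using D0 J0 by (intro mult_right_mono) (auto simp: N_def)
      finally show ?thesis by simp
    qed
    show "let D = exp (- (\<nu> / 6) * (of_int (fst \<xi>))\<^sup>2 * t ^ 3); N = norm (fourier_vec (complexify u_in) \<xi>) in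
      cmod (fourier (f 1 t) (shear t \<xi>)) \<le> 18 * (1 / sqrt (1 + t\<^sup>2)) * D * (japanese \<xi>)\<^sup>2 * N \<and>
      cmod (fourier (f 2 t) (shear t \<xi>)) \<le> 18 * (1 / sqrt (1 + t\<^sup>2)) * D * (japanese \<xi>)\<^sup>2 * N \<and>
      cmod (fourier (f 3 t) (shear t \<xi>)) \<le> 36 * D * (japanese \<xi>)\<^sup>2 * N"
      using 1 2 3 unfolding Let_def J2 r_def D_def N_def K_def by (simp add: \<xi>)
  qed
qed

text \<open>The norm of a pair is at most the sum of the moduli of its entries, which doubles 18 to
  36; off the frequency \<open>k\<close> the transforms vanish and the bounds are trivial.\<close>

lemma nonzero_mode_estimates:
  assumes t: "t \<ge> 0" and k: "k \<noteq> 0" and s: "in_sobolev (s + 2) (complexify u_in)"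
  defines "D \<equiv> exp (- (\<nu> / 6) * (of_int k)\<^sup>2 * t ^ 3)"
    and "U12 \<equiv> (\<lambda>p. vector [U_mode u k 1 t p, U_mode u k 2 t p] :: complex^2)"
    and "U3 \<equiv> (\<lambda>p. vector [U_mode u k 3 t p] :: complex^1)"
  shows "in_sobolev s U12" "in_sobolev s U3"
    "sobolev_norm s U12 \<le> 36 * (1 / sqrt (1 + t\<^sup>2)) * D * sobolev_norm (s + 2) (complexify u_in)"
    "sobolev_norm s U3 \<le> 36 * D * sobolev_norm (s + 2) (complexify u_in)"
proof -
  note U = fourier_U_mode[OF t k]
  have U12_j: "(\<lambda>p. U12 p $ 1) = U_mode u k 1 t" "(\<lambda>p. U12 p $ 2) = U_mode u k 2 t" "(\<lambda>p. U3 p $ 1) = U_mode u k 3 t"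
    by (simp_all add: U12_def U3_def)
  have "square_integrable cell (\<lambda>p. U12 p $ j)" for j using exhaust_2[of j] U12_j U(1) by auto
  hence s12: "square_integrable cell U12" by (rule square_integrable_vec)
  have "square_integrable cell (\<lambda>p. U3 p $ j)" for j unfolding num1_eq1[of j] U12_j(3) by (rule U(1))
  hence s3: "square_integrable cell U3" by (rule square_integrable_vec)
  have l12: "AE \<xi> in freq_measure. norm (fourier_vec U12 \<xi>)
      \<le> (36 * (1 / sqrt (1 + t\<^sup>2)) * D) * (japanese \<xi>)\<^sup>2 * norm (fourier_vec (complexify u_in) \<xi>)"
    using U(2)[of 1] U(2)[of 2] mode_bounds[OF t]
  proof eventually_elim
    case (elim \<xi>)
    have n: "norm (fourier_vec U12 \<xi>) \<le> cmod (fourier (U_mode u k 1 t) \<xi>) + cmod (fourier (U_mode u k 2 t) \<xi>)"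
      unfolding norm_vec_def L2_set_def sum_2 fourier_vec_component U12_j
      by (rule sqrt_sum_squares_le_sum) simp_all
    show ?case
    proof (cases "fst \<xi> = k")
      case True
      thus ?thesis using n elim k by (simp add: Let_def D_def)
    next
      case False
      hence "norm (fourier_vec U12 \<xi>) \<le> 0" using n elim by simp
      also have "0 \<le> (36 * (1 / sqrt (1 + t\<^sup>2)) * D) * (japanese \<xi>)\<^sup>2 * norm (fourier_vec (complexify u_in) \<xi>)"
        by (simp add: D_def)
      finally show ?thesis .
    qed
  qed
  have l3: "AE \<xi> in freq_measure. norm (fourier_vec U3 \<xi>)
      \<le> (36 * D) * (japanese \<xi>)\<^sup>2 * norm (fourier_vec (complexify u_in) \<xi>)"
    using U(2)[of 3] mode_bounds[OF t]
  proof eventually_elim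
    case (elim \<xi>)
    have n: "norm (fourier_vec U3 \<xi>) = cmod (fourier (U_mode u k 3 t) \<xi>)"
      by (simp add: norm_vec_def L2_set_def UNIV_1 fourier_vec_component U12_j)
    show ?case
    proof (cases "fst \<xi> = k")
      case True
      thus ?thesis using n elim k by (simp add: Let_def D_def)
    next
      case False
      thus ?thesis using n elim by (simp add: D_def)
    qed
  qed
  have C12: "36 * (1 / sqrt (1 + t\<^sup>2)) * D \<ge> 0" and C3: "36 * D \<ge> 0" by (simp_all add: D_def)
  note T12 = sobolev_transfer[OF s s12 C12 l12] and T3 = sobolev_transfer[OF s s3 C3 l3]
  show "in_sobolev s U12" "in_sobolev s U3"
    "sobolev_norm s U12 \<le> 36 * (1 / sqrt (1 + t\<^sup>2)) * D * sobolev_norm (s + 2) (complexify u_in)"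
    "sobolev_norm s U3 \<le> 36 * D * sobolev_norm (s + 2) (complexify u_in)"
    by (rule T12 T3)+
qed

text \<open>On k = 0 the shear is the identity, the action is t (\<eta>^2 + l^2), and
  \<open>coef\<close> and \<open>sqf\<close> coincide, so the solution formula reduces to products
  of the multiplier symbols. Injectivity of the transform carries this back to functions.\<close>

lemma zero_mode_formulas:
  assumes t: "t \<ge> 0"
  defines "g \<equiv> (\<lambda>j. component (zero_mode u_in) j)"
  shows "AE p in cell. component (zero_mode (u t)) 1 p = heat_yz \<nu> t (g 1) p"
    "AE p in cell. component (zero_mode (u t)) 2 p = heat_yz \<nu> t (\<lambda>q. g 2 q - of_real t * zz_op (g 1) q) p"
    "AE p in cell. component (zero_mode (u t)) 3 p = heat_yz \<nu> t (\<lambda>q. g 3 q + of_real t * zy_op (g 1) q) p"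
proof -
  have g: "g j = x_mean (f j 0)" for j
    unfolding g_def u_0[symmetric] by (rule component_zero_mode[OF u_cont]) simp
  have gs: "square_integrable cell (g j)" for j
    unfolding g by (intro x_mean_square_integrable f_borel f_sq) auto
  have gf: "AE \<xi> in freq_measure. fourier (g j) \<xi> = zero_ind \<xi> * fourier (f j 0) \<xi>" for j
    unfolding g by (intro fourier_x_mean f_borel f_sq) auto
  have w: "component (zero_mode (u t)) j = x_mean (f j t)" for j by (rule component_zero_mode[OF u_cont[OF t]])
  have ws: "square_integrable cell (x_mean (f j t))" for j
    using t by (intro x_mean_square_integrable f_borel f_sq)
  have wf: "AE \<xi> in freq_measure. fourier (x_mean (f j t)) \<xi> = zero_ind \<xi> * fourier (f j t) \<xi>" for j
    using t by (intro fourier_x_mean f_borel f_sq)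
  let ?h = "\<lambda>(k :: int, \<eta>, l :: int). complex_of_real (exp (- 4 * pi\<^sup>2 * \<nu> * t * (\<eta>\<^sup>2 + (of_int l)\<^sup>2)))"
  let ?zz = "\<lambda>(k :: int, \<eta>, l :: int). complex_of_real ((of_int l)\<^sup>2 / (\<eta>\<^sup>2 + (of_int l)\<^sup>2))"
  let ?zy = "\<lambda>(k :: int, \<eta>, l :: int). complex_of_real (\<eta> * of_int l / (\<eta>\<^sup>2 + (of_int l)\<^sup>2))"
  have hm: "?h \<in> borel_measurable freq_measure"
    by (rule freq_borel_measurable[of "\<lambda>k \<eta> l. complex_of_real (exp (- 4 * pi\<^sup>2 * \<nu> * t * (\<eta>\<^sup>2 + l\<^sup>2)))"]) (intro continuous_intros)
  have den: "(\<lambda>(k :: int, \<eta>, l :: int). complex_of_real (\<eta>\<^sup>2 + (of_int l)\<^sup>2)) \<in> borel_measurable freq_measure"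
    by (rule freq_borel_measurable[of "\<lambda>k \<eta> l. complex_of_real (\<eta>\<^sup>2 + l\<^sup>2)"]) (intro continuous_intros)
  have zzm: "?zz \<in> borel_measurable freq_measure"
  proof -
    have "(\<lambda>(k :: int, \<eta>, l :: int). complex_of_real ((of_int l)\<^sup>2)) \<in> borel_measurable freq_measure"
      by (rule freq_borel_measurable[of "\<lambda>k \<eta> l. complex_of_real (l\<^sup>2)"]) (intro continuous_intros)
    from borel_measurable_divide[OF this den] show ?thesis by (simp add: case_prod_unfold)
  qed
  have zym: "?zy \<in> borel_measurable freq_measure"
  proof -
    have "(\<lambda>(k :: int, \<eta>, l :: int). complex_of_real (\<eta> * of_int l)) \<in> borel_measurable freq_measure"
      by (rule freq_borel_measurable[of "\<lambda>k \<eta> l. complex_of_real (\<eta> * l)"]) (intro continuous_intros)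
    from borel_measurable_divide[OF this den] show ?thesis by (simp add: case_prod_unfold)
  qed
  have hb: "cmod (?h \<xi>) \<le> 1" for \<xi> using \<nu>_pos t by (simp add: case_prod_unfold)
  have zzb: "cmod (?zz \<xi>) \<le> 1" for \<xi> by (cases \<xi>) (simp add: norm_divide divide_le_eq not_sum_power2_lt_zero flip: of_real_power of_real_add)
  have zyb: "cmod (?zy \<xi>) \<le> 1" for \<xi>
  proof -
    obtain k \<eta> l where \<xi>: "\<xi> = (k, \<eta>, l)" by (cases \<xi>)
    have "\<bar>\<eta> * real_of_int l\<bar> \<le> \<eta>\<^sup>2 + (of_int l)\<^sup>2" unfolding abs_mult by (rule abs_mult_le_sum_squares)
    hence "\<bar>\<eta> * of_int l / (\<eta>\<^sup>2 + (of_int l)\<^sup>2)\<bar> \<le> 1" by (simp add: divide_le_eq not_sum_power2_lt_zero)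
    thus ?thesis unfolding \<xi> prod.case norm_of_real .
  qed
  have key: "AE p in cell. component (zero_mode (u t)) j p = heat_yz \<nu> t F p"
    if F: "square_integrable cell F"
      and e: "AE \<xi> in freq_measure. zero_ind \<xi> * fourier (f j t) \<xi> = ?h \<xi> * fourier F \<xi>" for F j
  proof -
    note M = multiplier_bounded[OF F hm hb, folded heat_yz_def]
    show ?thesis unfolding w
    proof (rule fourier_inject[OF ws M(1)])
      show "AE \<xi> in freq_measure. fourier (x_mean (f j t)) \<xi> = fourier (heat_yz \<nu> t F) \<xi>"
        using wf[of j] M(2) e by eventually_elim simp
    qed
  qed
  \<comment> \<open>Discards the zero frequency, where \<open>coef\<close> and \<open>sqf\<close>
    vanish on k = 0 and cannot be cancelled.\<close>
  have nz: "AE \<xi> in freq_measure. fst (snd \<xi>) \<noteq> 0"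
  proof (rule AE_freq_measureI)
    show "Measurable.pred freq_measure (\<lambda>\<xi>. fst (snd \<xi>) \<noteq> 0)" unfolding freq_measure_def by measurable
  qed (use AE_lborel_singleton[of 0] in simp)
  have sf: "AE \<xi> in freq_measure. fst \<xi> = 0 \<longrightarrow>
      fourier (f 1 t) \<xi> = ?h \<xi> * fourier (f 1 0) \<xi> \<and>
      fourier (f 2 t) \<xi> = ?h \<xi> * (fourier (f 2 0) \<xi> - of_real t * (?zz \<xi> * fourier (f 1 0) \<xi>)) \<and>
      fourier (f 3 t) \<xi> = ?h \<xi> * (fourier (f 3 0) \<xi> + of_real t * (?zy \<xi> * fourier (f 1 0) \<xi>))"
    using solution_formula[OF t] nz
  proof eventually_elim
    case (elim \<xi>)
    show ?case
    proof (intro impI)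
      assume k: "fst \<xi> = 0"
      obtain \<eta> l where \<xi>: "\<xi> = (0, \<eta>, l)" using k by (cases \<xi>) auto
      define A where "A = complex_of_real (\<eta>\<^sup>2 + (of_int l)\<^sup>2)"
      have "\<eta> \<noteq> 0" using elim(2) by (simp add: \<xi>)
      hence A0: "A \<noteq> 0" unfolding A_def of_real_eq_0_iff by (simp add: add_nonneg_eq_0_iff)
      have s: "shear t \<xi> = \<xi>" by (simp add: \<xi> shear_def)
      have d: "decay t \<xi> = ?h \<xi>" by (simp add: \<xi> decay_def action_def algebra_simps)
      have c: "coef t \<xi> = A" "sqf t \<xi> = A" by (simp_all add: \<xi> coef_def sqf_def freq_sq_def A_def)
      have k0: "fk \<xi> = 0" "fl \<xi> = of_int l" "fz t \<xi> = of_real \<eta>" by (simp_all add: \<xi> fk_def fl_def fz_def)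
      have z: "?zz \<xi> = of_int l ^ 2 / A" "?zy \<xi> = of_real \<eta> * of_int l / A" by (simp_all add: \<xi> A_def)
      show "fourier (f 1 t) \<xi> = ?h \<xi> * fourier (f 1 0) \<xi> \<and>
        fourier (f 2 t) \<xi> = ?h \<xi> * (fourier (f 2 0) \<xi> - of_real t * (?zz \<xi> * fourier (f 1 0) \<xi>)) \<and>
        fourier (f 3 t) \<xi> = ?h \<xi> * (fourier (f 3 0) \<xi> + of_real t * (?zy \<xi> * fourier (f 1 0) \<xi>))"
        using elim(1) A0 unfolding s d c k0 z by (simp add: field_simps)
    qed
  qed
  note ZZ = multiplier_bounded[OF gs zzm zzb, of 1, folded zz_op_def]
  note ZY = multiplier_bounded[OF gs zym zyb, of 1, folded zy_op_def]
  show "AE p in cell. component (zero_mode (u t)) 1 p = heat_yz \<nu> t (g 1) p"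
  proof (rule key[OF gs])
    show "AE \<xi> in freq_measure. zero_ind \<xi> * fourier (f 1 t) \<xi> = ?h \<xi> * fourier (g 1) \<xi>"
      using sf gf[of 1] by eventually_elim (auto simp: zero_ind_def)
  qed
  show "AE p in cell. component (zero_mode (u t)) 2 p = heat_yz \<nu> t (\<lambda>q. g 2 q - of_real t * zz_op (g 1) q) p"
  proof (rule key)
    show "square_integrable cell (\<lambda>q. g 2 q - of_real t * zz_op (g 1) q)"
      by (intro square_integrable_diff(1) square_integrable_scale(1) gs ZZ(1))
    show "AE \<xi> in freq_measure. zero_ind \<xi> * fourier (f 2 t) \<xi> = ?h \<xi> * fourier (\<lambda>q. g 2 q - of_real t * zz_op (g 1) q) \<xi>"
      using sf gf[of 1] gf[of 2] ZZ(2) fourier_scale_diff[OF gs[of 2] ZZ(1), of "of_real t"]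
      by eventually_elim (auto simp: zero_ind_def)
  qed
  show "AE p in cell. component (zero_mode (u t)) 3 p = heat_yz \<nu> t (\<lambda>q. g 3 q + of_real t * zy_op (g 1) q) p"
  proof (rule key)
    show "square_integrable cell (\<lambda>q. g 3 q + of_real t * zy_op (g 1) q)"
      by (intro square_integrable_add(1) square_integrable_scale(1) gs ZY(1))
    have "AE \<xi> in freq_measure. fourier (\<lambda>q. g 3 q + of_real t * zy_op (g 1) q) \<xi> = fourier (g 3) \<xi> + of_real t * fourier (zy_op (g 1)) \<xi>"
      using fourier_scale_diff[OF gs[of 3] ZY(1), of "- of_real t"] by simp
    thus "AE \<xi> in freq_measure. zero_ind \<xi> * fourier (f 3 t) \<xi> = ?h \<xi> * fourier (\<lambda>q. g 3 q + of_real t * zy_op (g 1) q) \<xi>"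
      using sf gf[of 1] gf[of 3] ZY(2)
      by eventually_elim (auto simp: zero_ind_def)
  qed
qed

end

theorem theorem1p1:
  shows "(\<forall>s::real. s \<ge> 0 \<longrightarrow> (\<exists>C>0. \<forall>\<nu>>0. \<forall>u_in u.
            initial_datum u_in \<and> in_sobolev (s + 2) (complexify u_in) \<and>
            linearized_solution \<nu> u_in u \<longrightarrow>
            (\<forall>k::int. \<forall>t\<ge>0. k \<noteq> 0 \<longrightarrow>
               (let U12 = (\<lambda>p. vector [U_mode u k 1 t p, U_mode u k 2 t p] :: complex^2);
                    U3 = (\<lambda>p. vector [U_mode u k 3 t p] :: complex^1);
                    decay = exp (- (\<nu> / 6) * (of_int k)\<^sup>2 * t ^ 3)
                in in_sobolev s U12 \<and> in_sobolev s U3 \<and>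
                   sobolev_norm s U12
                     \<le> C * (1 / sqrt (1 + t\<^sup>2)) * decay * sobolev_norm (s + 2) (complexify u_in) \<and>
                   sobolev_norm s U3
                     \<le> C * decay * sobolev_norm (s + 2) (complexify u_in)))))
       \<and>
       (\<forall>\<nu>>0. \<forall>u_in u. initial_datum u_in \<and> linearized_solution \<nu> u_in u \<longrightarrow>
          (\<forall>t\<ge>0. AE p in cell.
             component (zero_mode (u t)) 1 p = heat_yz \<nu> t (component (zero_mode u_in) 1) p \<and>
             component (zero_mode (u t)) 2 p =
               heat_yz \<nu> t (\<lambda>q. component (zero_mode u_in) 2 q
                                - of_real t * zz_op (component (zero_mode u_in) 1) q) p \<and>
             component (zero_mode (u t)) 3 p =
               heat_yz \<nu> t (\<lambda>q. component (zero_mode u_in) 3 q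
                                + of_real t * zy_op (component (zero_mode u_in) 1) q) p))"
proof (intro conjI allI impI)
  fix s :: real
  show "\<exists>C>0. \<forall>\<nu>>0. \<forall>u_in u.
            initial_datum u_in \<and> in_sobolev (s + 2) (complexify u_in) \<and>
            linearized_solution \<nu> u_in u \<longrightarrow>
            (\<forall>k::int. \<forall>t\<ge>0. k \<noteq> 0 \<longrightarrow>
               (let U12 = (\<lambda>p. vector [U_mode u k 1 t p, U_mode u k 2 t p] :: complex^2);
                    U3 = (\<lambda>p. vector [U_mode u k 3 t p] :: complex^1);
                    decay = exp (- (\<nu> / 6) * (of_int k)\<^sup>2 * t ^ 3)
                in in_sobolev s U12 \<and> in_sobolev s U3 \<and>
                   sobolev_norm s U12
                     \<le> C * (1 / sqrt (1 + t\<^sup>2)) * decay * sobolev_norm (s + 2) (complexify u_in) \<and>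
                   sobolev_norm s U3
                     \<le> C * decay * sobolev_norm (s + 2) (complexify u_in)))"
  \<comment> \<open>The constant 36 of \<open>nonzero_mode_estimates\<close> serves every
    \<open>s\<close>, since the weight of order \<open>s\<close> is common to both sides of the
    frequencywise bound.\<close>
  proof (intro exI[of _ 36] conjI allI impI)
    fix \<nu> u_in u and k :: int and t :: real
    assume \<nu>: "\<nu> > 0" and h: "initial_datum u_in \<and> in_sobolev (s + 2) (complexify u_in) \<and> linearized_solution \<nu> u_in u"
      and t: "t \<ge> 0" and k: "k \<noteq> 0"
    interpret linearized \<nu> u_in u using \<nu> h by unfold_locales auto
    show "let U12 = (\<lambda>p. vector [U_mode u k 1 t p, U_mode u k 2 t p] :: complex^2);
                    U3 = (\<lambda>p. vector [U_mode u k 3 t p] :: complex^1);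
                    decay = exp (- (\<nu> / 6) * (of_int k)\<^sup>2 * t ^ 3)
                in in_sobolev s U12 \<and> in_sobolev s U3 \<and>
                   sobolev_norm s U12
                     \<le> 36 * (1 / sqrt (1 + t\<^sup>2)) * decay * sobolev_norm (s + 2) (complexify u_in) \<and>
                   sobolev_norm s U3
                     \<le> 36 * decay * sobolev_norm (s + 2) (complexify u_in)"
      using nonzero_mode_estimates[OF t k, of s] h unfolding Let_def by blast
  qed simp
next
  fix \<nu> u_in u and t :: real
  assume \<nu>: "\<nu> > 0" and h: "initial_datum u_in \<and> linearized_solution \<nu> u_in u" and t: "t \<ge> 0"
  interpret linearized \<nu> u_in u using \<nu> h by unfold_locales auto
  show "AE p in cell.
             component (zero_mode (u t)) 1 p = heat_yz \<nu> t (component (zero_mode u_in) 1) p \<and>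
             component (zero_mode (u t)) 2 p =
               heat_yz \<nu> t (\<lambda>q. component (zero_mode u_in) 2 q
                                - of_real t * zz_op (component (zero_mode u_in) 1) q) p \<and>
             component (zero_mode (u t)) 3 p =
               heat_yz \<nu> t (\<lambda>q. component (zero_mode u_in) 3 q
                                + of_real t * zy_op (component (zero_mode u_in) 1) q) p"
    using zero_mode_formulas[OF t] by eventually_elim simp
qed

end
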